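(* Let $d,\alpha\in\mathbb{N}$ and $f\in\mathcal{H}(K^{\mathrm{Sob}}_{\alpha,d})$. Let $F$ be the function obtained by applying the Bernoulli polynomial method to $f$, i.e. $$F(\boldsymbol x)=f(\boldsymbol x)+\sum_{\boldsymbol0\ne\boldsymbol\tau\in\{0,\ldots,\alpha\}^d,\ \mathfrak u:=\mathrm{supp}(\boldsymbol\tau)}(-1)^{|\mathfrak u|}\left[\prod_{j\in\mathfrak u}\frac{B_{\tau_j}(x_j)}{\tau_j!}\right]\int_{[0,1]^{|\mathfrak u|}}f^{(\boldsymbol\tau)}(\boldsymbol x)\,\mathrm{d}\boldsymbol x_{\mathfrak u}.$$ Then for all $\boldsymbol y\in[0,1]^d$ $$F(\boldsymbol y)=\left\langle f,K^{\mathrm{Kor}}_{\alpha,d}(\cdot,\boldsymbol y)\right\rangle_{K^{\mathrm{Sob}}_{\alpha,d}}.$$ Therefore, the transformed function $F$ does not have a bigger norm than the original function $f$: $$\|F\|_{K^{\mathrm{Kor}}_{\alpha,d}}=\|F\|_{K^{\mathrm{Sob}}_{\alpha,d}}\le\|f\|_{K^{\mathrm{Sob}}_{\alpha,d}}.$$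
   Context: Notation: $f^{(\boldsymbol\tau)}=\partial^{\tau_1+\cdots+\tau_d}f/\partial x_1^{\tau_1}\cdots\partial x_d^{\tau_d}$; $\mathrm{supp}(\boldsymbol\tau)=\{j:\tau_j\ne0\}$; for $\mathfrak w\subseteq\{1,\ldots,d\}$, $-\mathfrak w$ is its complement and $\boldsymbol x_{\mathfrak w}=(x_j)_{j\in\mathfrak w}$; an integral over an empty set of variables is the identity operation. $B_\tau$ is the Bernoulli polynomial of degree $\tau$ ($B_0=1$, $B_1(x)=x-1/2$, $\ldots$), and $\widetilde B_\tau$ is its $1$-periodic version, $\widetilde B_\tau(x)=-\frac{\tau!}{(2\pi\mathrm i)^\tau}\sum_{0\ne h\in\mathbb{Z}}\exp(2\pi\mathrm i hx)/h^\tau$, which equals $B_\tau$ on $[0,1]$ for $\tau\ge2$ and on $(0,1)$ for $\tau=1$. $\mathcal{H}(K^{\mathrm{Sob}}_{\alpha,d})$ is the unanchored Sobolev space on $[0,1]^d$: the $d$-fold Hilbert tensor product of the one-dimensional spaces of real functions on $[0,1]$ whose derivatives of order $0,\ldots,\alpha-1$ are absolutely continuous and whose $\alpha$-th derivative is in $L_2([0,1])$, with inner product $$\langle f,g\rangle_{K^{\mathrm{Sob}}_{\alpha,d}}=\sum_{\boldsymbol\tau\in\{0,\ldots,\alpha\}^d,\ \mathfrak w:=\{j:\tau_j=\alpha\}}\int_{[0,1]^{|\mathfrak w|}}\left(\int_{[0,1]^{d-|\mathfrak w|}}f^{(\boldsymbol\tau)}(\boldsymbol x)\,\mathrm{d}\boldsymbol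 x_{-\mathfrak w}\right)\left(\int_{[0,1]^{d-|\mathfrak w|}}g^{(\boldsymbol\tau)}(\boldsymbol x)\,\mathrm{d}\boldsymbol x_{-\mathfrak w}\right)\mathrm{d}\boldsymbol x_{\mathfrak w}.$$ It is a reproducing kernel Hilbert space with kernel $K^{\mathrm{Sob}}_{\alpha,d}(\boldsymbol x,\boldsymbol y)=\prod_{j=1}^d\left(1+\sum_{\tau_j=1}^\alpha\frac{B_{\tau_j}(x_j)}{\tau_j!}\frac{B_{\tau_j}(y_j)}{\tau_j!}+(-1)^{\alpha+1}\frac{\widetilde B_{2\alpha}(x_j-y_j)}{(2\alpha)!}\right)$. $\mathcal{H}(K^{\mathrm{Kor}}_{\alpha,d})\subset\mathcal{H}(K^{\mathrm{Sob}}_{\alpha,d})$ is the Korobov space of real functions on $[0,1]^d$ given by absolutely converging Fourier series $f(\boldsymbol x)=\sum_{\boldsymbol h\in\mathbb{Z}^d}\widehat f(\boldsymbol h)\exp(2\pi\mathrm i\,\boldsymbol h\cdot\boldsymbol x)$ with finite norm for the inner product $\langle f,g\rangle_{K^{\mathrm{Kor}}_{\alpha,d}}=\sum_{\boldsymbol h\in\mathbb{Z}^d}\widehat f(\boldsymbol h)\overline{\widehat g(\boldsymbol h)}[r_{\alpha,d}(\boldsymbol h)]^2$, where $r_{\alpha,d}(\boldsymbol h)=\prod_{j=1}^dr_\alpha(h_j)$, $r_\alpha(0)=1$, $r_\alpha(h)=|2\pi h|^\alpha$ for $h\ne0$. Its reproducing kernel is $$K^{\mathrm{Kor}}_{\alpha,d}(\boldsymbol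 x,\boldsymbol y)=\sum_{\boldsymbol h\in\mathbb{Z}^d}\frac{\exp(2\pi\mathrm i\,\boldsymbol h\cdot(\boldsymbol x-\boldsymbol y))}{[r_{\alpha,d}(\boldsymbol h)]^2}=\prod_{j=1}^d\left(1+(-1)^{\alpha+1}\frac{\widetilde B_{2\alpha}(x_j-y_j)}{(2\alpha)!}\right).$$ *)

theory Defs
  imports "HOL-Analysis.Analysis"
begin

section \<open>Coordinates, integration and differentiation on the unit cube\<close>

text \<open>
  Points of the \<open>d\<close>-dimensional unit cube are functions \<open>nat \<Rightarrow> real\<close> with index set \<open>{..<d}\<close>
  (coordinates are numbered from \<open>0\<close>). Functions on the cube are functions on
  \<open>nat \<Rightarrow> real\<close> of which only the values on the cube matter.
\<close>

type_synonym point = "nat \<Rightarrow> real"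

definition unit_cube :: "nat \<Rightarrow> point set" where
  "unit_cube d = {..<d} \<rightarrow>\<^sub>E {0..1}"

definition multi_indices :: "nat \<Rightarrow> nat \<Rightarrow> (nat \<Rightarrow> nat) set" where
  "multi_indices d \<alpha> = {..<d} \<rightarrow>\<^sub>E {..\<alpha>}"

definition supp :: "nat \<Rightarrow> (nat \<Rightarrow> nat) \<Rightarrow> nat set" where
  "supp d \<tau> = {j. j < d \<and> \<tau> j \<noteq> 0}"

text \<open>
  Lebesgue measure on \<open>[0,1]\<^sup>u\<close>. It is completed because mixed derivatives of Sobolev functions
  are only determined almost everywhere. For \<open>u = {}\<close> it is the unit mass on the one-point
  space, so integrating over no variables is the identity operation.
\<close>

definition cube_measure :: "nat set \<Rightarrow> point measure" where
  "cube_measure u = completion (Pi\<^sub>M u (\<lambda>_. restrict_space lborel {0..1}))"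

text \<open>
  The integral of \<open>g\<close> over the variables with index in \<open>u\<close>, as a function of \<open>x\<close>;
  only the coordinates of \<open>x\<close> outside \<open>u\<close> are used.
\<close>

definition integrate_vars :: "nat set \<Rightarrow> (point \<Rightarrow> real) \<Rightarrow> point \<Rightarrow> real" where
  "integrate_vars u g x = (\<integral>z. g (override_on x z u) \<partial>cube_measure u)"

text \<open>
  Derivatives are classical ones (one-sided at the end points). A derivative that exists only
  almost everywhere has an irrelevant constant value at the exceptional points.
\<close>

definition deriv01 :: "(real \<Rightarrow> real) \<Rightarrow> real \<Rightarrow> real" where
  "deriv01 g t = vector_derivative g (at t within {0..1})"

definition partial_deriv :: "nat \<Rightarrow> (point \<Rightarrow> real) \<Rightarrow> point \<Rightarrow> real" where
  "partial_deriv j f x = deriv01 (\<lambda>t. f (x(j := t))) (x j)"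

text \<open>
  \<open>mixed_deriv d \<tau> f\<close> is
  \<open>\<partial>\<^sub>0\<^bsup>\<tau> 0\<^esup> (\<partial>\<^sub>1\<^bsup>\<tau> 1\<^esup> (\<dots> f))\<close>, where the derivative in the last coordinate is taken first.
\<close>

primrec mixed_deriv :: "nat \<Rightarrow> (nat \<Rightarrow> nat) \<Rightarrow> (point \<Rightarrow> real) \<Rightarrow> point \<Rightarrow> real" where
  "mixed_deriv 0 \<tau> f = f"
| "mixed_deriv (Suc n) \<tau> f = mixed_deriv n \<tau> ((partial_deriv n ^^ \<tau> n) f)"


section \<open>Bernoulli polynomials and the transformed function\<close>

fun bernoulli_number :: "nat \<Rightarrow> real" where
  "bernoulli_number n =
     (if n = 0 then 1
      else - (\<Sum>k<n. of_nat (Suc n choose k) * bernoulli_number k) / of_nat (Suc n))"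

declare bernoulli_number.simps [simp del]

definition bernoulli_poly :: "nat \<Rightarrow> real \<Rightarrow> real" where
  "bernoulli_poly n x = (\<Sum>k\<le>n. of_nat (n choose k) * bernoulli_number k * x ^ (n - k))"

definition bernoulli_transform :: "nat \<Rightarrow> nat \<Rightarrow> (point \<Rightarrow> real) \<Rightarrow> point \<Rightarrow> real" where
  "bernoulli_transform \<alpha> d f x =
     f x + (\<Sum>\<tau> \<in> multi_indices d \<alpha> - {\<lambda>j\<in>{..<d}. 0}.
              (- 1) ^ card (supp d \<tau>)
              * (\<Prod>j\<in>supp d \<tau>. bernoulli_poly (\<tau> j) (x j) / fact (\<tau> j))
              * integrate_vars (supp d \<tau>) (mixed_deriv d \<tau> f) x)"


section \<open>The unanchored Sobolev space\<close>

definition absolutely_continuous_on :: "real set \<Rightarrow> (real \<Rightarrow> real) \<Rightarrow> bool" where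
  "absolutely_continuous_on S g \<longleftrightarrow>
     (\<forall>\<epsilon>>0. \<exists>\<delta>>0. \<forall>\<D> T. \<D> division_of T \<and> T \<subseteq> S \<and> (\<Sum>k\<in>\<D>. measure lborel k) < \<delta> \<longrightarrow>
        (\<Sum>k\<in>\<D>. \<bar>g (Sup k) - g (Inf k)\<bar>) < \<epsilon>)"

definition sobolev1 :: "nat \<Rightarrow> (real \<Rightarrow> real) set" where
  "sobolev1 \<alpha> = {g.
     (\<forall>k. Suc k < \<alpha> \<longrightarrow> (\<forall>t\<in>{0..1}. (deriv01 ^^ k) g differentiable (at t within {0..1}))) \<and>
     (\<forall>k<\<alpha>. absolutely_continuous_on {0..1} ((deriv01 ^^ k) g)) \<and>
     (deriv01 ^^ \<alpha>) g \<in> borel_measurable (lebesgue_on {0..1}) \<and>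
     integrable (lebesgue_on {0..1}) (\<lambda>t. ((deriv01 ^^ \<alpha>) g t)\<^sup>2)}"

definition sobolev_inner ::
  "nat \<Rightarrow> nat \<Rightarrow> (point \<Rightarrow> real) \<Rightarrow> (point \<Rightarrow> real) \<Rightarrow> real" where
  "sobolev_inner \<alpha> d f g =
     (\<Sum>\<tau>\<in>multi_indices d \<alpha>.
        let w = {j. j < d \<and> \<tau> j = \<alpha>} in
          \<integral>x. integrate_vars ({..<d} - w) (mixed_deriv d \<tau> f) x
             * integrate_vars ({..<d} - w) (mixed_deriv d \<tau> g) x \<partial>cube_measure w)"

definition sobolev_norm :: "nat \<Rightarrow> nat \<Rightarrow> (point \<Rightarrow> real) \<Rightarrow> real" where
  "sobolev_norm \<alpha> d f = sqrt (sobolev_inner \<alpha> d f f)"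

text \<open>The algebraic tensor product, realised as a space of functions on the cube.\<close>

definition algebraic_tensor :: "nat \<Rightarrow> nat \<Rightarrow> (point \<Rightarrow> real) set" where
  "algebraic_tensor \<alpha> d = {f. \<exists>m g.
     (\<forall>i<m. \<forall>j<d. g i j \<in> sobolev1 \<alpha>) \<and>
     (\<forall>x\<in>unit_cube d. f x = (\<Sum>i<(m::nat). \<Prod>j<d. g i j (x j)))}"

text \<open>
  The Hilbert tensor product is the completion of the algebraic one. Since point evaluations are
  continuous, the completion is again a space of functions: its elements are the pointwise limits
  of Cauchy sequences. On elementary tensors, \<open>sobolev_inner\<close> is the product of the
  one-dimensional inner products.
\<close>

definition sobolev_space :: "nat \<Rightarrow> nat \<Rightarrow> (point \<Rightarrow> real) set" where
  "sobolev_space \<alpha> d = {f. \<exists>\<phi> :: nat \<Rightarrow> point \<Rightarrow> real.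
     (\<forall>n. \<phi> n \<in> algebraic_tensor \<alpha> d) \<and>
     (\<forall>\<epsilon>>0. \<exists>N. \<forall>m\<ge>N. \<forall>n\<ge>N. sobolev_norm \<alpha> d (\<lambda>x. \<phi> m x - \<phi> n x) < \<epsilon>) \<and>
     (\<forall>x\<in>unit_cube d. (\<lambda>n. \<phi> n x) \<longlonglongrightarrow> f x)}"


section \<open>The Korobov space\<close>

definition frequencies :: "nat \<Rightarrow> (nat \<Rightarrow> int) set" where
  "frequencies d = {..<d} \<rightarrow>\<^sub>E UNIV"

definition character :: "nat \<Rightarrow> (nat \<Rightarrow> int) \<Rightarrow> point \<Rightarrow> complex" where
  "character d h x = exp (2 * of_real pi * \<i> * of_real (\<Sum>j<d. of_int (h j) * x j))"

definition fourier_coeff :: "nat \<Rightarrow> (point \<Rightarrow> real) \<Rightarrow> (nat \<Rightarrow> int) \<Rightarrow> complex" where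
  "fourier_coeff d f h = (\<integral>x. of_real (f x) * cnj (character d h x) \<partial>cube_measure {..<d})"

definition korobov_weight1 :: "nat \<Rightarrow> int \<Rightarrow> real" where
  "korobov_weight1 \<alpha> h = (if h = 0 then 1 else \<bar>2 * pi * of_int h\<bar> ^ \<alpha>)"

definition korobov_weight :: "nat \<Rightarrow> nat \<Rightarrow> (nat \<Rightarrow> int) \<Rightarrow> real" where
  "korobov_weight \<alpha> d h = (\<Prod>j<d. korobov_weight1 \<alpha> (h j))"

definition korobov_space :: "nat \<Rightarrow> nat \<Rightarrow> (point \<Rightarrow> real) set" where
  "korobov_space \<alpha> d = {f.
     (\<lambda>h. norm (fourier_coeff d f h)) summable_on frequencies d \<and>
     (\<forall>x\<in>unit_cube d.
        of_real (f x) = (\<Sum>\<^sub>\<infinity>h\<in>frequencies d. fourier_coeff d f h * character d h x)) \<and>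
     (\<lambda>h. (norm (fourier_coeff d f h))\<^sup>2 * (korobov_weight \<alpha> d h)\<^sup>2) summable_on frequencies d}"

text \<open>For real functions the two series below have real values, so taking real parts loses nothing.\<close>

definition korobov_inner ::
  "nat \<Rightarrow> nat \<Rightarrow> (point \<Rightarrow> real) \<Rightarrow> (point \<Rightarrow> real) \<Rightarrow> real" where
  "korobov_inner \<alpha> d f g =
     Re (\<Sum>\<^sub>\<infinity>h\<in>frequencies d.
           fourier_coeff d f h * cnj (fourier_coeff d g h) * of_real ((korobov_weight \<alpha> d h)\<^sup>2))"

definition korobov_norm :: "nat \<Rightarrow> nat \<Rightarrow> (point \<Rightarrow> real) \<Rightarrow> real" where
  "korobov_norm \<alpha> d f = sqrt (korobov_inner \<alpha> d f f)"

definition korobov_kernel :: "nat \<Rightarrow> nat \<Rightarrow> point \<Rightarrow> point \<Rightarrow> real" where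
  "korobov_kernel \<alpha> d x y =
     Re (\<Sum>\<^sub>\<infinity>h\<in>frequencies d.
           character d h (\<lambda>j. x j - y j) / of_real ((korobov_weight \<alpha> d h)\<^sup>2))"

end

theory Submission
  imports Defs
begin

text \<open>
  For a function \<open>g\<close> of one variable, the Bernoulli polynomial method yields the sum over the
  frequencies \<open>h\<close> of \<open>\<langle>g, e h\<rangle> e h / r h ^ 2\<close>, with characters \<open>e h\<close> and the inner product of the
  Sobolev space, that is, the orthogonal projection of \<open>g\<close> onto the Korobov space:
  after integrations by parts the difference is an integral of a derivative of mean zero against the
  error of a partial sum of the Fourier series of a sawtooth, which tends to \<open>0\<close> in \<open>L\<^sup>2\<close> by
  \<open>\<Sum>n. 1 / n ^ 2 = pi ^ 2 / 6\<close>. Hence the claims hold for finite sums of products, with \<open>F\<close> the limit of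
  trigonometric partial sums, and the kernel is the limit of its own partial sums.

  An arbitrary \<open>f\<close> is the sum of a series of such tensors whose norms are summable. This series may
  be differentiated term by term up to order \<open>\<alpha>\<close>, almost everywhere in the variables in which the
  order is \<open>\<alpha>\<close>: there Lebesgue's differentiation theorem is applied to an integrable majorant.
  So the inner products and the transform of \<open>f\<close> are the limits of those of the partial sums.
\<close>

section \<open>Differentiation of integrals\<close>

text \<open>The obstacle is that \<open>mixed_deriv\<close> takes classical derivatives, with a
  default value where none exists, whereas a member of \<open>sobolev_space\<close> is only a
  pointwise limit of a Cauchy sequence. Its derivatives must be shown to exist one coordinate after
  another, and a null set met in one coordinate must not block the next: exceptional sets are
  cylinders over the coordinates of order \<alpha>. The majorant comes from an isometry into L^2 of
  a box (\<open>jet_hat\<close>, \<open>tensor_hat\<close>), in which the top derivative and the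
  means of the lower ones are coordinates. A lower derivative at a point is an integral of these
  against a bounded kernel, so a mixed derivative is at most a constant times a marginal of the
  absolute value of \<open>tensor_hat\<close>. Summable norms need a subsequence; the whole sequence
  has the same limits because it is Cauchy. The transform is reached along the diagonal
  \<open>tensor_partial \<alpha> n (L n)\<close>: partial sums are orthogonal projections, hence
  contractions, and their values are bounded uniformly in \<open>n\<close>.\<close>

lemmas lintegral_cong = Bochner_Integration.integral_cong
  and lintegrable_bound = Bochner_Integration.integrable_bound

text \<open>Vitali covering: outer regularity puts \<open>A\<close> into an open set of small
  \<open>M\<close>-mass, and disjoint balls in it on which \<open>M\<close> has density above
  \<open>c\<close> have total length at most \<open>2 / c\<close> times that mass.\<close>

lemma negligible_positive_density:
  fixes M :: "real measure"
  assumes M: "finite_measure M" "sets M = sets borel"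
    and A: "A \<in> sets borel" "emeasure M A = 0" and c: "c > 0"
  shows "negligible {x\<in>A. \<forall>\<delta>>0. \<exists>r. 0 < r \<and> r < \<delta> \<and> measure M (cball x r) > c * r}"
    (is "negligible ?S")
proof (rule negligible_outer[THEN iffD2], intro allI impI)
  interpret finite_measure M by fact
  have sM [simp]: "sets M = sets borel" by fact
  fix e :: real assume e: "e > 0"
  have "emeasure M A = (INF U \<in> {U. A \<subseteq> U \<and> open U}. emeasure M U)"
    using outer_regular[of M A] M A emeasure_finite by auto
  \<comment> \<open>A ball of radius \<open>r\<close> has length \<open>2 * r\<close>, below
    \<open>2 / c\<close> times its mass; a mass below \<open>c * e / 4\<close> thus leaves total
    length below \<open>e / 2\<close>.\<close>
  with A have "(INF U \<in> {U. A \<subseteq> U \<and> open U}. emeasure M U) < ennreal (c * e / 4)"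
    using c e by simp
  then obtain U where U: "A \<subseteq> U" "open U" "emeasure M U < ennreal (c * e / 4)"
    by (auto simp: INF_less_iff)
  have mU: "measure M U < c * e / 4"
    using U(3) c e by (simp add: emeasure_eq_measure ennreal_less_iff)
  define K where "K = {(x, r). x \<in> ?S \<and> 0 < r \<and> cball x r \<subseteq> U \<and> measure M (cball x r) > c * r}"
  have 1: "\<exists>i. i \<in> K \<and> x \<in> cball (fst i) (snd i) \<and> snd i < d" if "x \<in> ?S" "0 < d" for x d
  proof -
    have "x \<in> U" using that U by auto
    then obtain s where s: "s > 0" "cball x s \<subseteq> U"
      using U(2) open_contains_cball by blast
    have "\<forall>\<delta>>0. \<exists>r. 0 < r \<and> r < \<delta> \<and> measure M (cball x r) > c * r"
      using that(1) by simp
    then obtain r where r: "0 < r" "r < min d s" "measure M (cball x r) > c * r"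
      using \<open>0 < d\<close> s(1) by (metis min_less_iff_conj)
    have "cball x r \<subseteq> cball x s" using r by (simp add: subset_cball)
    then have "(x, r) \<in> K" using r s that unfolding K_def by auto
    then show ?thesis using r by (intro exI[of _ "(x,r)"]) auto
  qed
  have 2: "0 < snd i" if "i \<in> K" for i using that unfolding K_def by auto
  obtain C where C: "countable C" "C \<subseteq> K"
     "pairwise (\<lambda>i j. disjnt (cball (fst i) (snd i)) (cball (fst j) (snd j))) C"
     "negligible (?S - (\<Union>i \<in> C. cball (fst i) (snd i)))"
    using Vitali_covering_theorem_cballs[of K snd ?S fst] 1 2 by blast
  let ?V = "\<Union>i \<in> C. cball (fst i) (snd i)"
  have V: "?V \<in> sets borel" using C(1) by (auto intro!: sets.countable_UN')
  have dis: "disjoint_family_on (\<lambda>i. cball (fst i) (snd i)) C"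
    using C(3) by (auto simp: disjoint_family_on_def pairwise_def disjnt_def)
  have "emeasure lborel ?V = (\<integral>\<^sup>+i. emeasure lborel (cball (fst i) (snd i)) \<partial>count_space C)"
    using C(1) dis by (intro emeasure_UN_countable) auto
  also have "\<dots> \<le> (\<integral>\<^sup>+i. ennreal (2 / c) * emeasure M (cball (fst i) (snd i)) \<partial>count_space C)"
  proof (rule nn_integral_mono)
    fix i assume "i \<in> space (count_space C)"
    then have "i \<in> K" using C by auto
    then have i: "0 < snd i" "measure M (cball (fst i) (snd i)) > c * snd i"
      unfolding K_def by auto
    have "emeasure lborel (cball (fst i) (snd i)) = ennreal (2 * snd i)"
      using i by (simp add: cball_eq_atLeastAtMost)
    also have "\<dots> \<le> ennreal (2 / c * measure M (cball (fst i) (snd i)))"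
      using i c by (intro ennreal_leI) (simp add: field_simps)
    also have "\<dots> = ennreal (2 / c) * emeasure M (cball (fst i) (snd i))"
      using c by (simp add: emeasure_eq_measure flip: ennreal_mult')
    finally show "emeasure lborel (cball (fst i) (snd i))
      \<le> ennreal (2 / c) * emeasure M (cball (fst i) (snd i))" .
  qed
  also have "\<dots> = ennreal (2 / c) * (\<integral>\<^sup>+i. emeasure M (cball (fst i) (snd i)) \<partial>count_space C)"
    by (rule nn_integral_cmult) auto
  also have "\<dots> = ennreal (2 / c) * emeasure M ?V"
    using C(1) dis by (subst emeasure_UN_countable) auto
  also have "\<dots> \<le> ennreal (2 / c) * emeasure M U"
    using U(2) C(2) by (intro mult_left_mono emeasure_mono UN_least) (auto simp: K_def dest!: subsetD)
  also have "\<dots> = ennreal (2 / c * measure M U)"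
    using c by (simp add: emeasure_eq_measure flip: ennreal_mult')
  also have "\<dots> < ennreal e"
    using mU c e measure_nonneg[of M U] by (intro ennreal_lessI) (simp_all add: field_simps del: measure_nonneg)
  finally have V2: "emeasure lborel ?V < ennreal e" .
  have lV: "?V \<in> lmeasurable" "measure lebesgue ?V < e"
  proof -
    have "emeasure lebesgue ?V < ennreal e" using V V2 by simp
    then show l: "?V \<in> lmeasurable" using V by (auto simp: fmeasurable_def intro: less_trans)
    with \<open>emeasure lebesgue ?V < ennreal e\<close> e show "measure lebesgue ?V < e"
      by (simp add: emeasure_eq_measure2 ennreal_less_iff)
  qed
  let ?T = "?V \<union> (?S - ?V)"
  have ng: "(?S - ?V) \<in> lmeasurable" "measure lebesgue (?S - ?V) = 0"
    using C(4) negligible_iff_measure by blast+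
  show "\<exists>T. ?S \<subseteq> T \<and> T \<in> lmeasurable \<and> measure lebesgue T < e"
  proof (intro exI conjI)
    show "?S \<subseteq> ?T" by blast
    show "?T \<in> lmeasurable" using lV ng by (intro fmeasurable.Un) auto
    show "measure lebesgue ?T < e"
      using measure_Un_le[of ?V lebesgue "?S - ?V"] lV ng by (simp add: fmeasurableD)
  qed
qed

text \<open>The constants \<open>1 / Suc n\<close> are enough, and countably many null sets remain
  null.\<close>

lemma AE_density_zero_on:
  fixes M :: "real measure"
  assumes M: "finite_measure M" "sets M = sets borel"
    and A: "A \<in> sets borel" "emeasure M A = 0"
  shows "AE x in lborel. x \<in> A \<longrightarrow>
    (\<forall>c>0. \<exists>\<delta>>0. \<forall>r. 0 < r \<and> r < \<delta> \<longrightarrow> measure M (cball x r) \<le> c * r)"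
proof -
  let ?S = "\<lambda>c. {x\<in>A. \<forall>\<delta>>0. \<exists>r. 0 < r \<and> r < \<delta> \<and> measure M (cball x r) > c * r}"
  have "negligible (?S (1 / Suc n))" for n :: nat
    by (rule negligible_positive_density[OF M A]) simp
  then have "negligible (\<Union>n::nat. ?S (1 / Suc n))"
    by (intro negligible_countable_Union) auto
  then have "AE x in lebesgue. x \<notin> (\<Union>n::nat. ?S (1 / Suc n))"
    unfolding negligible_iff_null_sets by (rule AE_not_in)
  then have "AE x in lborel. x \<notin> (\<Union>n::nat. ?S (1 / Suc n))"
    unfolding AE_completion_iff .
  then show ?thesis
  proof (rule eventually_mono, intro impI allI)
    fix x and c :: real assume x: "x \<notin> (\<Union>n::nat. ?S (1 / Suc n))" and xA: "x \<in> A" and c: "c > 0"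
    obtain n where n: "1 / Suc n < c" using c nat_approx_posE by blast
    have "x \<notin> ?S (1 / Suc n)" using x by blast
    then obtain \<delta> where "\<delta> > 0" and d: "\<And>r. 0 < r \<Longrightarrow> r < \<delta> \<Longrightarrow> measure M (cball x r) \<le> 1 / Suc n * r"
      using xA unfolding mem_Collect_eq not_all not_ex not_imp de_Morgan_conj not_less not_le by (metis not_less)
    moreover have "1 / Suc n * r \<le> c * r" if "r > 0" for r using n that by (intro mult_right_mono) auto
    ultimately show "\<exists>\<delta>>0. \<forall>r. 0 < r \<and> r < \<delta> \<longrightarrow> measure M (cball x r) \<le> c * r"
      by (meson order_trans)
  qed
qed

text \<open>The interval need not contain \<open>x\<close> in its interior, and the error is
  measured against the radius \<open>h\<close>: this covers the difference quotients at
  \<open>x\<close> from both sides, with \<open>a\<close> or \<open>b\<close> equal to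
  \<open>x\<close>.\<close>

definition average_le :: "(real \<Rightarrow> real) \<Rightarrow> real \<Rightarrow> real \<Rightarrow> real \<Rightarrow> bool" where
  "average_le g x q e \<longleftrightarrow> (\<exists>\<delta>>0. \<forall>h a b. 0 < h \<and> h < \<delta> \<and> x - h \<le> a \<and> a \<le> b \<and> b \<le> x + h
      \<longrightarrow> (LBINT t:{a<..b}. g t) \<le> q * (b - a) + e * h)"

text \<open>The positive part of \<open>g - q\<close> is the density of a measure that vanishes on
  \<open>{x. g x \<le> q}\<close>, hence has density zero at almost every point of that set.
  Rational \<open>q\<close> keep the exceptional set null.\<close>

lemma AE_average_upper:
  fixes g :: "real \<Rightarrow> real"
  assumes g: "integrable lborel g"
  shows "AE x in lborel. \<forall>q\<in>\<rat>. g x \<le> q \<longrightarrow> (\<forall>e>0. average_le g x q e)"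
proof -
  have [measurable]: "g \<in> borel_measurable borel" using g by auto
  define P where "P n q x \<longleftrightarrow> (g x \<le> q \<and> \<bar>x\<bar> < real n \<longrightarrow> (\<forall>e>0. average_le g x q e))" for n :: nat and q x :: real
  have main: "AE x in lborel. P n q x" for n :: nat and q
  proof -
    \<comment> \<open>Cutting down to a bounded interval makes the constant \<open>q\<close>
      integrable and the measure \<open>M\<close> finite.\<close>
    let ?f = "\<lambda>t. indicator {- real n .. real n} t * max 0 (g t - q)"
    define M where "M = density lborel (\<lambda>t. ennreal (?f t))"
    have intf: "integrable lborel ?f"
    proof -
      have "integrable lborel (\<lambda>t. indicator {- real n .. real n} t *\<^sub>R g t - indicator {- real n .. real n} t * q)"
        using g by (intro Bochner_Integration.integrable_diff integrable_mult_indicator integrable_mult_left) auto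
      then show ?thesis
        by (rule lintegrable_bound) (auto split: split_indicator)
    qed
    have emM: "emeasure M X = ennreal (LBINT t:X. ?f t)" if [measurable]: "X \<in> sets borel" for X
    proof -
      have "emeasure M X = (\<integral>\<^sup>+t. ennreal (?f t) * indicator X t \<partial>lborel)"
        unfolding M_def by (subst emeasure_density) auto
      also have "\<dots> = (\<integral>\<^sup>+t. ennreal (indicator X t *\<^sub>R ?f t) \<partial>lborel)"
        by (intro nn_integral_cong) (auto split: split_indicator)
      also have "\<dots> = ennreal (LBINT t:X. ?f t)"
        unfolding set_lebesgue_integral_def using intf
        by (intro nn_integral_eq_integral integrable_mult_indicator) auto
      finally show ?thesis .
    qed
    have fin: "finite_measure M"
      by standard (use emM[of UNIV] in \<open>simp add: M_def\<close>)
    interpret finite_measure M by fact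
    have sM: "sets M = sets borel" unfolding M_def by simp
    have meM: "measure M X = (LBINT t:X. ?f t)" if "X \<in> sets borel" for X
      using emM[OF that] unfolding emeasure_eq_measure
      by (subst (asm) ennreal_inj) (auto simp: set_lebesgue_integral_def intro!: integral_nonneg_AE AE_I2)
    define A where "A = {x. g x \<le> q}"
    have [measurable]: "A \<in> sets borel" unfolding A_def by measurable
    have "(LBINT t:A. ?f t) = 0"
      unfolding set_lebesgue_integral_def A_def by (intro integral_eq_zero_AE AE_I2) (auto split: split_indicator)
    then have "emeasure M A = 0" using emM[of A] by simp
    from AE_density_zero_on[OF fin sM _ this]
    have "AE x in lborel. x \<in> A \<longrightarrow>
      (\<forall>c>0. \<exists>\<delta>>0. \<forall>r. 0 < r \<and> r < \<delta> \<longrightarrow> measure M (cball x r) \<le> c * r)" by simp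
    then show ?thesis
    proof (rule eventually_mono, unfold P_def, intro impI allI)
      fix x e :: real
      assume *: "x \<in> A \<longrightarrow> (\<forall>c>0. \<exists>\<delta>>0. \<forall>r. 0 < r \<and> r < \<delta> \<longrightarrow> measure M (cball x r) \<le> c * r)"
        and x: "g x \<le> q \<and> \<bar>x\<bar> < real n" and e: "0 < e"
      obtain \<delta> where d: "\<delta> > 0" "\<And>r. 0 < r \<Longrightarrow> r < \<delta> \<Longrightarrow> measure M (cball x r) \<le> e * r"
        using * x e unfolding A_def by blast
      show "average_le g x q e"
        unfolding average_le_def
      proof (intro exI[of _ "min \<delta> (real n - \<bar>x\<bar>)"] conjI allI impI)
        show "0 < min \<delta> (real n - \<bar>x\<bar>)" using d x by auto
        fix h a b assume h: "0 < h \<and> h < min \<delta> (real n - \<bar>x\<bar>) \<and> x - h \<le> a \<and> a \<le> b \<and> b \<le> x + h"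
        have i1: "integrable lborel (\<lambda>t. indicator {a<..b} t *\<^sub>R g t)"
          using g by (intro integrable_mult_indicator) auto
        have i2: "integrable lborel (\<lambda>t. indicator {a<..b} t * q)"
          using h by (intro integrable_mult_left integrable_real_indicator) auto
        have i3: "integrable lborel (\<lambda>t. indicator (cball x h) t *\<^sub>R ?f t)"
          using intf by (intro integrable_mult_indicator) auto
        have "(LBINT t:{a<..b}. g t)
            \<le> (LBINT t. indicator {a<..b} t * q + indicator (cball x h) t *\<^sub>R ?f t)"
          unfolding set_lebesgue_integral_def using i1 i2 i3 h
          by (intro integral_mono Bochner_Integration.integrable_add) 
            (auto split: split_indicator simp: cball_eq_atLeastAtMost)
        also have "\<dots> = q * (b - a) + measure M (cball x h)"
          using i2 i3 h by (subst Bochner_Integration.integral_add)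
            (auto simp: meM set_lebesgue_integral_def mult.commute)
        also have "\<dots> \<le> q * (b - a) + e * h" using d h by auto
        finally show "(LBINT t:{a<..b}. g t) \<le> q * (b - a) + e * h" .
      qed
    qed
  qed
  have "AE x in lborel. \<forall>n. \<forall>q\<in>\<rat>. P n q x"
    unfolding AE_all_countable by (intro allI AE_ball_countable' main) (simp add: countable_rat)
  then show ?thesis
  proof (rule eventually_mono, intro ballI impI allI)
    fix x q e :: real assume P: "\<forall>n. \<forall>q\<in>\<rat>. P n q x" and q: "q \<in> \<rat>" "g x \<le> q" "0 < e"
    obtain n :: nat where "\<bar>x\<bar> < real n" using reals_Archimedean2 by blast
    with P q show "average_le g x q e"
      unfolding P_def by blast
  qed
qed

lemma LINT_greaterThanAtMost_diff:
  fixes g :: "real \<Rightarrow> real"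
  assumes "integrable lborel g" "a \<le> b"
  shows "(LBINT t:{a<..b}. g t) = (LBINT t:{..b}. g t) - (LBINT t:{..a}. g t)"
proof -
  have "(LBINT t:{..b}. g t) = (LBINT t:{..a} \<union> {a<..b}. g t)"
    using assms by (simp add: ivl_disj_un)
  also have "\<dots> = (LBINT t:{..a}. g t) + (LBINT t:{a<..b}. g t)"
    using assms by (intro set_integral_Un) (auto simp: set_integrable_def simp del: real_scaleR_def intro!: integrable_mult_indicator)
  finally show ?thesis by simp
qed

text \<open>Upper bounds for the averages of \<open>g\<close> and of \<open>-g\<close>, at rationals
  less than \<open>e / 2\<close> above the values at \<open>x\<close>, squeeze the difference
  quotient.\<close>

theorem lebesgue_differentiation:
  fixes g :: "real \<Rightarrow> real"
  assumes g: "integrable lborel g"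
  shows "AE x in lborel. ((\<lambda>s. LBINT t:{..s}. g t) has_real_derivative g x) (at x)"
proof -
  have g': "integrable lborel (\<lambda>x. - g x)" using g by simp
  show ?thesis
    using AE_average_upper[OF g] AE_average_upper[OF g']
  proof eventually_elim
    fix x assume u: "\<forall>q\<in>\<rat>. g x \<le> q \<longrightarrow> (\<forall>e>0. average_le g x q e)"
     and l: "\<forall>q\<in>\<rat>. - g x \<le> q \<longrightarrow> (\<forall>e>0. average_le (\<lambda>t. - g t) x q e)"
    let ?G = "\<lambda>s. LBINT t:{..s}. g t"
    show "(?G has_real_derivative g x) (at x)"
      unfolding has_field_derivative_iff
    proof (rule LIM_I)
      fix e :: real assume e: "e > 0"
      obtain q where q: "q \<in> \<rat>" "g x < q" "q < g x + e / 2"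
        using Rats_dense_in_real[of "g x" "g x + e / 2"] e by auto
      obtain p where p: "p \<in> \<rat>" "- g x < p" "p < - g x + e / 2"
        using Rats_dense_in_real[of "- g x" "- g x + e / 2"] e by auto
      obtain d1 where d1: "d1 > 0" "\<And>h a b. 0 < h \<and> h < d1 \<and> x - h \<le> a \<and> a \<le> b \<and> b \<le> x + h
        \<Longrightarrow> (LBINT t:{a<..b}. g t) \<le> q * (b - a) + e / 2 * h"
        using u[rule_format, of q "e/2"] q e unfolding average_le_def by auto
      obtain d2 where d2: "d2 > 0" "\<And>h a b. 0 < h \<and> h < d2 \<and> x - h \<le> a \<and> a \<le> b \<and> b \<le> x + h
        \<Longrightarrow> (LBINT t:{a<..b}. - g t) \<le> p * (b - a) + e / 2 * h"
        using l[rule_format, of p "e/2"] p e unfolding average_le_def by auto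
      show "\<exists>s>0. \<forall>y. y \<noteq> x \<and> norm (y - x) < s \<longrightarrow> norm ((?G y - ?G x) / (y - x) - g x) < e"
      proof (intro exI[of _ "min d1 d2"] conjI allI impI)
        show "0 < min d1 d2" using d1 d2 by simp
        fix y assume y: "y \<noteq> x \<and> norm (y - x) < min d1 d2"
        define h a b where "h = \<bar>y - x\<bar>" and "a = min x y" and "b = max x y"
        have hab: "0 < h" "h < d1" "h < d2" "x - h \<le> a" "a \<le> b" "b \<le> x + h" "b - a = h"
          using y unfolding h_def a_def b_def by (auto simp: abs_if)
        have eq: "(?G y - ?G x) / (y - x) = (LBINT t:{a<..b}. g t) / h"
          unfolding LINT_greaterThanAtMost_diff[OF g \<open>a \<le> b\<close>] using y unfolding h_def a_def b_def
          by (cases "x < y") (auto simp: min_def max_def divide_simps algebra_simps)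
        have "(LBINT t:{a<..b}. g t) \<le> q * h + e / 2 * h" using d1(2)[of h a b] hab by simp
        also have "\<dots> = (q + e / 2) * h" by (simp add: algebra_simps)
        also have "\<dots> < (g x + e) * h" using q hab by (intro mult_strict_right_mono) auto
        finally have 1: "(LBINT t:{a<..b}. g t) < (g x + e) * h" .
        have "- (LBINT t:{a<..b}. g t) \<le> p * h + e / 2 * h"
          using d2(2)[of h a b] hab by (simp add: set_lebesgue_integral_def)
        also have "\<dots> = (p + e / 2) * h" by (simp add: algebra_simps)
        also have "\<dots> < (- g x + e) * h" using p hab by (intro mult_strict_right_mono) auto
        finally have 2: "- (LBINT t:{a<..b}. g t) < (- g x + e) * h" .
        show "norm ((?G y - ?G x) / (y - x) - g x) < e"
          unfolding eq using 1 2 hab by (simp add: abs_less_iff field_simps)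
      qed
    qed
  qed
qed


lemma continuous_on_LINT_atMost:
  fixes g :: "real \<Rightarrow> real"
  assumes g: "integrable lborel g"
  shows "continuous_on UNIV (\<lambda>s. LBINT t:{..s}. g t)"
proof -
  have [measurable]: "g \<in> borel_measurable borel" using g by auto
  have "(\<lambda>n. LBINT t:{..X n}. g t) \<longlonglongrightarrow> (LBINT t:{..s}. g t)"
    if X: "X \<longlonglongrightarrow> s" for X s
    unfolding set_lebesgue_integral_def
  proof (rule integral_dominated_convergence[where w = "\<lambda>t. norm (g t)"])
    show "AE t in lborel. (\<lambda>n. indicat_real {..X n} t *\<^sub>R g t) \<longlonglongrightarrow> indicat_real {..s} t *\<^sub>R g t"
      using AE_lborel_singleton[of s]
    proof eventually_elim
      fix t assume "t \<noteq> s"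
      then consider "t < s" | "t > s" by linarith
      then have "eventually (\<lambda>n. indicat_real {..X n} t *\<^sub>R g t = indicat_real {..s} t *\<^sub>R g t) sequentially"
      proof cases
        case 1
        from order_tendstoD(1)[OF X 1] show ?thesis
          by eventually_elim (use 1 in auto)
      next
        case 2
        from order_tendstoD(2)[OF X 2] show ?thesis
          by eventually_elim (use 2 in auto)
      qed
      then show "(\<lambda>n. indicat_real {..X n} t *\<^sub>R g t) \<longlonglongrightarrow> indicat_real {..s} t *\<^sub>R g t"
        by (rule tendsto_eventually)
    qed
  qed (use g in \<open>auto split: split_indicator\<close>)
  then show ?thesis
    by (simp add: continuous_on_sequentially o_def)
qed

text \<open>Fubini turns the exceptional sets for the single parameters into one null set of the
  product, provided that the set of good pairs is measurable; so differentiability is first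
  expressed by countably many conditions. Integrability is asked for the given parameter only,
  because the application has it only off a null set of parameters.\<close>

lemma parametric_lebesgue_differentiation:
  fixes F :: "'a \<times> real \<Rightarrow> real"
  assumes M: "sigma_finite_measure M" and F [measurable]: "F \<in> borel_measurable (M \<Otimes>\<^sub>M lborel)"
  obtains N where "N \<in> null_sets (M \<Otimes>\<^sub>M lborel)"
    "\<And>y t. y \<in> space M \<Longrightarrow> integrable lborel (\<lambda>r. F (y, r)) \<Longrightarrow> (y, t) \<notin> N \<Longrightarrow>
      ((\<lambda>s. LBINT r:{..s}. F (y, r)) has_real_derivative F (y, t)) (at t)"
proof -
  interpret sigma_finite_measure M by fact
  interpret pair_sigma_finite M lborel ..
  define H where "H z s = (LBINT r. (if r \<le> s then F (fst z, r) else 0))" for z :: "'a \<times> real" and s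
  have H: "H z s = (LBINT r:{..s}. F (fst z, r))" for z s
    unfolding H_def set_lebesgue_integral_def by (intro lintegral_cong) auto
  \<comment> \<open>Rational increments make this a countable, hence measurable, condition.
    Continuity of the integral in its upper end restores real increments below.\<close>
  define R where "R z \<longleftrightarrow> (\<forall>n::nat. \<exists>m::nat. \<forall>q::rat. q \<noteq> 0 \<and> \<bar>real_of_rat q\<bar> < 1 / Suc m \<longrightarrow>
      \<bar>(H z (snd z + real_of_rat q) - H z (snd z)) / real_of_rat q - F z\<bar> \<le> 1 / Suc n)" for z
  have [measurable]: "(\<lambda>z. H z (snd z + c)) \<in> borel_measurable (M \<Otimes>\<^sub>M lborel)" for c
    unfolding H_def by measurable
  have [measurable]: "(\<lambda>z. H z (snd z)) \<in> borel_measurable (M \<Otimes>\<^sub>M lborel)"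
    unfolding H_def by measurable
  have [measurable]: "Measurable.pred (M \<Otimes>\<^sub>M lborel) R"
    unfolding R_def by measurable
  define Y where "Y y \<longleftrightarrow> (\<integral>\<^sup>+r. ennreal \<bar>F (y, r)\<bar> \<partial>lborel) < \<infinity>" for y
  have [measurable]: "Measurable.pred M Y" unfolding Y_def by measurable
  have Y: "Y y \<longleftrightarrow> integrable lborel (\<lambda>r. F (y, r))" if "y \<in> space M" for y
  proof -
    have "(\<lambda>r. F (y, r)) \<in> borel_measurable lborel"
      using that by (auto intro: measurable_Pair2)
    then show ?thesis unfolding Y_def integrable_iff_bounded by simp
  qed
  let ?N = "{z \<in> space (M \<Otimes>\<^sub>M lborel). Y (fst z) \<and> \<not> R z}"
  show thesis
  proof (rule that[of ?N])
    have "AE z in M \<Otimes>\<^sub>M lborel. Y (fst z) \<longrightarrow> R z"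
    proof (rule AE_pair_measure)
      show "{z \<in> space (M \<Otimes>\<^sub>M lborel). Y (fst z) \<longrightarrow> R z} \<in> sets (M \<Otimes>\<^sub>M lborel)" by measurable
      show "AE y in M. AE t in lborel. Y (fst (y, t)) \<longrightarrow> R (y, t)"
      proof (rule AE_I2)
        fix y assume y: "y \<in> space M"
        show "AE t in lborel. Y (fst (y, t)) \<longrightarrow> R (y, t)"
        proof (cases "Y y")
          case True
          with Y[OF y] have "integrable lborel (\<lambda>r. F (y, r))" by simp
          from lebesgue_differentiation[OF this] show ?thesis
          proof (rule eventually_mono)
            fix t assume "((\<lambda>s. LBINT r:{..s}. F (y, r)) has_real_derivative F (y, t)) (at t)"
            then have lim: "((\<lambda>h. (H (y, t) (t + h) - H (y, t) t) / h) \<longlongrightarrow> F (y, t)) (at 0)"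
              unfolding DERIV_def H by simp
            have "R (y, t)"
              unfolding R_def
            proof
              fix n :: nat
              have "eventually (\<lambda>h. dist ((H (y, t) (t + h) - H (y, t) t) / h) (F (y, t)) < 1 / Suc n) (at 0)"
                using tendstoD[OF lim, of "1 / Suc n"] by simp
              then obtain d where d: "d > 0" "\<And>h. h \<noteq> 0 \<Longrightarrow> \<bar>h\<bar> < d \<Longrightarrow>
                  dist ((H (y, t) (t + h) - H (y, t) t) / h) (F (y, t)) < 1 / Suc n"
                unfolding eventually_at by (auto simp: dist_real_def)
              obtain m where m: "1 / Suc m < d" using d nat_approx_posE by blast
              show "\<exists>m::nat. \<forall>q::rat. q \<noteq> 0 \<and> \<bar>real_of_rat q\<bar> < 1 / Suc m \<longrightarrow>
                \<bar>(H (y, t) (snd (y, t) + real_of_rat q) - H (y, t) (snd (y, t))) / real_of_rat q - F (y, t)\<bar> \<le> 1 / Suc n"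
              proof (intro exI[of _ m] allI impI)
                fix q :: rat assume q: "q \<noteq> 0 \<and> \<bar>real_of_rat q\<bar> < 1 / Suc m"
                have "dist ((H (y, t) (t + real_of_rat q) - H (y, t) t) / real_of_rat q) (F (y, t)) < 1 / Suc n"
                  using q m by (intro d(2)) auto
                then show "\<bar>(H (y, t) (snd (y, t) + real_of_rat q) - H (y, t) (snd (y, t))) / real_of_rat q - F (y, t)\<bar> \<le> 1 / Suc n"
                  by (simp add: dist_real_def)
              qed
            qed
            then show "Y (fst (y, t)) \<longrightarrow> R (y, t)" by simp
          qed
        qed simp
      qed
    qed
    moreover have "?N \<in> sets (M \<Otimes>\<^sub>M lborel)" by measurable
    ultimately show "?N \<in> null_sets (M \<Otimes>\<^sub>M lborel)"
      using AE_iff_null[of "M \<Otimes>\<^sub>M lborel" "\<lambda>z. Y (fst z) \<longrightarrow> R z"] by simp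
    fix y t assume y: "y \<in> space M" and i: "integrable lborel (\<lambda>r. F (y, r))" and N: "(y, t) \<notin> ?N"
    have R: "R (y, t)" using y i N Y by (auto simp: space_pair_measure)
    let ?G = "\<lambda>s. LBINT r:{..s}. F (y, r)"
    have cont: "continuous_on UNIV ?G" by (rule continuous_on_LINT_atMost[OF i])
    show "(?G has_real_derivative F (y, t)) (at t)"
      unfolding DERIV_def
    proof (rule LIM_I)
      fix e :: real assume "e > 0"
      then obtain n where n: "1 / Suc n < e" using nat_approx_posE by blast
      from R obtain m where m: "\<And>q::rat. q \<noteq> 0 \<Longrightarrow> \<bar>real_of_rat q\<bar> < 1 / Suc m \<Longrightarrow>
        \<bar>(?G (t + real_of_rat q) - ?G t) / real_of_rat q - F (y, t)\<bar> \<le> 1 / Suc n"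
        unfolding R_def H by fastforce
      let ?\<phi> = "\<lambda>h. \<bar>(?G (t + h) - ?G t) / h - F (y, t)\<bar>"
      show "\<exists>s>0. \<forall>h. h \<noteq> 0 \<and> norm (h - 0) < s \<longrightarrow>
          norm ((?G (t + h) - ?G t) / h - F (y, t)) < e"
      proof (intro exI[of _ "1 / Suc m"] conjI allI impI)
        fix h :: real assume h: "h \<noteq> 0 \<and> norm (h - 0) < 1 / Suc m"
        have "?\<phi> h \<le> 1 / Suc n"
        proof (rule ccontr)
          assume "\<not> ?thesis"
          then have gt: "?\<phi> h > 1 / Suc n" by simp
          have "isCont ?G (t + h)" using cont by (simp add: continuous_on_eq_continuous_at)
          then have "isCont (\<lambda>h. ?G (t + h)) h"
            by (intro isCont_o2[where g = ?G and f = "\<lambda>h. t + h"]) auto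
          then have "isCont ?\<phi> h" using h by (intro continuous_intros) auto
          then have "(?\<phi> \<longlongrightarrow> ?\<phi> h) (at h)" by (simp add: isCont_def)
          from order_tendstoD(1)[OF this gt] obtain d where d: "d > 0"
            "\<And>k. k \<noteq> h \<Longrightarrow> dist k h < d \<Longrightarrow> ?\<phi> k > 1 / Suc n"
            unfolding eventually_at by auto
          \<comment> \<open>A rational between \<open>lo\<close> and \<open>h\<close> has the sign
            of \<open>h\<close>, is smaller than \<open>1 / Suc m\<close> in absolute value, and
            lies within \<open>d\<close> of \<open>h\<close>.\<close>
          define lo where "lo = (if h > 0 then max 0 (h - d) else max (- 1 / Suc m) (h - d))"
          have "lo < h" using d h unfolding lo_def by auto
          then obtain q where q: "lo < real_of_rat q" "real_of_rat q < h" using of_rat_dense by blast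
          have "?\<phi> (real_of_rat q) > 1 / Suc n"
            using q unfolding lo_def by (intro d(2)) (auto simp: dist_real_def split: if_splits)
          moreover have "q \<noteq> 0" "\<bar>real_of_rat q\<bar> < 1 / Suc m"
            using q h unfolding lo_def by (auto simp: abs_if split: if_splits)
          ultimately show False using m[of q] by simp
        qed
        then show "norm ((?G (t + h) - ?G t) / h - F (y, t)) < e" using n by simp
      qed auto
    qed
  qed
qed

section \<open>Absolutely continuous functions\<close>

text \<open>Intervals are pairs of end points here, not sets as in a division, so that they can be
  clipped at a point and their increments summed directly.\<close>

definition interval_system :: "real set \<Rightarrow> (real \<times> real) set \<Rightarrow> bool" where
  "interval_system S D \<longleftrightarrow> finite D \<and> (\<forall>p\<in>D. fst p < snd p \<and> {fst p..snd p} \<subseteq> S) \<and>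
     pairwise (\<lambda>p q. disjnt {fst p<..<snd p} {fst q<..<snd q}) D"

definition increments :: "(real \<Rightarrow> real) \<Rightarrow> (real \<times> real) set \<Rightarrow> real" where
  "increments g D = (\<Sum>p\<in>D. g (snd p) - g (fst p))"

text \<open>Signed increments and a non-strict bound, so that the condition passes to suprema.
  Absolute continuity of \<open>g\<close> will give it for \<open>g\<close> and for
  \<open>-g\<close>.\<close>

definition ac_increments :: "(real \<Rightarrow> real) \<Rightarrow> bool" where
  "ac_increments g \<longleftrightarrow> (\<forall>\<epsilon>>0. \<exists>\<delta>>0. \<forall>D. interval_system UNIV D \<and> increments (\<lambda>x. x) D < \<delta> \<longrightarrow> increments g D \<le> \<epsilon>)"

lemma interval_systemD:
  assumes "interval_system S D"
  shows "finite D" "\<And>p. p \<in> D \<Longrightarrow> fst p < snd p" "\<And>p. p \<in> D \<Longrightarrow> {fst p..snd p} \<subseteq> S"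
    "\<And>p q. p \<in> D \<Longrightarrow> q \<in> D \<Longrightarrow> p \<noteq> q \<Longrightarrow> snd p \<le> fst q \<or> snd q \<le> fst p"
proof -
  show "finite D" "\<And>p. p \<in> D \<Longrightarrow> fst p < snd p" "\<And>p. p \<in> D \<Longrightarrow> {fst p..snd p} \<subseteq> S"
    using assms by (auto simp: interval_system_def)
  fix p q assume pq: "p \<in> D" "q \<in> D" "p \<noteq> q"
  then have d: "disjnt {fst p<..<snd p} {fst q<..<snd q}" and l: "fst p < snd p" "fst q < snd q"
    using assms by (auto simp: interval_system_def pairwise_def)
  show "snd p \<le> fst q \<or> snd q \<le> fst p"
  proof (rule ccontr)
    assume "\<not> ?thesis"
    then have "max (fst p) (fst q) < min (snd p) (snd q)" using l by auto
    then obtain x where "max (fst p) (fst q) < x" "x < min (snd p) (snd q)" using dense by blast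
    then show False using d by (auto simp: disjnt_iff)
  qed
qed

lemma interval_systemI:
  assumes "finite D" "\<And>p. p \<in> D \<Longrightarrow> fst p < snd p" "\<And>p. p \<in> D \<Longrightarrow> {fst p..snd p} \<subseteq> S"
    "\<And>p q. p \<in> D \<Longrightarrow> q \<in> D \<Longrightarrow> p \<noteq> q \<Longrightarrow> snd p \<le> fst q \<or> snd q \<le> fst p"
  shows "interval_system S D"
  unfolding interval_system_def pairwise_def disjnt_iff
proof (intro conjI ballI impI allI notI assms(1-3))
  fix p q x assume *: "p \<in> D" "q \<in> D" "p \<noteq> q" "x \<in> {fst p<..<snd p} \<and> x \<in> {fst q<..<snd q}"
  show False using assms(4)[OF *(1-3)] *(4) by auto
qed auto

lemma interval_system_mono: "interval_system S D \<Longrightarrow> S \<subseteq> T \<Longrightarrow> interval_system T D"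
  unfolding interval_system_def by blast

lemma interval_system_length_le_measure:
  assumes D: "interval_system S D" and S: "S \<in> fmeasurable lborel"
  shows "increments (\<lambda>x. x) D \<le> measure lborel S"
proof -
  note * = interval_systemD[OF D]
  have "increments (\<lambda>x. x) D = (\<Sum>p\<in>D. measure lborel {fst p<..<snd p})"
    unfolding increments_def using *(2) by (intro sum.cong) (auto simp: less_imp_le)
  also have "\<dots> = measure lborel (\<Union>p\<in>D. {fst p<..<snd p})"
    using *(1) D by (intro measure_finite_Union [symmetric])
      (auto simp: disjoint_family_on_def interval_system_def pairwise_def disjnt_def)
  also have "\<dots> \<le> measure lborel S"
  proof (rule measure_mono_fmeasurable[OF _ _ S])
    show "(\<Union>p\<in>D. {fst p<..<snd p}) \<subseteq> S"
    proof (rule UN_least)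
      fix p assume "p \<in> D"
      have "{fst p<..<snd p} \<subseteq> {fst p..snd p}" by auto
      with *(3)[OF \<open>p \<in> D\<close>] show "{fst p<..<snd p} \<subseteq> S" by (rule order_trans[rotated])
    qed
    show "(\<Union>p\<in>D. {fst p<..<snd p}) \<in> sets lborel" using *(1) by (intro sets.finite_UN) auto
  qed
  finally show ?thesis .
qed

lemma interval_system_length_le:
  assumes "interval_system {s..t} D" "s \<le> t"
  shows "increments (\<lambda>x. x) D \<le> t - s"
  using interval_system_length_le_measure[OF assms(1)] assms(2) by (simp add: fmeasurable_def)

text \<open>An interval that crosses \<open>s\<close> is split there and its increment telescopes.
  This is what makes suprema of increments additive.\<close>

lemma interval_system_cut:
  assumes D: "interval_system S D"
  obtains D1 D2 where "interval_system (S \<inter> {..s}) D1" "interval_system (S \<inter> {s..}) D2"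
    "\<And>g. increments g D = increments g D1 + increments g D2"
proof -
  note * = interval_systemD[OF D]
  let ?l = "\<lambda>p. (fst p, min (snd p) s)" and ?r = "\<lambda>p. (max (fst p) s, snd p)"
  let ?L = "{p\<in>D. fst p < s}" and ?R = "{p\<in>D. s < snd p}"
  have injl: "inj_on ?l ?L"
  proof (rule inj_onI)
    fix p q assume pq: "p \<in> ?L" "q \<in> ?L" "?l p = ?l q"
    then show "p = q" using *(4)[of p q] *(2)[of p] *(2)[of q] by (cases "p = q") auto
  qed
  have injr: "inj_on ?r ?R"
  proof (rule inj_onI)
    fix p q assume pq: "p \<in> ?R" "q \<in> ?R" "?r p = ?r q"
    then show "p = q" using *(4)[of p q] *(2)[of p] *(2)[of q] by (cases "p = q") auto
  qed
  show thesis
  proof (rule that[of "?l ` ?L" "?r ` ?R"])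
    show "interval_system (S \<inter> {..s}) (?l ` ?L)"
    proof (rule interval_systemI; (elim imageE)?)
      fix p q x y assume "p = ?l x" "x \<in> ?L" "q = ?l y" "y \<in> ?L" "p \<noteq> q"
      then show "snd p \<le> fst q \<or> snd q \<le> fst p" using *(4)[of x y] by (cases "x = y") auto
    qed (use *(1,2,3) in \<open>auto simp: subset_iff\<close>)
    show "interval_system (S \<inter> {s..}) (?r ` ?R)"
    proof (rule interval_systemI; (elim imageE)?)
      fix p q x y assume "p = ?r x" "x \<in> ?R" "q = ?r y" "y \<in> ?R" "p \<noteq> q"
      then show "snd p \<le> fst q \<or> snd q \<le> fst p" using *(4)[of x y] by (cases "x = y") auto
    qed (use *(1,2,3) in \<open>auto simp: subset_iff\<close>)
    fix g
    have "increments g (?l ` ?L) = (\<Sum>p\<in>D. if fst p < s then g (min (snd p) s) - g (fst p) else 0)"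
      unfolding increments_def using *(1) by (subst sum.reindex[OF injl]) (simp add: sum.inter_filter)
    moreover have "increments g (?r ` ?R) = (\<Sum>p\<in>D. if s < snd p then g (snd p) - g (max (fst p) s) else 0)"
      unfolding increments_def using *(1) by (subst sum.reindex[OF injr]) (simp add: sum.inter_filter)
    moreover have "increments g D = (\<Sum>p\<in>D. (if fst p < s then g (min (snd p) s) - g (fst p) else 0)
        + (if s < snd p then g (snd p) - g (max (fst p) s) else 0))"
      unfolding increments_def
    proof (rule sum.cong)
      fix p assume "p \<in> D"
      from *(2)[OF this] show "g (snd p) - g (fst p) = (if fst p < s then g (min (snd p) s) - g (fst p) else 0)
        + (if s < snd p then g (snd p) - g (max (fst p) s) else 0)"
        by (auto simp: min_def max_def)
    qed simp
    ultimately show "increments g D = increments g (?l ` ?L) + increments g (?r ` ?R)"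
      by (simp add: sum.distrib)
  qed
qed

lemma increments_insert:
  assumes "interval_system {..s} D" "s < t"
  shows "interval_system {..t} (insert (s, t) D)" "increments g (insert (s, t) D) = increments g D + (g t - g s)"
proof -
  note * = interval_systemD[OF assms(1)]
  have le: "snd p \<le> s" if "p \<in> D" for p using *(2,3)[OF that] by auto
  show "interval_system {..t} (insert (s, t) D)"
  proof (rule interval_systemI)
    fix p q assume pq: "p \<in> insert (s, t) D" "q \<in> insert (s, t) D" "p \<noteq> q"
    show "snd p \<le> fst q \<or> snd q \<le> fst p"
    proof (cases "p \<in> D \<and> q \<in> D")
      case True
      then show ?thesis using *(4)[of p q] pq by blast
    next
      case False
      then show ?thesis using pq le[of p] le[of q] by auto
    qed
  next
    show "finite (insert (s, t) D)" using *(1) by simp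
  next
    fix p assume "p \<in> insert (s, t) D"
    then show "fst p < snd p" "{fst p..snd p} \<subseteq> {..t}"
      using *(2)[of p] le[of p] assms(2) by auto
  qed
  have "(s, t) \<notin> D" using le assms by force
  then show "increments g (insert (s, t) D) = increments g D + (g t - g s)"
    unfolding increments_def using *(1) by simp
qed

section \<open>Positive variation and the Jordan decomposition\<close>

text \<open>Constancy outside \<open>{0..1}\<close> allows systems on whole half-lines, so that the
  variation functions are defined on the entire real line, as \<open>interval_measure\<close>
  expects.\<close>

locale positive_variation =
  fixes g :: "real \<Rightarrow> real"
  assumes ac: "ac_increments g" and const: "\<And>t. t \<le> 0 \<Longrightarrow> g t = g 0" "\<And>t. t \<ge> 1 \<Longrightarrow> g t = g 1"
begin

text \<open>Cut \<open>{0..1}\<close> into pieces of length \<open>1 / Suc n\<close> below \<delta>: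
  on each piece the increments add up to at most 1, and outside of \<open>{0..1}\<close> they
  vanish.\<close>

lemma increments_bounded: "\<exists>B. \<forall>D S. interval_system S D \<longrightarrow> increments g D \<le> B"
proof -
  obtain \<delta> where \<delta>: "\<delta> > 0" "\<And>D. interval_system UNIV D \<Longrightarrow> increments (\<lambda>x. x) D < \<delta> \<Longrightarrow> increments g D \<le> 1"
    using ac unfolding ac_increments_def by (metis zero_less_one)
  obtain n where n: "1 / Suc n < \<delta>" using \<delta> nat_approx_posE by blast
  have step: "increments g D \<le> real k" if "interval_system {..real k / Suc n} D" for k D
    using that
  proof (induction k arbitrary: D)
    case 0
    then have "g (snd p) - g (fst p) = 0" if "p \<in> D" for p
      using interval_systemD(2,3)[OF 0 that] const(1)[of "snd p"] const(1)[of "fst p"] by auto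
    then show ?case unfolding increments_def by simp
  next
    case (Suc k)
    let ?s = "real k / Suc n" and ?t = "real (Suc k) / Suc n"
    obtain D1 D2 where D: "interval_system ({..?t} \<inter> {..?s}) D1" "interval_system ({..?t} \<inter> {?s..}) D2"
        "\<And>g. increments g D = increments g D1 + increments g D2"
      using interval_system_cut[OF Suc.prems] by blast
    have "interval_system {..?s} D1" using D(1) by (rule interval_system_mono) auto
    with Suc.IH have 1: "increments g D1 \<le> real k" by simp
    have "interval_system {?s..?t} D2" using D(2) by (rule interval_system_mono) auto
    then have "increments (\<lambda>x. x) D2 \<le> ?t - ?s"
      by (rule interval_system_length_le) (auto simp: divide_right_mono)
    also have "\<dots> < \<delta>" using n by (simp add: diff_divide_distrib [symmetric])
    finally have "increments g D2 \<le> 1"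
      using \<delta>(2)[of D2] interval_system_mono[OF D(2)] by simp
    with 1 D(3)[of g] show ?case by simp
  qed
  have "increments g D \<le> real (Suc n)" if SD: "interval_system S D" for S D
  proof -
    obtain D1 D2 where D: "interval_system (S \<inter> {..1}) D1" "interval_system (S \<inter> {1..}) D2"
        "\<And>g. increments g D = increments g D1 + increments g D2"
      using interval_system_cut[OF SD] by blast
    have "g (snd p) - g (fst p) = 0" if "p \<in> D2" for p
      using interval_systemD(2,3)[OF D(2) that] const(2)[of "snd p"] const(2)[of "fst p"] by auto
    then have "increments g D2 = 0" unfolding increments_def by simp
    moreover have "increments g D1 \<le> real (Suc n)"
      using interval_system_mono[OF D(1), of "{..1}"] step[of "Suc n" D1] by simp
    ultimately show ?thesis using D(3)[of g] by simp
  qed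
  then show ?thesis by blast
qed

text \<open>The positive variation of \<open>g\<close> on \<open>{..t}\<close>. The Jordan
  decomposition in use is \<open>g = P - (P - g)\<close>.\<close>

definition "P t = Sup (increments g ` {D. interval_system {..t} D})"

lemma nonempty: "{} \<in> {D. interval_system {..t} D}"
  by (simp add: interval_system_def)

lemma bdd: "bdd_above (increments g ` {D. interval_system {..t} D})"
  using increments_bounded by (auto simp: bdd_above_def)

lemma increments_le_P: "interval_system {..t} D \<Longrightarrow> increments g D \<le> P t"
  unfolding P_def by (intro cSUP_upper bdd) auto

text \<open>A nearly optimal system for \<open>P t\<close> is cut at \<open>s\<close>; its left part
  contributes at most \<open>P s\<close>.\<close>

lemma P_approx:
  assumes "s \<le> t" "\<eta> > 0"
  obtains D where "interval_system {s..t} D" "P t - P s \<le> increments g D + \<eta>"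
proof -
  have "P t - \<eta> < Sup (increments g ` {D. interval_system {..t} D})" using assms unfolding P_def by simp
  then obtain D where D: "interval_system {..t} D" "P t - \<eta> < increments g D"
    using less_cSUP_iff[OF _ bdd[of t]] nonempty[of t] by blast
  obtain D1 D2 where *: "interval_system ({..t} \<inter> {..s}) D1" "interval_system ({..t} \<inter> {s..}) D2"
        "\<And>g. increments g D = increments g D1 + increments g D2"
    using interval_system_cut[OF D(1)] by blast
  have "increments g D1 \<le> P s"
    using interval_system_mono[OF *(1), of "{..s}"] by (intro increments_le_P) auto
  then have "P t - P s \<le> increments g D2 + \<eta>" using D(2) *(3)[of g] by simp
  moreover have "interval_system {s..t} D2" using *(2) by (rule interval_system_mono) auto
  ultimately show thesis using that by blast
qed

lemma mono_P: "mono P"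
proof (rule monoI)
  fix s t :: real assume "s \<le> t"
  then show "P s \<le> P t" unfolding P_def
    by (intro cSUP_subset_mono bdd) (use nonempty in \<open>auto intro: interval_system_mono\<close>)
qed

text \<open>Appending \<open>(s, t)\<close> to a system below \<open>s\<close> gives a competitor
  for \<open>P t\<close>.\<close>

lemma mono_P_minus: "mono (\<lambda>t. P t - g t)"
proof (rule monoI)
  fix s t :: real assume st: "s \<le> t"
  show "P s - g s \<le> P t - g t"
  proof (cases "s = t")
    case False
    then have "s < t" using st by simp
    have "increments g D \<le> P t - (g t - g s)" if "interval_system {..s} D" for D
      using increments_insert(1)[OF that \<open>s < t\<close>] increments_insert(2)[OF that \<open>s < t\<close>, of g] increments_le_P[of t "insert (s, t) D"] by simp
    then have "P s \<le> P t - (g t - g s)"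
      using nonempty[of s] by (subst P_def, intro cSUP_least) auto
    then show ?thesis by simp
  qed simp
qed

text \<open>Refine each interval of \<open>D\<close> by a nearly optimal system inside it: the union
  is no longer than \<open>D\<close>, so the absolute continuity of \<open>g\<close> applies to
  it.\<close>

lemma ac_P: "ac_increments P"
  unfolding ac_increments_def
proof (intro allI impI)
  fix \<epsilon> :: real assume "\<epsilon> > 0"
  then obtain \<delta> where \<delta>: "\<delta> > 0" "\<And>D. interval_system UNIV D \<Longrightarrow> increments (\<lambda>x. x) D < \<delta> \<Longrightarrow> increments g D \<le> \<epsilon> / 2"
    using ac unfolding ac_increments_def by (metis half_gt_zero)
  show "\<exists>\<delta>>0. \<forall>D. interval_system UNIV D \<and> increments (\<lambda>x. x) D < \<delta> \<longrightarrow> increments P D \<le> \<epsilon>"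
  proof (intro exI[of _ \<delta>] conjI allI impI)
    fix D assume D: "interval_system UNIV D \<and> increments (\<lambda>x. x) D < \<delta>"
    note * = interval_systemD[OF conjunct1[OF D]]
    \<comment> \<open>Shares \<open>\<epsilon> / 2\<close> among the intervals of \<open>D\<close>;
      the summand 1 covers the empty system.\<close>
    define \<eta> where "\<eta> = \<epsilon> / 2 / (real (card D) + 1)"
    have \<eta>: "\<eta> > 0" "real (card D) * \<eta> \<le> \<epsilon> / 2"
      using \<open>\<epsilon> > 0\<close> unfolding \<eta>_def by (auto simp: field_simps)
    have "\<exists>E. interval_system {fst p..snd p} E \<and> P (snd p) - P (fst p) \<le> increments g E + \<eta>" if "p \<in> D" for p
      using P_approx[of "fst p" "snd p" \<eta>] *(2)[OF that] \<eta>(1) by (metis less_imp_le)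
    then obtain E where E: "\<And>p. p \<in> D \<Longrightarrow> interval_system {fst p..snd p} (E p)"
      "\<And>p. p \<in> D \<Longrightarrow> P (snd p) - P (fst p) \<le> increments g (E p) + \<eta>" by metis
    have within: "fst p \<le> fst q" "snd q \<le> snd p" "fst q < snd q" if "p \<in> D" "q \<in> E p" for p q
      using interval_systemD(2,3)[OF E(1)[OF that(1)] that(2)] by auto
    have disj: "E p \<inter> E q = {}" if "p \<in> D" "q \<in> D" "p \<noteq> q" for p q
    proof -
      { fix r assume "r \<in> E p" "r \<in> E q"
        with within[of p r] within[of q r] that *(4)[OF that] have False by fastforce }
      then show ?thesis by blast
    qed
    let ?U = "\<Union>p\<in>D. E p"
    have finE: "finite (E p)" if "p \<in> D" for p using E(1)[OF that] interval_systemD(1) by blast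
    have sumU: "increments f ?U = (\<Sum>p\<in>D. increments f (E p))" for f
      unfolding increments_def using *(1) finE disj by (intro sum.UNION_disjoint) auto
    have "interval_system UNIV ?U"
    proof (rule interval_systemI)
      show "finite ?U" using *(1) finE by auto
      fix q r assume "q \<in> ?U" "r \<in> ?U" "q \<noteq> r"
      then obtain p p' where pp: "p \<in> D" "q \<in> E p" "p' \<in> D" "r \<in> E p'" by blast
      show "snd q \<le> fst r \<or> snd r \<le> fst q"
      proof (cases "p = p'")
        case True
        then show ?thesis using interval_systemD(4)[OF E(1)[OF pp(1)], of q r] pp \<open>q \<noteq> r\<close> by blast
      next
        case False
        then show ?thesis using *(4)[OF pp(1) pp(3)] within[OF pp(1,2)] within[OF pp(3,4)] by linarith
      qed
    qed (use within in auto)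
    moreover have "increments (\<lambda>x. x) ?U \<le> increments (\<lambda>x. x) D"
      unfolding sumU increments_def[of _ D] using E(1) *(2)
      by (intro sum_mono interval_system_length_le) (auto simp: less_imp_le)
    ultimately have "increments g ?U \<le> \<epsilon> / 2" using \<delta>(2)[of ?U] D by auto
    moreover have "increments P D \<le> (\<Sum>p\<in>D. increments g (E p) + \<eta>)"
      unfolding increments_def[of P] by (intro sum_mono E(2))
    moreover have "\<dots> = increments g ?U + real (card D) * \<eta>" by (simp add: sumU sum.distrib)
    ultimately show "increments P D \<le> \<epsilon>" using \<eta>(2) by linarith
  qed fact
qed

end


section \<open>Densities of absolutely continuous functions\<close>

lemma ac_increments_continuous:
  assumes "mono P" "ac_increments P"
  shows "isCont P x"
proof -
  have "\<exists>s>0. \<forall>y. y \<noteq> x \<and> norm (y - x) < s \<longrightarrow> norm (P y - P x) < e" if "e > 0" for e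
  proof -
    obtain \<delta> where \<delta>: "\<delta> > 0" "\<And>D. interval_system UNIV D \<Longrightarrow> increments (\<lambda>x. x) D < \<delta> \<Longrightarrow> increments P D \<le> e / 2"
      using assms(2) \<open>e > 0\<close> unfolding ac_increments_def by (metis half_gt_zero)
    have 1: "P b - P a \<le> e / 2" if "a < b" "b - a < \<delta>" for a b
      using \<delta>(2)[of "{(a, b)}"] that by (simp add: interval_system_def increments_def)
    have 2: "P a \<le> P b" if "a < b" for a b using that assms(1) by (auto simp: mono_def)
    show ?thesis
    proof (intro exI[of _ \<delta>] conjI allI impI)
      fix y assume "y \<noteq> x \<and> norm (y - x) < \<delta>"
      then show "norm (P y - P x) < e"
        using 1[of x y] 1[of y x] 2[of x y] 2[of y x] \<open>e > 0\<close> by (cases "x < y") auto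
    qed fact
  qed
  then show ?thesis unfolding isCont_def by (rule LIM_I)
qed

text \<open>A null set has open neighbourhoods of small length. Finite unions of boxes inside such a
  neighbourhood form interval systems, whose mass is at most the increment of \<open>P\<close>, and
  continuity from below reaches the whole neighbourhood.\<close>

lemma absolutely_continuous_interval_measure:
  assumes P: "mono P" and ac: "ac_increments P"
  shows "absolutely_continuous lborel (interval_measure P)"
  unfolding absolutely_continuous_def
proof
  let ?\<nu> = "interval_measure P"
  have Icc: "emeasure ?\<nu> {a..b} = P b - P a" if "a \<le> b" for a b
    using that P ac_increments_continuous[OF P ac]
    by (intro emeasure_interval_measure_Icc) (auto simp: mono_def continuous_at_imp_continuous_on)
  fix N :: "real set" assume N: "N \<in> null_sets lborel"
  have "emeasure ?\<nu> N \<le> ennreal e" if e: "e > 0" for e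
  proof -
    obtain \<delta> where \<delta>: "\<delta> > 0" "\<And>D. interval_system UNIV D \<Longrightarrow> increments (\<lambda>x. x) D < \<delta> \<Longrightarrow> increments P D \<le> e"
      using ac e unfolding ac_increments_def by metis
    obtain U where U: "open U" "N \<subseteq> U" "emeasure lborel (U - N) < ennreal \<delta>"
      using outer_regular_lborel[of N \<delta>] null_setsD2[OF N] \<delta>(1) by (metis sets_lborel)
    have "N \<union> (U - N) = U" using U by auto
    then have "emeasure lborel U \<le> emeasure lborel N + emeasure lborel (U - N)"
      using emeasure_subadditive[of N lborel "U - N"] N U by (auto simp: null_setsD2)
    then have emU: "emeasure lborel U < ennreal \<delta>" using N U by (simp add: null_setsD1)
    then have U': "U \<in> fmeasurable lborel" using U by (auto simp: fmeasurable_def intro: less_trans)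
    have mU: "measure lborel U < \<delta>"
      using emU \<delta>(1) unfolding emeasure_eq_measure2[OF U'] by (simp add: ennreal_less_iff)
    obtain \<D> where \<D>: "countable \<D>" "\<D> \<subseteq> Pow U" "\<And>X. X \<in> \<D> \<Longrightarrow> \<exists>a b. X = cbox a b" "\<Union>\<D> = U"
      using open_countable_Union_open_cbox[OF U(1)] by blast
    have fin: "emeasure ?\<nu> (\<Union>F) \<le> ennreal e" if F: "finite F" "F \<subseteq> \<D>" for F
    proof -
      \<comment> \<open>The boxes in \<open>F\<close> may overlap; the members of a division of
        their union do not.\<close>
      obtain p where p: "p division_of (\<Union>F)"
        using elementary_unions_intervals[of F] F \<D>(3) by blast
      have fp: "finite p" using p by auto
      have pk: "\<exists>a b. a \<le> b \<and> k = {a..b}" if k: "k \<in> p" for k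
        using division_ofD(3,4)[OF p k] by fastforce
      \<comment> \<open>One-point members have no place in an interval system. They are dropped, as
        their increment is 0.\<close>
      let ?f = "\<lambda>k. (Inf k, Sup k)" and ?p = "{k\<in>p. Inf k < Sup k}"
      have Ik: "{Inf k..Sup k} = k" "Inf k \<le> Sup k" if k: "k \<in> p" for k :: "real set"
      proof -
        obtain a b where "a \<le> b" "k = {a..b}" using pk[OF k] by blast
        then show "{Inf k..Sup k} = k" "Inf k \<le> Sup k" by simp_all
      qed
      have inj: "inj_on ?f ?p" 
      proof (rule inj_onI)
        fix k l assume kl: "k \<in> ?p" "l \<in> ?p" "?f k = ?f l"
        have "k = {Inf k..Sup k}" using Ik(1)[of k] kl(1) by blast
        also have "\<dots> = {Inf l..Sup l}" using kl(3) by simp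
        also have "\<dots> = l" using Ik(1)[of l] kl(2) by blast
        finally show "k = l" .
      qed
      have sys: "interval_system U (?f ` ?p)"
        unfolding interval_system_def
      proof (intro conjI ballI)
        show "finite (?f ` ?p)" using fp by auto
        fix q assume "q \<in> ?f ` ?p"
        then obtain k where k: "k \<in> p" "Inf k < Sup k" "q = ?f k" by auto
        then show "fst q < snd q" by simp
        have "k \<subseteq> \<Union>F" using division_ofD(2)[OF p] k by blast
        moreover have "{fst q..snd q} = k" using Ik(1)[OF k(1)] unfolding k(3) by simp
        ultimately show "{fst q..snd q} \<subseteq> U" using F \<D>(4) by blast
      next
        show "pairwise (\<lambda>p q. disjnt {fst p<..<snd p} {fst q<..<snd q}) (?f ` ?p)"
        proof (rule pairwiseI; elim imageE)
          fix q r k l assume *: "q \<noteq> r" "q = ?f k" "k \<in> ?p" "r = ?f l" "l \<in> ?p"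
          then have "interior k \<inter> interior l = {}" using division_ofD(5)[OF p, of k l] by auto
          moreover have "interior k = {Inf k<..<Sup k}" "interior l = {Inf l<..<Sup l}"
            using arg_cong[OF Ik(1)[of k], of interior] arg_cong[OF Ik(1)[of l], of interior] *(3,5)
          unfolding interior_atLeastAtMost_real by blast+
          ultimately show "disjnt {fst q<..<snd q} {fst r<..<snd r}" using * by (simp add: disjnt_def)
        qed
      qed
      have "emeasure ?\<nu> (\<Union>F) = emeasure ?\<nu> (\<Union>k\<in>p. k)" using division_ofD(6)[OF p] by simp
      also have "\<dots> \<le> (\<Sum>k\<in>p. emeasure ?\<nu> k)"
        using fp by (intro emeasure_subadditive_finite) (auto dest!: pk)
      also have "\<dots> = (\<Sum>k\<in>p. ennreal (P (Sup k) - P (Inf k)))"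
      proof (rule sum.cong)
        fix k assume k: "k \<in> p"
        show "emeasure ?\<nu> k = ennreal (P (Sup k) - P (Inf k))"
          using Icc[OF Ik(2)[OF k]] unfolding Ik(1)[OF k] .
      qed simp
      also have "\<dots> = ennreal (\<Sum>k\<in>p. P (Sup k) - P (Inf k))"
        using Ik P by (intro sum_ennreal) (auto simp: mono_def)
      also have "(\<Sum>k\<in>p. P (Sup k) - P (Inf k)) = (\<Sum>k\<in>?p. P (Sup k) - P (Inf k))"
      proof (rule sum.mono_neutral_right)
        show "\<forall>k\<in>p - ?p. P (Sup k) - P (Inf k) = 0"
        proof
          fix k assume "k \<in> p - ?p"
          then have "Inf k = Sup k" using Ik(2)[of k] by auto
          then show "P (Sup k) - P (Inf k) = 0" by simp
        qed
      qed (use fp in auto)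
      also have "\<dots> = increments P (?f ` ?p)"
        unfolding increments_def by (subst sum.reindex[OF inj]) simp
      also have "\<dots> \<le> e"
        using interval_system_length_le_measure[OF sys U'] mU sys
        by (intro \<delta>(2)) (auto intro: interval_system_mono)
      finally show ?thesis by (simp add: ennreal_leI)
    qed
    have "emeasure ?\<nu> U \<le> ennreal e"
    proof (cases "\<D> = {}")
      case True
      then show ?thesis using \<D>(4) by auto
    next
      case False
      let ?X = "from_nat_into \<D>" and ?T = "\<lambda>n. \<Union>(from_nat_into \<D> ` {..n})"
      have rg: "range ?X = \<D>" using \<D>(1) False by (simp add: range_from_nat_into)
      have "U = \<Union>(range ?X)" using rg \<D>(4) by simp
      also have "\<dots> = (\<Union>n. ?T n)" by auto
      finally have UT: "U = (\<Union>n. ?T n)" .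
      have st: "?T n \<in> sets ?\<nu>" for n
      proof -
        have "?X i \<in> sets borel" for i
        proof -
          have "?X i \<in> \<D>" using rg by blast
          from \<D>(3)[OF this] obtain a b where "?X i = cbox a b" by blast
          then show ?thesis by simp
        qed
        then show ?thesis by auto
      qed
      have "emeasure ?\<nu> U = (SUP n. emeasure ?\<nu> (?T n))"
      proof (subst UT, rule SUP_emeasure_incseq [symmetric])
        show "range ?T \<subseteq> sets ?\<nu>" using st by blast
        show "incseq ?T" unfolding incseq_def by (intro allI impI Union_mono image_mono) simp
      qed
      also have "\<dots> \<le> ennreal e"
      proof (rule SUP_least)
        fix n
        show "emeasure ?\<nu> (?T n) \<le> ennreal e" using rg by (intro fin) blast+
      qed
      finally show ?thesis .
    qed
    moreover have "emeasure ?\<nu> N \<le> emeasure ?\<nu> U" using U by (intro emeasure_mono) auto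
    ultimately show ?thesis by simp
  qed
  then have "emeasure ?\<nu> N \<le> 0 + ennreal e" if "e > 0" for e using that by simp
  then have "emeasure ?\<nu> N \<le> 0" by (rule ennreal_le_epsilon)
  then have "emeasure ?\<nu> N = 0" by simp
  moreover have "N \<in> sets ?\<nu>" using null_setsD2[OF N] by simp
  ultimately show "N \<in> null_sets ?\<nu>" by (rule null_setsI)
qed

text \<open>Radon-Nikodym. The density is finite almost everywhere because bounded intervals have
  finite mass, so \<open>enn2real\<close> changes it only on a null set.\<close>

lemma mono_ac_density:
  assumes P: "mono P" and ac: "ac_increments P"
  obtains f :: "real \<Rightarrow> real" where "f \<in> borel_measurable borel" "\<And>x. 0 \<le> f x"
    "\<And>a b. a \<le> b \<Longrightarrow> set_integrable lborel {a<..b} f"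
    "\<And>a b. a \<le> b \<Longrightarrow> (LBINT t:{a<..b}. f t) = P b - P a"
proof -
  let ?\<nu> = "interval_measure P"
  have Ioc: "emeasure ?\<nu> {a<..b} = P b - P a" if "a \<le> b" for a b
    using that P ac_increments_continuous[OF P ac]
    by (intro emeasure_interval_measure_Ioc) (auto simp: mono_def continuous_at_imp_continuous_at_within)
  obtain f where f: "f \<in> borel_measurable lborel" "density lborel f = ?\<nu>"
    using sigma_finite_measure.Radon_Nikodym[OF sigma_finite_lborel absolutely_continuous_interval_measure[OF P ac]] by auto
  have fb [measurable]: "f \<in> borel_measurable borel" using f(1) by simp
  have nn: "(\<integral>\<^sup>+t. f t * indicator {a<..b} t \<partial>lborel) = P b - P a" if "a \<le> b" for a b
    using Ioc[OF that] unfolding f(2)[symmetric] by (subst (asm) emeasure_density) auto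
  have fin: "AE t in lborel. f t \<noteq> \<infinity>"
  proof -
    have "AE t in lborel. \<forall>n::nat. f t * indicator {- real n<..real n} t \<noteq> \<infinity>"
      unfolding AE_all_countable
    proof
      fix n :: nat
      show "AE t in lborel. f t * indicator {- real n<..real n} t \<noteq> \<infinity>"
        using nn[of "- real n" "real n"] by (intro nn_integral_noteq_infinite) auto
    qed
    then show ?thesis
    proof eventually_elim
      fix t assume *: "\<forall>n::nat. f t * indicator {- real n<..real n} t \<noteq> \<infinity>"
      obtain n :: nat where "\<bar>t\<bar> < real n" using reals_Archimedean2 by blast
      then have "t \<in> {- real n<..real n}" by auto
      then show "f t \<noteq> \<infinity>" using *[rule_format, of n] by simp
    qed
  qed
  define h where "h t = enn2real (f t)" for t
  have hb [measurable]: "h \<in> borel_measurable borel" unfolding h_def by measurable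
  have h: "(\<integral>\<^sup>+t. ennreal (indicator {a<..b} t *\<^sub>R h t) \<partial>lborel) = P b - P a" if "a \<le> b" for a b
    unfolding nn[OF that, symmetric]
  proof (rule nn_integral_cong_AE)
    show "AE t in lborel. ennreal (indicator {a<..b} t *\<^sub>R h t) = f t * indicator {a<..b} t"
      using fin by eventually_elim (auto simp: h_def less_top split: split_indicator)
  qed
  show thesis
  proof (rule that[of h])
    fix a b :: real assume ab: "a \<le> b"
    then show "set_integrable lborel {a<..b} h"
      unfolding set_integrable_def using h[OF ab]
      by (intro integrableI_nonneg) (auto simp: h_def)
    show "(LBINT t:{a<..b}. h t) = P b - P a"
      unfolding set_lebesgue_integral_def using P ab h[OF ab]
      by (subst integral_eq_nn_integral) (auto simp: h_def mono_def)
  qed (auto simp: h_def)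
qed

text \<open>The density of \<open>g\<close> is the difference of those of \<open>P\<close> and
  \<open>P - g\<close>; the condition on \<open>-g\<close> makes the second of these functions
  absolutely continuous.\<close>

lemma ac_increments_FTC:
  assumes g: "positive_variation g" and ac': "ac_increments (\<lambda>t. - g t)"
  obtains h where "h \<in> borel_measurable borel" "\<And>a b. a \<le> b \<Longrightarrow> set_integrable lborel {a<..b} h"
    "\<And>a b. a \<le> b \<Longrightarrow> (LBINT t:{a<..b}. h t) = g b - g a"
proof -
  interpret positive_variation g by fact
  have "ac_increments (\<lambda>t. P t - g t)"
    unfolding ac_increments_def
  proof (intro allI impI)
    fix \<epsilon> :: real assume "\<epsilon> > 0"
    then obtain d1 where d1: "d1 > 0" "\<And>D. interval_system UNIV D \<Longrightarrow> increments (\<lambda>x. x) D < d1 \<Longrightarrow> increments P D \<le> \<epsilon> / 2"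
      using ac_P unfolding ac_increments_def by (metis half_gt_zero)
    from \<open>\<epsilon> > 0\<close> obtain d2 where d2: "d2 > 0" "\<And>D. interval_system UNIV D \<Longrightarrow> increments (\<lambda>x. x) D < d2 \<Longrightarrow> increments (\<lambda>t. - g t) D \<le> \<epsilon> / 2"
      using ac' unfolding ac_increments_def by (metis half_gt_zero)
    show "\<exists>\<delta>>0. \<forall>D. interval_system UNIV D \<and> increments (\<lambda>x. x) D < \<delta> \<longrightarrow> increments (\<lambda>t. P t - g t) D \<le> \<epsilon>"
    proof (intro exI[of _ "min d1 d2"] conjI allI impI)
      fix D assume D: "interval_system UNIV D \<and> increments (\<lambda>x. x) D < min d1 d2"
      have "increments (\<lambda>t. P t - g t) D = increments P D + increments (\<lambda>t. - g t) D"
        unfolding increments_def sum.distrib [symmetric] by (intro sum.cong) auto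
      then show "increments (\<lambda>t. P t - g t) D \<le> \<epsilon>" using d1(2)[of D] d2(2)[of D] D by simp
    qed (use d1 d2 in auto)
  qed
  then obtain q where q: "q \<in> borel_measurable borel" "\<And>t. 0 \<le> q t"
    "\<And>a b. a \<le> b \<Longrightarrow> set_integrable lborel {a<..b} q"
    "\<And>a b. a \<le> b \<Longrightarrow> (LBINT t:{a<..b}. q t) = (P b - g b) - (P a - g a)"
    by (rule mono_ac_density[OF mono_P_minus]) (rule that; assumption)
  obtain p where p: "p \<in> borel_measurable borel" "\<And>t. 0 \<le> p t"
    "\<And>a b. a \<le> b \<Longrightarrow> set_integrable lborel {a<..b} p"
    "\<And>a b. a \<le> b \<Longrightarrow> (LBINT t:{a<..b}. p t) = P b - P a"
    by (rule mono_ac_density[OF mono_P ac_P]) (rule that; assumption)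
  show thesis
  proof (rule that[of "\<lambda>t. p t - q t"])
    show "(\<lambda>t. p t - q t) \<in> borel_measurable borel" using p(1) q(1) by simp
    fix a b :: real assume ab: "a \<le> b"
    show "set_integrable lborel {a<..b} (\<lambda>t. p t - q t)" using p(3) q(3) ab by (intro set_integral_diff) auto
    show "(LBINT t:{a<..b}. p t - q t) = g b - g a"
      using p(3,4) q(3,4) ab by (subst set_integral_diff) auto
  qed
qed

text \<open>Clamping to \<open>{0..1}\<close> is monotone and lengthens no interval. A system on the
  line becomes a division inside \<open>{0..1}\<close> once collapsed intervals are dropped, and
  these contribute no increment.\<close>

lemma absolutely_continuous_on_ac_increments:
  fixes g :: "real \<Rightarrow> real"
  assumes g: "absolutely_continuous_on {0..1} g"
  shows "ac_increments (\<lambda>t. g (max 0 (min 1 t)))" "ac_increments (\<lambda>t. - g (max 0 (min 1 t)))"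
proof -
  define c where "c = (\<lambda>t::real. max 0 (min 1 t))"
  have c: "c x \<in> {0..1}" "c x - c y \<le> x - y" "c y \<le> c x" if "y \<le> x" for x y
    using that unfolding c_def by (auto simp: min_def max_def)
  have c1: "0 \<le> c x" "c x \<le> 1" for x using c(1)[of x x] by auto
  have disj: "b \<le> a' \<or> b' \<le> a \<Longrightarrow> {a<..<b} \<inter> {a'<..<b'} = {}" for a b a' b' :: real by auto
  have *: "\<exists>\<delta>>0. \<forall>D. interval_system UNIV D \<and> increments (\<lambda>x. x) D < \<delta> \<longrightarrow>
      (\<Sum>p\<in>D. \<bar>g (c (snd p)) - g (c (fst p))\<bar>) \<le> \<epsilon>" if "\<epsilon> > 0" for \<epsilon>
  proof -
    obtain \<delta> where \<delta>: "\<delta> > 0" "\<And>\<D> T. \<D> division_of T \<Longrightarrow> T \<subseteq> {0..1} \<Longrightarrow> (\<Sum>k\<in>\<D>. measure lborel k) < \<delta>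
        \<Longrightarrow> (\<Sum>k\<in>\<D>. \<bar>g (Sup k) - g (Inf k)\<bar>) < \<epsilon>"
      using g \<open>\<epsilon> > 0\<close> unfolding absolutely_continuous_on_def by metis
    show ?thesis
    proof (intro exI[of _ \<delta>] conjI allI impI)
      fix D assume D: "interval_system UNIV D \<and> increments (\<lambda>x. x) D < \<delta>"
      note D' = interval_systemD[OF conjunct1[OF D]]
      let ?f = "\<lambda>p. {c (fst p)..c (snd p)}" and ?D = "{p\<in>D. c (fst p) < c (snd p)}"
      have inj: "inj_on ?f ?D"
      proof (rule inj_onI)
        fix p q assume pq: "p \<in> ?D" "q \<in> ?D" "?f p = ?f q"
        then have le: "c (fst p) < c (snd p)" "c (fst q) < c (snd q)" "p \<in> D" "q \<in> D" by auto
        with pq(3) have eq: "c (fst p) = c (fst q)" "c (snd p) = c (snd q)"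
          unfolding Icc_eq_Icc by argo+
        show "p = q"
        proof (rule ccontr)
          assume "p \<noteq> q"
          from D'(4)[OF le(3,4) this] show False using c(3) le eq by fastforce
        qed
      qed
      have div: "?f ` ?D division_of (\<Union>(?f ` ?D))"
      proof (rule division_ofI)
        show "finite (?f ` ?D)" using D'(1) by simp
        fix k assume "k \<in> ?f ` ?D"
        then show "k \<subseteq> \<Union>(?f ` ?D)" "k \<noteq> {}" "\<exists>a b. k = cbox a b" by fastforce+
      next
        fix k l assume "k \<in> ?f ` ?D" "l \<in> ?f ` ?D" "k \<noteq> l"
        then obtain p q where pq: "p \<in> D" "q \<in> D" "p \<noteq> q" "k = ?f p" "l = ?f q" by auto
        from D'(4)[OF this(1-3)] have "c (snd p) \<le> c (fst q) \<or> c (snd q) \<le> c (fst p)" using c(3) by blast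
        then show "interior k \<inter> interior l = {}" unfolding pq interior_atLeastAtMost_real by (rule disj)
      qed simp
      have "(\<Sum>k\<in>?f ` ?D. measure lborel k) = (\<Sum>p\<in>?D. c (snd p) - c (fst p))"
        by (subst sum.reindex[OF inj]) (auto intro!: sum.cong)
      also have "\<dots> \<le> (\<Sum>p\<in>?D. snd p - fst p)"
        using D'(2) c(2) by (intro sum_mono) (auto simp: less_imp_le)
      also have "\<dots> \<le> increments (\<lambda>x. x) D"
        unfolding increments_def using D'(1,2) by (intro sum_mono2) (auto simp: less_imp_le)
      also have "\<dots> < \<delta>" using D by simp
      finally have "(\<Sum>k\<in>?f ` ?D. \<bar>g (Sup k) - g (Inf k)\<bar>) < \<epsilon>"
        by (intro \<delta>(2)[OF div]) (auto intro: order_trans[OF c1(1)] order_trans[OF _ c1(2)])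
      also have "(\<Sum>k\<in>?f ` ?D. \<bar>g (Sup k) - g (Inf k)\<bar>) = (\<Sum>p\<in>?D. \<bar>g (c (snd p)) - g (c (fst p))\<bar>)"
        by (subst sum.reindex[OF inj]) (auto intro!: sum.cong simp: less_imp_le)
      also have "\<dots> = (\<Sum>p\<in>D. \<bar>g (c (snd p)) - g (c (fst p))\<bar>)"
      proof (rule sum.mono_neutral_left)
        show "\<forall>p\<in>D - ?D. \<bar>g (c (snd p)) - g (c (fst p))\<bar> = 0"
        proof
          fix p assume p: "p \<in> D - ?D"
          then have "fst p < snd p" "\<not> c (fst p) < c (snd p)" using D'(2) by auto
          then have "c (fst p) = c (snd p)" using c(3)[of "fst p" "snd p"] by auto
          then show "\<bar>g (c (snd p)) - g (c (fst p))\<bar> = 0" by simp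
        qed
      qed (use D'(1) in auto)
      finally show "(\<Sum>p\<in>D. \<bar>g (c (snd p)) - g (c (fst p))\<bar>) \<le> \<epsilon>" by simp
    qed fact
  qed
  have le: "increments (\<lambda>t. g (c t)) D \<le> (\<Sum>p\<in>D. \<bar>g (c (snd p)) - g (c (fst p))\<bar>)"
    "increments (\<lambda>t. - g (c t)) D \<le> (\<Sum>p\<in>D. \<bar>g (c (snd p)) - g (c (fst p))\<bar>)" for D
    unfolding increments_def by (intro sum_mono; simp)+
  have 1: "ac_increments (\<lambda>t. g (c t))"
    unfolding ac_increments_def
  proof (intro allI impI)
    fix \<epsilon> :: real assume "\<epsilon> > 0"
    from *[OF this] show "\<exists>\<delta>>0. \<forall>D. interval_system UNIV D \<and> increments (\<lambda>x. x) D < \<delta> \<longrightarrow> increments (\<lambda>t. g (c t)) D \<le> \<epsilon>"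
      using order_trans[OF le(1)] by blast
  qed
  have 2: "ac_increments (\<lambda>t. - g (c t))"
    unfolding ac_increments_def
  proof (intro allI impI)
    fix \<epsilon> :: real assume "\<epsilon> > 0"
    from *[OF this] show "\<exists>\<delta>>0. \<forall>D. interval_system UNIV D \<and> increments (\<lambda>x. x) D < \<delta> \<longrightarrow> increments (\<lambda>t. - g (c t)) D \<le> \<epsilon>"
      using order_trans[OF le(2)] by blast
  qed
  from 1 2 show "ac_increments (\<lambda>t. g (max 0 (min 1 t)))" "ac_increments (\<lambda>t. - g (max 0 (min 1 t)))"
    unfolding c_def by auto
qed

text \<open>Lebesgue's differentiation theorem identifies the density with the derivative almost
  everywhere. The density is cut off outside \<open>{0<..1}\<close>, so that integrals over
  \<open>{..t}\<close> effectively start at 0.\<close>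

theorem absolutely_continuous_on_FTC:
  fixes g :: "real \<Rightarrow> real"
  assumes g: "absolutely_continuous_on {0..1} g"
  obtains h where "h \<in> borel_measurable borel" "integrable lborel h" "\<And>t. t \<notin> {0..1} \<Longrightarrow> h t = 0"
    "\<And>t. t \<in> {0..1} \<Longrightarrow> g t = g 0 + (LBINT r:{..t}. h r)"
    "AE t in lborel. t \<in> {0..1} \<longrightarrow> (g has_real_derivative h t) (at t within {0..1})"
proof -
  let ?g = "\<lambda>t. g (max 0 (min 1 t))"
  have "positive_variation ?g"
    using absolutely_continuous_on_ac_increments[OF g] by unfold_locales auto
  then obtain h where h: "h \<in> borel_measurable borel" "\<And>a b. a \<le> b \<Longrightarrow> set_integrable lborel {a<..b} h"
    "\<And>a b. a \<le> b \<Longrightarrow> (LBINT t:{a<..b}. h t) = ?g b - ?g a"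
    by (rule ac_increments_FTC[OF _ absolutely_continuous_on_ac_increments(2)[OF g]]) (rule that; assumption)
  define k where "k t = indicator {0<..1} t * h t" for t
  have [measurable]: "k \<in> borel_measurable borel" using h(1) unfolding k_def by measurable
  have intk: "integrable lborel k"
    using h(2)[of 0 1] unfolding k_def set_integrable_def by simp
  have eq: "g t = g 0 + (LBINT r:{..t}. k r)" if "t \<in> {0..1}" for t
  proof -
    have "(LBINT r:{..t}. k r) = (LBINT r:{0<..t}. h r)"
      unfolding set_lebesgue_integral_def k_def using that
      by (intro lintegral_cong) (auto split: split_indicator)
    then show ?thesis using h(3)[of 0 t] that by simp
  qed
  show thesis
  proof (rule that[of k])
    show "AE t in lborel. t \<in> {0..1} \<longrightarrow> (g has_real_derivative k t) (at t within {0..1})"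
      using lebesgue_differentiation[OF intk]
    proof (eventually_elim, intro impI)
      fix t assume d: "((\<lambda>s. LBINT t:{..s}. k t) has_real_derivative k t) (at t)" and t: "t \<in> {0..1::real}"
      have "((\<lambda>s. g 0 + (LBINT t:{..s}. k t)) has_real_derivative k t) (at t within {0..1})"
        using has_field_derivative_at_within[OF d, of "{0..1}"] by (auto intro!: derivative_eq_intros)
      then show "(g has_real_derivative k t) (at t within {0..1})"
        by (rule has_field_derivative_transform_within[where d = 1]) (use t in \<open>auto simp: eq[symmetric]\<close>)
    qed
    show "g t = g 0 + (LBINT r:{..t}. k r)" if "t \<in> {0..1}" for t using eq[OF that] .
  qed (use intk in \<open>auto simp: k_def\<close>)
qed

section \<open>Jets of Sobolev functions\<close>

lemma deriv01_eq:
  assumes "t \<in> {0..1}" "(f has_real_derivative D) (at t within {0..1})"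
  shows "deriv01 f t = D"
  using assms vector_derivative_within_cbox[of 0 1 t f D]
  by (simp add: deriv01_def has_real_derivative_iff_has_vector_derivative)

lemma deriv01_cong:
  assumes "t \<in> {0..1}" "\<And>s. s \<in> {0..1} \<Longrightarrow> f s = g s"
  shows "deriv01 f t = deriv01 g t"
proof -
  have "(f has_vector_derivative D) (at t within {0..1}) \<longleftrightarrow> (g has_vector_derivative D) (at t within {0..1})" for D
    using assms has_vector_derivative_transform[of t "{0..1}" f g D] has_vector_derivative_transform[of t "{0..1}" g f D]
    by auto
  then show ?thesis by (simp add: deriv01_def vector_derivative_def)
qed

lemma deriv01_works:
  assumes "f differentiable (at t within {0..1})"
  shows "(f has_real_derivative deriv01 f t) (at t within {0..1})"
  using assms by (simp add: deriv01_def vector_derivative_works has_real_derivative_iff_has_vector_derivative)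

type_synonym jet = "nat \<Rightarrow> real \<Rightarrow> real"
text \<open>Each list entry is an elementary tensor, with one jet for each coordinate; the list
  stands for the sum of its entries.\<close>

type_synonym tensor = "(nat \<Rightarrow> jet) list"

text \<open>A jet lists the derivatives of a function on \<open>[0,1]\<close>, extended by \<open>0\<close>; the one of order
  \<open>\<alpha>\<close> is a Borel representative of a derivative that exists almost everywhere.\<close>

definition sobolev_jet :: "nat \<Rightarrow> jet \<Rightarrow> bool" where
  "sobolev_jet \<alpha> G \<longleftrightarrow>
     (\<forall>k\<le>\<alpha>. G k \<in> borel_measurable borel \<and> (\<forall>t. t \<notin> {0..1} \<longrightarrow> G k t = 0)) \<and>
     (\<forall>k<\<alpha>. continuous_on {0..1} (G k)) \<and>
     integrable lborel (\<lambda>t. (G \<alpha> t)\<^sup>2) \<and>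
     (\<forall>k<\<alpha>. \<forall>t\<in>{0..1}. G k t = G k 0 + (LBINT r:{..t}. G (Suc k) r)) \<and>
     (\<forall>k. Suc k < \<alpha> \<longrightarrow> (\<forall>t\<in>{0..1}. (G k has_real_derivative G (Suc k) t) (at t within {0..1}))) \<and>
     (\<forall>k<\<alpha>. AE t in lborel. t \<in> {0..1} \<longrightarrow> (G k has_real_derivative G (Suc k) t) (at t within {0..1}))"

lemma sobolev_jetD:
  assumes "sobolev_jet \<alpha> G"
  shows "k \<le> \<alpha> \<Longrightarrow> G k \<in> borel_measurable borel"
    "k \<le> \<alpha> \<Longrightarrow> t \<notin> {0..1} \<Longrightarrow> G k t = 0"
    "k < \<alpha> \<Longrightarrow> continuous_on {0..1} (G k)"
    "integrable lborel (\<lambda>t. (G \<alpha> t)\<^sup>2)"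
    "k < \<alpha> \<Longrightarrow> t \<in> {0..1} \<Longrightarrow> G k t = G k 0 + (LBINT r:{..t}. G (Suc k) r)"
    "Suc k < \<alpha> \<Longrightarrow> t \<in> {0..1} \<Longrightarrow> (G k has_real_derivative G (Suc k) t) (at t within {0..1})"
    "k < \<alpha> \<Longrightarrow> AE t in lborel. t \<in> {0..1} \<longrightarrow> (G k has_real_derivative G (Suc k) t) (at t within {0..1})"
  using assms unfolding sobolev_jet_def by blast+

lemma sobolev_jet_bounded:
  assumes "sobolev_jet \<alpha> G" "k < \<alpha>"
  obtains B where "B \<ge> 0" "\<And>t. \<bar>G k t\<bar> \<le> B"
proof -
  have "compact (G k ` {0..1})"
    using sobolev_jetD(3)[OF assms] by (intro compact_continuous_image) auto
  then obtain B where B: "\<And>t. t \<in> {0..1} \<Longrightarrow> \<bar>G k t\<bar> \<le> B"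
    using compact_imp_bounded bounded_iff by (metis imageI real_norm_def)
  have "\<bar>G k t\<bar> \<le> max B 0" for t
    using B[of t] sobolev_jetD(2)[OF assms(1), of k t] assms(2) by (cases "t \<in> {0..1}") auto
  then show thesis using that[of "max B 0"] by auto
qed

lemma sobolev_jet_integrable_square:
  assumes G: "sobolev_jet \<alpha> G" and k: "k \<le> \<alpha>"
  shows "integrable lborel (\<lambda>t. (G k t)\<^sup>2)"
proof (cases "k = \<alpha>")
  case True
  then show ?thesis using sobolev_jetD(4)[OF G] by simp
next
  case False
  then have "k < \<alpha>" using k by simp
  from sobolev_jet_bounded[OF G this] obtain B where B: "B \<ge> 0" "\<And>t. \<bar>G k t\<bar> \<le> B" by blast
  have [measurable]: "G k \<in> borel_measurable borel" using sobolev_jetD(1)[OF G k] .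
  show ?thesis
  proof (rule lintegrable_bound)
    show "integrable lborel (\<lambda>t. indicator {0..1::real} t * B\<^sup>2 :: real)"
      by (intro integrable_mult_left integrable_real_indicator) auto
    show "AE t in lborel. norm ((G k t)\<^sup>2) \<le> norm (indicat_real {0..1} t * B\<^sup>2)"
    proof (rule AE_I2)
      fix t
      have "(G k t)\<^sup>2 \<le> B\<^sup>2" using B by (simp add: abs_le_square_iff [symmetric])
      then show "norm ((G k t)\<^sup>2) \<le> norm (indicat_real {0..1} t * B\<^sup>2)"
        using sobolev_jetD(2)[OF G k, of t] by (cases "t \<in> {0..1}") auto
    qed
  qed measurable
qed

lemma sobolev_jet_integrable:
  assumes G: "sobolev_jet \<alpha> G" and k: "k \<le> \<alpha>"
  shows "integrable lborel (G k)"
proof (rule lintegrable_bound)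
  show "integrable lborel (\<lambda>t. indicator {0..1::real} t + (G k t)\<^sup>2 :: real)"
    using sobolev_jet_integrable_square[OF G k]
    by (intro Bochner_Integration.integrable_add integrable_real_indicator) auto
  show "G k \<in> borel_measurable lborel" using sobolev_jetD(1)[OF G k] by simp
  show "AE t in lborel. norm (G k t) \<le> norm (indicat_real {0..1} t + (G k t)\<^sup>2)"
  proof (rule AE_I2)
    fix t
    have "\<bar>x\<bar> \<le> 1 + x\<^sup>2" for x :: real
    proof -
      have "0 \<le> (\<bar>x\<bar> - 1)\<^sup>2 + \<bar>x\<bar>" by simp
      also have "\<dots> = 1 + x\<^sup>2 - \<bar>x\<bar>" by (simp add: power2_eq_square algebra_simps)
      finally show ?thesis by simp
    qed
    from this[of "G k t"] show "norm (G k t) \<le> norm (indicat_real {0..1} t + (G k t)\<^sup>2)"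
      using sobolev_jetD(2)[OF G k, of t] by (cases "t \<in> {0..1}") auto
  qed
qed

text \<open>The derivative of order \<alpha> in \<open>sobolev1\<close> is only Lebesgue measurable
  and has default values. The top entry of the jet is therefore the Borel density of the derivative
  of order \<alpha> - 1, which agrees with it almost everywhere.\<close>

lemma sobolev1_jet:
  assumes g: "g \<in> sobolev1 \<alpha>" and \<alpha>: "\<alpha> \<ge> 1"
  obtains G where "sobolev_jet \<alpha> G" "\<And>t. t \<in> {0..1} \<Longrightarrow> G 0 t = g t"
proof -
  let ?D = "\<lambda>k. (deriv01 ^^ k) g"
  have diff: "?D k differentiable (at t within {0..1})" if "Suc k < \<alpha>" "t \<in> {0..1}" for k t
    using g that by (auto simp: sobolev1_def)
  have ac: "absolutely_continuous_on {0..1} (?D k)" if "k < \<alpha>" for k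
    using g that by (auto simp: sobolev1_def)
  define Q where "Q k h \<longleftrightarrow> h \<in> borel_measurable borel \<and> integrable lborel h \<and> (\<forall>t. t \<notin> {0..1} \<longrightarrow> h t = 0) \<and>
    (\<forall>t\<in>{0..1}. ?D k t = ?D k 0 + (LBINT r:{..t}. h r)) \<and>
    (AE t in lborel. t \<in> {0..1} \<longrightarrow> (?D k has_real_derivative h t) (at t within {0..1}))" for k h
  have "\<exists>h. Q k h" if "k < \<alpha>" for k
  proof (rule absolutely_continuous_on_FTC[OF ac[OF that]], goal_cases)
    case (1 h)
    then show ?case unfolding Q_def by blast
  qed
  then obtain h where Q: "\<And>k. k < \<alpha> \<Longrightarrow> Q k (h k)" by metis
  have h: "\<And>k. k < \<alpha> \<Longrightarrow> h k \<in> borel_measurable borel" "\<And>k. k < \<alpha> \<Longrightarrow> integrable lborel (h k)"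
    "\<And>k t. k < \<alpha> \<Longrightarrow> t \<notin> {0..1} \<Longrightarrow> h k t = 0"
    "\<And>k t. k < \<alpha> \<Longrightarrow> t \<in> {0..1} \<Longrightarrow> ?D k t = ?D k 0 + (LBINT r:{..t}. h k r)"
    "\<And>k. k < \<alpha> \<Longrightarrow> AE t in lborel. t \<in> {0..1} \<longrightarrow> (?D k has_real_derivative h k t) (at t within {0..1})"
    using Q unfolding Q_def by blast+
  have hD: "AE t in lborel. t \<in> {0..1} \<longrightarrow> ?D (Suc k) t = h k t" if "k < \<alpha>" for k
    using h(5)[OF that]
  proof eventually_elim
    case (elim t)
    then show ?case using deriv01_eq[of t "?D k" "h k t"] by simp
  qed
  define G where "G k t = (if k < \<alpha> then indicator {0..1} t * ?D k t else h (\<alpha> - 1) t)" for k t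
  have Gh: "AE t in lborel. G (Suc k) t = h k t" if k: "k < \<alpha>" for k
  proof (cases "Suc k < \<alpha>")
    case True
    show ?thesis using hD[OF k]
    proof eventually_elim
      case (elim t)
      then show ?case using True h(3)[OF k, of t] by (cases "t \<in> {0..1}") (auto simp: G_def)
    qed
  next
    case False
    then have "\<alpha> - 1 = k" "\<not> Suc k < \<alpha>" using k by auto
    then show ?thesis unfolding G_def by simp
  qed
  have cont: "continuous_on {0..1} (?D k)" if k: "k < \<alpha>" for k
  proof -
    have "continuous_on {0..1} (\<lambda>t. ?D k 0 + (LBINT r:{..t}. h k r))"
      by (intro continuous_intros continuous_on_subset[OF continuous_on_LINT_atMost[OF h(2)[OF k]]]) auto
    then show ?thesis
      by (rule continuous_on_eq) (simp add: h(4)[OF k, symmetric])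
  qed
  have Gm: "G k \<in> borel_measurable borel" if "k \<le> \<alpha>" for k
  proof (cases "k < \<alpha>")
    case True
    have "(\<lambda>t. indicator {0..1} t *\<^sub>R ?D k t) \<in> borel_measurable borel"
      using cont[OF True] by (intro borel_measurable_continuous_on_indicator) auto
    then show ?thesis using True by (simp add: G_def[abs_def])
  next
    case False
    then show ?thesis using h(1)[of "\<alpha> - 1"] \<alpha> by (simp add: G_def[abs_def])
  qed
  have deriv: "(G k has_real_derivative D) (at t within {0..1})"
    if "(?D k has_real_derivative D) (at t within {0..1})" "t \<in> {0..1}" "k < \<alpha>" for k D t
    using that(1) by (rule has_field_derivative_transform_within[where d = 1]) (use that in \<open>auto simp: G_def\<close>)
  have "sobolev_jet \<alpha> G"
    unfolding sobolev_jet_def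
  proof (intro conjI allI impI ballI Gm)
    fix k t assume "k \<le> \<alpha>" "t \<notin> {0..1::real}"
    then show "G k t = 0" using h(3)[of "\<alpha> - 1" t] \<alpha> by (auto simp: G_def)
  next
    fix k assume k: "k < \<alpha>"
    show "continuous_on {0..1} (G k)"
      using cont[OF k] by (rule continuous_on_eq) (use k in \<open>simp add: G_def\<close>)
    show "AE t in lborel. t \<in> {0..1} \<longrightarrow> (G k has_real_derivative G (Suc k) t) (at t within {0..1})"
      using h(5)[OF k] Gh[OF k]
    proof eventually_elim
      case (elim t)
      then show ?case using deriv[of k "h k t" t] k by auto
    qed
    fix t assume t: "t \<in> {0..1::real}"
    have "(LBINT r:{..t}. h k r) = (LBINT r:{..t}. G (Suc k) r)"
      unfolding set_lebesgue_integral_def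
    proof (rule integral_cong_AE)
      show "AE r in lborel. indicat_real {..t} r *\<^sub>R h k r = indicat_real {..t} r *\<^sub>R G (Suc k) r"
        using Gh[OF k] by eventually_elim simp
    qed (use h(1)[OF k] Gm[of "Suc k"] k in auto)
    then show "G k t = G k 0 + (LBINT r:{..t}. G (Suc k) r)"
      using h(4)[OF k t] t k by (simp add: G_def[of k])
  next
    fix k t assume "Suc k < \<alpha>" "t \<in> {0..1::real}"
    then show "(G k has_real_derivative G (Suc k) t) (at t within {0..1})"
      using deriv[of k "?D (Suc k) t" t] deriv01_works[OF diff, of k t] by (simp add: G_def[of "Suc k"])
  next
    \<comment> \<open>The definition speaks of Lebesgue measure on the interval; equality almost
      everywhere and Borel measurability of \<open>G \<alpha>\<close> move square integrability to
      \<open>lborel\<close>.\<close>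
    have hD\<alpha>: "AE t in lborel. t \<in> {0..1} \<longrightarrow> ?D \<alpha> t = h (\<alpha> - 1) t"
      using hD[of "\<alpha> - 1"] \<alpha> by simp
    have sq: "integrable (lebesgue_on {0..1}) (\<lambda>t. (?D \<alpha> t)\<^sup>2)" using g by (auto simp: sobolev1_def)
    have "integrable lebesgue (\<lambda>t. indicator {0..1} t *\<^sub>R (?D \<alpha> t)\<^sup>2)"
      using sq by (subst (asm) integrable_restrict_space) auto
    moreover have "AE t in lebesgue. indicator {0..1} t *\<^sub>R (?D \<alpha> t)\<^sup>2 = (G \<alpha> t)\<^sup>2"
    proof -
      have "AE t in lborel. indicator {0..1} t *\<^sub>R (?D \<alpha> t)\<^sup>2 = (G \<alpha> t)\<^sup>2"
        using hD\<alpha>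
      proof eventually_elim
        case (elim t)
        then show ?case using h(3)[of "\<alpha> - 1" t] \<alpha> by (cases "t \<in> {0..1}") (auto simp: G_def)
      qed
      then show ?thesis by (rule AE_completion)
    qed
    moreover have "(\<lambda>t. (G \<alpha> t)\<^sup>2) \<in> borel_measurable lborel"
      using Gm[of \<alpha>] by simp
    ultimately have "integrable lebesgue (\<lambda>t. (G \<alpha> t)\<^sup>2)"
      by (subst integrable_cong_AE[symmetric]) (auto intro: measurable_completion)
    then show "integrable lborel (\<lambda>t. (G \<alpha> t)\<^sup>2)"
      using \<open>(\<lambda>t. (G \<alpha> t)\<^sup>2) \<in> borel_measurable lborel\<close> by (simp add: integrable_completion)
  qed
  moreover have "G 0 t = g t" if "t \<in> {0..1}" for t
    using that \<alpha> by (simp add: G_def)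
  ultimately show thesis using that by blast
qed

section \<open>Smooth functions as jets\<close>

definition smooth_jet :: "jet \<Rightarrow> bool" where
  "smooth_jet D \<longleftrightarrow> (\<forall>k t. (D k has_real_derivative D (Suc k) t) (at t))"

definition restrict_jet :: "jet \<Rightarrow> jet" where
  "restrict_jet D k t = indicator {0..1} t * D k t"

text \<open>By the mean value theorem \<open>f\<close> is Lipschitz on
  \<open>{0..1}\<close>.\<close>

lemma absolutely_continuous_on_C1:
  assumes D: "\<And>t. (f has_real_derivative f' t) (at t)" and cont: "continuous_on UNIV f'"
  shows "absolutely_continuous_on {0..1} f"
proof -
  have "compact (f' ` {0..1})"
    using cont by (intro compact_continuous_image) (auto intro: continuous_on_subset)
  then obtain B where B: "\<And>t. t \<in> {0..1} \<Longrightarrow> \<bar>f' t\<bar> \<le> B"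
    using compact_imp_bounded bounded_iff by (metis imageI real_norm_def)
  have "B \<ge> 0" using B[of 0] by auto
  have lip: "\<bar>f y - f x\<bar> \<le> B * (y - x)" if "0 \<le> x" "x \<le> y" "y \<le> 1" for x y
  proof (cases "x = y")
    case False
    then have "x < y" using that by simp
    then obtain z where z: "z > x" "z < y" "f y - f x = (y - x) * f' z"
      using MVT2[of x y f f'] D by blast
    then have "\<bar>f y - f x\<bar> = (y - x) * \<bar>f' z\<bar>" using \<open>x < y\<close> by (simp add: abs_mult)
    also have "\<dots> \<le> (y - x) * B" using z that by (intro mult_left_mono B) auto
    finally show ?thesis by (simp add: mult.commute)
  qed simp
  show ?thesis
    unfolding absolutely_continuous_on_def
  proof (intro allI impI)
    fix e :: real assume e: "e > 0"
    show "\<exists>\<delta>>0. \<forall>\<D> T. \<D> division_of T \<and> T \<subseteq> {0..1} \<and> (\<Sum>k\<in>\<D>. measure lborel k) < \<delta> \<longrightarrow>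
        (\<Sum>k\<in>\<D>. \<bar>f (Sup k) - f (Inf k)\<bar>) < e"
    proof (intro exI[of _ "e / (B + 1)"] conjI allI impI)
      show "0 < e / (B + 1)" using e \<open>B \<ge> 0\<close> by simp
      fix \<D> :: "real set set" and T assume *: "\<D> division_of T \<and> T \<subseteq> {0..1} \<and> (\<Sum>k\<in>\<D>. measure lborel k) < e / (B + 1)"
      have "\<bar>f (Sup k) - f (Inf k)\<bar> \<le> B * measure lborel k" if k: "k \<in> \<D>" for k
      proof -
        obtain a b where ab: "k = cbox a b" using division_ofD(4)[OF conjunct1[OF *] k] by blast
        have "k \<noteq> {}" using division_ofD(3)[OF conjunct1[OF *] k] .
        with ab have "a \<le> b" by simp
        have "k \<subseteq> {0..1}" using division_ofD(2)[OF conjunct1[OF *] k] * by blast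
        then have "0 \<le> a" "b \<le> 1" using ab \<open>a \<le> b\<close> by auto
        then show ?thesis using lip[of a b] \<open>a \<le> b\<close> ab by simp
      qed
      then have "(\<Sum>k\<in>\<D>. \<bar>f (Sup k) - f (Inf k)\<bar>) \<le> B * (\<Sum>k\<in>\<D>. measure lborel k)"
        by (simp add: sum_distrib_left sum_mono)
      also have "\<dots> \<le> B * (e / (B + 1))" using * \<open>B \<ge> 0\<close> by (intro mult_left_mono) auto
      also have "\<dots> < e" using e \<open>B \<ge> 0\<close> by (simp add: field_simps)
      finally show "(\<Sum>k\<in>\<D>. \<bar>f (Sup k) - f (Inf k)\<bar>) < e" .
    qed
  qed
qed

lemma smooth_jet_continuous: "smooth_jet D \<Longrightarrow> continuous_on A (D k)"
  unfolding smooth_jet_def by (meson DERIV_isCont continuous_at_imp_continuous_on)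

text \<open>This puts trigonometric polynomials into \<open>sobolev1\<close>, and so into
  \<open>algebraic_tensor\<close>. Iterated \<open>deriv01\<close> is known to agree with
  \<open>D k\<close> on \<open>{0..1}\<close> only, so each condition is transferred along that
  agreement.\<close>

lemma smooth_sobolev1:
  assumes D: "smooth_jet D"
  shows "D 0 \<in> sobolev1 \<alpha>"
proof -
  have dd: "(deriv01 ^^ k) (D 0) t = D k t" if "t \<in> {0..1}" for k t
    using that
  proof (induction k arbitrary: t)
    case (Suc k)
    have "(deriv01 ^^ Suc k) (D 0) t = deriv01 (D k) t"
      using Suc by (simp, intro deriv01_cong) auto
    also have "\<dots> = D (Suc k) t"
      using D Suc.prems by (intro deriv01_eq) (auto simp: smooth_jet_def intro: has_field_derivative_at_within)
    finally show ?case .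
  qed simp
  have ac: "absolutely_continuous_on {0..1} ((deriv01 ^^ k) (D 0))" for k
  proof -
    have "absolutely_continuous_on {0..1} (D k)"
      using D smooth_jet_continuous[OF D] unfolding smooth_jet_def
      by (intro absolutely_continuous_on_C1[of _ "D (Suc k)"]) auto
    moreover have eq: "(\<Sum>i\<in>\<D>. \<bar>(deriv01 ^^ k) (D 0) (Sup i) - (deriv01 ^^ k) (D 0) (Inf i)\<bar>) = (\<Sum>i\<in>\<D>. \<bar>D k (Sup i) - D k (Inf i)\<bar>)"
      if \<D>: "\<D> division_of T" "T \<subseteq> {0..1}" for \<D> :: "real set set" and T
    proof (rule sum.cong)
      fix i assume i: "i \<in> \<D>"
      obtain a b where ab: "i = cbox a b" using division_ofD(4)[OF \<D>(1) i] by blast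
      have "i \<noteq> {}" using division_ofD(3)[OF \<D>(1) i] .
      with ab have "a \<le> b" by simp
      have "i \<subseteq> {0..1}" using division_ofD(2)[OF \<D>(1) i] \<D>(2) by blast
      then have "a \<in> {0..1}" "b \<in> {0..1}" using ab \<open>a \<le> b\<close> by auto
      then show "\<bar>(deriv01 ^^ k) (D 0) (Sup i) - (deriv01 ^^ k) (D 0) (Inf i)\<bar> = \<bar>D k (Sup i) - D k (Inf i)\<bar>"
        using ab \<open>a \<le> b\<close> dd by simp
    qed simp
    ultimately show ?thesis unfolding absolutely_continuous_on_def
    proof (intro allI impI)
      fix e :: real
      assume "\<forall>\<epsilon>>0. \<exists>\<delta>>0. \<forall>\<D> T. \<D> division_of T \<and> T \<subseteq> {0..1} \<and> (\<Sum>k\<in>\<D>. measure lborel k) < \<delta> \<longrightarrow>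
        (\<Sum>i\<in>\<D>. \<bar>D k (Sup i) - D k (Inf i)\<bar>) < \<epsilon>" "0 < e"
      then obtain \<delta> where \<delta>: "\<delta> > 0" "\<forall>\<D> T. \<D> division_of T \<and> T \<subseteq> {0..1} \<and> (\<Sum>k\<in>\<D>. measure lborel k) < \<delta> \<longrightarrow>
        (\<Sum>i\<in>\<D>. \<bar>D k (Sup i) - D k (Inf i)\<bar>) < e" by blast
      show "\<exists>\<delta>>0. \<forall>\<D> T. \<D> division_of T \<and> T \<subseteq> {0..1} \<and> (\<Sum>k\<in>\<D>. measure lborel k) < \<delta> \<longrightarrow>
        (\<Sum>i\<in>\<D>. \<bar>(deriv01 ^^ k) (D 0) (Sup i) - (deriv01 ^^ k) (D 0) (Inf i)\<bar>) < e"
      proof (intro exI[of _ \<delta>] conjI allI impI \<delta>(1))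
        fix \<D> :: "real set set" and T
        assume *: "\<D> division_of T \<and> T \<subseteq> {0..1} \<and> (\<Sum>k\<in>\<D>. measure lborel k) < \<delta>"
        show "(\<Sum>i\<in>\<D>. \<bar>(deriv01 ^^ k) (D 0) (Sup i) - (deriv01 ^^ k) (D 0) (Inf i)\<bar>) < e"
          using \<delta>(2)[rule_format, OF *] eq[of \<D> T] * by presburger
      qed
    qed
  qed
  have df: "(deriv01 ^^ k) (D 0) differentiable (at t within {0..1})" if t: "t \<in> {0..1}" for k t
  proof -
    have "(D k has_real_derivative D (Suc k) t) (at t within {0..1})"
      using D by (auto simp: smooth_jet_def intro: has_field_derivative_at_within)
    then have "((deriv01 ^^ k) (D 0) has_real_derivative D (Suc k) t) (at t within {0..1})"
      by (rule has_field_derivative_transform_within[where d = 1]) (use t dd in auto)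
    then show ?thesis by (rule differentiableI[OF has_field_derivative_imp_has_derivative])
  qed
  have m: "D k \<in> borel_measurable (lebesgue_on {0..1})" for k
    using smooth_jet_continuous[OF D] by (intro continuous_imp_measurable_on_sets_lebesgue) auto
  have "(deriv01 ^^ \<alpha>) (D 0) \<in> borel_measurable (lebesgue_on {0..1})"
    using m[of \<alpha>] by (rule measurable_cong[THEN iffD1, rotated]) (simp add: dd)
  moreover have "integrable (lebesgue_on {0..1}) (\<lambda>t. ((deriv01 ^^ \<alpha>) (D 0) t)\<^sup>2)"
  proof -
    have "integrable (lebesgue_on {0..1}) (\<lambda>t. (D \<alpha> t)\<^sup>2)"
      using smooth_jet_continuous[OF D] by (intro continuous_imp_integrable_real continuous_intros)
    then show ?thesis
      by (rule Bochner_Integration.integrable_cong[THEN iffD1, rotated 2]) (simp_all add: dd)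
  qed
  ultimately show ?thesis using ac df unfolding sobolev1_def by blast
qed

lemma smooth_jet_FTC:
  assumes D: "smooth_jet D" and ab: "a \<le> b"
  shows "(LBINT r:{a..b}. D (Suc k) r) = D k b - D k a"
proof -
  have "has_bochner_integral lborel (\<lambda>r. indicator {a..b} r *\<^sub>R D (Suc k) r) (D k b - D k a)"
    using D smooth_jet_continuous[OF D] ab unfolding smooth_jet_def
    by (intro has_bochner_integral_FTC_Icc)
       (auto simp: has_real_derivative_iff_has_vector_derivative intro: has_vector_derivative_at_within)
  then show ?thesis unfolding set_lebesgue_integral_def by (rule has_bochner_integral_integral_eq)
qed

lemma sobolev_jet_restrict_jet:
  assumes D: "smooth_jet D"
  shows "sobolev_jet \<alpha> (restrict_jet D)"
  unfolding sobolev_jet_def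
proof (intro conjI allI impI ballI)
  have cont: "continuous_on A (D k)" for A k by (rule smooth_jet_continuous[OF D])
  show "restrict_jet D k \<in> borel_measurable borel" for k
    using borel_measurable_continuous_on_indicator[OF _ cont, of "{0..1}" k]
    by (simp add: restrict_jet_def[abs_def])
  show "restrict_jet D k t = 0" if "t \<notin> {0..1}" for k t using that by (simp add: restrict_jet_def)
  show "continuous_on {0..1} (restrict_jet D k)" for k
    using cont by (rule continuous_on_eq) (simp add: restrict_jet_def)
  have *: "(restrict_jet D k has_real_derivative restrict_jet D (Suc k) t) (at t within {0..1})" if "t \<in> {0..1}" for k t
  proof -
    have "(D k has_real_derivative restrict_jet D (Suc k) t) (at t within {0..1})"
      using D that by (auto simp: smooth_jet_def restrict_jet_def intro: has_field_derivative_at_within)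
    then show ?thesis
      by (rule has_field_derivative_transform_within[where d = 1]) (use that in \<open>auto simp: restrict_jet_def\<close>)
  qed
  then show "t \<in> {0..1} \<Longrightarrow> (restrict_jet D k has_real_derivative restrict_jet D (Suc k) t) (at t within {0..1})" for k t .
  show "AE t in lborel. t \<in> {0..1} \<longrightarrow> (restrict_jet D k has_real_derivative restrict_jet D (Suc k) t) (at t within {0..1})" for k
    using * by simp
  have "integrable lborel (\<lambda>t. indicator {0..1} t *\<^sub>R (D \<alpha> t)\<^sup>2)"
    using cont by (intro borel_integrable_compact continuous_intros) auto
  then show "integrable lborel (\<lambda>t. (restrict_jet D \<alpha> t)\<^sup>2)"
    by (rule Bochner_Integration.integrable_cong[THEN iffD1, rotated 2])
      (auto simp: restrict_jet_def indicator_def)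
  fix k and t :: real assume t: "t \<in> {0..1}"
  have "(LBINT r:{..t}. restrict_jet D (Suc k) r) = (LBINT r:{0..t}. D (Suc k) r)"
    unfolding set_lebesgue_integral_def using t
    by (intro lintegral_cong) (auto simp: restrict_jet_def indicator_def)
  also have "\<dots> = D k t - D k 0" using t by (intro smooth_jet_FTC[OF D]) auto
  finally show "restrict_jet D k t = restrict_jet D k 0 + (LBINT r:{..t}. restrict_jet D (Suc k) r)"
    using t by (simp add: restrict_jet_def[of D k])
qed

lemma sobolev_jet_linear_combination:
  assumes "sobolev_jet \<alpha> G" "sobolev_jet \<alpha> H"
  shows "sobolev_jet \<alpha> (\<lambda>k t. a * G k t + b * H k t)"
  unfolding sobolev_jet_def
proof (intro conjI allI impI ballI)
  note G = sobolev_jetD[OF assms(1)] and H = sobolev_jetD[OF assms(2)]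
  show "(\<lambda>t. a * G k t + b * H k t) \<in> borel_measurable borel" if "k \<le> \<alpha>" for k
    using G(1)[OF that] H(1)[OF that] by measurable
  show "a * G k t + b * H k t = 0" if "k \<le> \<alpha>" "t \<notin> {0..1}" for k t
    using G(2)[OF that] H(2)[OF that] by simp
  show "continuous_on {0..1} (\<lambda>t. a * G k t + b * H k t)" if "k < \<alpha>" for k
    using G(3)[OF that] H(3)[OF that] by (intro continuous_intros)
  show "((\<lambda>t. a * G k t + b * H k t) has_real_derivative a * G (Suc k) t + b * H (Suc k) t) (at t within {0..1})"
    if "Suc k < \<alpha>" "t \<in> {0..1}" for k t
    using G(6)[OF that] H(6)[OF that] by (auto intro!: derivative_eq_intros)
  show "AE t in lborel. t \<in> {0..1} \<longrightarrow> ((\<lambda>t. a * G k t + b * H k t) has_real_derivative a * G (Suc k) t + b * H (Suc k) t) (at t within {0..1})"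
    if "k < \<alpha>" for k
    using G(7)[OF that] H(7)[OF that] by eventually_elim (auto intro!: derivative_eq_intros)
  have iG: "set_integrable lborel {..t} (G (Suc k))" and iH: "set_integrable lborel {..t} (H (Suc k))" if "k < \<alpha>" for k t
    using that sobolev_jet_integrable[OF assms(1), of "Suc k"] sobolev_jet_integrable[OF assms(2), of "Suc k"]
    unfolding set_integrable_def by (auto simp del: real_scaleR_def intro!: integrable_mult_indicator)
  show "a * G k t + b * H k t = a * G k 0 + b * H k 0 + (LBINT r:{..t}. a * G (Suc k) r + b * H (Suc k) r)"
    if "k < \<alpha>" "t \<in> {0..1}" for k t
    using iG[OF that(1), of t] iH[OF that(1), of t]
    by (subst G(5)[OF that], subst H(5)[OF that], subst set_integral_add)
       (auto simp: algebra_simps)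
  show "integrable lborel (\<lambda>t. (a * G \<alpha> t + b * H \<alpha> t)\<^sup>2)"
  proof (rule lintegrable_bound)
    show "integrable lborel (\<lambda>t. 2 * (a\<^sup>2 * (G \<alpha> t)\<^sup>2 + b\<^sup>2 * (H \<alpha> t)\<^sup>2))"
      using G(4) H(4) by auto
    have "(x + y)\<^sup>2 \<le> 2 * (x\<^sup>2 + y\<^sup>2)" for x y :: real
      using sum_squares_bound[of x y] by (simp add: power2_sum)
    from this[of "a * G \<alpha> _" "b * H \<alpha> _"] show "AE t in lborel. norm ((a * G \<alpha> t + b * H \<alpha> t)\<^sup>2) \<le> norm (2 * (a\<^sup>2 * (G \<alpha> t)\<^sup>2 + b\<^sup>2 * (H \<alpha> t)\<^sup>2))"
      by (intro AE_I2) (simp add: power_mult_distrib)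
  qed (use G(1)[of \<alpha>] H(1)[of \<alpha>] in measurable)
qed

section \<open>Integration by parts and the isometry with L^2\<close>

text \<open>Fubini on the triangle \<open>r \<le> t\<close>: writing \<open>u r\<close> as
  \<open>u 1\<close> minus the integral of \<open>u'\<close> over \<open>{r..1}\<close> avoids
  differentiating \<open>F\<close>, which is only a primitive of an integrable function.\<close>

lemma jet_by_parts:
  fixes f F u u' :: "real \<Rightarrow> real"
  assumes f: "integrable lborel f" "\<And>t. t \<notin> {0..1} \<Longrightarrow> f t = 0"
    and F: "\<And>t. t \<in> {0..1} \<Longrightarrow> F t = F 0 + (LBINT r:{..t}. f r)"
    and u: "\<And>t. (u has_real_derivative u' t) (at t)" "continuous_on UNIV u'"
  shows "(LBINT r. f r * u r) = F 1 * u 1 - F 0 * u 0 - (LBINT t:{0..1}. F t * u' t)"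
proof -
  have [measurable]: "f \<in> borel_measurable borel" "u' \<in> borel_measurable borel"
    using f(1) u(2) by (auto intro: borel_measurable_continuous_onI)
  have FTC: "(LBINT t:{a..b}. u' t) = u b - u a" if "a \<le> b" for a b
    unfolding set_lebesgue_integral_def using that u
    by (intro has_bochner_integral_integral_eq has_bochner_integral_FTC_Icc)
       (auto simp: has_real_derivative_iff_has_vector_derivative intro: has_vector_derivative_at_within continuous_on_subset)
  have "compact (u' ` {0..1})"
    using u(2) by (intro compact_continuous_image) (auto intro: continuous_on_subset)
  then obtain B where B: "\<And>t. t \<in> {0..1} \<Longrightarrow> \<bar>u' t\<bar> \<le> B"
    using compact_imp_bounded bounded_iff by (metis imageI real_norm_def)
  have "B \<ge> 0" using B[of 0] by auto
  define \<phi> where "\<phi> r t = (if r \<le> t \<and> 0 \<le> t \<and> t \<le> 1 then f r * u' t else 0)" for r t :: real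
  have [measurable]: "case_prod \<phi> \<in> borel_measurable (lborel \<Otimes>\<^sub>M lborel)"
    unfolding \<phi>_def by measurable
  have iu: "integrable lborel (\<lambda>t. indicator {0..1} t *\<^sub>R u' t)"
    using u(2) by (intro borel_integrable_compact) (auto intro: continuous_on_subset)
  have bd: "\<bar>\<phi> r t\<bar> \<le> \<bar>f r\<bar> * (indicator {0..1} t * B)" for r t
    using B[of t] \<open>B \<ge> 0\<close> by (auto simp: \<phi>_def abs_mult intro!: mult_left_mono split: split_indicator)
  have iB: "integrable lborel (\<lambda>t. \<bar>f r\<bar> * (indicator {0..1::real} t * B))" for r
    by (intro integrable_mult_right integrable_mult_left integrable_real_indicator) auto
  have i\<phi>: "integrable lborel (\<phi> r)" for r
    by (rule lintegrable_bound[OF iB[of r]]) (use bd \<open>B \<ge> 0\<close> in \<open>auto simp: abs_mult\<close>)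
  have int\<phi>: "integrable (lborel \<Otimes>\<^sub>M lborel) (case_prod \<phi>)"
  proof (rule lborel_pair.Fubini_integrable)
    show "integrable lborel (\<lambda>r. \<integral>t. norm (case_prod \<phi> (r, t)) \<partial>lborel)"
    proof (rule lintegrable_bound)
      show "integrable lborel (\<lambda>r. \<bar>f r\<bar> * B)" using f(1) by auto
      show "AE r in lborel. norm (LBINT t. norm (case_prod \<phi> (r, t))) \<le> norm (\<bar>f r\<bar> * B)"
      proof (rule AE_I2)
        fix r
        have "(LBINT t. norm (case_prod \<phi> (r, t))) \<le> (LBINT t. \<bar>f r\<bar> * (indicator {0..1::real} t * B))"
          by (intro integral_mono iB) (use bd i\<phi>[of r] in auto)
        also have "\<dots> = \<bar>f r\<bar> * B" by simp
        finally show "norm (LBINT t. norm (case_prod \<phi> (r, t))) \<le> norm (\<bar>f r\<bar> * B)"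
          using \<open>B \<ge> 0\<close> by simp
      qed
    qed measurable
  qed (use i\<phi> in auto)
  have i1: "integrable lborel (\<lambda>r. f r * u 1)" using f(1) by simp
  have i2: "integrable lborel (\<lambda>r. \<integral>t. \<phi> r t \<partial>lborel)"
    using lborel_pair.integrable_fst'[OF int\<phi>] by simp
  have "(LBINT r. f r * u r) = (\<integral>r. f r * u 1 - (LBINT t. \<phi> r t) \<partial>lborel)"
  proof (rule lintegral_cong[OF refl])
    fix r
    show "f r * u r = f r * u 1 - (LBINT t. \<phi> r t)"
    proof (cases "r \<in> {0..1}")
      case True
      have "(LBINT t. \<phi> r t) = (LBINT t. f r * (indicator {r..1} t *\<^sub>R u' t))"
        using True by (intro lintegral_cong) (auto simp: \<phi>_def split: split_indicator)
      also have "\<dots> = f r * (u 1 - u r)"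
        using FTC[of r 1] True by (simp add: set_lebesgue_integral_def)
      finally show ?thesis by (simp add: algebra_simps)
    next
      case False
      then show ?thesis using f(2)[of r] by (simp add: \<phi>_def cong: if_cong)
    qed
  qed
  also have "\<dots> = (LBINT r. f r) * u 1 - (\<integral>r. \<integral>t. \<phi> r t \<partial>lborel \<partial>lborel)"
    using i1 i2 by simp
  also have "(\<integral>r. \<integral>t. \<phi> r t \<partial>lborel \<partial>lborel) = (\<integral>t. \<integral>r. \<phi> r t \<partial>lborel \<partial>lborel)"
    by (rule lborel_pair.Fubini_integral[OF int\<phi>, symmetric])
  also have "\<dots> = (LBINT t. indicator {0..1} t *\<^sub>R (F t * u' t) - F 0 * (indicator {0..1} t *\<^sub>R u' t))"
  proof (rule lintegral_cong[OF refl])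
    fix t
    show "(LBINT r. \<phi> r t) = indicator {0..1} t *\<^sub>R (F t * u' t) - F 0 * (indicator {0..1} t *\<^sub>R u' t)"
    proof (cases "t \<in> {0..1}")
      case True
      have "(LBINT r. \<phi> r t) = (LBINT r. (indicator {..t} r *\<^sub>R f r) * u' t)"
        using True by (intro lintegral_cong) (auto simp: \<phi>_def split: split_indicator)
      also have "\<dots> = (LBINT r:{..t}. f r) * u' t"
        by (simp add: set_lebesgue_integral_def)
      also have "\<dots> = (F t - F 0) * u' t" using F[OF True] by simp
      finally show ?thesis using True by (simp add: algebra_simps)
    next
      case False
      then have "\<phi> r t = 0" for r by (auto simp: \<phi>_def)
      then show ?thesis using False by simp
    qed
  qed
  also have "\<dots> = (LBINT t:{0..1}. F t * u' t) - F 0 * (LBINT t:{0..1}. u' t)"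
  proof -
    have "continuous_on {0..1} (\<lambda>t. F 0 + (LBINT r:{..t}. f r))"
      by (intro continuous_intros continuous_on_subset[OF continuous_on_LINT_atMost[OF f(1)]]) auto
    then have "continuous_on {0..1} F"
      by (rule continuous_on_eq) (simp add: F[symmetric])
    then have "integrable lborel (\<lambda>t. indicator {0..1} t *\<^sub>R (F t * u' t))"
      using u(2) by (intro borel_integrable_compact continuous_intros) (auto intro: continuous_on_subset)
    then show ?thesis using iu unfolding set_lebesgue_integral_def
      by (subst Bochner_Integration.integral_diff) auto
  qed
  also have "(LBINT t:{0..1}. u' t) = u 1 - u 0" using FTC[of 0 1] by simp
  also have "(LBINT r. f r) = F 1 - F 0"
  proof -
    have "(LBINT r:{..1}. f r) = (LBINT r. f r)"
      unfolding set_lebesgue_integral_def using f(2)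
      by (intro lintegral_cong) (auto split: split_indicator)
    then show ?thesis using F[of 1] by simp
  qed
  finally show ?thesis by (simp add: algebra_simps)
qed

lemma integrable_mult_of_squares:
  fixes f g :: "'a \<Rightarrow> real"
  assumes "integrable M (\<lambda>x. (f x)\<^sup>2)" "integrable M (\<lambda>x. (g x)\<^sup>2)"
    and [measurable]: "f \<in> borel_measurable M" "g \<in> borel_measurable M"
  shows "integrable M (\<lambda>x. f x * g x)"
proof (rule lintegrable_bound)
  show "integrable M (\<lambda>x. (f x)\<^sup>2 + (g x)\<^sup>2)" using assms by simp
  have "\<bar>x * y\<bar> \<le> x\<^sup>2 + y\<^sup>2" for x y :: real
  proof -
    have "2 * \<bar>x\<bar> * \<bar>y\<bar> \<le> x\<^sup>2 + y\<^sup>2" using sum_squares_bound[of "\<bar>x\<bar>" "\<bar>y\<bar>"] by simp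
    moreover have "0 \<le> \<bar>x\<bar> * \<bar>y\<bar>" by simp
    ultimately show ?thesis unfolding abs_mult by linarith
  qed
  then show "AE x in M. norm (f x * g x) \<le> norm ((f x)\<^sup>2 + (g x)\<^sup>2)" by simp
qed measurable

text \<open>The one-dimensional Sobolev inner product, read off the entries of the jets instead of
  being computed from derivatives.\<close>

definition jet_inner :: "nat \<Rightarrow> jet \<Rightarrow> jet \<Rightarrow> real" where
  "jet_inner \<alpha> G H = (\<Sum>k<\<alpha>. (LBINT t. G k t) * (LBINT t. H k t)) + (LBINT t. G \<alpha> t * H \<alpha> t)"

lemma jet_top_mult_integrable:
  assumes "sobolev_jet \<alpha> G" "sobolev_jet \<alpha> H"
  shows "integrable lborel (\<lambda>t. G \<alpha> t * H \<alpha> t)"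
  using sobolev_jetD(1,4)[OF assms(1)] sobolev_jetD(1,4)[OF assms(2)]
  by (intro integrable_mult_of_squares) auto

lemma jet_inner_commute: "jet_inner \<alpha> G H = jet_inner \<alpha> H G"
  by (simp add: jet_inner_def mult.commute)

lemma jet_inner_linear_left:
  assumes "sobolev_jet \<alpha> G" "sobolev_jet \<alpha> G'" "sobolev_jet \<alpha> H"
  shows "jet_inner \<alpha> (\<lambda>k t. a * G k t + b * G' k t) H = a * jet_inner \<alpha> G H + b * jet_inner \<alpha> G' H"
proof -
  have 1: "(LBINT t. a * G k t + b * G' k t) = a * (LBINT t. G k t) + b * (LBINT t. G' k t)"
    if "k \<le> \<alpha>" for k
    using sobolev_jet_integrable[OF assms(1) that] sobolev_jet_integrable[OF assms(2) that] by simp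
  have "(LBINT t. (a * G \<alpha> t + b * G' \<alpha> t) * H \<alpha> t)
      = (LBINT t. a * (G \<alpha> t * H \<alpha> t) + b * (G' \<alpha> t * H \<alpha> t))"
    by (simp add: algebra_simps)
  also have "\<dots> = a * (LBINT t. G \<alpha> t * H \<alpha> t) + b * (LBINT t. G' \<alpha> t * H \<alpha> t)"
    using jet_top_mult_integrable[OF assms(1,3)] jet_top_mult_integrable[OF assms(2,3)] by simp
  finally show ?thesis
    unfolding jet_inner_def using 1
    by (simp add: sum_distrib_left sum.distrib [symmetric] algebra_simps)
qed

text \<open>The coordinates of a jet in an isometric copy of the Sobolev space inside \<open>L\<^sup>2[0, \<alpha> + 1]\<close>:
  the top derivative on \<open>[0,1)\<close>, and the mean of the \<open>k\<close>-th one on \<open>[k + 1, k + 2)\<close>.\<close>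

definition jet_hat :: "nat \<Rightarrow> jet \<Rightarrow> real \<Rightarrow> real" where
  "jet_hat \<alpha> G t = indicator {0..<1} t * G \<alpha> t + (\<Sum>k<\<alpha>. indicator {real k + 1..<real k + 2} t * (LBINT s. G k s))"

lemma indicator_unit_interval:
  "t \<ge> 1 \<Longrightarrow> indicator {real k + 1..<real k + 2} t = (if k = nat \<lfloor>t\<rfloor> - 1 then 1 else 0 :: real)"
  by (auto simp: indicator_def) linarith+

lemma jet_hat_unit: "t \<in> {0..<1} \<Longrightarrow> jet_hat \<alpha> G t = G \<alpha> t"
  by (simp add: jet_hat_def)

lemma jet_hat_support:
  assumes "t \<notin> {0..real \<alpha> + 1}"
  shows "jet_hat \<alpha> G t = 0"
  using assms by (auto simp: jet_hat_def intro!: sum.neutral split: split_indicator)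

lemma jet_hat_measurable:
  "sobolev_jet \<alpha> G \<Longrightarrow> jet_hat \<alpha> G \<in> borel_measurable borel"
  using sobolev_jetD(1)[of \<alpha> G \<alpha>] unfolding jet_hat_def[abs_def] by measurable

text \<open>The intervals that carry the coordinates are disjoint, so no cross terms appear.\<close>

lemma jet_hat_mult:
  "jet_hat \<alpha> G t * jet_hat \<alpha> H t = indicator {0..<1} t * (G \<alpha> t * H \<alpha> t)
     + (\<Sum>k<\<alpha>. indicator {real k + 1..<real k + 2} t * ((LBINT s. G k s) * (LBINT s. H k s)))"
proof (cases "t \<ge> 1")
  case True
  let ?k = "nat \<lfloor>t\<rfloor> - 1"
  have "(\<Sum>k<\<alpha>. indicator {real k + 1..<real k + 2} t * c k) = (if ?k < \<alpha> then c ?k else 0)" for c :: "nat \<Rightarrow> real"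
    using True by (simp add: indicator_unit_interval if_distrib[of "\<lambda>x. x * _"] sum.delta' cong: if_cong)
  then show ?thesis using True by (simp add: jet_hat_def)
next
  case False
  then have "(\<Sum>k<\<alpha>. indicator {real k + 1..<real k + 2} t * c k) = 0" for c :: "nat \<Rightarrow> real"
    by (auto intro!: sum.neutral)
  then show ?thesis by (simp add: jet_hat_def indicator_def)
qed

text \<open>This is the isometry. The half-open interval loses the top derivative only at the point
  1.\<close>

lemma has_bochner_integral_jet_hat_mult:
  assumes "sobolev_jet \<alpha> G" "sobolev_jet \<alpha> H"
  shows "has_bochner_integral lborel (\<lambda>t. jet_hat \<alpha> G t * jet_hat \<alpha> H t) (jet_inner \<alpha> G H)"
proof -
  note G = sobolev_jetD[OF assms(1)] and H = sobolev_jetD[OF assms(2)]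
  have [measurable]: "G \<alpha> \<in> borel_measurable borel" "H \<alpha> \<in> borel_measurable borel" using G(1) H(1) by auto
  have "has_bochner_integral lborel (\<lambda>t. G \<alpha> t * H \<alpha> t) (LBINT t. G \<alpha> t * H \<alpha> t)"
    using jet_top_mult_integrable[OF assms] by (rule has_bochner_integral_integrable)
  moreover have "AE t in lborel. G \<alpha> t * H \<alpha> t = indicator {0..<1} t * (G \<alpha> t * H \<alpha> t)"
    using AE_lborel_singleton[of "1::real"]
  proof eventually_elim
    case (elim t)
    then show ?case using G(2)[of \<alpha> t] by (cases "t \<in> {0..1}") auto
  qed
  ultimately have 1: "has_bochner_integral lborel (\<lambda>t. indicator {0..<1} t * (G \<alpha> t * H \<alpha> t)) (LBINT t. G \<alpha> t * H \<alpha> t)"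
    by (subst (asm) has_bochner_integral_cong_AE) auto
  have "has_bochner_integral lborel (indicat_real {real k + 1..<real k + 2}) 1" for k
    using has_bochner_integral_real_indicator[of "{real k + 1..<real k + 2}" lborel] by simp
  from has_bochner_integral_mult_left[OF this]
  have "has_bochner_integral lborel (\<lambda>t. indicat_real {real k + 1..<real k + 2} t * c) c" for k c by simp
  then have 2: "has_bochner_integral lborel (\<lambda>t. \<Sum>k<\<alpha>. indicator {real k + 1..<real k + 2} t * ((LBINT s. G k s) * (LBINT s. H k s)))
      (\<Sum>k<\<alpha>. (LBINT s. G k s) * (LBINT s. H k s))"
    by (intro has_bochner_integral_sum)
  show ?thesis
    unfolding jet_hat_mult jet_inner_def using has_bochner_integral_add[OF 1 2] by (simp add: add.commute)
qed

lemma jet_hat_integrable: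
  assumes "sobolev_jet \<alpha> G"
  shows "integrable lborel (jet_hat \<alpha> G)"
proof -
  have "integrable lborel (\<lambda>t. indicator {0..<1} t *\<^sub>R G \<alpha> t)"
    using sobolev_jet_integrable[OF assms, of \<alpha>] by (intro integrable_mult_indicator) auto
  moreover have "integrable lborel (\<lambda>t. indicat_real {real k + 1..<real k + 2} t * (LBINT s. G k s))" for k
    by (intro integrable_mult_left integrable_real_indicator) auto
  ultimately show ?thesis unfolding jet_hat_def[abs_def]
    by (intro Bochner_Integration.integrable_add Bochner_Integration.integrable_sum) simp_all
qed

text \<open>For \<open>x\<close> in \<open>{0..1}\<close> and almost all \<open>r\<close> in
  \<open>{0..1}\<close> this is \<open>x - 1 / 2\<close> plus the periodic Bernoulli function of
  degree 1 at \<open>r - x\<close>: the Peano kernel for recovering a function from its mean and its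
  derivative.\<close>

definition mean_kernel :: "real \<Rightarrow> real \<Rightarrow> real" where
  "mean_kernel x r = indicator {0..1} r * (r - (if x < r then 1 else 0))"

text \<open>Integration by parts against the identity yields \<open>G k 1\<close> minus the mean;
  the jump in the kernel moves the evaluation from 1 to \<open>x\<close>.\<close>

lemma jet_mean_representation:
  assumes G: "sobolev_jet \<alpha> G" and k: "k < \<alpha>" and x: "x \<in> {0..1}"
  shows "G k x = (LBINT t. G k t) + (LBINT r. mean_kernel x r * G (Suc k) r)"
proof -
  note G' = sobolev_jetD[OF G]
  have i: "integrable lborel (G (Suc k))" using sobolev_jet_integrable[OF G, of "Suc k"] k by simp
  have z: "\<And>t. t \<notin> {0..1} \<Longrightarrow> G (Suc k) t = 0" using G'(2) k by simp
  have parts: "(LBINT r. G (Suc k) r * r) = G k 1 * 1 - G k 0 * 0 - (LBINT t:{0..1}. G k t * 1)"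
    by (rule jet_by_parts[OF i z G'(5)[OF k]]) auto
  have "(LBINT t:{0..1}. G k t * 1) = (LBINT t. G k t)"
    unfolding set_lebesgue_integral_def using G'(2)[of k] k
    by (intro lintegral_cong) (auto split: split_indicator)
  with parts have 1: "(LBINT r. G (Suc k) r * r) = G k 1 - (LBINT t. G k t)" by simp
  have ii: "integrable lborel (\<lambda>r. G (Suc k) r * r)"
  proof (rule lintegrable_bound[OF i])
    show "AE r in lborel. norm (G (Suc k) r * r) \<le> norm (G (Suc k) r)"
    proof (rule AE_I2)
      fix r show "norm (G (Suc k) r * r) \<le> norm (G (Suc k) r)"
        using z[of r] by (cases "r \<in> {0..1}") (auto simp: abs_mult intro: mult_left_le)
    qed
  qed (use i in auto)
  have "(LBINT r. mean_kernel x r * G (Suc k) r)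
    = (LBINT r. G (Suc k) r * r - indicator {x<..1} r *\<^sub>R G (Suc k) r)"
  proof (rule lintegral_cong[OF refl])
    fix r show "mean_kernel x r * G (Suc k) r = G (Suc k) r * r - indicator {x<..1} r *\<^sub>R G (Suc k) r"
      using z[of r] x by (cases "r \<in> {0..1}") (auto simp: mean_kernel_def algebra_simps)
  qed
  also have "\<dots> = (LBINT r. G (Suc k) r * r) - (LBINT r:{x<..1}. G (Suc k) r)"
    unfolding set_lebesgue_integral_def using ii i
    by (intro Bochner_Integration.integral_diff integrable_mult_indicator) auto
  also have "(LBINT r:{x<..1}. G (Suc k) r) = G k 1 - G k x"
    using LINT_greaterThanAtMost_diff[OF i, of x 1] G'(5)[OF k x] G'(5)[OF k, of 1] x by simp
  finally show ?thesis using 1 by simp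
qed

lemma jet_hat_eq_mean:
  assumes "sobolev_jet \<alpha> G" "k < \<alpha>"
  shows "(LBINT t. indicator {real k + 1..<real k + 2} t * jet_hat \<alpha> G t) = (LBINT t. G k t)"
proof -
  have "indicator {real k + 1..<real k + 2} t * jet_hat \<alpha> G t = indicator {real k + 1..<real k + 2} t * (LBINT t. G k t)" for t
  proof (cases "t \<in> {real k + 1..<real k + 2}")
    case True
    then have "t \<ge> 1" by simp
    then have "(\<Sum>k<\<alpha>. indicator {real k + 1..<real k + 2} t * c k) = (if nat \<lfloor>t\<rfloor> - 1 < \<alpha> then c (nat \<lfloor>t\<rfloor> - 1) else 0)" for c :: "nat \<Rightarrow> real"
      by (simp add: indicator_unit_interval if_distrib[of "\<lambda>x. x * _"] sum.delta' cong: if_cong)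
    moreover have "nat \<lfloor>t\<rfloor> - 1 = k" using True by (simp; linarith)
    ultimately show ?thesis using True assms(2) by (simp add: jet_hat_def)
  qed simp
  then have "(LBINT t. indicator {real k + 1..<real k + 2} t * jet_hat \<alpha> G t)
      = (\<integral>t. indicator {real k + 1..<real k + 2} t * (LBINT t. G k t) \<partial>lborel)"
    by (rule lintegral_cong[OF refl])
  then show ?thesis by simp
qed

text \<open>Downward induction on the order: at \<alpha> - 1 the derivative in
  \<open>jet_mean_representation\<close> is itself a coordinate of \<open>jet_hat\<close>, and below
  that the kernel of the next order is inserted by Fubini. Boundedness of the kernel is what later
  yields pointwise majorants.\<close>

lemma jet_kernel_representation:
  assumes "k < \<alpha>"
  shows "\<exists>\<kappa> C. case_prod \<kappa> \<in> borel_measurable (borel \<Otimes>\<^sub>M borel) \<and> (\<forall>x z. \<bar>\<kappa> x z\<bar> \<le> C) \<and>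
    (\<forall>G x. sobolev_jet \<alpha> G \<longrightarrow> x \<in> {0..1} \<longrightarrow> G k x = (LBINT z. \<kappa> x z * jet_hat \<alpha> G z))"
proof -
  have "k \<le> \<alpha> - 1" using assms by simp
  then show ?thesis
  proof (induction k rule: inc_induct)
    case base
    let ?\<kappa> = "\<lambda>x z. indicator {real (\<alpha> - 1) + 1..<real (\<alpha> - 1) + 2} z + indicator {0..<1} z * mean_kernel x z"
    have \<alpha>: "\<alpha> - 1 < \<alpha>" "Suc (\<alpha> - 1) = \<alpha>" using assms by auto
    show ?case
    proof (rule exI[of _ ?\<kappa>], rule exI[of _ 2], intro conjI allI impI)
      show "case_prod ?\<kappa> \<in> borel_measurable (borel \<Otimes>\<^sub>M borel)"
        unfolding mean_kernel_def by measurable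
      show "\<bar>?\<kappa> x z\<bar> \<le> 2" for x z
        by (auto simp: mean_kernel_def split: split_indicator)
      fix G x assume G: "sobolev_jet \<alpha> G" and x: "x \<in> {0..1::real}"
      have 1: "integrable lborel (\<lambda>z. indicat_real {real (\<alpha> - 1) + 1..<real (\<alpha> - 1) + 2} z *\<^sub>R jet_hat \<alpha> G z)"
        using jet_hat_integrable[OF G] by (intro integrable_mult_indicator) auto
      have 2: "integrable lborel (\<lambda>z. indicat_real {0..<1} z * mean_kernel x z * jet_hat \<alpha> G z)"
      proof (rule lintegrable_bound[OF jet_hat_integrable[OF G]])
        show "(\<lambda>z. indicat_real {0..<1} z * mean_kernel x z * jet_hat \<alpha> G z) \<in> borel_measurable lborel"
          unfolding mean_kernel_def using jet_hat_measurable[OF G] by measurable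
        have "\<bar>indicat_real {0..<1} z * mean_kernel x z\<bar> \<le> 1" for z
          by (auto simp: mean_kernel_def split: split_indicator)
        then show "AE z in lborel. norm (indicat_real {0..<1} z * mean_kernel x z * jet_hat \<alpha> G z) \<le> norm (jet_hat \<alpha> G z)"
          by (auto simp: abs_mult intro!: mult_left_le_one_le)
      qed
      have "(LBINT z. indicat_real {0..<1} z * mean_kernel x z * jet_hat \<alpha> G z) = (LBINT r. mean_kernel x r * G \<alpha> r)"
      proof (rule integral_cong_AE)
        show "AE z in lborel. indicat_real {0..<1} z * mean_kernel x z * jet_hat \<alpha> G z = mean_kernel x z * G \<alpha> z"
          using AE_lborel_singleton[of "1::real"]
        proof eventually_elim
          case (elim t)
          then show ?case using sobolev_jetD(2)[OF G, of \<alpha> t] by (cases "t \<in> {0..1}") (auto simp: jet_hat_unit)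
        qed
      qed (use 2 sobolev_jetD(1)[OF G, of \<alpha>] in \<open>auto simp: mean_kernel_def\<close>)
      then show "G (\<alpha> - 1) x = (LBINT z. ?\<kappa> x z * jet_hat \<alpha> G z)"
        using jet_mean_representation[OF G \<alpha>(1) x] jet_hat_eq_mean[OF G \<alpha>(1)] 1 2 \<alpha>(2)
        by (simp add: distrib_right)
    qed
  next
    case (step k)
    then obtain \<kappa> C where \<kappa> [measurable]: "case_prod \<kappa> \<in> borel_measurable (borel \<Otimes>\<^sub>M borel)"
      and C: "\<And>x z. \<bar>\<kappa> x z\<bar> \<le> C"
      and rep: "\<And>G x. sobolev_jet \<alpha> G \<Longrightarrow> x \<in> {0..1} \<Longrightarrow> G (Suc k) x = (LBINT z. \<kappa> x z * jet_hat \<alpha> G z)" by blast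
    have k: "k < \<alpha>" using step.hyps by simp
    have "C \<ge> 0" using C[of 0 0] by (rule order_trans[rotated]) simp
    \<comment> \<open>The mean kernel composed with the kernel of order \<open>Suc k\<close>. The
      first is at most 1 and lives on \<open>{0..1}\<close>, so \<open>C\<close> bounds the
      composition as well.\<close>
    let ?I = "\<lambda>x z. \<integral>r. mean_kernel x r * \<kappa> r z \<partial>lborel"
    let ?\<kappa> = "\<lambda>x z. indicator {real k + 1..<real k + 2} z + ?I x z"
    have [measurable]: "case_prod mean_kernel \<in> borel_measurable (borel \<Otimes>\<^sub>M borel)"
      unfolding mean_kernel_def[abs_def] by measurable
    have mk: "\<bar>mean_kernel x r\<bar> \<le> indicator {0..1} r" for x r
      by (auto simp: mean_kernel_def split: split_indicator)
    have bd: "\<bar>mean_kernel x r * \<kappa> r z\<bar> \<le> indicator {0..1} r * C" for x r z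
      unfolding abs_mult using mk C by (intro mult_mono) auto
    have iC: "integrable lborel (\<lambda>r. indicator {0..1::real} r * c)" for c :: real
      by (intro integrable_mult_left integrable_real_indicator) auto
    have I: "\<bar>?I x z\<bar> \<le> C" for x z
    proof -
      have "\<bar>?I x z\<bar> \<le> (LBINT r. \<bar>mean_kernel x r * \<kappa> r z\<bar>)" by (rule integral_abs_bound)
      also have "\<dots> \<le> (LBINT r. indicator {0..1::real} r * C)"
        by (intro integral_mono_AE' iC) (use bd \<open>C \<ge> 0\<close> in auto)
      finally show ?thesis by simp
    qed
    show ?case
    proof (rule exI[of _ ?\<kappa>], rule exI[of _ "1 + C"], intro conjI allI impI)
      show "case_prod ?\<kappa> \<in> borel_measurable (borel \<Otimes>\<^sub>M borel)" by measurable
      show "\<bar>?\<kappa> x z\<bar> \<le> 1 + C" for x z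
        using I[of x z] by (auto split: split_indicator)
      fix G x assume G: "sobolev_jet \<alpha> G" and x: "x \<in> {0..1::real}"
      have [measurable]: "jet_hat \<alpha> G \<in> borel_measurable borel" by (rule jet_hat_measurable[OF G])
      have ih: "integrable lborel (\<lambda>z. \<bar>jet_hat \<alpha> G z\<bar>)" using jet_hat_integrable[OF G] by simp
      let ?f = "\<lambda>(r, z). mean_kernel x r * \<kappa> r z * jet_hat \<alpha> G z"
      have bf: "\<bar>?f (r, z)\<bar> \<le> indicator {0..1} r * C * \<bar>jet_hat \<alpha> G z\<bar>" for r z
        using bd[of x r z] by (auto simp: abs_mult intro!: mult_right_mono)
      have iz: "integrable lborel (\<lambda>z. ?f (r, z))" for r
        by (rule lintegrable_bound[where f = "\<lambda>z. indicator {0..1} r * C * \<bar>jet_hat \<alpha> G z\<bar>"])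
          (use ih bf \<open>C \<ge> 0\<close> in \<open>auto simp: abs_mult\<close>)
      have int: "integrable (lborel \<Otimes>\<^sub>M lborel) ?f"
      proof (rule lborel_pair.Fubini_integrable)
        let ?c = "\<integral>z. \<bar>jet_hat \<alpha> G z\<bar> \<partial>lborel"
        show "integrable lborel (\<lambda>r. \<integral>z. norm (?f (r, z)) \<partial>lborel)"
        proof (rule lintegrable_bound[OF iC[of "C * ?c"]])
          show "AE r in lborel. norm (LBINT z. norm (?f (r, z))) \<le> norm (indicat_real {0..1} r * (C * ?c))"
          proof (rule AE_I2)
            fix r
            have "(LBINT z. norm (?f (r, z))) \<le> (LBINT z. indicator {0..1} r * C * \<bar>jet_hat \<alpha> G z\<bar>)"
              by (intro integral_mono) (use iz[of r] ih bf in auto)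
            then show "norm (LBINT z. norm (?f (r, z))) \<le> norm (indicat_real {0..1} r * (C * ?c))"
              using \<open>C \<ge> 0\<close> by (simp add: mult.assoc)
          qed
        qed measurable
      qed (use iz in auto)
      have "(LBINT r. mean_kernel x r * G (Suc k) r) = (\<integral>r. \<integral>z. ?f (r, z) \<partial>lborel \<partial>lborel)"
      proof (rule lintegral_cong[OF refl])
        fix r show "mean_kernel x r * G (Suc k) r = (LBINT z. ?f (r, z))"
          using rep[OF G, of r] by (cases "r \<in> {0..1}") (auto simp: mean_kernel_def mult.assoc)
      qed
      also have "\<dots> = (\<integral>z. \<integral>r. ?f (r, z) \<partial>lborel \<partial>lborel)"
        using lborel_pair.Fubini_integral[OF int] by simp
      also have "\<dots> = (LBINT z. ?I x z * jet_hat \<alpha> G z)" by simp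
      finally have 3: "(LBINT r. mean_kernel x r * G (Suc k) r) = (LBINT z. ?I x z * jet_hat \<alpha> G z)" .
      have 1: "integrable lborel (\<lambda>z. indicat_real {real k + 1..<real k + 2} z *\<^sub>R jet_hat \<alpha> G z)"
        using jet_hat_integrable[OF G] by (intro integrable_mult_indicator) auto
      have 2: "integrable lborel (\<lambda>z. ?I x z * jet_hat \<alpha> G z)"
      proof (rule lintegrable_bound[where f = "\<lambda>z. C * \<bar>jet_hat \<alpha> G z\<bar>"])
        show "AE z in lborel. norm (?I x z * jet_hat \<alpha> G z) \<le> norm (C * \<bar>jet_hat \<alpha> G z\<bar>)"
          using I[of x] \<open>C \<ge> 0\<close> by (auto simp: abs_mult simp del: integral_mult_left intro!: mult_right_mono)
      qed (use ih in auto)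
      show "G k x = (LBINT z. ?\<kappa> x z * jet_hat \<alpha> G z)"
        using jet_mean_representation[OF G k x] jet_hat_eq_mean[OF G k] 1 2 3
        by (simp add: distrib_right)
    qed
  qed
qed

section \<open>Tensors of jets\<close>

abbreviation lborel_on :: "nat set \<Rightarrow> point measure" where
  "lborel_on u \<equiv> Pi\<^sub>M u (\<lambda>_. lborel)"

interpretation lborel_PiM: product_sigma_finite "\<lambda>_::nat. lborel :: real measure"
  by (rule product_sigma_finite.intro) (rule sigma_finite_lborel)

definition tensor_deriv :: "nat \<Rightarrow> (nat \<Rightarrow> nat) \<Rightarrow> tensor \<Rightarrow> point \<Rightarrow> real" where
  "tensor_deriv d \<tau> L x = (\<Sum>J\<leftarrow>L. \<Prod>j<d. J j (\<tau> j) (x j))"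

text \<open>Tensor power of the isometry \<open>jet_hat\<close>: Sobolev inner products become inner
  products in L^2 of a box with sides \<open>[0, \<alpha> + 1]\<close>.\<close>

definition tensor_hat :: "nat \<Rightarrow> nat \<Rightarrow> tensor \<Rightarrow> point \<Rightarrow> real" where
  "tensor_hat \<alpha> d L z = (\<Sum>J\<leftarrow>L. \<Prod>j<d. jet_hat \<alpha> (J j) (z j))"

definition tensor_inner :: "nat \<Rightarrow> nat \<Rightarrow> tensor \<Rightarrow> tensor \<Rightarrow> real" where
  "tensor_inner \<alpha> d L M = (\<Sum>J\<leftarrow>L. \<Sum>K\<leftarrow>M. \<Prod>j<d. jet_inner \<alpha> (J j) (K j))"

definition jet_tensors :: "nat \<Rightarrow> nat \<Rightarrow> tensor \<Rightarrow> bool" where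
  "jet_tensors \<alpha> d L \<longleftrightarrow> (\<forall>J\<in>set L. \<forall>j<d. sobolev_jet \<alpha> (J j))"

lemma jet_tensorsD: "jet_tensors \<alpha> d L \<Longrightarrow> i < length L \<Longrightarrow> j < d \<Longrightarrow> sobolev_jet \<alpha> ((L ! i) j)"
  by (simp add: jet_tensors_def)

lemma sum_list_conv_sum: "(\<Sum>J\<leftarrow>L. f J) = (\<Sum>i<length L. f (L ! i))"
  by (simp add: sum_list_sum_nth atLeast0LessThan)

section \<open>Marginals\<close>

text \<open>The coordinates in \<open>w\<close> are kept, the others integrated out. Applied to the
  absolute value of \<open>tensor_hat\<close>, with \<open>w\<close> the coordinates of order
  \<alpha>, this will majorise a mixed derivative.\<close>

definition marginal :: "nat \<Rightarrow> nat set \<Rightarrow> (point \<Rightarrow> ennreal) \<Rightarrow> point \<Rightarrow> ennreal" where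
  "marginal d w a x = (\<integral>\<^sup>+z. a (\<lambda>j. if j \<in> w then x j else z j) \<partial>lborel_on ({..<d} - w))"

text \<open>Measurability on the product space constrains only extensional functions. The second
  condition admits the points inserted in \<open>marginal\<close>, which may carry arbitrary values
  outside \<open>{..<d}\<close>.\<close>

definition cylindrical :: "nat \<Rightarrow> (point \<Rightarrow> ennreal) \<Rightarrow> bool" where
  "cylindrical d a \<longleftrightarrow> a \<in> borel_measurable (lborel_on {..<d}) \<and> (\<forall>x y. (\<forall>j<d. x j = y j) \<longrightarrow> a x = a y)"

lemma cylindricalD:
  assumes "cylindrical d a"
  shows "a \<in> borel_measurable (lborel_on {..<d})" "(\<And>j. j < d \<Longrightarrow> x j = y j) \<Longrightarrow> a x = a y"
  using assms by (auto simp: cylindrical_def)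

lemma marginal_cong: "(\<And>j. j \<in> w \<Longrightarrow> x j = y j) \<Longrightarrow> marginal d w a x = marginal d w a y"
  unfolding marginal_def by (intro nn_integral_cong arg_cong[of _ _ a]) auto

lemma cylindrical_merge_measurable:
  assumes a: "cylindrical d a" and w: "w \<subseteq> {..<d}" "w \<subseteq> w'"
  shows "(\<lambda>(x, \<omega>). a (\<lambda>j. if j \<in> w then x j else \<omega> j))
    \<in> borel_measurable (lborel_on w' \<Otimes>\<^sub>M lborel_on ({..<d} - w))"
proof -
  have "(\<lambda>(x, \<omega>). a (\<lambda>j. if j \<in> w then x j else \<omega> j)) = (\<lambda>z. a (\<lambda>j\<in>{..<d}. if j \<in> w then fst z j else snd z j))"
    by (auto simp: fun_eq_iff intro!: cylindricalD(2)[OF a])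
  also have "\<dots> \<in> borel_measurable (lborel_on w' \<Otimes>\<^sub>M lborel_on ({..<d} - w))"
  proof (rule measurable_compose[OF _ cylindricalD(1)[OF a]])
    show "(\<lambda>z. \<lambda>j\<in>{..<d}. if j \<in> w then fst z j else snd z j)
      \<in> lborel_on w' \<Otimes>\<^sub>M lborel_on ({..<d} - w) \<rightarrow>\<^sub>M lborel_on {..<d}"
    proof (rule measurable_restrict)
      fix j assume j: "j \<in> {..<d}"
      show "(\<lambda>z. if j \<in> w then fst z j else snd z j)
        \<in> lborel_on w' \<Otimes>\<^sub>M lborel_on ({..<d} - w) \<rightarrow>\<^sub>M lborel"
      proof (cases "j \<in> w")
        case True
        then show ?thesis using w measurable_compose[OF measurable_fst measurable_component_singleton[of j w' "\<lambda>_. lborel"]]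
          by auto
      next
        case False
        then show ?thesis using j measurable_compose[OF measurable_snd measurable_component_singleton[of j "{..<d} - w" "\<lambda>_. lborel"]]
          by auto
      qed
    qed
  qed
  finally show ?thesis .
qed

lemma marginal_measurable:
  assumes "cylindrical d a" "w \<subseteq> {..<d}" "w \<subseteq> w'"
  shows "marginal d w a \<in> borel_measurable (lborel_on w')"
proof -
  interpret sigma_finite_measure "lborel_on ({..<d} - w)"
    by (rule lborel_PiM.sigma_finite) simp
  show ?thesis
    unfolding marginal_def[abs_def]
    by (rule borel_measurable_nn_integral) (rule cylindrical_merge_measurable[OF assms])
qed

lemma marginal_section_measurable:
  assumes a: "cylindrical d a" and w: "w \<subseteq> {..<d}"
  shows "(\<lambda>z. a (\<lambda>j. if j \<in> w then x j else z j)) \<in> borel_measurable (lborel_on ({..<d} - w))"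
proof -
  have "restrict x w \<in> space (lborel_on w)" by (simp add: space_PiM)
  from measurable_Pair2[OF cylindrical_merge_measurable[OF a w order_refl] this]
  show ?thesis by (simp cong: if_cong)
qed

text \<open>Tonelli in coordinate \<open>k\<close>. It makes the majorant for a derivative of order
  \<alpha> in \<open>k\<close> integrable along that coordinate.\<close>

lemma marginal_fubini:
  assumes a: "cylindrical d a" and w: "w \<subseteq> {..<d}" and k: "k < d" "k \<notin> w"
  shows "(\<integral>\<^sup>+t. marginal d (insert k w) a (x(k := t)) \<partial>lborel) = marginal d w a x"
proof -
  let ?v = "{..<d} - insert k w"
  have v: "insert k ?v = {..<d} - w" using k by auto
  have "marginal d w a x = (\<integral>\<^sup>+z. a (\<lambda>j. if j \<in> w then x j else z j) \<partial>lborel_on (insert k ?v))"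
    unfolding marginal_def v ..
  also have "\<dots> = (\<integral>\<^sup>+t. \<integral>\<^sup>+z. a (\<lambda>j. if j \<in> w then x j else fun_upd z k t j) \<partial>lborel_on ?v \<partial>lborel)"
    by (rule lborel_PiM.product_nn_integral_insert_rev) (use v marginal_section_measurable[OF a w, of x] in auto)
  also have "\<dots> = (\<integral>\<^sup>+t. marginal d (insert k w) a (x(k := t)) \<partial>lborel)"
    unfolding marginal_def using k by (intro nn_integral_cong arg_cong[of _ _ a]) auto
  finally show ?thesis ..
qed

lemma marginal_suminf:
  assumes "\<And>n. cylindrical d (a n)" "w \<subseteq> {..<d}"
  shows "marginal d w (\<lambda>z. \<Sum>n. a n z) x = (\<Sum>n. marginal d w (a n) x)"
  unfolding marginal_def using marginal_section_measurable[OF assms] by (intro nn_integral_suminf) auto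

lemma cylindrical_suminf:
  assumes "\<And>n::nat. cylindrical d (a n)"
  shows "cylindrical d (\<lambda>z. \<Sum>n. a n z)"
proof -
  have [measurable]: "a n \<in> borel_measurable (lborel_on {..<d})" for n using assms by (auto simp: cylindrical_def)
  have "(\<Sum>n. a n x) = (\<Sum>n. a n y)" if "\<forall>j<d. x j = y j" for x y
    using cylindricalD(2)[OF assms, of x y] that by auto
  then show ?thesis unfolding cylindrical_def by auto
qed

text \<open>Cauchy-Schwarz in the variables integrated out, against the indicator of a box of side
  \<open>c\<close>, whose volume is at most \<open>c ^ d\<close> as
  \<open>c \<ge> 1\<close>.\<close>

lemma marginal_square:
  assumes a: "cylindrical d a" and w: "w \<subseteq> {..<d}"
    and supp: "\<And>z j. j < d \<Longrightarrow> z j \<notin> {0..c} \<Longrightarrow> a z = 0" and c: "c \<ge> 1"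
  shows "(\<integral>\<^sup>+x. (marginal d w a x)\<^sup>2 \<partial>lborel_on w) \<le> ennreal (c ^ d) * (\<integral>\<^sup>+z. (a z)\<^sup>2 \<partial>lborel_on {..<d})"
proof -
  let ?v = "{..<d} - w"
  have fw: "finite w" using w finite_subset by blast
  have [measurable]: "a \<in> borel_measurable (lborel_on {..<d})" by (rule cylindricalD(1)[OF a])
  let ?B = "Pi\<^sub>E ?v (\<lambda>_. {0..c})"
  have B [measurable]: "?B \<in> sets (lborel_on ?v)" by (intro sets_PiM_I_finite) auto
  have emB: "emeasure (lborel_on ?v) ?B \<le> ennreal (c ^ d)"
  proof -
    have "emeasure (lborel_on ?v) ?B = (\<Prod>j\<in>?v. ennreal c)"
      using c by (subst lborel_PiM.emeasure_PiM) auto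
    also have "\<dots> = ennreal (c ^ card ?v)" using c by (simp add: ennreal_power)
    also have "\<dots> \<le> ennreal (c ^ d)"
      using c card_mono[of "{..<d}" ?v] by (intro ennreal_leI power_increasing) auto
    finally show ?thesis .
  qed
  have cs: "(marginal d w a x)\<^sup>2 \<le> ennreal (c ^ d) * marginal d w (\<lambda>z. (a z)\<^sup>2) x" for x
  proof -
    let ?g = "\<lambda>z. a (\<lambda>j. if j \<in> w then x j else z j)"
    have [measurable]: "?g \<in> borel_measurable (lborel_on ?v)" by (rule marginal_section_measurable[OF a w])
    have "marginal d w a x = (\<integral>\<^sup>+z. ?g z * indicator ?B z \<partial>lborel_on ?v)"
      unfolding marginal_def
    proof (rule nn_integral_cong)
      fix z assume om: "z \<in> space (lborel_on ?v)"
      show "?g z = ?g z * indicator ?B z"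
      proof (cases "z \<in> ?B")
        case False
        then obtain j where j: "j \<in> ?v" "z j \<notin> {0..c}" using om by (auto simp: space_PiM PiE_iff)
        then have "?g z = 0" by (intro supp[of j]) auto
        then show ?thesis by simp
      qed simp
    qed
    then have "(marginal d w a x)\<^sup>2 \<le> (\<integral>\<^sup>+z. (?g z)\<^sup>2 \<partial>lborel_on ?v) * (\<integral>\<^sup>+z. (indicator ?B z)\<^sup>2 \<partial>lborel_on ?v)"
      using Cauchy_Schwarz_nn_integral[of ?g "lborel_on ?v" "indicator ?B"] by simp
    also have "(\<integral>\<^sup>+z. (indicator ?B z)\<^sup>2 \<partial>lborel_on ?v) = emeasure (lborel_on ?v) ?B"
    proof -
      have "(indicator ?B z)\<^sup>2 = (indicator ?B z :: ennreal)" for z by (auto split: split_indicator)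
      then show ?thesis by simp
    qed
    also have "(\<integral>\<^sup>+z. (?g z)\<^sup>2 \<partial>lborel_on ?v) * emeasure (lborel_on ?v) ?B
        \<le> (\<integral>\<^sup>+z. (?g z)\<^sup>2 \<partial>lborel_on ?v) * ennreal (c ^ d)"
      by (rule mult_left_mono[OF emB]) simp
    also have "(\<integral>\<^sup>+z. (?g z)\<^sup>2 \<partial>lborel_on ?v) = marginal d w (\<lambda>z. (a z)\<^sup>2) x"
      by (simp add: marginal_def)
    finally show ?thesis by (simp add: mult.commute)
  qed
  have a2: "cylindrical d (\<lambda>z. (a z)\<^sup>2)"
    unfolding cylindrical_def
  proof (intro conjI allI impI)
    fix x y :: point assume "\<forall>j<d. x j = y j"
    then have "a x = a y" by (intro cylindricalD(2)[OF a]) auto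
    then show "(a x)\<^sup>2 = (a y)\<^sup>2" by simp
  qed measurable
  have "(\<integral>\<^sup>+x. (marginal d w a x)\<^sup>2 \<partial>lborel_on w)
      \<le> (\<integral>\<^sup>+x. ennreal (c ^ d) * marginal d w (\<lambda>z. (a z)\<^sup>2) x \<partial>lborel_on w)"
    by (intro nn_integral_mono cs)
  also have "\<dots> = ennreal (c ^ d) * (\<integral>\<^sup>+x. marginal d w (\<lambda>z. (a z)\<^sup>2) x \<partial>lborel_on w)"
    by (intro nn_integral_cmult marginal_measurable[OF a2 w order_refl])
  also have "(\<integral>\<^sup>+x. marginal d w (\<lambda>z. (a z)\<^sup>2) x \<partial>lborel_on w) = (\<integral>\<^sup>+z. (a z)\<^sup>2 \<partial>lborel_on (w \<union> ?v))"
  proof (subst lborel_PiM.product_nn_integral_fold)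
    have "w \<union> ?v = {..<d}" using w by auto
    then show "(\<lambda>z. (a z)\<^sup>2) \<in> borel_measurable (lborel_on (w \<union> ?v))" by simp
    show "(\<integral>\<^sup>+x. marginal d w (\<lambda>z. (a z)\<^sup>2) x \<partial>lborel_on w) =
      (\<integral>\<^sup>+x. \<integral>\<^sup>+y. (a (merge w ?v (x, y)))\<^sup>2 \<partial>lborel_on ?v \<partial>lborel_on w)"
      unfolding marginal_def
    proof (intro nn_integral_cong)
      fix x y
      have "a (\<lambda>j. if j \<in> w then x j else y j) = a (merge w ?v (x, y))"
        by (rule cylindricalD(2)[OF a]) (auto simp: merge_def)
      then show "(a (\<lambda>j. if j \<in> w then x j else y j))\<^sup>2 = (a (merge w ?v (x, y)))\<^sup>2" by simp
    qed
  qed (use fw in auto)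
  also have "w \<union> ?v = {..<d}" using w by auto
  finally show ?thesis .
qed

section \<open>The isometry for tensors\<close>

lemma tensor_hat_cong: "(\<And>j. j < d \<Longrightarrow> x j = y j) \<Longrightarrow> tensor_hat \<alpha> d L x = tensor_hat \<alpha> d L y"
  unfolding tensor_hat_def by (intro arg_cong[where f = sum_list] map_cong refl prod.cong) auto

lemma tensor_hat_measurable:
  assumes "jet_tensors \<alpha> d L"
  shows "tensor_hat \<alpha> d L \<in> borel_measurable (lborel_on {..<d})"
proof -
  have "(\<lambda>z. jet_hat \<alpha> ((L ! i) j) (z j)) \<in> borel_measurable (lborel_on {..<d})" if "i < length L" "j < d" for i j
    using that jet_hat_measurable[OF jet_tensorsD[OF assms that]]
    by (intro measurable_compose[OF measurable_component_singleton[of j "{..<d}"]]) auto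
  then show ?thesis
    unfolding tensor_hat_def[abs_def] sum_list_conv_sum
    by (intro borel_measurable_sum borel_measurable_prod) auto
qed

lemma cylindrical_tensor_hat:
  "jet_tensors \<alpha> d L \<Longrightarrow> cylindrical d (\<lambda>z. ennreal \<bar>tensor_hat \<alpha> d L z\<bar>)"
  unfolding cylindrical_def
proof (intro conjI allI impI)
  assume "jet_tensors \<alpha> d L"
  from tensor_hat_measurable[OF this] show "(\<lambda>z. ennreal \<bar>tensor_hat \<alpha> d L z\<bar>) \<in> borel_measurable (lborel_on {..<d})"
    by measurable
  fix x y :: point assume "\<forall>j<d. x j = y j"
  then have "tensor_hat \<alpha> d L x = tensor_hat \<alpha> d L y" by (intro tensor_hat_cong) auto
  then show "ennreal \<bar>tensor_hat \<alpha> d L x\<bar> = ennreal \<bar>tensor_hat \<alpha> d L y\<bar>" by simp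
qed

lemma tensor_hat_support:
  assumes "j < d" "z j \<notin> {0..real \<alpha> + 1}"
  shows "tensor_hat \<alpha> d L z = 0"
proof -
  have *: "(\<Prod>j<d. jet_hat \<alpha> (J j) (z j)) = 0" for J
    using assms jet_hat_support[of "z j" \<alpha> "J j"] by (intro prod_zero) auto
  show ?thesis unfolding tensor_hat_def by (simp only: *) simp
qed

text \<open>Products over the coordinates integrate factor by factor to \<open>jet_inner\<close>;
  the double sum over list entries is the bilinear expansion.\<close>

lemma has_bochner_integral_tensor_hat_mult:
  assumes L: "jet_tensors \<alpha> d L" and M: "jet_tensors \<alpha> d M"
  shows "has_bochner_integral (lborel_on {..<d}) (\<lambda>z. tensor_hat \<alpha> d L z * tensor_hat \<alpha> d M z) (tensor_inner \<alpha> d L M)"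
proof -
  have 1: "has_bochner_integral (lborel_on {..<d})
      (\<lambda>z. \<Prod>j<d. jet_hat \<alpha> ((L ! i) j) (z j) * jet_hat \<alpha> ((M ! k) j) (z j))
      (\<Prod>j<d. jet_inner \<alpha> ((L ! i) j) ((M ! k) j))" if ik: "i < length L" "k < length M" for i k
  proof -
    note * = has_bochner_integral_jet_hat_mult[OF jet_tensorsD[OF L ik(1)] jet_tensorsD[OF M ik(2)]]
    have "integrable (lborel_on {..<d}) (\<lambda>z. \<Prod>j<d. jet_hat \<alpha> ((L ! i) j) (z j) * jet_hat \<alpha> ((M ! k) j) (z j))"
      using * by (intro lborel_PiM.product_integrable_prod[where f = "\<lambda>j t. jet_hat \<alpha> ((L ! i) j) t * jet_hat \<alpha> ((M ! k) j) t"]) 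
        (auto simp: has_bochner_integral_iff)
    moreover have "(\<integral>z. (\<Prod>j<d. jet_hat \<alpha> ((L ! i) j) (z j) * jet_hat \<alpha> ((M ! k) j) (z j)) \<partial>lborel_on {..<d})
       = (\<Prod>j<d. jet_inner \<alpha> ((L ! i) j) ((M ! k) j))"
      using * by (subst lborel_PiM.product_integral_prod[where f = "\<lambda>j t. jet_hat \<alpha> ((L ! i) j) t * jet_hat \<alpha> ((M ! k) j) t"])
        (auto simp: has_bochner_integral_iff)
    ultimately show ?thesis by (simp add: has_bochner_integral_iff)
  qed
  have "has_bochner_integral (lborel_on {..<d})
      (\<lambda>z. \<Sum>i<length L. \<Sum>k<length M. \<Prod>j<d. jet_hat \<alpha> ((L ! i) j) (z j) * jet_hat \<alpha> ((M ! k) j) (z j))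
      (\<Sum>i<length L. \<Sum>k<length M. \<Prod>j<d. jet_inner \<alpha> ((L ! i) j) ((M ! k) j))"
    by (intro has_bochner_integral_sum 1) auto
  then show ?thesis
    unfolding tensor_inner_def tensor_hat_def sum_list_conv_sum
    by (simp add: sum_product prod.distrib)
qed

lemma nn_integral_tensor_hat_square:
  assumes L: "jet_tensors \<alpha> d L"
  shows "(\<integral>\<^sup>+z. (ennreal \<bar>tensor_hat \<alpha> d L z\<bar>)\<^sup>2 \<partial>lborel_on {..<d}) = ennreal (tensor_inner \<alpha> d L L)"
    and "tensor_inner \<alpha> d L L \<ge> 0"
proof -
  note * = has_bochner_integral_tensor_hat_mult[OF L L]
  have "(\<integral>\<^sup>+z. (ennreal \<bar>tensor_hat \<alpha> d L z\<bar>)\<^sup>2 \<partial>lborel_on {..<d})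
    = (\<integral>\<^sup>+z. ennreal (tensor_hat \<alpha> d L z * tensor_hat \<alpha> d L z) \<partial>lborel_on {..<d})"
    by (intro nn_integral_cong) (simp add: ennreal_power flip: power2_eq_square)
  also have "\<dots> = ennreal (tensor_inner \<alpha> d L L)"
    using * by (subst nn_integral_eq_integral) (auto simp: has_bochner_integral_iff)
  finally show "(\<integral>\<^sup>+z. (ennreal \<bar>tensor_hat \<alpha> d L z\<bar>)\<^sup>2 \<partial>lborel_on {..<d}) = ennreal (tensor_inner \<alpha> d L L)" .
  have "tensor_inner \<alpha> d L L = (\<integral>z. tensor_hat \<alpha> d L z * tensor_hat \<alpha> d L z \<partial>lborel_on {..<d})"
    using * by (simp add: has_bochner_integral_iff)
  then show "tensor_inner \<alpha> d L L \<ge> 0" by simp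
qed

section \<open>Pointwise bounds for mixed derivatives\<close>

text \<open>One constant for all orders below \<alpha>, taken at least 1 so that its powers
  increase.\<close>

lemma uniform_jet_kernels:
  obtains \<kappa> :: "nat \<Rightarrow> real \<Rightarrow> real \<Rightarrow> real" and C where "C \<ge> 1"
    "\<And>k x. k < \<alpha> \<Longrightarrow> \<kappa> k x \<in> borel_measurable borel" "\<And>k x z. k < \<alpha> \<Longrightarrow> \<bar>\<kappa> k x z\<bar> \<le> C"
    "\<And>k G x. k < \<alpha> \<Longrightarrow> sobolev_jet \<alpha> G \<Longrightarrow> x \<in> {0..1} \<Longrightarrow> G k x = (LBINT z. \<kappa> k x z * jet_hat \<alpha> G z)"
proof -
  define Q where "Q k \<kappa> C \<longleftrightarrow> case_prod \<kappa> \<in> borel_measurable (borel \<Otimes>\<^sub>M borel) \<and> (\<forall>x z. \<bar>\<kappa> x z\<bar> \<le> C) \<and>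
    (\<forall>G x. sobolev_jet \<alpha> G \<longrightarrow> x \<in> {0..1} \<longrightarrow> G k x = (LBINT z. \<kappa> x z * jet_hat \<alpha> G z))" for k \<kappa> C
  have "\<forall>k. \<exists>\<kappa> C. k < \<alpha> \<longrightarrow> Q k \<kappa> C"
    using jet_kernel_representation unfolding Q_def by blast
  then obtain \<kappa> C where Q: "\<And>k. k < \<alpha> \<Longrightarrow> Q k (\<kappa> k) (C k)" by metis
  let ?C = "1 + (\<Sum>k<\<alpha>. \<bar>C k\<bar>)"
  have le: "C k \<le> ?C" if "k < \<alpha>" for k
  proof -
    have "\<bar>C k\<bar> \<le> (\<Sum>k<\<alpha>. \<bar>C k\<bar>)" using that by (intro member_le_sum) auto
    then show ?thesis by linarith
  qed
  show thesis
  proof (rule that[of ?C \<kappa>])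
    show "1 \<le> ?C" by (simp add: sum_nonneg)
    fix k x z assume k: "k < \<alpha>"
    have [measurable]: "case_prod (\<kappa> k) \<in> borel_measurable (borel \<Otimes>\<^sub>M borel)" using Q[OF k] by (simp add: Q_def)
    show "\<kappa> k x \<in> borel_measurable borel"
    proof -
      have "(\<lambda>z. case_prod (\<kappa> k) (x, z)) \<in> borel_measurable borel" by measurable
      then show ?thesis by simp
    qed
    show "\<bar>\<kappa> k x z\<bar> \<le> ?C" using Q[OF k] le[OF k] unfolding Q_def by (meson order_trans)
    fix G assume "sobolev_jet \<alpha> G" "x \<in> {0..1}"
    then show "G k x = (LBINT z. \<kappa> k x z * jet_hat \<alpha> G z)" using Q[OF k] unfolding Q_def by blast
  qed
qed

text \<open>Coordinates of order below \<alpha> are replaced by kernel integrals; those of order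
  \<alpha> are read off \<open>tensor_hat\<close> directly. The latter needs
  \<open>x j \<noteq> 1\<close>, because \<open>jet_hat\<close> shows the top derivative on
  \<open>[0,1)\<close> only. It matters that the constant does not depend on the tensor.\<close>

lemma tensor_deriv_bound:
  obtains C :: real where "C \<ge> 1" "\<And>L \<tau> (x :: point) w. jet_tensors \<alpha> d L \<Longrightarrow> (\<And>j. j < d \<Longrightarrow> \<tau> j \<le> \<alpha>) \<Longrightarrow> w = {j. j < d \<and> \<tau> j = \<alpha>}
    \<Longrightarrow> (\<And>j. j < d \<Longrightarrow> x j \<in> {0..1}) \<Longrightarrow> (\<And>j. j \<in> w \<Longrightarrow> x j \<noteq> 1) \<Longrightarrow>
    ennreal \<bar>tensor_deriv d \<tau> L x\<bar> \<le> ennreal C * marginal d w (\<lambda>z. ennreal \<bar>tensor_hat \<alpha> d L z\<bar>) x"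
proof -
  obtain \<kappa> :: "nat \<Rightarrow> real \<Rightarrow> real \<Rightarrow> real" and C where C: "C \<ge> 1"
    and \<kappa>: "\<And>k x. k < \<alpha> \<Longrightarrow> \<kappa> k x \<in> borel_measurable borel" "\<And>k x z. k < \<alpha> \<Longrightarrow> \<bar>\<kappa> k x z\<bar> \<le> C"
    "\<And>k G x. k < \<alpha> \<Longrightarrow> sobolev_jet \<alpha> G \<Longrightarrow> x \<in> {0..1} \<Longrightarrow> G k x = (LBINT z. \<kappa> k x z * jet_hat \<alpha> G z)"
    by (rule uniform_jet_kernels[of \<alpha>]) (rule that; assumption)
  show thesis
  \<comment> \<open>The product of kernels has at most \<open>d\<close> factors, each bounded by
    \<open>C\<close>.\<close>
  proof (rule that[of "C ^ d"])
    show "1 \<le> C ^ d" using C by simp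
    fix L \<tau> w and x :: point
    assume L: "jet_tensors \<alpha> d L" and \<tau>: "\<And>j. j < d \<Longrightarrow> \<tau> j \<le> \<alpha>" and w: "w = {j. j < d \<and> \<tau> j = \<alpha>}"
      and x: "\<And>j. j < d \<Longrightarrow> x j \<in> {0..1}" and x1: "\<And>j. j \<in> w \<Longrightarrow> x j \<noteq> 1"
    let ?v = "{..<d} - w" and ?P = "lborel_on ({..<d} - w)"
    have \<tau>v: "\<tau> j < \<alpha>" if "j \<in> ?v" for j using \<tau>[of j] that w by force
    have split: "(\<Prod>j<d. f j) = (\<Prod>j\<in>w. f j) * (\<Prod>j\<in>?v. f j)" for f :: "nat \<Rightarrow> real"
      using w by (subst prod.union_disjoint[symmetric]) (auto intro!: prod.cong)
    let ?x = "\<lambda>z j. if j \<in> w then x j else z j"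
    have hb: "has_bochner_integral ?P (\<lambda>z. (\<Prod>j\<in>?v. \<kappa> (\<tau> j) (x j) (z j)) * (\<Prod>j<d. jet_hat \<alpha> ((L ! i) j) (?x z j)))
       (\<Prod>j<d. (L ! i) j (\<tau> j) (x j))" if i: "i < length L" for i
    proof -
      note J = jet_tensorsD[OF L i]
      have int: "integrable lborel (\<lambda>t. \<kappa> (\<tau> j) (x j) t * jet_hat \<alpha> ((L ! i) j) t)" if j: "j \<in> ?v" for j
      proof (rule lintegrable_bound[where f = "\<lambda>t. C * jet_hat \<alpha> ((L ! i) j) t"])
        show "integrable lborel (\<lambda>t. C * jet_hat \<alpha> ((L ! i) j) t)" using jet_hat_integrable[OF J, of j] j by simp
        show "(\<lambda>t. \<kappa> (\<tau> j) (x j) t * jet_hat \<alpha> ((L ! i) j) t) \<in> borel_measurable lborel"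
          using \<kappa>(1)[OF \<tau>v[OF j], of "x j"] jet_hat_measurable[OF J, of j] j by simp
        show "AE t in lborel. norm (\<kappa> (\<tau> j) (x j) t * jet_hat \<alpha> ((L ! i) j) t) \<le> norm (C * jet_hat \<alpha> ((L ! i) j) t)"
          using \<kappa>(2)[OF \<tau>v[OF j], of "x j"] C by (auto simp: abs_mult intro!: mult_right_mono)
      qed
      have "has_bochner_integral ?P (\<lambda>z. \<Prod>j\<in>?v. \<kappa> (\<tau> j) (x j) (z j) * jet_hat \<alpha> ((L ! i) j) (z j))
        (\<Prod>j\<in>?v. (L ! i) j (\<tau> j) (x j))"
      proof -
        have "integrable ?P (\<lambda>z. \<Prod>j\<in>?v. \<kappa> (\<tau> j) (x j) (z j) * jet_hat \<alpha> ((L ! i) j) (z j))"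
          by (intro lborel_PiM.product_integrable_prod[where f = "\<lambda>j t. \<kappa> (\<tau> j) (x j) t * jet_hat \<alpha> ((L ! i) j) t"] int) auto
        moreover have "(\<integral>z. (\<Prod>j\<in>?v. \<kappa> (\<tau> j) (x j) (z j) * jet_hat \<alpha> ((L ! i) j) (z j)) \<partial>?P)
          = (\<Prod>j\<in>?v. (L ! i) j (\<tau> j) (x j))"
        proof (subst lborel_PiM.product_integral_prod[where f = "\<lambda>j t. \<kappa> (\<tau> j) (x j) t * jet_hat \<alpha> ((L ! i) j) t"])
          show "(\<Prod>j\<in>?v. \<integral>t. \<kappa> (\<tau> j) (x j) t * jet_hat \<alpha> ((L ! i) j) t \<partial>lborel) = (\<Prod>j\<in>?v. (L ! i) j (\<tau> j) (x j))"
          proof (rule prod.cong[OF refl])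
            fix j assume j: "j \<in> ?v"
            then show "(LBINT t. \<kappa> (\<tau> j) (x j) t * jet_hat \<alpha> ((L ! i) j) t) = (L ! i) j (\<tau> j) (x j)"
              using \<kappa>(3)[OF \<tau>v[OF j] J x, of j] by simp
          qed
        qed (use int in auto)
        ultimately show ?thesis by (simp add: has_bochner_integral_iff)
      qed
      from has_bochner_integral_mult_right[OF this, of "\<Prod>j\<in>w. (L ! i) j (\<tau> j) (x j)"]
      have "has_bochner_integral ?P (\<lambda>z. (\<Prod>j\<in>w. (L ! i) j (\<tau> j) (x j)) * (\<Prod>j\<in>?v. \<kappa> (\<tau> j) (x j) (z j) * jet_hat \<alpha> ((L ! i) j) (z j)))
        (\<Prod>j<d. (L ! i) j (\<tau> j) (x j))"
        unfolding split[of "\<lambda>j. (L ! i) j (\<tau> j) (x j)"] by blast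
      moreover have "(\<Prod>j\<in>w. (L ! i) j (\<tau> j) (x j)) * (\<Prod>j\<in>?v. \<kappa> (\<tau> j) (x j) (z j) * jet_hat \<alpha> ((L ! i) j) (z j))
         = (\<Prod>j\<in>?v. \<kappa> (\<tau> j) (x j) (z j)) * (\<Prod>j<d. jet_hat \<alpha> ((L ! i) j) (?x z j))" for z
      proof -
        have "(\<Prod>j\<in>w. jet_hat \<alpha> ((L ! i) j) (?x z j)) = (\<Prod>j\<in>w. (L ! i) j (\<tau> j) (x j))"
        proof (rule prod.cong[OF refl])
          fix j assume j: "j \<in> w"
          then have "x j \<in> {0..<1}" using x[of j] x1[of j] w by auto
          then show "jet_hat \<alpha> ((L ! i) j) (?x z j) = (L ! i) j (\<tau> j) (x j)"
            using j w by (simp add: jet_hat_unit)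
        qed
        then show ?thesis unfolding split[of "\<lambda>j. jet_hat \<alpha> ((L ! i) j) (?x z j)"]
          by (simp add: prod.distrib mult_ac)
      qed
      ultimately show ?thesis by simp
    qed
    have "has_bochner_integral ?P (\<lambda>z. \<Sum>i<length L. (\<Prod>j\<in>?v. \<kappa> (\<tau> j) (x j) (z j)) * (\<Prod>j<d. jet_hat \<alpha> ((L ! i) j) (?x z j)))
       (\<Sum>i<length L. \<Prod>j<d. (L ! i) j (\<tau> j) (x j))"
      by (intro has_bochner_integral_sum hb) auto
    then have hb': "has_bochner_integral ?P (\<lambda>z. (\<Prod>j\<in>?v. \<kappa> (\<tau> j) (x j) (z j)) * tensor_hat \<alpha> d L (?x z)) (tensor_deriv d \<tau> L x)"
      unfolding tensor_deriv_def tensor_hat_def sum_list_conv_sum sum_distrib_left .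
    have "ennreal \<bar>tensor_deriv d \<tau> L x\<bar> \<le> (\<integral>\<^sup>+z. ennreal (norm ((\<Prod>j\<in>?v. \<kappa> (\<tau> j) (x j) (z j)) * tensor_hat \<alpha> d L (?x z))) \<partial>?P)"
      using integral_norm_bound_ennreal[OF integrable.intros[OF hb']]
      unfolding has_bochner_integral_integral_eq[OF hb'] real_norm_def .
    also have "\<dots> \<le> (\<integral>\<^sup>+z. ennreal (C ^ d) * ennreal \<bar>tensor_hat \<alpha> d L (?x z)\<bar> \<partial>?P)"
    proof (rule nn_integral_mono)
      fix z
      have "\<bar>\<Prod>j\<in>?v. \<kappa> (\<tau> j) (x j) (z j)\<bar> \<le> (\<Prod>j\<in>?v. C)"
        unfolding abs_prod using \<kappa>(2) \<tau>v by (intro prod_mono) auto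
      also have "\<dots> \<le> C ^ d"
        using C card_mono[of "{..<d}" ?v] by (auto intro!: power_increasing)
      finally have "\<bar>\<Prod>j\<in>?v. \<kappa> (\<tau> j) (x j) (z j)\<bar> \<le> C ^ d" .
      then have "norm ((\<Prod>j\<in>?v. \<kappa> (\<tau> j) (x j) (z j)) * tensor_hat \<alpha> d L (?x z)) \<le> C ^ d * \<bar>tensor_hat \<alpha> d L (?x z)\<bar>"
        by (simp only: real_norm_def abs_mult) (rule mult_right_mono, auto)
      then show "ennreal (norm ((\<Prod>j\<in>?v. \<kappa> (\<tau> j) (x j) (z j)) * tensor_hat \<alpha> d L (?x z))) \<le> ennreal (C ^ d) * ennreal \<bar>tensor_hat \<alpha> d L (?x z)\<bar>"
        using C by (simp add: ennreal_leI flip: ennreal_mult)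
    qed
    also have "\<dots> = ennreal (C ^ d) * marginal d w (\<lambda>z. ennreal \<bar>tensor_hat \<alpha> d L z\<bar>) x"
      unfolding marginal_def w[symmetric]
      using marginal_section_measurable[OF cylindrical_tensor_hat[OF L], of w x] w
      by (intro nn_integral_cmult) auto
    finally show "ennreal \<bar>tensor_deriv d \<tau> L x\<bar> \<le> ennreal (C ^ d) * marginal d w (\<lambda>z. ennreal \<bar>tensor_hat \<alpha> d L z\<bar>) x" .
  qed
qed

section \<open>Series of tensors\<close>

text \<open>Fubini's argument for differentiating a series term by term at a single point: the tails of
  the series vary no more than functions \<open>H K\<close> whose derivatives at that point tend to \<open>0\<close>.\<close>

lemma termwise_derivative_majorant:
  fixes u :: "nat \<Rightarrow> real \<Rightarrow> real"
  assumes t: "t \<in> A"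
    and U: "\<And>s. s \<in> A \<Longrightarrow> (\<lambda>n. u n s) sums U s"
    and u: "\<And>n. (u n has_real_derivative v n) (at t within A)"
    and v: "summable v"
    and tail: "\<And>K s. s \<in> A \<Longrightarrow> \<bar>\<Sum>n. u (n + K) s - u (n + K) t\<bar> \<le> \<bar>H K s - H K t\<bar>"
    and H: "\<And>K. (H K has_real_derivative h K) (at t within A)" "h \<longlonglongrightarrow> 0"
  shows "(U has_real_derivative (\<Sum>n. v n)) (at t within A)"
  unfolding has_field_derivative_iff
proof (rule tendstoI)
  fix e :: real assume e: "e > 0"
  have "(\<lambda>K. \<Sum>n. v (n + K)) \<longlonglongrightarrow> 0"
    using suminf_exist_split2[OF v] by simp
  with H(2) have "eventually (\<lambda>K. \<bar>h K\<bar> < e / 4 \<and> \<bar>\<Sum>n. v (n + K)\<bar> < e / 4) sequentially"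
    using e by (intro eventually_conj order_tendstoD(2)[OF tendsto_rabs_zero]) auto
  \<comment> \<open>Three errors stay below \<open>e / 4\<close> each: the quotient of the tail,
    bounded by that of \<open>H K\<close>; the error in the quotient of the first \<open>K\<close>
    terms; and the tail of \<open>v\<close>.\<close>
  then obtain K where K: "\<bar>h K\<bar> < e / 4" "\<bar>\<Sum>n. v (n + K)\<bar> < e / 4"
    by (auto simp: eventually_sequentially)
  have "((\<lambda>s. \<Sum>n<K. (u n s - u n t) / (s - t)) \<longlongrightarrow> (\<Sum>n<K. v n)) (at t within A)"
    using u unfolding has_field_derivative_iff by (intro tendsto_sum) auto
  then have 1: "eventually (\<lambda>s. \<bar>(\<Sum>n<K. (u n s - u n t) / (s - t)) - (\<Sum>n<K. v n)\<bar> < e / 4) (at t within A)"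
    using e tendstoD[of _ "\<Sum>n<K. v n" "at t within A" "e / 4"] by (simp add: dist_real_def)
  have "((\<lambda>s. \<bar>(H K s - H K t) / (s - t)\<bar>) \<longlongrightarrow> \<bar>h K\<bar>) (at t within A)"
    using H(1)[of K] unfolding has_field_derivative_iff by (rule tendsto_rabs)
  then have 2: "eventually (\<lambda>s. \<bar>(H K s - H K t) / (s - t)\<bar> < e / 4) (at t within A)"
    using K(1) by (rule order_tendstoD(2))
  have 3: "eventually (\<lambda>s. s \<in> A \<and> s \<noteq> t) (at t within A)"
    by (simp add: eventually_at_filter)
  show "eventually (\<lambda>s. dist ((U s - U t) / (s - t)) (\<Sum>n. v n) < e) (at t within A)"
    using 1 2 3
  proof eventually_elim
    case (elim s)
    have d: "(\<lambda>n. u n s - u n t) sums (U s - U t)" using U elim t by (intro sums_diff) auto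
    have "U s - U t = (\<Sum>n. u (n + K) s - u (n + K) t) + (\<Sum>n<K. u n s - u n t)"
      using suminf_split_initial_segment[OF sums_summable[OF d], of K] sums_unique[OF d] by simp
    then have q: "(U s - U t) / (s - t) = (\<Sum>n. u (n + K) s - u (n + K) t) / (s - t) + (\<Sum>n<K. (u n s - u n t) / (s - t))"
      by (simp add: add_divide_distrib sum_divide_distrib)
    have "\<bar>(\<Sum>n. u (n + K) s - u (n + K) t) / (s - t)\<bar> \<le> \<bar>(H K s - H K t) / (s - t)\<bar>"
      using tail[of s K] elim by (simp add: divide_right_mono)
    moreover have "(\<Sum>n. v n) = (\<Sum>n. v (n + K)) + (\<Sum>n<K. v n)"
      using suminf_split_initial_segment[OF v, of K] by simp
    ultimately show ?case
      unfolding dist_real_def q using elim K by linarith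
  qed
qed

text \<open>Along one coordinate a tensor is a linear combination of jets whose coefficients depend
  on the other coordinates only; so it suffices to differentiate jets.\<close>

lemma tensor_deriv_split:
  assumes "k < d"
  shows "tensor_deriv d \<tau> L (x(k := t)) = (\<Sum>i<length L. (\<Prod>j\<in>{..<d} - {k}. (L ! i) j (\<tau> j) (x j)) * (L ! i) k (\<tau> k) t)"
proof -
  have "(\<Prod>j<d. f j) = (\<Prod>j\<in>{..<d} - {k}. f j) * f k" for f :: "nat \<Rightarrow> real"
    using assms by (subst prod.remove[of _ k]) auto
  then show ?thesis
    unfolding tensor_deriv_def sum_list_conv_sum by (auto intro!: sum.cong prod.cong)
qed

lemma tensor_deriv_upd:
  assumes "k < d"
  shows "tensor_deriv d (\<tau>(k := s)) L (x(k := t)) = (\<Sum>i<length L. (\<Prod>j\<in>{..<d} - {k}. (L ! i) j (\<tau> j) (x j)) * (L ! i) k s t)"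
  using assms by (subst tensor_deriv_split) (auto intro!: sum.cong prod.cong)

lemma restrict_upd_notin: "k \<notin> w \<Longrightarrow> restrict (x(k := t)) w = restrict x w"
  by (auto simp: restrict_def fun_eq_iff)

section \<open>Termwise differentiation of a series of tensors\<close>

text \<open>\<open>C(2)\<close> is the bound of \<open>tensor_deriv_bound\<close>, with one constant
  for all terms. \<open>finite_L2\<close> will come from rapidly decreasing norms: even the sum of
  the absolute values is square integrable.\<close>

locale tensor_series =
  fixes d \<alpha> :: nat and L :: "nat \<Rightarrow> tensor" and C :: real
  assumes jets: "\<And>n. jet_tensors \<alpha> d (L n)" and \<alpha>: "\<alpha> \<ge> 1"
    and C: "C \<ge> 0" "\<And>n \<tau> x w. (\<And>j. j < d \<Longrightarrow> \<tau> j \<le> \<alpha>) \<Longrightarrow> w = {j. j < d \<and> \<tau> j = \<alpha>}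
      \<Longrightarrow> (\<And>j. j < d \<Longrightarrow> x j \<in> {0..1}) \<Longrightarrow> (\<And>j. j \<in> w \<Longrightarrow> x j \<noteq> 1) \<Longrightarrow>
      ennreal \<bar>tensor_deriv d \<tau> (L n) x\<bar> \<le> ennreal C * marginal d w (\<lambda>z. ennreal \<bar>tensor_hat \<alpha> d (L n) z\<bar>) x"
    and finite_L2: "(\<integral>\<^sup>+z. (\<Sum>n. ennreal \<bar>tensor_hat \<alpha> d (L n) z\<bar>)\<^sup>2 \<partial>lborel_on {..<d}) < \<infinity>"
begin

definition "a n z = ennreal \<bar>tensor_hat \<alpha> d (L n) z\<bar>"

text \<open>Up to the factor \<open>C\<close> this majorises the tail from \<open>K\<close> on of a
  differentiated series, with \<open>w\<close> the coordinates of order \<alpha>;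
  \<open>K = 0\<close> dominates the whole series.\<close>

definition "S K w x = (\<Sum>n. marginal d w (a (n + K)) x)"

lemma cylindrical_a: "cylindrical d (a n)"
  unfolding a_def[abs_def] by (rule cylindrical_tensor_hat[OF jets])

lemma S_eq_marginal: "w \<subseteq> {..<d} \<Longrightarrow> S K w x = marginal d w (\<lambda>z. \<Sum>n. a (n + K) z) x"
  unfolding S_def by (rule marginal_suminf[symmetric]) (auto intro: cylindrical_a)

lemma S_cong: "(\<And>j. j \<in> w \<Longrightarrow> x j = y j) \<Longrightarrow> S K w x = S K w y"
  unfolding S_def by (intro arg_cong[where f = suminf] ext marginal_cong)

lemma S_measurable: "w \<subseteq> {..<d} \<Longrightarrow> w \<subseteq> w' \<Longrightarrow> S K w \<in> borel_measurable (lborel_on w')"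
  unfolding S_def[abs_def] by (intro borel_measurable_suminf_order marginal_measurable cylindrical_a)

lemma S_fubini:
  assumes "w \<subseteq> {..<d}" "k < d" "k \<notin> w"
  shows "(\<integral>\<^sup>+t. S K (insert k w) (x(k := t)) \<partial>lborel) = S K w x"
  using assms marginal_fubini[OF cylindrical_suminf[of d "\<lambda>n. a (n + K)"], of w k x] cylindrical_a
  by (simp add: S_eq_marginal)

lemma S_le: "S K w x \<le> S 0 w x"
proof -
  have "(\<Sum>n. marginal d w (a n) x) = (\<Sum>n. marginal d w (a (n + K)) x) + (\<Sum>n<K. marginal d w (a n) x)"
    by (rule suminf_offset) auto
  then show ?thesis unfolding S_def by (simp add: le_iff_add)
qed

text \<open>The side \<alpha> + 1 put into \<open>marginal_square\<close> is the length of the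
  interval that carries \<open>jet_hat\<close>.\<close>

lemma S_square_integral:
  assumes "w \<subseteq> {..<d}"
  shows "(\<integral>\<^sup>+x. (S 0 w x)\<^sup>2 \<partial>lborel_on w) < \<infinity>"
proof -
  have "(\<integral>\<^sup>+x. (S 0 w x)\<^sup>2 \<partial>lborel_on w)
     \<le> ennreal ((real \<alpha> + 1) ^ d) * (\<integral>\<^sup>+z. (\<Sum>n. a n z)\<^sup>2 \<partial>lborel_on {..<d})"
    unfolding S_eq_marginal[OF assms] add_0_right
  proof (rule marginal_square[OF cylindrical_suminf[OF cylindrical_a] assms])
    fix z :: point and j assume "j < d" "z j \<notin> {0..real \<alpha> + 1}"
    then have "a n z = 0" for n using tensor_hat_support[of j d z \<alpha>] by (simp add: a_def)
    then show "(\<Sum>n. a n z) = 0" by simp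
  qed simp
  also have "\<dots> < \<infinity>"
    using finite_L2 unfolding a_def by (simp add: ennreal_mult_less_top)
  finally show ?thesis .
qed

lemma S_AE_finite:
  assumes "w \<subseteq> {..<d}"
  shows "{x \<in> space (lborel_on w). S 0 w x = \<infinity>} \<in> null_sets (lborel_on w)"
proof -
  have [measurable]: "S 0 w \<in> borel_measurable (lborel_on w)" using S_measurable[OF assms] by simp
  have "AE x in lborel_on w. (S 0 w x)\<^sup>2 \<noteq> \<infinity>"
    using S_square_integral[OF assms] by (intro nn_integral_noteq_infinite) auto
  then have "AE x in lborel_on w. S 0 w x \<noteq> \<infinity>"
    by eventually_elim (auto simp: power2_eq_square ennreal_top_mult)
  then show ?thesis by (subst (asm) AE_iff_null) auto
qed

definition top_vars :: "(nat \<Rightarrow> nat) \<Rightarrow> nat set" where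
  "top_vars \<tau> = {j. j < d \<and> \<tau> j = \<alpha>}"

text \<open>Finiteness of \<open>S 0 w\<close> at the single point \<open>x\<close> is enough,
  because the bound in \<open>C(2)\<close> is pointwise.\<close>

lemma tensor_deriv_summable:
  assumes \<tau>: "\<And>j. j < d \<Longrightarrow> \<tau> j \<le> \<alpha>" "w = top_vars \<tau>"
    and x: "\<And>j. j < d \<Longrightarrow> x j \<in> {0..1}" "\<And>j. j \<in> w \<Longrightarrow> x j \<noteq> 1" and S: "S 0 w x < \<infinity>"
  shows "\<bar>tensor_deriv d \<tau> (L n) x\<bar> \<le> C * enn2real (marginal d w (a n) x)"
    "summable (\<lambda>n. C * enn2real (marginal d w (a n) x))"
    "summable (\<lambda>n. tensor_deriv d \<tau> (L n) x)"
    "(\<Sum>n. \<bar>tensor_deriv d \<tau> (L (n + K)) x\<bar>) \<le> C * enn2real (S K w x)"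
    "\<bar>tensor_deriv d \<tau> (L n) x\<bar> \<le> C * enn2real (S 0 w x)"
proof -
  have fin: "marginal d w (a n) x < \<infinity>" for n
  proof -
    have "marginal d w (a n) x \<le> S 0 w x"
      using sum_le_suminf[of "\<lambda>n. marginal d w (a n) x" "{n}"] by (simp add: S_def)
    then show ?thesis using S by (rule le_less_trans)
  qed
  have SK: "S K w x < \<infinity>" for K using S_le S by (rule le_less_trans)
  have mr: "marginal d w (a n) x = ennreal (enn2real (marginal d w (a n) x))" for n
    using fin[of n] by (simp add: ennreal_enn2real_if)
  have su: "summable (\<lambda>n. enn2real (marginal d w (a (n + K)) x))" for K
    using SK[of K] unfolding S_def by (subst (asm) mr) (auto intro!: summable_suminf_not_top)
  have SK': "enn2real (S K w x) = (\<Sum>n. enn2real (marginal d w (a (n + K)) x))" for K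
    unfolding S_def by (subst mr, subst suminf_ennreal2[OF _ su]) (simp_all add: suminf_nonneg[OF su])
  show bd: "\<bar>tensor_deriv d \<tau> (L n) x\<bar> \<le> C * enn2real (marginal d w (a n) x)" for n
  proof -
    have "ennreal \<bar>tensor_deriv d \<tau> (L n) x\<bar> \<le> ennreal C * marginal d w (a n) x"
      using C(2)[OF \<tau>(1) \<tau>(2)[unfolded top_vars_def] x] unfolding a_def[abs_def] .
    also have "\<dots> = ennreal (C * enn2real (marginal d w (a n) x))"
      using C(1) by (subst mr) (simp add: ennreal_mult)
    finally show ?thesis using C(1) by (subst (asm) ennreal_le_iff) auto
  qed
  show s: "summable (\<lambda>n. C * enn2real (marginal d w (a n) x))"
    using su[of 0] by (simp add: summable_mult)
  show "summable (\<lambda>n. tensor_deriv d \<tau> (L n) x)"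
    by (rule summable_comparison_test'[OF s, of 0]) (use bd in auto)
  have s': "summable (\<lambda>n. \<bar>tensor_deriv d \<tau> (L (n + K)) x\<bar>)" for K
    by (rule summable_comparison_test'[OF summable_mult[OF su[of K], of C], of 0]) (use bd in auto)
  show tl: "(\<Sum>n. \<bar>tensor_deriv d \<tau> (L (n + K)) x\<bar>) \<le> C * enn2real (S K w x)" for K
    unfolding SK' using su[of K] s'[of K] bd
    by (subst suminf_mult[symmetric]) (auto intro!: suminf_le summable_mult)
  have "\<bar>tensor_deriv d \<tau> (L n) x\<bar> \<le> (\<Sum>n. \<bar>tensor_deriv d \<tau> (L n) x\<bar>)"
    using sum_le_suminf[OF s'[of 0], of "{n}"] by simp
  with tl[of 0] show "\<bar>tensor_deriv d \<tau> (L n) x\<bar> \<le> C * enn2real (S 0 w x)" by simp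
qed

text \<open>The exceptional set is a cylinder over the coordinates of order \<alpha>. Moving a good
  point along any other coordinate keeps it good, so the next derivative can be taken there.
  Finiteness of \<open>S\<close> and \<open>x j \<noteq> 1\<close> are carried along because the
  bounds require them.\<close>

definition represents :: "(nat \<Rightarrow> nat) \<Rightarrow> (point \<Rightarrow> real) \<Rightarrow> bool" where
  "represents \<tau> f \<longleftrightarrow> (\<exists>N\<in>null_sets (lborel_on (top_vars \<tau>)). \<forall>x\<in>unit_cube d. restrict x (top_vars \<tau>) \<notin> N \<longrightarrow>
     S 0 (top_vars \<tau>) x < \<infinity> \<and> (\<forall>j\<in>top_vars \<tau>. x j \<noteq> 1) \<and> f x = (\<Sum>n. tensor_deriv d \<tau> (L n) x))"

lemma unit_cubeD: "x \<in> unit_cube d \<Longrightarrow> j < d \<Longrightarrow> x j \<in> {0..1}"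
  unfolding unit_cube_def by (erule PiE_mem) simp

lemma unit_cube_upd: "x \<in> unit_cube d \<Longrightarrow> k < d \<Longrightarrow> t \<in> {0..1} \<Longrightarrow> x(k := t) \<in> unit_cube d"
  using PiE_fun_upd[of t "\<lambda>_. {0..1}" k x "{..<d}"] by (simp add: unit_cube_def insert_absorb)

text \<open>The order in \<open>k\<close> stays below \<alpha>, so the majorant does not depend on
  that coordinate, and the differentiated series converges uniformly along it by the Weierstrass
  test. No new exceptional points arise.\<close>

lemma represents_partial_deriv:
  assumes rep: "represents \<tau> f" and \<tau>: "\<And>j. j < d \<Longrightarrow> \<tau> j \<le> \<alpha>" and k: "k < d" "Suc (\<tau> k) < \<alpha>"
  shows "represents (\<tau>(k := Suc (\<tau> k))) (partial_deriv k f)"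
proof -
  let ?\<tau> = "\<tau>(k := Suc (\<tau> k))" and ?w = "top_vars \<tau>"
  have w: "top_vars ?\<tau> = ?w" using k by (auto simp: top_vars_def)
  have kw: "k \<notin> ?w" using k by (auto simp: top_vars_def)
  have \<tau>': "?\<tau> j \<le> \<alpha>" if "j < d" for j using \<tau>[OF that] k by auto
  obtain N where N: "N \<in> null_sets (lborel_on ?w)" and N2:
    "\<And>x. x \<in> unit_cube d \<Longrightarrow> restrict x ?w \<notin> N \<Longrightarrow>
     S 0 ?w x < \<infinity> \<and> (\<forall>j\<in>?w. x j \<noteq> 1) \<and> f x = (\<Sum>n. tensor_deriv d \<tau> (L n) x)"
    using rep unfolding represents_def by blast
  show ?thesis
    unfolding represents_def w
  proof (intro bexI[OF _ N] ballI impI)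
    fix x assume x: "x \<in> unit_cube d" and xN: "restrict x ?w \<notin> N"
    have good: "x(k := t) \<in> unit_cube d" "restrict (x(k := t)) ?w \<notin> N" if "t \<in> {0..1}" for t
      using unit_cube_upd[OF x k(1) that] xN restrict_upd_notin[OF kw, of x t] by simp_all
    note Nx = N2[OF x xN]
    have S: "S 0 ?w x < \<infinity>" and x1: "\<forall>j\<in>?w. x j \<noteq> 1" using Nx by auto
    have St: "S 0 ?w (x(k := t)) = S 0 ?w x" for t
      by (rule S_cong) (use kw in auto)
    have mt: "marginal d ?w (a n) (x(k := t)) = marginal d ?w (a n) x" for t n
      by (rule marginal_cong) (use kw in auto)
    let ?u = "\<lambda>n t. tensor_deriv d \<tau> (L n) (x(k := t))" and ?v = "\<lambda>n t. tensor_deriv d ?\<tau> (L n) (x(k := t))"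
    have du: "(?u n has_real_derivative ?v n t) (at t within {0..1})" if t: "t \<in> {0..1}" for n t
      unfolding tensor_deriv_upd[OF k(1)] tensor_deriv_split[OF k(1), of \<tau>]
    proof (rule DERIV_sum)
      fix i assume "i \<in> {..<length (L n)}"
      then have "((L n ! i) k (\<tau> k) has_real_derivative (L n ! i) k (Suc (\<tau> k)) t) (at t within {0..1})"
        using jet_tensorsD[OF jets _ k(1)] k(2) t by (intro sobolev_jetD(6)) auto
      then show "((\<lambda>t. (\<Prod>j\<in>{..<d} - {k}. (L n ! i) j (\<tau> j) (x j)) * (L n ! i) k (\<tau> k) t) has_real_derivative
         (\<Prod>j\<in>{..<d} - {k}. (L n ! i) j (\<tau> j) (x j)) * (L n ! i) k (Suc (\<tau> k)) t) (at t within {0..1})"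
        by (rule DERIV_cmult)
    qed
    have xt: "(x(k := t)) j \<in> {0..1}" if "j < d" "t \<in> {0..1}" for j t
      using that unit_cubeD[OF x, of j] by (cases "j = k") simp_all
    have x1t: "(x(k := t)) j \<noteq> 1" if "j \<in> ?w" for j t using x1 that kw by auto
    have bv: "norm (?v n t) \<le> C * enn2real (marginal d ?w (a n) x)" if t: "t \<in> {0..1}" for n t
      using tensor_deriv_summable(1)[OF \<tau>' w[symmetric] xt[OF _ t] x1t S[folded St[of t]]] mt by simp
    have sM: "summable (\<lambda>n. C * enn2real (marginal d ?w (a n) x))"
      by (rule tensor_deriv_summable(2)[OF \<tau> refl unit_cubeD[OF x] x1[rule_format] S])
    have ul: "uniform_limit {0..1} (\<lambda>n t. \<Sum>i<n. ?v i t) (\<lambda>t. \<Sum>n. ?v n t) sequentially"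
      by (rule Weierstrass_m_test[OF bv sM])
    have x0: "summable (\<lambda>n. ?u n 0)"
      by (rule tensor_deriv_summable(3)[OF \<tau> refl xt x1t S[folded St[of 0]]]) simp_all
    have "\<exists>g. \<forall>t\<in>{0..1}. (\<lambda>n. ?u n t) sums g t \<and> (g has_real_derivative (\<Sum>n. ?v n t)) (at t within {0..1})"
      by (rule has_field_derivative_series[OF _ du ul _ x0]) (auto simp: convex_real_interval)
    then obtain g where g: "\<And>t. t \<in> {0..1} \<Longrightarrow> (\<lambda>n. ?u n t) sums g t"
      "\<And>t. t \<in> {0..1} \<Longrightarrow> (g has_real_derivative (\<Sum>n. ?v n t)) (at t within {0..1})" by blast
    have fg: "g t = f (x(k := t))" if t: "t \<in> {0..1}" for t
      using N2[OF good[OF t]] sums_unique[OF g(1)[OF t]] by simp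
    have xk: "x k \<in> {0..1}" using unit_cubeD[OF x k(1)] .
    have "((\<lambda>t. f (x(k := t))) has_real_derivative (\<Sum>n. ?v n (x k))) (at (x k) within {0..1})"
      using g(2)[OF xk] by (rule has_field_derivative_transform_within[where d = 1]) (use xk fg in auto)
    from deriv01_eq[OF xk this] have "partial_deriv k f x = (\<Sum>n. tensor_deriv d ?\<tau> (L n) x)"
      unfolding partial_deriv_def by simp
    with S x1 show "S 0 ?w x < \<infinity> \<and> (\<forall>j\<in>?w. x j \<noteq> 1) \<and> partial_deriv k f x = (\<Sum>n. tensor_deriv d ?\<tau> (L n) x)"
      by blast
  qed
qed


text \<open>Now \<open>k\<close> becomes a top variable and the majorant varies with it. By Tonelli
  the majorant is integrable along the line, and its primitive dominates the increments of the
  tails, so \<open>termwise_derivative_majorant\<close> applies wherever all these primitives have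
  the expected derivatives.\<close>

lemma represents_partial_deriv_top:
  assumes rep: "represents \<tau> f" and \<tau>: "\<And>j. j < d \<Longrightarrow> \<tau> j \<le> \<alpha>" and k: "k < d" "Suc (\<tau> k) = \<alpha>"
  shows "represents (\<tau>(k := \<alpha>)) (partial_deriv k f)"
proof -
  let ?\<tau> = "\<tau>(k := \<alpha>)" and ?w = "top_vars \<tau>"
  let ?w' = "insert k ?w"
  have w': "top_vars ?\<tau> = ?w'" using k by (auto simp: top_vars_def)
  have kw: "k \<notin> ?w" using k by (auto simp: top_vars_def)
  have wd: "?w \<subseteq> {..<d}" "?w' \<subseteq> {..<d}" using k by (auto simp: top_vars_def)
  have fw: "finite ?w" using wd finite_subset by blast
  have \<tau>': "?\<tau> j \<le> \<alpha>" if "j < d" for j using \<tau>[OF that] by auto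
  obtain N where N: "N \<in> null_sets (lborel_on ?w)" and N2:
    "\<And>x. x \<in> unit_cube d \<Longrightarrow> restrict x ?w \<notin> N \<Longrightarrow>
     S 0 ?w x < \<infinity> \<and> (\<forall>j\<in>?w. x j \<noteq> 1) \<and> f x = (\<Sum>n. tensor_deriv d \<tau> (L n) x)"
    using rep unfolding represents_def by blast
  let ?P = "lborel_on ?w" and ?P' = "lborel_on ?w'"
  have sP: "sigma_finite_measure ?P" by (rule lborel_PiM.sigma_finite[OF fw])
  \<comment> \<open>The majorant of the tail from \<open>K\<close> on, as a function of the old top
    variables and of the new one; a null set where it is infinite is mapped to 0.\<close>
  define F where "F K z = enn2real (S K ?w' ((fst z)(k := snd z)))" for K and z :: "point \<times> real"
  have Fm: "F K \<in> borel_measurable (?P \<Otimes>\<^sub>M lborel)" for K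
  proof -
    have "(\<lambda>z. (fst z)(k := snd z)) \<in> ?P \<Otimes>\<^sub>M lborel \<rightarrow>\<^sub>M ?P'"
      using measurable_add_dim[of k ?w "\<lambda>_. lborel"] by (simp add: case_prod_beta)
    from measurable_compose[OF this S_measurable[OF wd(2) order_refl, of K]]
    show ?thesis unfolding F_def[abs_def] by measurable
  qed
  have "\<exists>B. B \<in> null_sets (?P \<Otimes>\<^sub>M lborel) \<and> (\<forall>y t. y \<in> space ?P \<longrightarrow> integrable lborel (\<lambda>r. F K (y, r)) \<longrightarrow> (y, t) \<notin> B \<longrightarrow>
      ((\<lambda>s. LBINT r:{..s}. F K (y, r)) has_real_derivative F K (y, t)) (at t))" for K
    by (rule parametric_lebesgue_differentiation[OF sP Fm[of K]]) blast
  then obtain B where B: "\<And>K. B K \<in> null_sets (?P \<Otimes>\<^sub>M lborel)"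
    and B2: "\<And>K y t. y \<in> space ?P \<Longrightarrow> integrable lborel (\<lambda>r. F K (y, r)) \<Longrightarrow> (y, t) \<notin> B K \<Longrightarrow>
      ((\<lambda>s. LBINT r:{..s}. F K (y, r)) has_real_derivative F K (y, t)) (at t)"
    by metis
  have "AE t in lborel. \<forall>n. \<forall>i<length (L n). t \<in> {0..1} \<longrightarrow>
      ((L n ! i) k (\<tau> k) has_real_derivative (L n ! i) k \<alpha> t) (at t within {0..1})"
    unfolding AE_all_countable
  proof (intro allI)
    fix n i
    show "AE t in lborel. i < length (L n) \<longrightarrow> t \<in> {0..1} \<longrightarrow>
      ((L n ! i) k (\<tau> k) has_real_derivative (L n ! i) k \<alpha> t) (at t within {0..1})"
    proof (cases "i < length (L n)")
      case True
      from sobolev_jetD(7)[OF jet_tensorsD[OF jets True k(1)], of "\<tau> k"] k show ?thesis by simp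
    qed simp
  qed
  then obtain N1 where N1: "N1 \<in> null_sets lborel" and N12:
    "{t \<in> space lborel. \<not> (\<forall>n. \<forall>i<length (L n). t \<in> {0..1} \<longrightarrow>
      ((L n ! i) k (\<tau> k) has_real_derivative (L n ! i) k \<alpha> t) (at t within {0..1}))} \<subseteq> N1"
    by (auto elim: AE_E simp: null_sets_def)
  \<comment> \<open>Collects the failures: of Lebesgue differentiation for some \<open>K\<close>, of
    the given representation, of the differentiability of some jet, and the end point 1, which the
    bounds exclude.\<close>
  define B' where "B' = (\<Union>K. B K) \<union> N \<times> UNIV \<union> space ?P \<times> (N1 \<union> {1})"
  interpret P: sigma_finite_measure ?P by fact
  have B': "B' \<in> null_sets (?P \<Otimes>\<^sub>M lborel)"
  proof -
    have "N \<times> UNIV \<in> null_sets (?P \<Otimes>\<^sub>M lborel)"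
      using N by (auto simp: null_sets_def lborel.emeasure_pair_measure_Times)
    moreover have "N1 \<union> {1} \<in> null_sets lborel" using N1 by (intro null_sets.Un) auto
    then have "space ?P \<times> (N1 \<union> {1}) \<in> null_sets (?P \<Otimes>\<^sub>M lborel)"
      by (auto simp: null_sets_def lborel.emeasure_pair_measure_Times simp del: insert_is_Un Un_insert_right)
    ultimately show ?thesis unfolding B'_def using B by (intro null_sets.Un null_sets_UN) auto
  qed
  \<comment> \<open>The same set over the enlarged coordinates, together with the points where the
    majorant series diverges.\<close>
  define N' where "N' = {y \<in> space ?P'. (restrict y ?w, y k) \<in> B'} \<union> {y \<in> space ?P'. S 0 ?w' y = \<infinity>}"
  have N'null: "N' \<in> null_sets ?P'"
    unfolding N'_def
  proof (rule null_sets.Un)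
    show "{y \<in> space ?P'. S 0 ?w' y = \<infinity>} \<in> null_sets ?P'" by (rule S_AE_finite[OF wd(2)])
    have B'm [measurable]: "B' \<in> sets (?P \<Otimes>\<^sub>M lborel)" using B' by auto
    have m: "(\<lambda>y. (restrict y ?w, y k)) \<in> ?P' \<rightarrow>\<^sub>M ?P \<Otimes>\<^sub>M lborel"
      by (intro measurable_Pair measurable_restrict_subset measurable_component_singleton) auto
    let ?Q = "{y \<in> space ?P'. (restrict y ?w, y k) \<in> B'}"
    have Q: "?Q \<in> sets ?P'"
      using measurable_sets[OF m B'm] by (simp add: vimage_def Int_def conj_commute)
    have "emeasure ?P' ?Q = (\<integral>\<^sup>+y. indicator ?Q y \<partial>?P')" using Q by simp
    also have "\<dots> = (\<integral>\<^sup>+y. \<integral>\<^sup>+t. indicator ?Q (y(k := t)) \<partial>lborel \<partial>?P)"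
      by (rule lborel_PiM.product_nn_integral_insert) (use fw kw Q in auto)
    also have "\<dots> = (\<integral>\<^sup>+y. \<integral>\<^sup>+t. indicator B' (y, t) \<partial>lborel \<partial>?P)"
    proof (intro nn_integral_cong)
      fix y t assume y: "y \<in> space ?P"
      have "restrict (y(k := t)) ?w = y" using y kw by (auto simp: space_PiM fun_eq_iff PiE_iff extensional_def)
      moreover have "y(k := t) \<in> space ?P'" using y by (auto simp: space_PiM PiE_iff extensional_def)
      ultimately show "indicator ?Q (y(k := t)) = (indicator B' (y, t) :: ennreal)" by (simp add: indicator_def)
    qed
    also have "\<dots> = (\<integral>\<^sup>+z. indicator B' z \<partial>(?P \<Otimes>\<^sub>M lborel))"
      by (rule lborel.nn_integral_fst) auto
    also have "\<dots> = emeasure (?P \<Otimes>\<^sub>M lborel) B'" using B' by (intro nn_integral_indicator) auto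
    also have "\<dots> = 0" by (rule null_setsD1[OF B'])
    finally show "?Q \<in> null_sets ?P'" using Q by (simp add: null_sets_def)
  qed
  show ?thesis
    unfolding represents_def w'
  proof (intro bexI[OF _ N'null] ballI impI)
    fix x assume x: "x \<in> unit_cube d" and xN': "restrict x ?w' \<notin> N'"
    have sp: "restrict x ?w' \<in> space ?P'" "restrict x ?w \<in> space ?P" by (auto simp: space_PiM)
    have rr: "restrict (restrict x ?w') ?w = restrict x ?w" by (auto simp: fun_eq_iff restrict_def)
    let ?y = "restrict x ?w"
    have xB: "(?y, x k) \<notin> B'" using xN' sp rr unfolding N'_def by auto
    have S': "S 0 ?w' x < \<infinity>"
    proof -
      have "S 0 ?w' (restrict x ?w') = S 0 ?w' x" by (rule S_cong) auto
      then show ?thesis using xN' sp unfolding N'_def by (auto simp: less_top)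
    qed
    have xN: "?y \<notin> N" and xN1: "x k \<notin> N1" "x k \<noteq> 1" and xBK: "(?y, x k) \<notin> B K" for K
      using xB sp unfolding B'_def by auto
    note Nx = N2[OF x xN]
    have S: "S 0 ?w x < \<infinity>" and x1: "\<forall>j\<in>?w. x j \<noteq> 1" using Nx by auto
    have x1': "\<forall>j\<in>?w'. x j \<noteq> 1" using x1 xN1 by auto
    have good: "x(k := t) \<in> unit_cube d" "restrict (x(k := t)) ?w \<notin> N" if "t \<in> {0..1}" for t
      using unit_cube_upd[OF x k(1) that] xN restrict_upd_notin[OF kw, of x t] by simp_all
    have St: "S 0 ?w (x(k := t)) = S 0 ?w x" for t
      by (rule S_cong) (use kw in auto)
    have xt: "(x(k := t)) j \<in> {0..1}" if "j < d" "t \<in> {0..1}" for j t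
      using that unit_cubeD[OF x, of j] by (cases "j = k") simp_all
    have x1t: "(x(k := t)) j \<noteq> 1" if "j \<in> ?w" for j t using x1 that kw by auto
    have xk: "x k \<in> {0..1}" using unit_cubeD[OF x k(1)] .
    let ?u = "\<lambda>n t. tensor_deriv d \<tau> (L n) (x(k := t))" and ?v = "\<lambda>n t. tensor_deriv d ?\<tau> (L n) (x(k := t))"
    have SF: "(\<integral>\<^sup>+r. S K ?w' (x(k := r)) \<partial>lborel) = S K ?w x" for K
      by (rule S_fubini[OF wd(1) k(1) kw])
    have SK: "S K ?w x < \<infinity>" for K using S_le S by (rule le_less_trans)
    have Fx: "F K (?y, r) = enn2real (S K ?w' (x(k := r)))" for K r
      unfolding F_def by (intro arg_cong[where f = enn2real] S_cong) auto
    have Sm: "(\<lambda>r. S K ?w' (x(k := r))) \<in> borel_measurable lborel" for K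
    proof -
      have "(\<lambda>r. (?y)(k := r)) \<in> lborel \<rightarrow>\<^sub>M ?P'"
        using measurable_Pair2[OF _ sp(2), of "\<lambda>z. (fst z)(k := snd z)" lborel ?P'] measurable_add_dim[of k ?w "\<lambda>_. lborel"]
        by (simp add: case_prod_beta)
      from measurable_compose[OF this S_measurable[OF wd(2) order_refl, of K]]
      have "(\<lambda>r. S K ?w' (?y(k := r))) \<in> borel_measurable lborel" .
      moreover have "S K ?w' (?y(k := r)) = S K ?w' (x(k := r))" for r by (rule S_cong) auto
      ultimately show ?thesis by simp
    qed
    have Sfin: "AE r in lborel. S K ?w' (x(k := r)) < \<infinity>" for K
      using nn_integral_noteq_infinite[OF Sm, of K] SF[of K] SK[of K] by (auto simp: less_top)
    have Fint: "integrable lborel (\<lambda>r. F K (?y, r))" for K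
    proof (rule integrableI_nonneg)
      show "(\<lambda>r. F K (?y, r)) \<in> borel_measurable lborel" unfolding Fx using Sm by measurable
      have "(\<integral>\<^sup>+r. ennreal (F K (?y, r)) \<partial>lborel) \<le> (\<integral>\<^sup>+r. S K ?w' (x(k := r)) \<partial>lborel)"
        unfolding Fx by (intro nn_integral_mono) (auto simp: ennreal_enn2real_if)
      then show "(\<integral>\<^sup>+r. ennreal (F K (?y, r)) \<partial>lborel) < \<infinity>" using SF[of K] SK[of K] by simp
    qed (simp add: F_def)
    define H where "H K s = C * (LBINT r:{..s}. F K (?y, r))" for K s
    have dH: "(H K has_real_derivative C * F K (?y, x k)) (at (x k) within {0..1})" for K
      unfolding H_def[abs_def]
      by (rule DERIV_cmult[OF has_field_derivative_at_within[OF B2[OF sp(2) Fint xBK]]])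
    \<comment> \<open>At \<open>x\<close> the majorant series converges, so its tails tend to
      0.\<close>
    have hlim: "(\<lambda>K. C * F K (?y, x k)) \<longlonglongrightarrow> 0"
    proof -
      have Sx: "F K (?y, x k) = enn2real (S K ?w' x)" for K by (simp add: Fx)
      have fin: "marginal d ?w' (a n) x < \<infinity>" for n
      proof -
        have "marginal d ?w' (a n) x \<le> S 0 ?w' x"
          using sum_le_suminf[of "\<lambda>n. marginal d ?w' (a n) x" "{n}"] by (simp add: S_def)
        then show ?thesis using S' by (rule le_less_trans)
      qed
      have mr: "marginal d ?w' (a n) x = ennreal (enn2real (marginal d ?w' (a n) x))" for n
        using fin[of n] by (simp add: ennreal_enn2real_if)
      have SK': "S K ?w' x < \<infinity>" for K using S_le S' by (rule le_less_trans)
      have su: "summable (\<lambda>n. enn2real (marginal d ?w' (a (n + K)) x))" for K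
        using SK'[of K] unfolding S_def by (subst (asm) mr) (auto intro!: summable_suminf_not_top)
      have "enn2real (S K ?w' x) = (\<Sum>n. enn2real (marginal d ?w' (a (n + K)) x))" for K
        unfolding S_def by (subst mr, subst suminf_ennreal2[OF _ su]) (simp_all add: suminf_nonneg[OF su])
      moreover have "(\<lambda>K. \<Sum>n. enn2real (marginal d ?w' (a (n + K)) x)) \<longlonglongrightarrow> 0"
        using suminf_exist_split2[of "\<lambda>n. enn2real (marginal d ?w' (a n) x)"] su[of 0] by simp
      ultimately have "(\<lambda>K. enn2real (S K ?w' x)) \<longlonglongrightarrow> 0" by simp
      then show ?thesis unfolding Sx by (rule tendsto_mult_right_zero)
    qed
    have sU: "(\<lambda>n. ?u n s) sums f (x(k := s))" if s: "s \<in> {0..1}" for s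
    proof -
      have "summable (\<lambda>n. ?u n s)"
        by (rule tensor_deriv_summable(3)[OF \<tau> refl xt[OF _ s] x1t S[folded St[of s]]])
      then show ?thesis using N2[OF good[OF s]] by (simp add: summable_sums)
    qed
    have du: "(?u n has_real_derivative ?v n (x k)) (at (x k) within {0..1})" for n
      unfolding tensor_deriv_upd[OF k(1)] tensor_deriv_split[OF k(1), of \<tau>]
    proof (rule DERIV_sum)
      fix i assume "i \<in> {..<length (L n)}"
      then have "((L n ! i) k (\<tau> k) has_real_derivative (L n ! i) k \<alpha> (x k)) (at (x k) within {0..1})"
        using N12 xN1 xk by auto
      then show "((\<lambda>t. (\<Prod>j\<in>{..<d} - {k}. (L n ! i) j (\<tau> j) (x j)) * (L n ! i) k (\<tau> k) t) has_real_derivative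
         (\<Prod>j\<in>{..<d} - {k}. (L n ! i) j (\<tau> j) (x j)) * (L n ! i) k \<alpha> (x k)) (at (x k) within {0..1})"
        by (rule DERIV_cmult)
    qed
    have sv: "summable (\<lambda>n. ?v n (x k))"
    proof -
      have "summable (\<lambda>n. tensor_deriv d ?\<tau> (L n) x)"
        by (rule tensor_deriv_summable(3)[OF \<tau>' w'[symmetric] unit_cubeD[OF x] x1'[rule_format] S'])
      then show ?thesis by simp
    qed
    text \<open>The increments of each term are integrals of its top derivative, which the marginals dominate.\<close>
    have inc: "?u n b - ?u n a = (LBINT r:{a<..b}. ?v n r)" and
      ivn: "integrable lborel (?v n)"
      if "a \<in> {0..1}" "b \<in> {0..1}" "a \<le> b" for n a b
    proof -
      let ?c = "\<lambda>i. \<Prod>j\<in>{..<d} - {k}. (L n ! i) j (\<tau> j) (x j)"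
      have iJ: "integrable lborel ((L n ! i) k \<alpha>)" if "i \<in> {..<length (L n)}" for i
        using that by (intro sobolev_jet_integrable[OF jet_tensorsD[OF jets _ k(1)]]) auto
      have veq: "?v n = (\<lambda>r. \<Sum>i<length (L n). ?c i * (L n ! i) k \<alpha> r)"
        by (rule ext) (rule tensor_deriv_upd[OF k(1)])
      show iv: "integrable lborel (?v n)" unfolding veq using iJ by (intro Bochner_Integration.integrable_sum integrable_mult_right)
      have lin: "(LBINT r:{..s}. ?v n r) = (\<Sum>i<length (L n). ?c i * (LBINT r:{..s}. (L n ! i) k \<alpha> r))" for s
      proof -
        have "(LBINT r:{..s}. ?v n r) = (LBINT r. (\<Sum>i<length (L n). ?c i * (indicator {..s} r *\<^sub>R (L n ! i) k \<alpha> r)))"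
          unfolding set_lebesgue_integral_def veq
          by (intro lintegral_cong refl) (simp add: sum_distrib_left mult_ac)
        also have "\<dots> = (\<Sum>i<length (L n). \<integral>r. ?c i * (indicator {..s} r *\<^sub>R (L n ! i) k \<alpha> r) \<partial>lborel)"
          using iJ by (intro Bochner_Integration.integral_sum integrable_mult_right integrable_mult_indicator) auto
        finally show ?thesis by (simp add: set_lebesgue_integral_def)
      qed
      have FTC: "(L n ! i) k (\<tau> k) s - (L n ! i) k (\<tau> k) 0 = (LBINT r:{..s}. (L n ! i) k \<alpha> r)"
        if "i < length (L n)" "s \<in> {0..1}" for i s
        using sobolev_jetD(5)[OF jet_tensorsD[OF jets that(1) k(1)] _ that(2), of "\<tau> k"] k(2) by simp
      have us: "?u n s - ?u n 0 = (LBINT r:{..s}. ?v n r)" if "s \<in> {0..1}" for s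
        unfolding lin tensor_deriv_split[OF k(1), of \<tau>] sum_subtractf[symmetric] right_diff_distrib[symmetric]
        using FTC that by (intro sum.cong) auto
      show "?u n b - ?u n a = (LBINT r:{a<..b}. ?v n r)"
        unfolding LINT_greaterThanAtMost_diff[OF iv \<open>a \<le> b\<close>] us[OF that(1), symmetric] us[OF that(2), symmetric] by simp
    qed
    \<comment> \<open>Summation under the integral leaves the increment of \<open>H K\<close>.
      Ordering the end points as \<open>p\<close> and \<open>q\<close> treats both sides of
      \<open>x k\<close> at once.\<close>
    have tail: "\<bar>\<Sum>n. ?u (n + K) s - ?u (n + K) (x k)\<bar> \<le> \<bar>H K s - H K (x k)\<bar>" if s: "s \<in> {0..1}" for K s
    proof -
      define p q where "p = min s (x k)" and "q = max s (x k)"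
      have pq: "p \<in> {0..1}" "q \<in> {0..1}" "p \<le> q" using s xk unfolding p_def q_def by (auto simp: min_def max_def)
      let ?\<Delta> = "\<lambda>n. ?u (n + K) s - ?u (n + K) (x k)"
      have \<Delta>: "ennreal \<bar>?\<Delta> n\<bar> \<le> (\<integral>\<^sup>+r. indicator {p<..q} r * ennreal \<bar>?v (n + K) r\<bar> \<partial>lborel)" for n
      proof -
        have "\<bar>?\<Delta> n\<bar> = \<bar>?u (n + K) q - ?u (n + K) p\<bar>" unfolding p_def q_def by (auto simp: min_def max_def abs_minus_commute)
        then have "ennreal \<bar>?\<Delta> n\<bar> = ennreal (norm (LBINT r:{p<..q}. ?v (n + K) r))" using inc[OF pq] by simp
        also have "\<dots> \<le> (\<integral>\<^sup>+r. norm (indicator {p<..q} r *\<^sub>R ?v (n + K) r) \<partial>lborel)"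
          unfolding set_lebesgue_integral_def
          by (intro integral_norm_bound_ennreal integrable_mult_indicator ivn[OF pq]) auto
        also have "\<dots> = (\<integral>\<^sup>+r. indicator {p<..q} r * ennreal \<bar>?v (n + K) r\<bar> \<partial>lborel)"
        proof (rule nn_integral_cong)
          fix r show "ennreal (norm (indicator {p<..q} r *\<^sub>R ?v (n + K) r)) = indicator {p<..q} r * ennreal \<bar>?v (n + K) r\<bar>"
            by (cases "r \<in> {p<..q}") simp_all
        qed
        finally show ?thesis .
      qed
      have vm: "?v n \<in> borel_measurable lborel" for n using ivn[OF pq] by auto
      have bound: "(\<Sum>n. ennreal \<bar>?\<Delta> n\<bar>) \<le> ennreal \<bar>H K s - H K (x k)\<bar>"
      proof -
        have "(\<Sum>n. ennreal \<bar>?\<Delta> n\<bar>) \<le> (\<Sum>n. \<integral>\<^sup>+r. indicator {p<..q} r * ennreal \<bar>?v (n + K) r\<bar> \<partial>lborel)"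
          by (intro suminf_le \<Delta>) auto
        also have "\<dots> = (\<integral>\<^sup>+r. (\<Sum>n. indicator {p<..q} r * ennreal \<bar>?v (n + K) r\<bar>) \<partial>lborel)"
        proof (rule nn_integral_suminf[symmetric])
          fix n
          have [measurable]: "?v (n + K) \<in> borel_measurable borel" using vm[of "n + K"] by simp
          show "(\<lambda>r. indicator {p<..q} r * ennreal \<bar>?v (n + K) r\<bar>) \<in> borel_measurable lborel" by measurable
        qed
        also have "\<dots> \<le> (\<integral>\<^sup>+r. ennreal (indicator {p<..q} r *\<^sub>R (C * F K (?y, r))) \<partial>lborel)"
        \<comment> \<open>Along the line the majorant may be infinite on a null set, where
          \<open>F\<close> is 0, and \<open>r = 1\<close> is excluded by the bounds; the comparison
          is needed almost everywhere only.\<close>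
        proof (rule nn_integral_mono_AE)
          show "AE r in lborel. (\<Sum>n. indicator {p<..q} r * ennreal \<bar>?v (n + K) r\<bar>) \<le> ennreal (indicator {p<..q} r *\<^sub>R (C * F K (?y, r)))"
            using Sfin[of K] AE_lborel_singleton[of "1::real"]
          proof eventually_elim
            case (elim r)
            show ?case
            proof (cases "r \<in> {p<..q}")
              case True
              then have r: "r \<in> {0..1}" using pq by auto
              have xr: "(x(k := r)) j \<in> {0..1}" if "j < d" for j using xt[OF that r] .
              have x1r: "(x(k := r)) j \<noteq> 1" if "j \<in> ?w'" for j using x1 that elim(2) by auto
              have "ennreal \<bar>?v (n + K) r\<bar> \<le> ennreal C * marginal d ?w' (a (n + K)) (x(k := r))" for n
                using C(2)[OF \<tau>' w'[symmetric, unfolded top_vars_def] xr x1r]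
                unfolding a_def[abs_def] top_vars_def .
              then have "(\<Sum>n. ennreal \<bar>?v (n + K) r\<bar>) \<le> (\<Sum>n. ennreal C * marginal d ?w' (a (n + K)) (x(k := r)))"
                by (intro suminf_le) auto
              also have "\<dots> = ennreal C * S K ?w' (x(k := r))" unfolding S_def by simp
              also have "\<dots> = ennreal (C * F K (?y, r))"
                using elim(1) C(1) unfolding Fx by (simp add: ennreal_mult ennreal_enn2real_if)
              finally show ?thesis using True by simp
            qed simp
          qed
        qed
        also have "\<dots> = ennreal (LBINT r. indicator {p<..q} r *\<^sub>R (C * F K (?y, r)))"
        proof (rule nn_integral_eq_integral)
          show "integrable lborel (\<lambda>r. indicator {p<..q} r *\<^sub>R (C * F K (?y, r)))"
            by (intro integrable_mult_indicator integrable_mult_right Fint) simp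
          have "0 \<le> F K (?y, r)" for r by (simp add: F_def)
          then show "AE r in lborel. 0 \<le> indicator {p<..q} r *\<^sub>R (C * F K (?y, r))" using C(1) by simp
        qed
        also have "\<dots> = ennreal (H K q - H K p)"
        proof -
          have "(LBINT r. indicator {p<..q} r *\<^sub>R (C * F K (?y, r))) = C * (LBINT r:{p<..q}. F K (?y, r))"
            unfolding set_lebesgue_integral_def by (simp add: mult.left_commute)
          also have "\<dots> = H K q - H K p"
            unfolding H_def LINT_greaterThanAtMost_diff[OF Fint pq(3)] by (simp add: right_diff_distrib)
          finally show ?thesis by (simp only:)
        qed
        also have "\<dots> \<le> ennreal \<bar>H K s - H K (x k)\<bar>"
          unfolding p_def q_def by (intro ennreal_leI) (auto simp: min_def max_def abs_if)
        finally show ?thesis .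
      qed
      then have "(\<Sum>n. ennreal \<bar>?\<Delta> n\<bar>) \<noteq> top" by (auto simp: top_unique)
      then have su: "summable (\<lambda>n. \<bar>?\<Delta> n\<bar>)" by (intro summable_suminf_not_top) auto
      have "\<bar>\<Sum>n. ?\<Delta> n\<bar> \<le> (\<Sum>n. \<bar>?\<Delta> n\<bar>)" by (rule summable_rabs[OF su])
      also have "\<dots> \<le> \<bar>H K s - H K (x k)\<bar>"
        using bound by (subst (asm) suminf_ennreal2[OF _ su]) simp_all
      finally show ?thesis .
    qed
    have "((\<lambda>t. f (x(k := t))) has_real_derivative (\<Sum>n. ?v n (x k))) (at (x k) within {0..1})"
      by (rule termwise_derivative_majorant[where u = ?u and H = H, OF xk sU du sv tail dH hlim])
    from deriv01_eq[OF xk this] have "partial_deriv k f x = (\<Sum>n. tensor_deriv d ?\<tau> (L n) x)"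
      unfolding partial_deriv_def by simp
    with S' x1' show "S 0 ?w' x < \<infinity> \<and> (\<forall>j\<in>?w'. x j \<noteq> 1) \<and> partial_deriv k f x = (\<Sum>n. tensor_deriv d ?\<tau> (L n) x)"
      by blast
  qed
qed

lemma represents_cong:
  assumes "\<And>j. j < d \<Longrightarrow> \<tau> j = \<tau>' j"
  shows "represents \<tau> f \<longleftrightarrow> represents \<tau>' f"
proof -
  have "top_vars \<tau> = top_vars \<tau>'" using assms by (auto simp: top_vars_def)
  moreover have "tensor_deriv d \<tau> = tensor_deriv d \<tau>'"
    unfolding tensor_deriv_def[abs_def]
    by (intro ext arg_cong[where f = sum_list] map_cong refl prod.cong) (use assms in auto)
  ultimately show ?thesis unfolding represents_def by simp
qed

lemma represents_partial_deriv_power: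
  assumes "represents \<tau> f" "\<And>j. j < d \<Longrightarrow> \<tau> j \<le> \<alpha>" "k < d" "\<tau> k = 0" "s \<le> \<alpha>"
  shows "represents (\<tau>(k := s)) ((partial_deriv k ^^ s) f)"
  using assms(5)
proof (induction s)
  case 0
  have "\<tau>(k := 0) = \<tau>" using assms(4) by auto
  then show ?case using assms(1) by simp
next
  case (Suc s)
  let ?\<tau> = "\<tau>(k := s)"
  have rep: "represents ?\<tau> ((partial_deriv k ^^ s) f)" by (rule Suc.IH) (use Suc.prems in simp)
  have le: "?\<tau> j \<le> \<alpha>" if "j < d" for j using assms(2)[OF that] Suc.prems by auto
  show ?case
  proof (cases "Suc s < \<alpha>")
    case True
    have "represents (?\<tau>(k := Suc (?\<tau> k))) (partial_deriv k ((partial_deriv k ^^ s) f))"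
      by (rule represents_partial_deriv[OF rep le assms(3)]) (use True in simp_all)
    moreover have "?\<tau>(k := Suc (?\<tau> k)) = \<tau>(k := Suc s)" by simp
    ultimately show ?thesis by (simp only: funpow.simps o_apply)
  next
    case False
    then have \<alpha>': "Suc s = \<alpha>" using Suc.prems by simp
    have "represents (?\<tau>(k := \<alpha>)) (partial_deriv k ((partial_deriv k ^^ s) f))"
      by (rule represents_partial_deriv_top[OF rep le assms(3)]) (use \<alpha>' in simp_all)
    moreover have "?\<tau>(k := \<alpha>) = \<tau>(k := Suc s)" using \<alpha>' by simp
    ultimately show ?thesis by (simp only: funpow.simps o_apply)
  qed
qed

text \<open>\<open>mixed_deriv\<close> differentiates in the last coordinate first, so the induction
  has to allow orders \<tau> already reached in the coordinates from \<open>n\<close> on.\<close>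

lemma represents_mixed_deriv:
  assumes "n \<le> d" "represents \<tau> f" "\<And>j. j < d \<Longrightarrow> \<tau> j \<le> \<alpha>" "\<And>j. j < n \<Longrightarrow> \<tau> j = 0" "\<And>j. j < n \<Longrightarrow> \<sigma> j \<le> \<alpha>"
  shows "represents (\<lambda>j. if j < n then \<sigma> j else \<tau> j) (mixed_deriv n \<sigma> f)"
  using assms
proof (induction n arbitrary: \<tau> f)
  case (Suc n)
  let ?\<tau> = "\<tau>(n := \<sigma> n)"
  have rep: "represents ?\<tau> ((partial_deriv n ^^ \<sigma> n) f)"
    by (rule represents_partial_deriv_power[OF Suc.prems(2,3)]) (use Suc.prems in auto)
  have "represents (\<lambda>j. if j < n then \<sigma> j else ?\<tau> j) (mixed_deriv n \<sigma> ((partial_deriv n ^^ \<sigma> n) f))"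
    by (rule Suc.IH[OF _ rep]) (use Suc.prems in auto)
  moreover have "(\<lambda>j. if j < n then \<sigma> j else ?\<tau> j) = (\<lambda>j. if j < Suc n then \<sigma> j else \<tau> j)"
    by (auto simp: less_Suc_eq)
  ultimately show ?case by simp
qed simp

text \<open>The measure on no coordinates is a unit mass at one point, so square integrability there
  is finiteness. Hence the undifferentiated series converges everywhere.\<close>

lemma S_empty_finite: "S 0 {} x < \<infinity>"
proof -
  have "(\<integral>\<^sup>+x. (S 0 {} x)\<^sup>2 \<partial>lborel_on {}) = (S 0 {} (\<lambda>_. undefined))\<^sup>2"
    by (rule lborel_PiM.nn_integral_empty) simp
  moreover have "S 0 {} (\<lambda>_. undefined) = S 0 {} x" by (rule S_cong) simp
  ultimately have "(S 0 {} x)\<^sup>2 < \<infinity>" using S_square_integral[of "{}"] by simp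
  then show ?thesis by (cases "S 0 {} x") (auto simp: power2_eq_square ennreal_top_mult)
qed

text \<open>Order 0 has no top variables because \<open>\<alpha> \<ge> 1\<close>; its exceptional
  set is empty and the induction can start.\<close>

theorem mixed_deriv_series:
  assumes f: "\<And>x. x \<in> unit_cube d \<Longrightarrow> (\<lambda>n. tensor_deriv d (\<lambda>_. 0) (L n) x) sums f x"
    and \<tau>: "\<And>j. j < d \<Longrightarrow> \<tau> j \<le> \<alpha>"
  shows "represents \<tau> (mixed_deriv d \<tau> f)"
proof -
  have w: "top_vars (\<lambda>_. 0) = {}" using \<alpha> by (auto simp: top_vars_def)
  have "represents (\<lambda>_. 0) f"
    unfolding represents_def w
  proof (rule bexI[of _ "{}"], intro ballI impI conjI)
    fix x assume "x \<in> unit_cube d"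
    then show "f x = (\<Sum>n. tensor_deriv d (\<lambda>_. 0) (L n) x)" using sums_unique[OF f] by simp
    show "S 0 {} x < \<infinity>" by (rule S_empty_finite)
  qed auto
  from represents_mixed_deriv[OF order_refl this, of \<tau>]
  have "represents (\<lambda>j. if j < d then \<tau> j else 0) (mixed_deriv d \<tau> f)" using \<tau> by simp
  then show ?thesis by (subst represents_cong[of \<tau> "\<lambda>j. if j < d then \<tau> j else 0"]) auto
qed

end

section \<open>From the whole space to the unit cube\<close>

abbreviation unit_lborel :: "real measure" where
  "unit_lborel \<equiv> restrict_space lborel {0..1}"

abbreviation unit_lborel_on :: "nat set \<Rightarrow> point measure" where
  "unit_lborel_on u \<equiv> Pi\<^sub>M u (\<lambda>_. unit_lborel)"

interpretation unit_finite: finite_measure unit_lborel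
  by (rule finite_measureI) (simp_all add: emeasure_restrict_space space_restrict_space)

interpretation unit_PiM: product_sigma_finite "\<lambda>_::nat. unit_lborel"
  by (rule product_sigma_finite.intro) (rule unit_finite.sigma_finite_measure_axioms)

lemma emeasure_space_unit_PiM:
  assumes "finite v"
  shows "emeasure (unit_lborel_on v) (space (unit_lborel_on v)) = 1"
  unfolding space_PiM
proof (subst unit_PiM.emeasure_PiM[OF assms])
  show "space unit_lborel \<in> sets unit_lborel" by (rule sets.top)
qed (simp add: emeasure_restrict_space space_restrict_space)

lemma ident_measurable_unit_PiM:
  assumes "finite v"
  shows "(\<lambda>x. x) \<in> unit_lborel_on v \<rightarrow>\<^sub>M lborel_on v"
proof -
  have "(\<lambda>x. \<lambda>j\<in>v. x j) \<in> unit_lborel_on v \<rightarrow>\<^sub>M lborel_on v"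
  proof (rule measurable_restrict)
    fix j assume "j \<in> v"
    have "(\<lambda>x. x) \<in> unit_lborel \<rightarrow>\<^sub>M lborel" by (rule measurable_restrict_space1) simp
    from measurable_compose[OF measurable_component_singleton[OF \<open>j \<in> v\<close>] this]
    show "(\<lambda>x. x j) \<in> unit_lborel_on v \<rightarrow>\<^sub>M lborel" .
  qed
  then show ?thesis
    by (rule measurable_cong[THEN iffD1, rotated]) (auto simp: space_PiM PiE_iff extensional_def fun_eq_iff restrict_def)
qed

lemma unit_PiM_measurable:
  "finite v \<Longrightarrow> h \<in> borel_measurable (lborel_on v) \<Longrightarrow> h \<in> borel_measurable (unit_lborel_on v)"
  using measurable_compose[OF ident_measurable_unit_PiM] by blast

lemma nn_integral_unit_PiM_le:
  assumes "finite v" "h \<in> borel_measurable (lborel_on v)"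
  shows "(\<integral>\<^sup>+x. h x \<partial>unit_lborel_on v) \<le> (\<integral>\<^sup>+x. h x \<partial>lborel_on v)"
  using assms
proof (induction v arbitrary: h rule: finite_induct)
  case empty
  then show ?case by (simp add: unit_PiM.nn_integral_empty lborel_PiM.nn_integral_empty)
next
  case (insert i v)
  have m: "(\<lambda>x. \<integral>\<^sup>+y. h (x(i := y)) \<partial>lborel) \<in> borel_measurable (lborel_on v)"
  proof (rule lborel.borel_measurable_nn_integral)
    show "(\<lambda>(x, y). h (x(i := y))) \<in> borel_measurable (lborel_on v \<Otimes>\<^sub>M lborel)"
      using measurable_compose[OF measurable_add_dim[of i v "\<lambda>_. lborel"] insert.prems] unfolding case_prod_beta .
  qed
  have "(\<integral>\<^sup>+x. h x \<partial>unit_lborel_on (insert i v))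
      = (\<integral>\<^sup>+x. \<integral>\<^sup>+y. h (x(i := y)) \<partial>unit_lborel \<partial>unit_lborel_on v)"
    using insert by (intro unit_PiM.product_nn_integral_insert unit_PiM_measurable) auto
  also have "\<dots> \<le> (\<integral>\<^sup>+x. \<integral>\<^sup>+y. h (x(i := y)) \<partial>lborel \<partial>unit_lborel_on v)"
  proof (rule nn_integral_mono)
    fix x
    show "(\<integral>\<^sup>+y. h (x(i := y)) \<partial>unit_lborel) \<le> (\<integral>\<^sup>+y. h (x(i := y)) \<partial>lborel)"
      by (subst nn_integral_restrict_space) (auto intro!: nn_integral_mono split: split_indicator)
  qed
  also have "\<dots> \<le> (\<integral>\<^sup>+x. \<integral>\<^sup>+y. h (x(i := y)) \<partial>lborel \<partial>lborel_on v)"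
    by (rule insert.IH[OF m])
  also have "\<dots> = (\<integral>\<^sup>+x. h x \<partial>lborel_on (insert i v))"
    using insert by (intro lborel_PiM.product_nn_integral_insert[symmetric]) auto
  finally show ?case .
qed

text \<open>Coordinates outside \<open>w\<close> integrate to 1 over the cube; in those inside
  \<open>w\<close> the domain is enlarged to the whole line.\<close>

lemma nn_integral_unit_PiM_restrict_le:
  assumes v: "finite v" "w \<subseteq> v" and h: "h \<in> borel_measurable (lborel_on w)"
  shows "(\<integral>\<^sup>+x. h (restrict x w) \<partial>unit_lborel_on v) \<le> (\<integral>\<^sup>+x. h x \<partial>lborel_on w)"
proof -
  have fw: "finite w" using v finite_subset by blast
  have vw: "w \<union> (v - w) = v" using v by auto
  have hm: "h \<in> borel_measurable (unit_lborel_on w)" by (rule unit_PiM_measurable[OF fw h])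
  have m: "(\<lambda>x. h (restrict x w)) \<in> borel_measurable (Pi\<^sub>M (w \<union> (v - w)) (\<lambda>_::nat. unit_lborel))"
    unfolding vw by (rule measurable_compose[OF measurable_restrict_subset[OF v(2)] hm])
  have "(\<integral>\<^sup>+x. h (restrict x w) \<partial>Pi\<^sub>M (w \<union> (v - w)) (\<lambda>_::nat. unit_lborel))
    = (\<integral>\<^sup>+x. \<integral>\<^sup>+y. h (restrict (merge w (v - w) (x, y)) w) \<partial>unit_lborel_on (v - w) \<partial>unit_lborel_on w)"
    using v fw by (intro unit_PiM.product_nn_integral_fold m) auto
  also have "\<dots> = (\<integral>\<^sup>+x. h x \<partial>unit_lborel_on w)"
  proof (rule nn_integral_cong)
    fix x assume x: "x \<in> space (unit_lborel_on w)"
    have "restrict (merge w (v - w) (x, y)) w = x" for y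
      using x by (auto simp: space_PiM PiE_iff extensional_def fun_eq_iff restrict_def merge_def)
    then show "(\<integral>\<^sup>+y. h (restrict (merge w (v - w) (x, y)) w) \<partial>unit_lborel_on (v - w)) = h x"
      using emeasure_space_unit_PiM[of "v - w"] v by simp
  qed
  also have "\<dots> \<le> (\<integral>\<^sup>+x. h x \<partial>lborel_on w)" by (rule nn_integral_unit_PiM_le[OF fw h])
  finally show ?thesis unfolding vw .
qed

lemma AE_unit_PiM_restrict_notin:
  assumes v: "finite v" "w \<subseteq> v" and N: "N \<in> null_sets (lborel_on w)"
  shows "AE x in unit_lborel_on v. restrict x w \<notin> N"
proof -
  have fw: "finite w" using v finite_subset by blast
  have [measurable]: "N \<in> sets (lborel_on w)" using N by auto
  have hm: "(indicator N :: point \<Rightarrow> ennreal) \<in> borel_measurable (lborel_on w)" by measurable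
  have "(\<integral>\<^sup>+x. indicator N (restrict x w) \<partial>unit_lborel_on v) \<le> (\<integral>\<^sup>+x. indicator N x \<partial>lborel_on w)"
    by (rule nn_integral_unit_PiM_restrict_le[OF v hm])
  also have "\<dots> = emeasure (lborel_on w) N" by (rule nn_integral_indicator) simp
  also have "\<dots> = 0" by (rule null_setsD1[OF N])
  finally have z: "(\<integral>\<^sup>+x. indicator N (restrict x w) \<partial>unit_lborel_on v) = (0::ennreal)" by simp
  have m: "(\<lambda>x. indicator N (restrict x w) :: ennreal) \<in> borel_measurable (unit_lborel_on v)"
    by (rule measurable_compose[OF measurable_restrict_subset[OF v(2)] unit_PiM_measurable[OF fw hm]])
  have "AE x in unit_lborel_on v. indicator N (restrict x w) = (0::ennreal)"
    using nn_integral_0_iff_AE[OF m] z by simp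
  then show ?thesis by eventually_elim (auto simp: indicator_def split: if_splits)
qed

text \<open>Measurability of \<open>f\<close> comes from completeness. So the mixed derivatives,
  whose values on null sets are uncontrolled, need no measurability argument of their own.\<close>

lemma integral_completion_AE_eq:
  fixes f g :: "'a \<Rightarrow> 'b::{banach, second_countable_topology}"
  assumes g: "g \<in> borel_measurable M" and eq: "AE x in M. f x = g x"
  shows "integral\<^sup>L (completion M) f = integral\<^sup>L M g"
proof -
  have gc: "g \<in> borel_measurable (completion M)" using g by (rule measurable_completion)
  have ae: "AE x in completion M. f x = g x" using eq by (rule AE_completion)
  have fc: "f \<in> borel_measurable (completion M)"
  proof (rule measurableI)
    fix A :: "'b set" assume A: "A \<in> sets borel"
    have A1: "g -` A \<inter> space (completion M) \<in> sets (completion M)" using gc A by (rule measurable_sets)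
    have A2: "AE x in completion M. x \<in> g -` A \<inter> space (completion M) \<longleftrightarrow> x \<in> f -` A \<inter> space (completion M)"
      using ae by eventually_elim auto
    show "f -` A \<inter> space (completion M) \<in> sets (completion M)"
      by (rule completion.in_sets_AE[OF A2 A1]) simp
  qed auto
  have "integral\<^sup>L (completion M) f = integral\<^sup>L (completion M) g" by (rule integral_cong_AE[OF fc gc ae])
  also have "\<dots> = integral\<^sup>L M g" by (rule integral_completion[OF g])
  finally show ?thesis .
qed

lemma integral_unit_interval:
  "(\<And>t. t \<notin> {0..1} \<Longrightarrow> f t = 0) \<Longrightarrow> (\<integral>t. f t \<partial>unit_lborel) = (LBINT t. f t :: real)"
  by (subst integral_restrict_space) (auto intro!: lintegral_cong split: split_indicator)

lemma integrable_unit_interval: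
  fixes f :: "real \<Rightarrow> real"
  shows "integrable lborel f \<Longrightarrow> integrable unit_lborel f"
  by (subst integrable_restrict_space) (auto simp del: real_scaleR_def intro: integrable_mult_indicator)

section \<open>Integrals of mixed derivatives and the inner product\<close>

definition tensor_mean :: "nat \<Rightarrow> nat set \<Rightarrow> (nat \<Rightarrow> nat) \<Rightarrow> tensor \<Rightarrow> point \<Rightarrow> real" where
  "tensor_mean d v \<tau> L x = (\<Sum>J\<leftarrow>L. \<Prod>j<d. if j \<in> v then (LBINT t. J j (\<tau> j) t) else J j (\<tau> j) (x j))"

lemma has_bochner_integral_tensor_deriv:
  assumes L: "jet_tensors \<alpha> d L" and \<tau>: "\<And>j. j < d \<Longrightarrow> \<tau> j \<le> \<alpha>" and v: "v \<subseteq> {..<d}"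
  shows "has_bochner_integral (unit_lborel_on v) (\<lambda>z. tensor_deriv d \<tau> L (override_on x z v)) (tensor_mean d v \<tau> L x)"
proof -
  let ?P = "unit_lborel_on v"
  have fv: "finite v" using v finite_subset by blast
  have split: "(\<Prod>j<d. f j) = (\<Prod>j\<in>{..<d} - v. f j) * (\<Prod>j\<in>v. f j)" for f :: "nat \<Rightarrow> real"
    using v by (subst prod.union_disjoint[symmetric]) (auto intro!: prod.cong fv)
  have 1: "has_bochner_integral ?P (\<lambda>z. \<Prod>j<d. (L ! i) j (\<tau> j) (override_on x z v j))
     (\<Prod>j<d. if j \<in> v then (LBINT t. (L ! i) j (\<tau> j) t) else (L ! i) j (\<tau> j) (x j))" if i: "i < length L" for i
  proof -
    have J: "sobolev_jet \<alpha> ((L ! i) j)" "\<tau> j \<le> \<alpha>" if "j \<in> v" for j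
      using jet_tensorsD[OF L i] \<tau> that v by auto
    have int: "integrable unit_lborel ((L ! i) j (\<tau> j))" if "j \<in> v" for j
      by (rule integrable_unit_interval[OF sobolev_jet_integrable[OF J[OF that]]])
    have val: "(\<integral>t. (L ! i) j (\<tau> j) t \<partial>unit_lborel) = (LBINT t. (L ! i) j (\<tau> j) t)" if "j \<in> v" for j
      by (rule integral_unit_interval) (rule sobolev_jetD(2)[OF J[OF that]])
    have "integrable ?P (\<lambda>z. \<Prod>j\<in>v. (L ! i) j (\<tau> j) (z j))"
      by (rule unit_PiM.product_integrable_prod[OF fv int])
    moreover have "(\<integral>z. (\<Prod>j\<in>v. (L ! i) j (\<tau> j) (z j)) \<partial>?P) = (\<Prod>j\<in>v. \<integral>t. (L ! i) j (\<tau> j) t \<partial>lborel)"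
      by (subst unit_PiM.product_integral_prod[OF fv int]) (auto intro!: prod.cong val)
    ultimately have "has_bochner_integral ?P (\<lambda>z. \<Prod>j\<in>v. (L ! i) j (\<tau> j) (z j)) (\<Prod>j\<in>v. \<integral>t. (L ! i) j (\<tau> j) t \<partial>lborel)"
      by (simp add: has_bochner_integral_iff)
    from has_bochner_integral_mult_right[OF this, of "\<Prod>j\<in>{..<d} - v. (L ! i) j (\<tau> j) (x j)"]
    have "has_bochner_integral ?P (\<lambda>z. (\<Prod>j\<in>{..<d} - v. (L ! i) j (\<tau> j) (x j)) * (\<Prod>j\<in>v. (L ! i) j (\<tau> j) (z j)))
      ((\<Prod>j\<in>{..<d} - v. (L ! i) j (\<tau> j) (x j)) * (\<Prod>j\<in>v. \<integral>t. (L ! i) j (\<tau> j) t \<partial>lborel))" by blast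
    moreover have "(\<Prod>j\<in>{..<d} - v. (L ! i) j (\<tau> j) (x j)) * (\<Prod>j\<in>v. (L ! i) j (\<tau> j) (z j))
        = (\<Prod>j<d. (L ! i) j (\<tau> j) (override_on x z v j))" for z
    proof -
      have "(\<Prod>j\<in>{..<d} - v. (L ! i) j (\<tau> j) (x j)) = (\<Prod>j\<in>{..<d} - v. (L ! i) j (\<tau> j) (override_on x z v j))"
        by (rule prod.cong) auto
      moreover have "(\<Prod>j\<in>v. (L ! i) j (\<tau> j) (z j)) = (\<Prod>j\<in>v. (L ! i) j (\<tau> j) (override_on x z v j))"
        by (rule prod.cong) auto
      ultimately show ?thesis by (simp only: split)
    qed
    moreover have "(\<Prod>j\<in>{..<d} - v. (L ! i) j (\<tau> j) (x j)) * (\<Prod>j\<in>v. \<integral>t. (L ! i) j (\<tau> j) t \<partial>lborel)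
        = (\<Prod>j<d. if j \<in> v then (LBINT t. (L ! i) j (\<tau> j) t) else (L ! i) j (\<tau> j) (x j))" (is "_ = (\<Prod>j<d. ?f j)")
    proof -
      have "(\<Prod>j\<in>{..<d} - v. (L ! i) j (\<tau> j) (x j)) = (\<Prod>j\<in>{..<d} - v. ?f j)"
        by (rule prod.cong) auto
      moreover have "(\<Prod>j\<in>v. \<integral>t. (L ! i) j (\<tau> j) t \<partial>lborel) = (\<Prod>j\<in>v. ?f j)"
        by (rule prod.cong) auto
      ultimately show ?thesis by (simp only: split)
    qed
    ultimately show ?thesis by (simp only:)
  qed
  have "has_bochner_integral ?P (\<lambda>z. \<Sum>i<length L. \<Prod>j<d. (L ! i) j (\<tau> j) (override_on x z v j))
     (\<Sum>i<length L. \<Prod>j<d. if j \<in> v then (LBINT t. (L ! i) j (\<tau> j) t) else (L ! i) j (\<tau> j) (x j))"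
    by (rule has_bochner_integral_sum) (use 1 in auto)
  then show ?thesis unfolding tensor_deriv_def tensor_mean_def sum_list_conv_sum .
qed

lemma has_bochner_integral_tensor_mean_mult:
  assumes L: "jet_tensors \<alpha> d L" and M: "jet_tensors \<alpha> d M" and \<tau>: "\<And>j. j < d \<Longrightarrow> \<tau> j \<le> \<alpha>" and w: "w = {j. j < d \<and> \<tau> j = \<alpha>}"
  shows "has_bochner_integral (unit_lborel_on w)
      (\<lambda>y. tensor_mean d ({..<d} - w) \<tau> L y * tensor_mean d ({..<d} - w) \<tau> M y)
      (\<Sum>J\<leftarrow>L. \<Sum>K\<leftarrow>M. \<Prod>j<d. if j \<in> w then (LBINT t. J j \<alpha> t * K j \<alpha> t)
         else (LBINT t. J j (\<tau> j) t) * (LBINT t. K j (\<tau> j) t))"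
proof -
  let ?P = "unit_lborel_on w"
  have wd: "w \<subseteq> {..<d}" "finite w" using w by auto
  have split: "(\<Prod>j<d. f j) = (\<Prod>j\<in>{..<d} - w. f j) * (\<Prod>j\<in>w. f j)" for f :: "nat \<Rightarrow> real"
    using wd by (subst prod.union_disjoint[symmetric]) (auto intro!: prod.cong)
  let ?m = "\<lambda>J y j. if j \<in> {..<d} - w then (LBINT t. J j (\<tau> j) t) else J j (\<tau> j) (y j)"
  let ?c = "\<lambda>J K j. if j \<in> w then (LBINT t. J j \<alpha> t * K j \<alpha> t)
         else (LBINT t. J j (\<tau> j) t) * (LBINT t. K j (\<tau> j) t)"
  have 1: "has_bochner_integral ?P (\<lambda>y. (\<Prod>j<d. ?m (L ! i) y j) * (\<Prod>j<d. ?m (M ! k) y j)) (\<Prod>j<d. ?c (L ! i) (M ! k) j)"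
    if ik: "i < length L" "k < length M" for i k
  proof -
    let ?J = "L ! i" and ?K = "M ! k"
    have J: "sobolev_jet \<alpha> (?J j)" "sobolev_jet \<alpha> (?K j)" "\<tau> j = \<alpha>" if "j \<in> w" for j
      using jet_tensorsD[OF L ik(1)] jet_tensorsD[OF M ik(2)] that w by auto
    have int: "integrable unit_lborel (\<lambda>t. ?J j \<alpha> t * ?K j \<alpha> t)" if "j \<in> w" for j
      by (rule integrable_unit_interval[OF jet_top_mult_integrable[OF J(1,2)[OF that]]])
    have val: "(\<integral>t. ?J j \<alpha> t * ?K j \<alpha> t \<partial>unit_lborel) = (LBINT t. ?J j \<alpha> t * ?K j \<alpha> t)" if "j \<in> w" for j
      by (rule integral_unit_interval) (simp add: sobolev_jetD(2)[OF J(1)[OF that]])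
    have "integrable ?P (\<lambda>z. \<Prod>j\<in>w. ?J j \<alpha> (z j) * ?K j \<alpha> (z j))"
      by (rule unit_PiM.product_integrable_prod[OF wd(2) int])
    moreover have "(\<integral>z. (\<Prod>j\<in>w. ?J j \<alpha> (z j) * ?K j \<alpha> (z j)) \<partial>?P) = (\<Prod>j\<in>w. \<integral>t. ?J j \<alpha> t * ?K j \<alpha> t \<partial>lborel)"
      by (subst unit_PiM.product_integral_prod[OF wd(2) int]) (auto intro!: prod.cong val)
    ultimately have "has_bochner_integral ?P (\<lambda>z. \<Prod>j\<in>w. ?J j \<alpha> (z j) * ?K j \<alpha> (z j)) (\<Prod>j\<in>w. \<integral>t. ?J j \<alpha> t * ?K j \<alpha> t \<partial>lborel)"
      by (simp add: has_bochner_integral_iff)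
    from has_bochner_integral_mult_right[OF this, of "\<Prod>j\<in>{..<d} - w. (LBINT t. ?J j (\<tau> j) t) * (LBINT t. ?K j (\<tau> j) t)"]
    have hb: "has_bochner_integral ?P (\<lambda>z. (\<Prod>j\<in>{..<d} - w. (LBINT t. ?J j (\<tau> j) t) * (LBINT t. ?K j (\<tau> j) t)) * (\<Prod>j\<in>w. ?J j \<alpha> (z j) * ?K j \<alpha> (z j)))
      ((\<Prod>j\<in>{..<d} - w. (LBINT t. ?J j (\<tau> j) t) * (LBINT t. ?K j (\<tau> j) t)) * (\<Prod>j\<in>w. \<integral>t. ?J j \<alpha> t * ?K j \<alpha> t \<partial>lborel))" by blast
    have e1: "(\<Prod>j<d. ?m ?J y j) * (\<Prod>j<d. ?m ?K y j)
      = (\<Prod>j\<in>{..<d} - w. (LBINT t. ?J j (\<tau> j) t) * (LBINT t. ?K j (\<tau> j) t)) * (\<Prod>j\<in>w. ?J j \<alpha> (y j) * ?K j \<alpha> (y j))" for y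
    proof -
      have "(\<Prod>j<d. ?m ?J y j) * (\<Prod>j<d. ?m ?K y j) = (\<Prod>j<d. ?m ?J y j * ?m ?K y j)" by (rule prod.distrib[symmetric])
      also have "\<dots> = (\<Prod>j\<in>{..<d} - w. ?m ?J y j * ?m ?K y j) * (\<Prod>j\<in>w. ?m ?J y j * ?m ?K y j)" by (rule split)
      also have "(\<Prod>j\<in>{..<d} - w. ?m ?J y j * ?m ?K y j) = (\<Prod>j\<in>{..<d} - w. (LBINT t. ?J j (\<tau> j) t) * (LBINT t. ?K j (\<tau> j) t))"
        by (rule prod.cong) auto
      also have "(\<Prod>j\<in>w. ?m ?J y j * ?m ?K y j) = (\<Prod>j\<in>w. ?J j \<alpha> (y j) * ?K j \<alpha> (y j))"
        by (rule prod.cong) (use w in auto)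
      finally show ?thesis .
    qed
    have e2: "(\<Prod>j<d. ?c ?J ?K j) = (\<Prod>j\<in>{..<d} - w. (LBINT t. ?J j (\<tau> j) t) * (LBINT t. ?K j (\<tau> j) t)) * (\<Prod>j\<in>w. \<integral>t. ?J j \<alpha> t * ?K j \<alpha> t \<partial>lborel)"
    proof -
      have "(\<Prod>j<d. ?c ?J ?K j) = (\<Prod>j\<in>{..<d} - w. ?c ?J ?K j) * (\<Prod>j\<in>w. ?c ?J ?K j)" by (rule split)
      also have "(\<Prod>j\<in>{..<d} - w. ?c ?J ?K j) = (\<Prod>j\<in>{..<d} - w. (LBINT t. ?J j (\<tau> j) t) * (LBINT t. ?K j (\<tau> j) t))"
        by (rule prod.cong) auto
      also have "(\<Prod>j\<in>w. ?c ?J ?K j) = (\<Prod>j\<in>w. \<integral>t. ?J j \<alpha> t * ?K j \<alpha> t \<partial>lborel)"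
        by (rule prod.cong) auto
      finally show ?thesis .
    qed
    show ?thesis unfolding e1 e2 by (rule hb)
  qed
  have "has_bochner_integral ?P (\<lambda>y. \<Sum>i<length L. \<Sum>k<length M. (\<Prod>j<d. ?m (L ! i) y j) * (\<Prod>j<d. ?m (M ! k) y j))
     (\<Sum>i<length L. \<Sum>k<length M. \<Prod>j<d. ?c (L ! i) (M ! k) j)"
    by (intro has_bochner_integral_sum 1) auto
  then show ?thesis
    unfolding tensor_mean_def sum_list_conv_sum sum_product .
qed

lemma finite_multi_indices: "finite (multi_indices d \<alpha>)"
  unfolding multi_indices_def by (intro finite_PiE) auto

lemma multi_indices_le: "\<tau> \<in> multi_indices d \<alpha> \<Longrightarrow> j < d \<Longrightarrow> \<tau> j \<le> \<alpha>"
  unfolding multi_indices_def by (drule PiE_mem[of _ _ _ j]) auto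

text \<open>Expanding the product over coordinates of the sums over orders produces the sum over
  multi-indices in \<open>sobolev_inner\<close>: order \<alpha> contributes the integral of a
  product, lower orders contribute products of integrals.\<close>

lemma tensor_inner_eq_sum:
  assumes L: "jet_tensors \<alpha> d L" and M: "jet_tensors \<alpha> d M"
  shows "tensor_inner \<alpha> d L M = (\<Sum>\<tau>\<in>multi_indices d \<alpha>. let w = {j. j < d \<and> \<tau> j = \<alpha>} in
      \<integral>y. tensor_mean d ({..<d} - w) \<tau> L y * tensor_mean d ({..<d} - w) \<tau> M y \<partial>unit_lborel_on w)"
proof -
  let ?e = "\<lambda>J K k. if k = \<alpha> then (LBINT t. J \<alpha> t * K \<alpha> t) else (LBINT t. J k t) * (LBINT t. K k t)"
  have ji: "jet_inner \<alpha> J K = (\<Sum>k\<le>\<alpha>. ?e J K k)" for J K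
    unfolding jet_inner_def lessThan_Suc_atMost[symmetric] sum.lessThan_Suc by simp
  have "tensor_inner \<alpha> d L M = (\<Sum>J\<leftarrow>L. \<Sum>K\<leftarrow>M. \<Sum>\<tau>\<in>multi_indices d \<alpha>. \<Prod>j<d. ?e (J j) (K j) (\<tau> j))"
    unfolding tensor_inner_def ji multi_indices_def by (subst prod_sum_PiE) auto
  also have "\<dots> = (\<Sum>\<tau>\<in>multi_indices d \<alpha>. \<Sum>J\<leftarrow>L. \<Sum>K\<leftarrow>M. \<Prod>j<d. ?e (J j) (K j) (\<tau> j))"
    unfolding sum_list_conv_sum
    by (simp only: sum.swap[of _ "multi_indices d \<alpha>"])
  also have "\<dots> = (\<Sum>\<tau>\<in>multi_indices d \<alpha>. let w = {j. j < d \<and> \<tau> j = \<alpha>} in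
      \<integral>y. tensor_mean d ({..<d} - w) \<tau> L y * tensor_mean d ({..<d} - w) \<tau> M y \<partial>unit_lborel_on w)"
  proof (rule sum.cong[OF refl])
    fix \<tau> assume \<tau>: "\<tau> \<in> multi_indices d \<alpha>"
    show "(\<Sum>J\<leftarrow>L. \<Sum>K\<leftarrow>M. \<Prod>j<d. ?e (J j) (K j) (\<tau> j)) = (let w = {j. j < d \<and> \<tau> j = \<alpha>} in
      \<integral>y. tensor_mean d ({..<d} - w) \<tau> L y * tensor_mean d ({..<d} - w) \<tau> M y \<partial>unit_lborel_on w)"
      unfolding Let_def
      by (subst has_bochner_integral_integral_eq[OF has_bochner_integral_tensor_mean_mult[OF L M multi_indices_le[OF \<tau>] refl]])
        (auto intro!: arg_cong[where f = sum_list] map_cong prod.cong)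
  qed
  finally show ?thesis .
qed

lemma integrable_power2_of_nn:
  fixes f :: "'a \<Rightarrow> ennreal"
  assumes [measurable]: "f \<in> borel_measurable M" and fin: "(\<integral>\<^sup>+x. (f x)\<^sup>2 \<partial>M) < \<infinity>"
  shows "integrable M (\<lambda>x. (enn2real (f x))\<^sup>2)"
proof (rule integrableI_nonneg)
  have "ennreal ((enn2real y)\<^sup>2) \<le> y\<^sup>2" for y :: ennreal
    by (cases y) (simp_all add: ennreal_power)
  then have "(\<integral>\<^sup>+x. ennreal ((enn2real (f x))\<^sup>2) \<partial>M) \<le> (\<integral>\<^sup>+x. (f x)\<^sup>2 \<partial>M)"
    by (intro nn_integral_mono)
  then show "(\<integral>\<^sup>+x. ennreal ((enn2real (f x))\<^sup>2) \<partial>M) < \<infinity>" using fin by (rule le_less_trans)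
qed auto

context tensor_series
begin

definition good :: "(nat \<Rightarrow> nat) \<Rightarrow> (point \<Rightarrow> real) \<Rightarrow> point \<Rightarrow> bool" where
  "good \<tau> D p \<longleftrightarrow> p \<in> unit_cube d \<and> S 0 (top_vars \<tau>) p < \<infinity> \<and> (\<forall>j\<in>top_vars \<tau>. p j \<noteq> 1)
     \<and> D p = (\<Sum>n. tensor_deriv d \<tau> (L n) p)"

lemma top_vars_subset: "top_vars \<tau> \<subseteq> {..<d}" "finite (top_vars \<tau>)"
  by (auto simp: top_vars_def)

text \<open>Dominated convergence with majorant \<open>C * S 0\<close>;
  \<open>integral_completion_AE_eq\<close> replaces \<open>D\<close> by the sum of the series. The
  second claim keeps the domination available for one further integration.\<close>

lemma integrate_vars_sums:
  assumes \<tau>: "\<And>j. j < d \<Longrightarrow> \<tau> j \<le> \<alpha>" and v: "v \<subseteq> {..<d}"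
    and good: "AE z in unit_lborel_on v. good \<tau> D (override_on x z v)"
    and W: "integrable (unit_lborel_on v) (\<lambda>z. enn2real (S 0 (top_vars \<tau>) (override_on x z v)))"
  shows "(\<lambda>n. tensor_mean d v \<tau> (L n) x) sums integrate_vars v D x"
    and "\<bar>\<Sum>n<N. tensor_mean d v \<tau> (L n) x\<bar> \<le> (\<integral>z. C * enn2real (S 0 (top_vars \<tau>) (override_on x z v)) \<partial>unit_lborel_on v)"
proof -
  let ?P = "unit_lborel_on v"
  let ?h = "\<lambda>n z. tensor_deriv d \<tau> (L n) (override_on x z v)"
  let ?W = "\<lambda>z. C * enn2real (S 0 (top_vars \<tau>) (override_on x z v))"
  have hb: "has_bochner_integral ?P (?h n) (tensor_mean d v \<tau> (L n) x)" for n
    by (rule has_bochner_integral_tensor_deriv[OF jets \<tau> v])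
  have hm [measurable]: "?h n \<in> borel_measurable ?P" for n using hb[of n] by (rule borel_measurable_has_bochner_integral)
  have iW: "integrable ?P ?W" using W by simp
  have hbN: "has_bochner_integral ?P (\<lambda>z. \<Sum>n<N. ?h n z) (\<Sum>n<N. tensor_mean d v \<tau> (L n) x)" for N
    by (rule has_bochner_integral_sum) (rule hb)
  have props: "AE z in ?P. summable (\<lambda>n. ?h n z) \<and> (\<forall>N. \<bar>\<Sum>n<N. ?h n z\<bar> \<le> ?W z)"
    using good
  proof eventually_elim
    fix z assume "good \<tau> D (override_on x z v)"
    then have g: "override_on x z v \<in> unit_cube d" "S 0 (top_vars \<tau>) (override_on x z v) < \<infinity>"
       "\<And>j. j \<in> top_vars \<tau> \<Longrightarrow> override_on x z v j \<noteq> 1" by (auto simp: good_def)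
    note ts = tensor_deriv_summable[OF \<tau> refl unit_cubeD[OF g(1)] g(3) g(2)]
    have sa: "summable (\<lambda>n. \<bar>?h n z\<bar>)"
      by (rule summable_comparison_test'[OF ts(2), of 0]) (use ts(1) in auto)
    have "\<bar>\<Sum>n<N. ?h n z\<bar> \<le> ?W z" for N
    proof -
      have "\<bar>\<Sum>n<N. ?h n z\<bar> \<le> (\<Sum>n<N. \<bar>?h n z\<bar>)" by (rule sum_abs)
      also have "\<dots> \<le> (\<Sum>n. \<bar>?h n z\<bar>)" using sa by (intro sum_le_suminf) auto
      also have "\<dots> \<le> ?W z" using ts(4)[of 0] by simp
      finally show ?thesis .
    qed
    then show "summable (\<lambda>n. ?h n z) \<and> (\<forall>N. \<bar>\<Sum>n<N. ?h n z\<bar> \<le> ?W z)" using ts(3) by blast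
  qed
  have "(\<lambda>N. \<integral>z. (\<Sum>n<N. ?h n z) \<partial>?P) \<longlonglongrightarrow> (\<integral>z. (\<Sum>n. ?h n z) \<partial>?P)"
  proof (rule integral_dominated_convergence[where w = ?W])
    show "AE z in ?P. (\<lambda>N. \<Sum>n<N. ?h n z) \<longlonglongrightarrow> (\<Sum>n. ?h n z)"
      using props by eventually_elim (auto dest: summable_LIMSEQ)
    show "AE z in ?P. norm (\<Sum>n<N. ?h n z) \<le> ?W z" for N
      using props by eventually_elim auto
  qed (use iW in auto)
  moreover have "integrate_vars v D x = (\<integral>z. (\<Sum>n. ?h n z) \<partial>?P)"
    unfolding integrate_vars_def cube_measure_def
  proof (rule integral_completion_AE_eq)
    show "AE z in ?P. D (override_on x z v) = (\<Sum>n. ?h n z)"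
      using good by eventually_elim (simp add: good_def)
  qed measurable
  moreover have "(\<integral>z. (\<Sum>n<N. ?h n z) \<partial>?P) = (\<Sum>n<N. tensor_mean d v \<tau> (L n) x)" for N
    by (rule has_bochner_integral_integral_eq[OF hbN])
  ultimately show "(\<lambda>n. tensor_mean d v \<tau> (L n) x) sums integrate_vars v D x"
    unfolding sums_def by (simp only:)
  have "\<bar>\<Sum>n<N. tensor_mean d v \<tau> (L n) x\<bar> = \<bar>\<integral>z. (\<Sum>n<N. ?h n z) \<partial>?P\<bar>"
    by (simp only: has_bochner_integral_integral_eq[OF hbN])
  also have "\<dots> \<le> (\<integral>z. \<bar>\<Sum>n<N. ?h n z\<bar> \<partial>?P)" by (rule integral_abs_bound)
  also have "\<dots> \<le> (\<integral>z. ?W z \<partial>?P)"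
  proof (rule integral_mono_AE)
    show "integrable ?P (\<lambda>z. \<bar>\<Sum>n<N. ?h n z\<bar>)" using hbN[of N] by (intro integrable_abs integrable.intros)
    show "AE z in ?P. \<bar>\<Sum>n<N. ?h n z\<bar> \<le> ?W z" using props by eventually_elim auto
  qed (rule iW)
  finally show "\<bar>\<Sum>n<N. tensor_mean d v \<tau> (L n) x\<bar> \<le> (\<integral>z. ?W z \<partial>?P)" .
qed

lemma S_square_unit:
  assumes "top_vars \<tau> \<subseteq> v" "finite v"
  shows "(\<integral>\<^sup>+z. (S 0 (top_vars \<tau>) z)\<^sup>2 \<partial>unit_lborel_on v) < \<infinity>"
proof -
  let ?w = "top_vars \<tau>"
  have m: "(\<lambda>z. (S 0 ?w z)\<^sup>2) \<in> borel_measurable (lborel_on ?w)"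
    using S_measurable[OF top_vars_subset(1)[of \<tau>] order_refl, of 0] by measurable
  have "S 0 ?w (restrict z ?w) = S 0 ?w z" for z by (rule S_cong) simp
  then have "(\<integral>\<^sup>+z. (S 0 ?w z)\<^sup>2 \<partial>unit_lborel_on v)
     = (\<integral>\<^sup>+z. (S 0 ?w (restrict z ?w))\<^sup>2 \<partial>unit_lborel_on v)" by simp
  also have "\<dots> \<le> (\<integral>\<^sup>+z. (S 0 ?w z)\<^sup>2 \<partial>lborel_on ?w)"
    by (rule nn_integral_unit_PiM_restrict_le[OF assms(2,1) m])
  also have "\<dots> < \<infinity>" by (rule S_square_integral[OF top_vars_subset(1)])
  finally show ?thesis .
qed

lemma S_measurable_unit:
  assumes "top_vars \<tau> \<subseteq> v" "finite v"
  shows "S 0 (top_vars \<tau>) \<in> borel_measurable (unit_lborel_on v)"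
  by (rule unit_PiM_measurable[OF assms(2) S_measurable[OF top_vars_subset(1) assms(1)]])

lemma finite_measure_unit_PiM: "finite v \<Longrightarrow> finite_measure (unit_lborel_on v)"
  by (rule finite_measureI) (simp add: emeasure_space_unit_PiM)

lemma override_on_unit_cube:
  assumes "x \<in> unit_cube d" "z \<in> space (unit_lborel_on v)" "v \<subseteq> {..<d}"
  shows "override_on x z v \<in> unit_cube d"
  using assms by (auto simp: unit_cube_def space_PiM PiE_iff extensional_def override_on_def space_restrict_space)

lemma override_on_unit_cube_complement:
  assumes "y \<in> space (unit_lborel_on w)" "w \<subseteq> {..<d}"
    "z \<in> space (unit_lborel_on ({..<d} - w))"
  shows "override_on y z ({..<d} - w) \<in> unit_cube d"
  using assms by (auto simp: unit_cube_def space_PiM PiE_iff extensional_def override_on_def space_restrict_space)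

text \<open>All top variables are integrated out, which absorbs the null set, so the claim holds at
  every \<open>x\<close>. This is the situation in the Bernoulli transform, where integration runs
  over the support.\<close>

lemma integrate_vars_sums_superset:
  assumes rep: "represents \<tau> D" and \<tau>: "\<And>j. j < d \<Longrightarrow> \<tau> j \<le> \<alpha>"
    and v: "v \<subseteq> {..<d}" "top_vars \<tau> \<subseteq> v" and x: "x \<in> unit_cube d"
  shows "(\<lambda>n. tensor_mean d v \<tau> (L n) x) sums integrate_vars v D x"
proof (rule integrate_vars_sums(1)[OF \<tau> v(1)])
  let ?w = "top_vars \<tau>" and ?P = "unit_lborel_on v"
  have fv: "finite v" using v finite_subset by blast
  interpret finite_measure ?P by (rule finite_measure_unit_PiM[OF fv])
  obtain N where N: "N \<in> null_sets (lborel_on ?w)" and N2: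
    "\<And>x. x \<in> unit_cube d \<Longrightarrow> restrict x ?w \<notin> N \<Longrightarrow>
     S 0 ?w x < \<infinity> \<and> (\<forall>j\<in>?w. x j \<noteq> 1) \<and> D x = (\<Sum>n. tensor_deriv d \<tau> (L n) x)"
    using rep unfolding represents_def by blast
  show "AE z in ?P. good \<tau> D (override_on x z v)"
    using AE_unit_PiM_restrict_notin[OF fv v(2) N] AE_space[of ?P]
  proof eventually_elim
    case (elim z)
    have "restrict (override_on x z v) ?w = restrict z ?w"
      using v(2) by (auto simp: restrict_def override_on_def fun_eq_iff)
    with elim show ?case
      unfolding good_def using N2 override_on_unit_cube[OF x elim(2) v(1)] by auto
  qed
  have Sz: "S 0 ?w (override_on x z v) = S 0 ?w z" for z
    by (rule S_cong) (use v(2) in \<open>auto simp: override_on_def\<close>)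
  have m: "(\<lambda>z. enn2real (S 0 ?w z)) \<in> borel_measurable ?P"
    using S_measurable_unit[OF v(2) fv] by measurable
  have i2: "integrable ?P (\<lambda>z. (enn2real (S 0 ?w z))\<^sup>2)"
    by (rule integrable_power2_of_nn[OF S_measurable_unit[OF v(2) fv] S_square_unit[OF v(2) fv]])
  have "integrable ?P (\<lambda>z. enn2real (S 0 ?w z) * 1)"
    by (rule integrable_mult_of_squares[OF i2 _ m]) auto
  then show "integrable ?P (\<lambda>z. enn2real (S 0 ?w (override_on x z v)))" unfolding Sz by simp
qed

text \<open>The opposite situation, from \<open>sobolev_inner\<close>: the top variables stay. The
  claim holds for almost all of them, and then no exceptional point remains in the other variables.
  The bound is the majorant for the outer integral.\<close>

lemma integrate_vars_sums_complement:
  assumes rep: "represents \<tau> D" and \<tau>: "\<And>j. j < d \<Longrightarrow> \<tau> j \<le> \<alpha>"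
  shows "AE y in unit_lborel_on (top_vars \<tau>).
    (\<lambda>n. tensor_mean d ({..<d} - top_vars \<tau>) \<tau> (L n) y) sums integrate_vars ({..<d} - top_vars \<tau>) D y
    \<and> (\<forall>N. \<bar>\<Sum>n<N. tensor_mean d ({..<d} - top_vars \<tau>) \<tau> (L n) y\<bar> \<le> C * enn2real (S 0 (top_vars \<tau>) y))"
proof -
  let ?w = "top_vars \<tau>" and ?v = "{..<d} - top_vars \<tau>"
  let ?P = "unit_lborel_on ?v" and ?Q = "unit_lborel_on ?w"
  interpret finite_measure ?P by (rule finite_measure_unit_PiM) simp
  obtain N where N: "N \<in> null_sets (lborel_on ?w)" and N2:
    "\<And>x. x \<in> unit_cube d \<Longrightarrow> restrict x ?w \<notin> N \<Longrightarrow>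
     S 0 ?w x < \<infinity> \<and> (\<forall>j\<in>?w. x j \<noteq> 1) \<and> D x = (\<Sum>n. tensor_deriv d \<tau> (L n) x)"
    using rep unfolding represents_def by blast
  show ?thesis
    using AE_unit_PiM_restrict_notin[OF top_vars_subset(2) order_refl N] AE_space[of ?Q]
  proof eventually_elim
    case (elim y)
    have eq: "restrict (override_on y z ?v) ?w = restrict y ?w" for z
      by (auto simp: restrict_def override_on_def fun_eq_iff)
    have Sz: "S 0 ?w (override_on y z ?v) = S 0 ?w y" for z
      by (rule S_cong) (auto simp: override_on_def)
    have g: "AE z in ?P. good \<tau> D (override_on y z ?v)"
    proof (rule AE_I2)
      fix z assume z: "z \<in> space ?P"
      have c: "override_on y z ?v \<in> unit_cube d"
        by (rule override_on_unit_cube_complement[OF elim(2) top_vars_subset(1) z])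
      show "good \<tau> D (override_on y z ?v)"
        unfolding good_def using N2[OF c] eq elim(1) c by simp
    qed
    have i: "integrable ?P (\<lambda>z. enn2real (S 0 ?w (override_on y z ?v)))" unfolding Sz by simp
    have "measure ?P (space ?P) = 1" using emeasure_space_unit_PiM[of ?v] by (simp add: measure_def)
    then have "(\<integral>z. C * enn2real (S 0 ?w (override_on y z ?v)) \<partial>?P) = C * enn2real (S 0 ?w y)" unfolding Sz by simp
    then show ?case
      using integrate_vars_sums[OF \<tau> _ g i] by auto
  qed
qed

end

section \<open>The Bernoulli transform of a tensor\<close>

text \<open>The transform in dimension 1.\<close>

definition bernoulli_remainder :: "nat \<Rightarrow> jet \<Rightarrow> real \<Rightarrow> real" where
  "bernoulli_remainder \<alpha> G t = G 0 t - (\<Sum>k\<in>{1..\<alpha>}. bernoulli_poly k t / fact k * (LBINT s. G k s))"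

definition tensor_transform :: "nat \<Rightarrow> nat \<Rightarrow> tensor \<Rightarrow> point \<Rightarrow> real" where
  "tensor_transform \<alpha> d L x = (\<Sum>J\<leftarrow>L. \<Prod>j<d. bernoulli_remainder \<alpha> (J j) (x j))"

text \<open>Expand the product of the one-dimensional transforms: order 0 in a coordinate keeps the
  value, any other order contributes minus a Bernoulli polynomial times a mean, and the signs
  collect to the power of the size of the support.\<close>

lemma tensor_transform_eq_sum:
  "tensor_transform \<alpha> d L x = (\<Sum>\<tau>\<in>multi_indices d \<alpha>.
     (- 1) ^ card (supp d \<tau>) * (\<Prod>j\<in>supp d \<tau>. bernoulli_poly (\<tau> j) (x j) / fact (\<tau> j)) * tensor_mean d (supp d \<tau>) \<tau> L x)"
proof -
  let ?u = "\<lambda>J j k. if k = 0 then J j 0 (x j) else - (bernoulli_poly k (x j) / fact k) * (LBINT s. J j k s)"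
  have r: "bernoulli_remainder \<alpha> (J j) (x j) = (\<Sum>k\<le>\<alpha>. ?u J j k)" for J :: "nat \<Rightarrow> jet" and j
  proof -
    have "(\<Sum>k\<le>\<alpha>. ?u J j k) = ?u J j 0 + (\<Sum>k\<in>{1..\<alpha>}. ?u J j k)"
      unfolding atMost_atLeast0 by (subst sum.atLeast_Suc_atMost) auto
    also have "(\<Sum>k\<in>{1..\<alpha>}. ?u J j k) = - (\<Sum>k\<in>{1..\<alpha>}. bernoulli_poly k (x j) / fact k * (LBINT s. J j k s))"
      unfolding sum_negf[symmetric] by (rule sum.cong) auto
    finally show ?thesis unfolding bernoulli_remainder_def by simp
  qed
  have "tensor_transform \<alpha> d L x = (\<Sum>J\<leftarrow>L. \<Sum>\<tau>\<in>multi_indices d \<alpha>. \<Prod>j<d. ?u J j (\<tau> j))"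
    unfolding tensor_transform_def r multi_indices_def by (subst prod_sum_PiE) auto
  also have "\<dots> = (\<Sum>\<tau>\<in>multi_indices d \<alpha>. \<Sum>J\<leftarrow>L. \<Prod>j<d. ?u J j (\<tau> j))"
    unfolding sum_list_conv_sum by (rule sum.swap)
  also have "\<dots> = (\<Sum>\<tau>\<in>multi_indices d \<alpha>.
     (- 1) ^ card (supp d \<tau>) * (\<Prod>j\<in>supp d \<tau>. bernoulli_poly (\<tau> j) (x j) / fact (\<tau> j)) * tensor_mean d (supp d \<tau>) \<tau> L x)"
  proof (rule sum.cong[OF refl])
    fix \<tau>
    let ?c = "(- 1) ^ card (supp d \<tau>) * (\<Prod>j\<in>supp d \<tau>. bernoulli_poly (\<tau> j) (x j) / fact (\<tau> j))"
    have sd: "supp d \<tau> \<subseteq> {..<d}" by (auto simp: supp_def)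
    have c: "?c = (\<Prod>j<d. if j \<in> supp d \<tau> then - (bernoulli_poly (\<tau> j) (x j) / fact (\<tau> j)) else 1)"
    proof -
      have "?c = (\<Prod>j\<in>supp d \<tau>. - (bernoulli_poly (\<tau> j) (x j) / fact (\<tau> j)))"
        by (simp add: prod_constant[symmetric] prod.distrib[symmetric] del: prod_constant)
      also have "\<dots> = (\<Prod>j<d. if j \<in> supp d \<tau> then - (bernoulli_poly (\<tau> j) (x j) / fact (\<tau> j)) else 1)"
        using sd by (subst prod.inter_restrict[symmetric]) (auto simp: Int_absorb1)
      finally show ?thesis .
    qed
    have "(\<Prod>j<d. ?u J j (\<tau> j)) = ?c * (\<Prod>j<d. if j \<in> supp d \<tau> then (LBINT t. J j (\<tau> j) t) else J j (\<tau> j) (x j))" for J :: "nat \<Rightarrow> jet"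
      unfolding c prod.distrib[symmetric] by (rule prod.cong) (auto simp: supp_def)
    then show "(\<Sum>J\<leftarrow>L. \<Prod>j<d. ?u J j (\<tau> j)) = ?c * tensor_mean d (supp d \<tau>) \<tau> L x"
      unfolding tensor_mean_def sum_list_conv_sum sum_distrib_left by (simp only:)
  qed
  finally show ?thesis .
qed

text \<open>Top variables lie in the support because \<open>\<alpha> \<ge> 1\<close>. The zero
  multi-index, excluded from the sum in \<open>bernoulli_transform\<close>, accounts for
  \<open>f\<close> itself.\<close>

lemma (in tensor_series) bernoulli_transform_sums:
  assumes f: "\<And>x. x \<in> unit_cube d \<Longrightarrow> (\<lambda>n. tensor_deriv d (\<lambda>_. 0) (L n) x) sums f x"
    and x: "x \<in> unit_cube d"
  shows "(\<lambda>n. tensor_transform \<alpha> d (L n) x) sums bernoulli_transform \<alpha> d f x"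
proof -
  let ?z = "\<lambda>j\<in>{..<d}. 0::nat"
  let ?c = "\<lambda>\<tau>. (- 1) ^ card (supp d \<tau>) * (\<Prod>j\<in>supp d \<tau>. bernoulli_poly (\<tau> j) (x j) / fact (\<tau> j))"
  have z: "?z \<in> multi_indices d \<alpha>" by (auto simp: multi_indices_def)
  have s: "(\<lambda>n. tensor_mean d (supp d \<tau>) \<tau> (L n) x) sums integrate_vars (supp d \<tau>) (mixed_deriv d \<tau> f) x"
    if \<tau>: "\<tau> \<in> multi_indices d \<alpha>" for \<tau>
    by (rule integrate_vars_sums_superset[OF mixed_deriv_series[OF f multi_indices_le[OF \<tau>]] multi_indices_le[OF \<tau>] _ _ x])
      (use \<alpha> in \<open>auto simp: supp_def top_vars_def\<close>)
  have "(\<lambda>n. \<Sum>\<tau>\<in>multi_indices d \<alpha> - {?z}. ?c \<tau> * tensor_mean d (supp d \<tau>) \<tau> (L n) x)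
     sums (\<Sum>\<tau>\<in>multi_indices d \<alpha> - {?z}. ?c \<tau> * integrate_vars (supp d \<tau>) (mixed_deriv d \<tau> f) x)"
    by (intro sums_sum sums_mult s) auto
  then have "(\<lambda>n. tensor_deriv d (\<lambda>_. 0) (L n) x + (\<Sum>\<tau>\<in>multi_indices d \<alpha> - {?z}. ?c \<tau> * tensor_mean d (supp d \<tau>) \<tau> (L n) x))
     sums bernoulli_transform \<alpha> d f x"
    unfolding bernoulli_transform_def by (intro sums_add f x)
  moreover have "tensor_transform \<alpha> d (L n) x = tensor_deriv d (\<lambda>_. 0) (L n) x
      + (\<Sum>\<tau>\<in>multi_indices d \<alpha> - {?z}. ?c \<tau> * tensor_mean d (supp d \<tau>) \<tau> (L n) x)" for n
  proof -
    have "supp d ?z = {}" by (auto simp: supp_def)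
    then have "?c ?z * tensor_mean d (supp d ?z) ?z (L n) x = tensor_mean d {} ?z (L n) x" by simp
    also have "\<dots> = tensor_deriv d (\<lambda>_. 0) (L n) x"
      unfolding tensor_mean_def tensor_deriv_def by (intro arg_cong[where f = sum_list] map_cong refl prod.cong) auto
    finally show ?thesis
      unfolding tensor_transform_eq_sum by (subst sum.remove[OF finite_multi_indices z]) simp
  qed
  ultimately show ?thesis by simp
qed

text \<open>For each multi-index the partial sums of both series converge almost everywhere in the
  top variables, under majorants with integrable squares; the product of these majorants is
  integrable, and dominated convergence applies.\<close>

theorem sobolev_inner_limit:
  assumes "tensor_series d \<alpha> L C" "tensor_series d \<alpha> M C'"
    and f: "\<And>x. x \<in> unit_cube d \<Longrightarrow> (\<lambda>n. tensor_deriv d (\<lambda>_. 0) (L n) x) sums f x"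
    and g: "\<And>x. x \<in> unit_cube d \<Longrightarrow> (\<lambda>n. tensor_deriv d (\<lambda>_. 0) (M n) x) sums g x"
  shows "(\<lambda>N. \<Sum>n<N. \<Sum>m<N. tensor_inner \<alpha> d (L n) (M m)) \<longlonglongrightarrow> sobolev_inner \<alpha> d f g"
proof -
  interpret F: tensor_series d \<alpha> L C by fact
  interpret G: tensor_series d \<alpha> M C' by fact
  let ?w = "\<lambda>\<tau>. {j. j < d \<and> \<tau> j = \<alpha>}"
  let ?P = "\<lambda>\<tau>. unit_lborel_on (?w \<tau>)"
  let ?mL = "\<lambda>\<tau> n y. tensor_mean d ({..<d} - ?w \<tau>) \<tau> (L n) y"
  let ?mM = "\<lambda>\<tau> n y. tensor_mean d ({..<d} - ?w \<tau>) \<tau> (M n) y"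
  have lim: "(\<lambda>N. \<Sum>n<N. \<Sum>m<N. \<integral>y. ?mL \<tau> n y * ?mM \<tau> m y \<partial>?P \<tau>) \<longlonglongrightarrow>
      (\<integral>x. integrate_vars ({..<d} - ?w \<tau>) (mixed_deriv d \<tau> f) x * integrate_vars ({..<d} - ?w \<tau>) (mixed_deriv d \<tau> g) x \<partial>cube_measure (?w \<tau>))"
    if \<tau>: "\<tau> \<in> multi_indices d \<alpha>" for \<tau>
  proof -
    let ?Q = "?P \<tau>" and ?v = "{..<d} - ?w \<tau>"
    let ?WL = "\<lambda>y. enn2real (F.S 0 (?w \<tau>) y)" and ?WM = "\<lambda>y. enn2real (G.S 0 (?w \<tau>) y)"
    note le = multi_indices_le[OF \<tau>]
    have fw: "finite (?w \<tau>)" by simp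
    have aeF: "AE y in ?Q. (\<lambda>n. ?mL \<tau> n y) sums integrate_vars ?v (mixed_deriv d \<tau> f) y \<and> (\<forall>N. \<bar>\<Sum>n<N. ?mL \<tau> n y\<bar> \<le> C * ?WL y)"
      using F.integrate_vars_sums_complement[OF F.mixed_deriv_series[OF f le] le] unfolding F.top_vars_def .
    have aeG: "AE y in ?Q. (\<lambda>n. ?mM \<tau> n y) sums integrate_vars ?v (mixed_deriv d \<tau> g) y \<and> (\<forall>N. \<bar>\<Sum>n<N. ?mM \<tau> n y\<bar> \<le> C' * ?WM y)"
      using G.integrate_vars_sums_complement[OF G.mixed_deriv_series[OF g le] le] unfolding G.top_vars_def .
    have mm: "?mL \<tau> n \<in> borel_measurable ?Q" "?mM \<tau> n \<in> borel_measurable ?Q" for n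
    proof -
      have "(\<lambda>y. tensor_mean d ?v \<tau> K y) \<in> borel_measurable ?Q" if K: "jet_tensors \<alpha> d K" for K
      proof -
        have c: "(\<lambda>y. if j \<in> ?v then (LBINT t. (K ! i) j (\<tau> j) t) else (K ! i) j (\<tau> j) (y j)) \<in> borel_measurable ?Q"
          if ij: "i < length K" "j < d" for i j
        proof (cases "j \<in> ?v")
          case False
          then have jw: "j \<in> ?w \<tau>" using ij by auto
          have "(K ! i) j (\<tau> j) \<in> borel_measurable unit_lborel"
            using sobolev_jetD(1)[OF jet_tensorsD[OF K ij] le[OF ij(2)]] by (intro measurable_restrict_space1) simp
          from measurable_compose[OF measurable_component_singleton[OF jw] this]
          show ?thesis using False by simp
        qed simp
        show ?thesis unfolding tensor_mean_def sum_list_conv_sum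
          by (intro borel_measurable_sum borel_measurable_prod c) auto
      qed
      then show "?mL \<tau> n \<in> borel_measurable ?Q" "?mM \<tau> n \<in> borel_measurable ?Q" using F.jets G.jets by blast+
    qed
    note [measurable] = mm
    let ?If = "\<lambda>y. \<Sum>n. ?mL \<tau> n y" and ?Ig = "\<lambda>y. \<Sum>n. ?mM \<tau> n y"
    have tF: "F.top_vars \<tau> \<subseteq> ?w \<tau>" and tG: "G.top_vars \<tau> \<subseteq> ?w \<tau>" by (auto simp: F.top_vars_def G.top_vars_def)
    have WLm: "?WL \<in> borel_measurable ?Q" and WMm: "?WM \<in> borel_measurable ?Q"
      using F.S_measurable_unit[OF tF fw] G.S_measurable_unit[OF tG fw] unfolding F.top_vars_def G.top_vars_def
      by measurable
    have "integrable ?Q (\<lambda>y. ?WL y * ?WM y)"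
    proof (rule integrable_mult_of_squares[OF _ _ WLm WMm])
      show "integrable ?Q (\<lambda>y. (?WL y)\<^sup>2)"
        using integrable_power2_of_nn[OF F.S_measurable_unit[OF tF fw] F.S_square_unit[OF tF fw]] unfolding F.top_vars_def .
      show "integrable ?Q (\<lambda>y. (?WM y)\<^sup>2)"
        using integrable_power2_of_nn[OF G.S_measurable_unit[OF tG fw] G.S_square_unit[OF tG fw]] unfolding G.top_vars_def .
    qed
    then have iW: "integrable ?Q (\<lambda>y. (C * C') * (?WL y * ?WM y))" by simp
    have "(\<lambda>N. \<integral>y. (\<Sum>n<N. ?mL \<tau> n y) * (\<Sum>m<N. ?mM \<tau> m y) \<partial>?Q) \<longlonglongrightarrow> (\<integral>y. ?If y * ?Ig y \<partial>?Q)"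
    proof (rule integral_dominated_convergence[OF _ _ iW])
      show "AE y in ?Q. (\<lambda>N. (\<Sum>n<N. ?mL \<tau> n y) * (\<Sum>m<N. ?mM \<tau> m y)) \<longlonglongrightarrow> ?If y * ?Ig y"
        using aeF aeG
      proof eventually_elim
        case (elim y)
        from elim have "(\<lambda>n. ?mL \<tau> n y) sums ?If y" "(\<lambda>n. ?mM \<tau> n y) sums ?Ig y"
          by (auto intro: summable_sums sums_summable)
        then show ?case unfolding sums_def by (rule tendsto_mult)
      qed
      show "AE y in ?Q. norm ((\<Sum>n<N. ?mL \<tau> n y) * (\<Sum>m<N. ?mM \<tau> m y)) \<le> (C * C') * (?WL y * ?WM y)" for N
        using aeF aeG
      proof eventually_elim
        case (elim y)
        have "\<bar>\<Sum>n<N. ?mL \<tau> n y\<bar> * \<bar>\<Sum>m<N. ?mM \<tau> m y\<bar> \<le> (C * ?WL y) * (C' * ?WM y)"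
          by (rule mult_mono) (use elim F.C(1) in auto)
        then show ?case by (simp add: abs_mult mult_ac)
      qed
    qed measurable
    moreover have "(\<integral>x. integrate_vars ?v (mixed_deriv d \<tau> f) x * integrate_vars ?v (mixed_deriv d \<tau> g) x \<partial>cube_measure (?w \<tau>))
       = (\<integral>y. ?If y * ?Ig y \<partial>?Q)"
      unfolding cube_measure_def
    proof (rule integral_completion_AE_eq)
      show "AE y in ?Q. integrate_vars ?v (mixed_deriv d \<tau> f) y * integrate_vars ?v (mixed_deriv d \<tau> g) y = ?If y * ?Ig y"
        using aeF aeG by eventually_elim (simp add: sums_iff)
    qed measurable
    moreover have "(\<integral>y. (\<Sum>n<N. ?mL \<tau> n y) * (\<Sum>m<N. ?mM \<tau> m y) \<partial>?Q) = (\<Sum>n<N. \<Sum>m<N. \<integral>y. ?mL \<tau> n y * ?mM \<tau> m y \<partial>?Q)" for N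
    proof -
      have i: "integrable ?Q (\<lambda>y. ?mL \<tau> n y * ?mM \<tau> m y)" for n m
        using has_bochner_integral_tensor_mean_mult[OF F.jets G.jets le refl] by (rule integrable.intros)
      show ?thesis unfolding sum_product
        by (subst Bochner_Integration.integral_sum) (auto intro!: Bochner_Integration.integrable_sum i sum.cong Bochner_Integration.integral_sum)
    qed
    ultimately show ?thesis by simp
  qed
  have "(\<lambda>N. \<Sum>\<tau>\<in>multi_indices d \<alpha>. \<Sum>n<N. \<Sum>m<N. \<integral>y. ?mL \<tau> n y * ?mM \<tau> m y \<partial>?P \<tau>) \<longlonglongrightarrow> sobolev_inner \<alpha> d f g"
    unfolding sobolev_inner_def Let_def by (intro tendsto_sum lim)
  moreover have "(\<Sum>\<tau>\<in>multi_indices d \<alpha>. \<Sum>n<N. \<Sum>m<N. \<integral>y. ?mL \<tau> n y * ?mM \<tau> m y \<partial>?P \<tau>) = (\<Sum>n<N. \<Sum>m<N. tensor_inner \<alpha> d (L n) (M m))" for N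
    unfolding tensor_inner_eq_sum[OF F.jets G.jets] Let_def
    by (simp only: sum.swap[of _ _ "multi_indices d \<alpha>"])
  ultimately show ?thesis by simp
qed

section \<open>Fourier expansion in one variable\<close>

text \<open>The derivatives of a cosine: each one multiplies by the angular frequency and advances
  the phase by \<open>pi / 2\<close>. Jets are real, so the phases 0 and \<open>- (pi / 2)\<close>
  supply cosine and sine in place of a character.\<close>

definition wave :: "int \<Rightarrow> real \<Rightarrow> jet" where
  "wave h c k t = (2 * pi * of_int h) ^ k * cos (2 * pi * of_int h * t + c + real k * (pi / 2))"

lemma smooth_jet_wave: "smooth_jet (wave h c)"
  unfolding smooth_jet_def
proof (intro allI)
  fix k t
  have "(wave h c k has_real_derivative (2 * pi * of_int h) ^ k * (- sin (2 * pi * of_int h * t + c + real k * (pi / 2)) * (2 * pi * of_int h))) (at t)"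
    unfolding wave_def[abs_def] by (auto intro!: derivative_eq_intros)
  moreover have "wave h c (Suc k) t = (2 * pi * of_int h) ^ k * (- sin (2 * pi * of_int h * t + c + real k * (pi / 2)) * (2 * pi * of_int h))"
  proof -
    have "2 * pi * of_int h * t + c + real (Suc k) * (pi / 2) = (2 * pi * of_int h * t + c + real k * (pi / 2)) + pi / 2"
      by (simp add: algebra_simps add_divide_distrib)
    then show ?thesis unfolding wave_def by (simp only: cos_add) simp
  qed
  ultimately show "(wave h c k has_real_derivative wave h c (Suc k) t) (at t)" by simp
qed

lemma has_bochner_integral_cos_period:
  "has_bochner_integral lborel (\<lambda>t. indicator {0..1} t * cos (2 * pi * of_int m * t + c)) (if m = 0 then cos c else 0)"
proof (cases "m = 0")
  case True
  then show ?thesis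
    using has_bochner_integral_mult_left[OF has_bochner_integral_real_indicator[of "{0..1::real}" lborel], of "cos c"] by simp
next
  case False
  let ?F = "\<lambda>t. sin (2 * pi * of_int m * t + c) / (2 * pi * of_int m)"
  have "has_bochner_integral lborel (\<lambda>t. indicator {0..1} t *\<^sub>R cos (2 * pi * of_int m * t + c)) (?F 1 - ?F 0)"
  proof (rule has_bochner_integral_FTC_Icc)
    fix t :: real
    show "(?F has_vector_derivative cos (2 * pi * of_int m * t + c)) (at t within {0..1})"
      unfolding has_real_derivative_iff_has_vector_derivative[symmetric]
      using False by (auto intro!: derivative_eq_intros)
  qed (auto intro!: continuous_intros)
  moreover have "sin (2 * pi * of_int m + c) = sin c"
    using sin_int_2pin[of m] cos_int_2pin[of m] by (simp add: sin_add mult_ac)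
  ultimately show ?thesis using False by simp
qed

lemma has_bochner_integral_cos_mult:
  "has_bochner_integral lborel (\<lambda>t. indicator {0..1} t * (cos (2 * pi * of_int h * t + c) * cos (2 * pi * of_int l * t + b)))
     (((if h = l then cos (c - b) else 0) + (if h = - l then cos (c + b) else 0)) / 2)"
proof -
  have "indicator {0..1} t * (cos (2 * pi * of_int h * t + c) * cos (2 * pi * of_int l * t + b))
      = (indicator {0..1} t * cos (2 * pi * of_int (h - l) * t + (c - b)) + indicator {0..1} t * cos (2 * pi * of_int (h + l) * t + (c + b))) / 2" for t
  proof -
    have "cos (2 * pi * of_int h * t + c) * cos (2 * pi * of_int l * t + b)
      = (cos ((2 * pi * of_int h * t + c) - (2 * pi * of_int l * t + b)) + cos ((2 * pi * of_int h * t + c) + (2 * pi * of_int l * t + b))) / 2"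
      by (rule cos_times_cos)
    moreover have "(2 * pi * of_int h * t + c) - (2 * pi * of_int l * t + b) = 2 * pi * of_int (h - l) * t + (c - b)"
      "(2 * pi * of_int h * t + c) + (2 * pi * of_int l * t + b) = 2 * pi * of_int (h + l) * t + (c + b)"
      by (simp_all add: algebra_simps)
    ultimately show ?thesis by (simp only:) (simp add: algebra_simps add_divide_distrib)
  qed
  moreover have "has_bochner_integral lborel (\<lambda>t. (indicator {0..1} t * cos (2 * pi * of_int (h - l) * t + (c - b))
     + indicator {0..1} t * cos (2 * pi * of_int (h + l) * t + (c + b))) / 2)
     (((if h - l = 0 then cos (c - b) else 0) + (if h + l = 0 then cos (c + b) else 0)) / 2)"
    by (intro has_bochner_integral_divide_zero has_bochner_integral_add has_bochner_integral_cos_period)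
  moreover have "h - l = 0 \<longleftrightarrow> h = l" "h + l = 0 \<longleftrightarrow> h = - l" by auto
  ultimately show ?thesis by (simp only:)
qed

lemma wave_minus: "wave (- h) c = wave h (- c)"
proof (intro ext)
  fix k t
  let ?\<theta> = "2 * pi * of_int h * t"
  have "cos (2 * pi * of_int (- h) * t + c + real k * (pi / 2)) = cos (- (?\<theta> - c + real k * (pi / 2)) + real k * pi)"
    by (rule arg_cong[where f = cos]) (simp add: algebra_simps)
  also have "\<dots> = (- 1) ^ k * cos (?\<theta> - c + real k * (pi / 2))"
    by (simp only: cos_add cos_npi sin_npi cos_minus) simp
  finally have c: "cos (2 * pi * of_int (- h) * t + c + real k * (pi / 2)) = (- 1) ^ k * cos (?\<theta> - c + real k * (pi / 2))" .
  have p: "(2 * pi * of_int (- h)) ^ k = (- 1) ^ k * (2 * pi * of_int h) ^ k"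
    by (simp add: power_mult_distrib[symmetric])
  have "wave (- h) c k t = ((- 1) ^ k * (- 1) ^ k) * ((2 * pi * of_int h) ^ k * cos (?\<theta> - c + real k * (pi / 2)))"
    unfolding wave_def c p by (simp only: mult_ac)
  then show "wave (- h) c k t = wave h (- c) k t"
    by (simp add: wave_def power_mult_distrib[symmetric])
qed

lemma wave_add_pi: "wave h (c + pi) k t = - wave h c k t"
proof -
  have "2 * pi * of_int h * t + (c + pi) + real k * (pi / 2) = (2 * pi * of_int h * t + c + real k * (pi / 2)) + pi" by simp
  then show ?thesis unfolding wave_def by (simp only: cos_periodic_pi mult_minus_right)
qed

lemma wave_shift: "wave h (- (2 * pi * of_int h * y)) k t = cos (2 * pi * of_int h * y) * wave h 0 k t + sin (2 * pi * of_int h * y) * wave h (- (pi / 2)) k t"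
proof -
  let ?a = "2 * pi * of_int h * t + real k * (pi / 2)" and ?b = "2 * pi * of_int h * y"
  have "cos (2 * pi * of_int h * t + - ?b + real k * (pi / 2)) = cos ?a * cos ?b + sin ?a * sin ?b"
    using cos_diff[of ?a ?b] by (simp add: algebra_simps)
  moreover have "cos (2 * pi * of_int h * t + - (pi / 2) + real k * (pi / 2)) = sin ?a"
    using cos_diff[of ?a "pi / 2"] by (simp add: algebra_simps)
  ultimately show ?thesis unfolding wave_def by (simp add: algebra_simps)
qed

text \<open>For the phases 0 and \<open>- (pi / 2)\<close> these are the real part and minus the
  imaginary part of the inner product of \<open>G\<close> with the character of frequency
  \<open>h\<close>.\<close>

definition jet_coeff :: "nat \<Rightarrow> jet \<Rightarrow> int \<Rightarrow> real \<Rightarrow> real" where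
  "jet_coeff \<alpha> G h c = jet_inner \<alpha> G (restrict_jet (wave h c))"

lemma integral_restrict_wave:
  "(LBINT t. restrict_jet (wave h c) k t) = (if h = 0 \<and> k = 0 then cos c else 0)"
proof -
  have "(LBINT t. restrict_jet (wave h c) k t)
     = (LBINT t. (2 * pi * of_int h) ^ k * (indicator {0..1} t * cos (2 * pi * of_int h * t + (c + real k * (pi / 2)))))"
    by (intro lintegral_cong) (auto simp: restrict_jet_def wave_def algebra_simps)
  also have "\<dots> = (2 * pi * of_int h) ^ k * (if h = 0 then cos (c + real k * (pi / 2)) else 0)"
    using has_bochner_integral_integral_eq[OF has_bochner_integral_cos_period] by simp
  finally show ?thesis by (cases k) auto
qed

text \<open>Waves and their derivatives have mean 0, apart from the constant wave, so the orders
  below \<alpha> contribute only at frequency 0.\<close>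

lemma jet_coeff_eq:
  assumes "\<alpha> \<ge> 1"
  shows "jet_coeff \<alpha> G h c = (if h = 0 then (LBINT t. G 0 t) * cos c else 0) + (LBINT t. G \<alpha> t * restrict_jet (wave h c) \<alpha> t)"
proof -
  have "(\<Sum>k<\<alpha>. (LBINT t. G k t) * (LBINT t. restrict_jet (wave h c) k t))
     = (\<Sum>k<\<alpha>. if k = 0 then (if h = 0 then (LBINT t. G 0 t) * cos c else 0) else 0)"
    unfolding integral_restrict_wave by (rule sum.cong) auto
  also have "\<dots> = (if h = 0 then (LBINT t. G 0 t) * cos c else 0)"
    using assms by (simp add: sum.delta)
  finally show ?thesis unfolding jet_coeff_def jet_inner_def by simp
qed

lemma korobov_weight1_pos: "korobov_weight1 \<alpha> h > 0"
  by (simp add: korobov_weight1_def)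

lemma korobov_weight1_minus: "korobov_weight1 \<alpha> (- h) = korobov_weight1 \<alpha> h"
  by (simp add: korobov_weight1_def)

lemma korobov_weight1_square:
  assumes "h \<noteq> 0"
  shows "(2 * pi * of_int h) ^ \<alpha> * (2 * pi * of_int h) ^ \<alpha> = (korobov_weight1 \<alpha> h)\<^sup>2"
proof -
  have "korobov_weight1 \<alpha> h = \<bar>(2 * pi * of_int h) ^ \<alpha>\<bar>"
    using assms by (simp only: korobov_weight1_def if_False power_abs)
  then show ?thesis by (simp only: power2_abs power2_eq_square[symmetric])
qed

text \<open>Waves of frequencies \<open>h\<close> and \<open>- h\<close> span the same functions,
  hence two terms of weight one half; at frequency 0 both are present.\<close>

lemma jet_inner_wave_wave:
  assumes "\<alpha> \<ge> 1"
  shows "jet_coeff \<alpha> (restrict_jet (wave h c)) l b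
    = (korobov_weight1 \<alpha> h)\<^sup>2 * (((if h = l then cos (c - b) else 0) + (if h = - l then cos (c + b) else 0)) / 2)"
proof -
  let ?a = "c + real \<alpha> * (pi / 2)" and ?b = "b + real \<alpha> * (pi / 2)"
  have "(LBINT t. restrict_jet (wave h c) \<alpha> t * restrict_jet (wave l b) \<alpha> t)
     = (\<integral>t. ((2 * pi * of_int h) ^ \<alpha> * (2 * pi * of_int l) ^ \<alpha>)
         * (indicator {0..1} t * (cos (2 * pi * of_int h * t + ?a) * cos (2 * pi * of_int l * t + ?b))) \<partial>lborel)"
    by (intro lintegral_cong) (auto simp: restrict_jet_def wave_def algebra_simps indicator_def)
  also have "\<dots> = (2 * pi * of_int h) ^ \<alpha> * (2 * pi * of_int l) ^ \<alpha> *
     (((if h = l then cos (?a - ?b) else 0) + (if h = - l then cos (?a + ?b) else 0)) / 2)"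
    using has_bochner_integral_integral_eq[OF has_bochner_integral_cos_mult[of h ?a l ?b]] by (simp only: integral_mult_right_zero)
  also have "?a - ?b = c - b" by simp
  also have "cos (?a + ?b) = (- 1) ^ \<alpha> * cos (c + b)"
  proof -
    have "?a + ?b = (c + b) + real \<alpha> * pi" by (simp add: algebra_simps)
    then show ?thesis by (simp only: cos_add cos_npi sin_npi) simp
  qed
  finally have top: "(LBINT t. restrict_jet (wave h c) \<alpha> t * restrict_jet (wave l b) \<alpha> t) =
    (2 * pi * of_int h) ^ \<alpha> * (2 * pi * of_int l) ^ \<alpha> *
     (((if h = l then cos (c - b) else 0) + (if h = - l then (- 1) ^ \<alpha> * cos (c + b) else 0)) / 2)" .
  consider "h = 0" | "h \<noteq> 0" "h = l" | "h \<noteq> 0" "h = - l" | "h \<noteq> l" "h \<noteq> - l" "h \<noteq> 0" by metis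
  then show ?thesis
  proof cases
    case 1
    then have z: "(2 * pi * of_int h) ^ \<alpha> = 0" using assms by simp
    show ?thesis
    proof (cases "l = 0")
      case True
      have "cos c * cos b = (cos (c - b) + cos (c + b)) / 2" by (rule cos_times_cos)
      then show ?thesis unfolding jet_coeff_eq[OF assms] top integral_restrict_wave z using 1 True
        by (simp add: korobov_weight1_def)
    next
      case False
      then show ?thesis unfolding jet_coeff_eq[OF assms] top integral_restrict_wave z using 1
        by (simp add: korobov_weight1_def)
    qed
  next
    case 2
    have "h \<noteq> - l" using 2 by linarith
    then show ?thesis unfolding jet_coeff_eq[OF assms] top integral_restrict_wave
      using 2 korobov_weight1_square[OF 2(1), of \<alpha>] by (simp only: if_True if_False simp_thms)
  next
    case 3
    have hl: "h \<noteq> l" "l \<noteq> 0" using 3 by linarith+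
    have "2 * pi * of_int h = 2 * pi * of_int l * (- 1)" using 3(2) by simp
    then have "(2 * pi * of_int l) ^ \<alpha> * (- 1) ^ \<alpha> = (2 * pi * of_int h) ^ \<alpha>" by (simp only: power_mult_distrib)
    then have "(2 * pi * of_int h) ^ \<alpha> * ((2 * pi * of_int l) ^ \<alpha> * (- 1) ^ \<alpha>) = (korobov_weight1 \<alpha> h)\<^sup>2"
      using korobov_weight1_square[OF 3(1), of \<alpha>] by (simp only:)
    then have "(2 * pi * of_int h) ^ \<alpha> * (2 * pi * of_int l) ^ \<alpha> * (((0::real) + (- 1) ^ \<alpha> * cos (c + b)) / 2)
      = (korobov_weight1 \<alpha> h)\<^sup>2 * ((0 + cos (c + b)) / 2)" by (simp only: add_0_left times_divide_eq_right mult.assoc[symmetric])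
    then show ?thesis unfolding jet_coeff_eq[OF assms] top integral_restrict_wave using 3(1,2) hl
      by (simp only: if_True if_False simp_thms)
  next
    case 4
    then show ?thesis unfolding jet_coeff_eq[OF assms] top integral_restrict_wave by simp
  qed
qed

text \<open>Symmetric, so that the contributions of \<open>h\<close> and \<open>- h\<close> combine
  to real sums.\<close>

definition freq_box :: "nat \<Rightarrow> int set" where "freq_box N = {- int N..int N}"

lemma finite_freq_box [simp]: "finite (freq_box N)"
  by (simp add: freq_box_def)

lemma freq_box_minus [simp]: "- h \<in> freq_box N \<longleftrightarrow> h \<in> freq_box N"
  by (auto simp: freq_box_def)

lemma sum_freq_box:
  fixes f :: "int \<Rightarrow> 'a::comm_monoid_add"
  shows "(\<Sum>h\<in>freq_box N. f h) = f 0 + (\<Sum>n\<in>{1..N}. f (int n) + f (- int n))"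
proof (induction N)
  case (Suc N)
  have "freq_box (Suc N) = insert (int (Suc N)) (insert (- int (Suc N)) (freq_box N))"
    by (auto simp: freq_box_def)
  then have "(\<Sum>h\<in>freq_box (Suc N). f h) = f (int (Suc N)) + (f (- int (Suc N)) + (\<Sum>h\<in>freq_box N. f h))"
    by (simp add: freq_box_def)
  then show ?case unfolding Suc.IH by (simp add: add_ac)
qed (simp add: freq_box_def)

lemma jet_inner_sum_right:
  assumes "finite I" "\<And>i. i \<in> I \<Longrightarrow> sobolev_jet \<alpha> (H i)" "sobolev_jet \<alpha> G"
  shows "jet_inner \<alpha> G (\<lambda>k t. \<Sum>i\<in>I. a i * H i k t) = (\<Sum>i\<in>I. a i * jet_inner \<alpha> G (H i))"
    and "sobolev_jet \<alpha> (\<lambda>k t. \<Sum>i\<in>I. a i * H i k t)"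
proof -
  have "jet_inner \<alpha> G (\<lambda>k t. \<Sum>i\<in>I. a i * H i k t) = (\<Sum>i\<in>I. a i * jet_inner \<alpha> G (H i))
     \<and> sobolev_jet \<alpha> (\<lambda>k t. \<Sum>i\<in>I. a i * H i k t)"
    using assms(1,2)
  proof (induction I rule: finite_induct)
    case empty
    have "sobolev_jet \<alpha> (\<lambda>k t. 0 * G k t + 0 * G k t)" by (rule sobolev_jet_linear_combination[OF assms(3,3)])
    then show ?case by (simp add: jet_inner_def)
  next
    case (insert i I)
    have i: "sobolev_jet \<alpha> (H i)" and IH: "sobolev_jet \<alpha> (\<lambda>k t. \<Sum>i\<in>I. a i * H i k t)"
      "jet_inner \<alpha> G (\<lambda>k t. \<Sum>i\<in>I. a i * H i k t) = (\<Sum>i\<in>I. a i * jet_inner \<alpha> G (H i))" using insert by auto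
    have eq: "(\<lambda>k t. \<Sum>i\<in>insert i I. a i * H i k t) = (\<lambda>k t. a i * H i k t + 1 * (\<Sum>i\<in>I. a i * H i k t))"
      using insert by simp
    show ?case
      unfolding eq using sobolev_jet_linear_combination[OF i IH(1), of "a i" 1]
        jet_inner_linear_left[OF i IH(1) assms(3), of "a i" 1] IH(2) insert.hyps
      by (simp add: jet_inner_commute[of \<alpha> G])
  qed
  then show "jet_inner \<alpha> G (\<lambda>k t. \<Sum>i\<in>I. a i * H i k t) = (\<Sum>i\<in>I. a i * jet_inner \<alpha> G (H i))"
    and "sobolev_jet \<alpha> (\<lambda>k t. \<Sum>i\<in>I. a i * H i k t)" by blast+
qed

text \<open>Partial sum of the expansion of the projection onto the Korobov space. Each summand is
  the real part of the term with the character of frequency \<open>h\<close>; the imaginary parts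
  cancel between \<open>h\<close> and \<open>- h\<close>.\<close>

definition partial_jet :: "nat \<Rightarrow> nat \<Rightarrow> jet \<Rightarrow> jet" where
  "partial_jet \<alpha> N G k t = (\<Sum>h\<in>freq_box N. (jet_coeff \<alpha> G h 0 * wave h 0 k t
     + jet_coeff \<alpha> G h (- (pi / 2)) * wave h (- (pi / 2)) k t) / (korobov_weight1 \<alpha> h)\<^sup>2)"

definition kernel_jet :: "nat \<Rightarrow> nat \<Rightarrow> real \<Rightarrow> jet" where
  "kernel_jet \<alpha> N y k t = (\<Sum>h\<in>freq_box N. wave h (- (2 * pi * of_int h * y)) k t / (korobov_weight1 \<alpha> h)\<^sup>2)"

lemma smooth_jet_sum: "finite I \<Longrightarrow> (\<And>i. i \<in> I \<Longrightarrow> smooth_jet (D i)) \<Longrightarrow> smooth_jet (\<lambda>k t. \<Sum>i\<in>I. D i k t)"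
  unfolding smooth_jet_def by (auto intro!: DERIV_sum)

lemma smooth_partial_jet: "smooth_jet (partial_jet \<alpha> N G)"
proof -
  have w: "(wave h c k has_real_derivative wave h c (Suc k) t) (at t)" for h c k t
    using smooth_jet_wave unfolding smooth_jet_def by blast
  show ?thesis
    unfolding partial_jet_def[abs_def]
  proof (rule smooth_jet_sum)
    fix h
    show "smooth_jet (\<lambda>k t. (jet_coeff \<alpha> G h 0 * wave h 0 k t + jet_coeff \<alpha> G h (- (pi / 2)) * wave h (- (pi / 2)) k t) / (korobov_weight1 \<alpha> h)\<^sup>2)"
      unfolding smooth_jet_def by (intro allI DERIV_cdivide DERIV_add DERIV_cmult w)
  qed simp
qed

lemma smooth_kernel_jet: "smooth_jet (kernel_jet \<alpha> N y)"
proof -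
  have w: "(wave h c k has_real_derivative wave h c (Suc k) t) (at t)" for h c k t
    using smooth_jet_wave unfolding smooth_jet_def by blast
  show ?thesis
    unfolding kernel_jet_def[abs_def]
  proof (rule smooth_jet_sum)
    fix h
    show "smooth_jet (\<lambda>k t. wave h (- (2 * pi * of_int h * y)) k t / (korobov_weight1 \<alpha> h)\<^sup>2)"
      unfolding smooth_jet_def by (intro allI DERIV_cdivide w)
  qed simp
qed

lemma sobolev_jet_restrict_wave: "sobolev_jet \<alpha> (restrict_jet (wave h c))"
  by (rule sobolev_jet_restrict_jet[OF smooth_jet_wave])

lemma jet_inner_wave_sum:
  assumes G: "sobolev_jet \<alpha> G"
  shows "jet_inner \<alpha> G (restrict_jet (\<lambda>k t. \<Sum>h\<in>freq_box N. (a h * wave h 0 k t + b h * wave h (- (pi / 2)) k t) / r h))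
    = (\<Sum>h\<in>freq_box N. (a h * jet_coeff \<alpha> G h 0 + b h * jet_coeff \<alpha> G h (- (pi / 2))) / r h)"
proof -
  let ?u = "restrict_jet (wave h 0)"
  let ?H = "\<lambda>h k t. (a h / r h) * restrict_jet (wave h 0) k t + (b h / r h) * restrict_jet (wave h (- (pi / 2))) k t"
  have H: "sobolev_jet \<alpha> (?H h)" for h
    by (intro sobolev_jet_linear_combination sobolev_jet_restrict_wave)
  have "restrict_jet (\<lambda>k t. \<Sum>h\<in>freq_box N. (a h * wave h 0 k t + b h * wave h (- (pi / 2)) k t) / r h)
     = (\<lambda>k t. \<Sum>h\<in>freq_box N. 1 * ?H h k t)"
    by (intro ext) (simp add: restrict_jet_def sum_distrib_left algebra_simps add_divide_distrib)
  then have "jet_inner \<alpha> G (restrict_jet (\<lambda>k t. \<Sum>h\<in>freq_box N. (a h * wave h 0 k t + b h * wave h (- (pi / 2)) k t) / r h))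
     = (\<Sum>h\<in>freq_box N. 1 * jet_inner \<alpha> G (?H h))"
    using jet_inner_sum_right(1)[of "freq_box N" \<alpha> ?H G "\<lambda>_. 1"] H G by simp
  also have "\<dots> = (\<Sum>h\<in>freq_box N. (a h * jet_coeff \<alpha> G h 0 + b h * jet_coeff \<alpha> G h (- (pi / 2))) / r h)"
  proof (rule sum.cong[OF refl])
    fix h
    have "jet_inner \<alpha> (?H h) G = a h / r h * jet_inner \<alpha> (restrict_jet (wave h 0)) G + b h / r h * jet_inner \<alpha> (restrict_jet (wave h (- (pi / 2)))) G"
      by (rule jet_inner_linear_left[OF sobolev_jet_restrict_wave sobolev_jet_restrict_wave G])
    then show "1 * jet_inner \<alpha> G (?H h) = (a h * jet_coeff \<alpha> G h 0 + b h * jet_coeff \<alpha> G h (- (pi / 2))) / r h"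
      unfolding jet_coeff_def by (simp add: jet_inner_commute[of \<alpha> G] add_divide_distrib)
  qed
  finally show ?thesis .
qed

text \<open>By Parseval's formula, the inner product of the projections of \<open>G\<close> and
  \<open>H\<close> to the frequencies in the box.\<close>

definition coeff_inner :: "nat \<Rightarrow> nat \<Rightarrow> jet \<Rightarrow> jet \<Rightarrow> real" where
  "coeff_inner \<alpha> N G H = (\<Sum>h\<in>freq_box N. (jet_coeff \<alpha> G h 0 * jet_coeff \<alpha> H h 0
     + jet_coeff \<alpha> G h (- (pi / 2)) * jet_coeff \<alpha> H h (- (pi / 2))) / (korobov_weight1 \<alpha> h)\<^sup>2)"

lemma jet_inner_partial_jet:
  assumes "sobolev_jet \<alpha> G"
  shows "jet_inner \<alpha> G (restrict_jet (partial_jet \<alpha> N H)) = coeff_inner \<alpha> N H G"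
  unfolding partial_jet_def[abs_def] jet_inner_wave_sum[OF assms] coeff_inner_def ..

lemma kernel_jet_eq:
  "kernel_jet \<alpha> N y k t = (\<Sum>h\<in>freq_box N. (cos (2 * pi * of_int h * y) * wave h 0 k t
     + sin (2 * pi * of_int h * y) * wave h (- (pi / 2)) k t) / (korobov_weight1 \<alpha> h)\<^sup>2)"
  unfolding kernel_jet_def wave_shift ..

lemma wave_sin: "wave h (- (pi / 2)) 0 t = sin (2 * pi * of_int h * t)"
  unfolding wave_def by (simp add: cos_diff)

text \<open>The finite kernel reproduces partial sums: after \<open>wave_shift\<close> its
  coefficients are the values at \<open>y\<close> of the waves in
  \<open>partial_jet\<close>.\<close>

lemma jet_inner_kernel_jet:
  assumes "sobolev_jet \<alpha> G"
  shows "jet_inner \<alpha> G (restrict_jet (kernel_jet \<alpha> N y)) = partial_jet \<alpha> N G 0 y"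
  unfolding kernel_jet_eq[abs_def] jet_inner_wave_sum[OF assms] partial_jet_def wave_sin
  by (simp add: wave_def mult.commute)

lemma jet_coeff_minus: "jet_coeff \<alpha> G (- h) 0 = jet_coeff \<alpha> G h 0"
  "jet_coeff \<alpha> G (- h) (- (pi / 2)) = - jet_coeff \<alpha> G h (- (pi / 2))"
proof -
  show "jet_coeff \<alpha> G (- h) 0 = jet_coeff \<alpha> G h 0" unfolding jet_coeff_def wave_minus by simp
  have "restrict_jet (wave h (pi / 2)) = (\<lambda>k t. - restrict_jet (wave h (- (pi / 2))) k t)"
    using wave_add_pi[of h "- (pi / 2)"] by (intro ext) (simp add: restrict_jet_def)
  then have "jet_inner \<alpha> G (restrict_jet (wave h (pi / 2))) = - jet_inner \<alpha> G (restrict_jet (wave h (- (pi / 2))))"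
    by (simp add: jet_inner_def sum_negf)
  then show "jet_coeff \<alpha> G (- h) (- (pi / 2)) = - jet_coeff \<alpha> G h (- (pi / 2))"
    unfolding jet_coeff_def wave_minus by simp
qed

lemma jet_coeff_wave_sum:
  assumes \<alpha>: "\<alpha> \<ge> 1"
  shows "jet_coeff \<alpha> (restrict_jet (\<lambda>k t. \<Sum>h\<in>freq_box N. (a h * wave h 0 k t + b h * wave h (- (pi / 2)) k t) / (korobov_weight1 \<alpha> h)\<^sup>2)) l c
     = (if l \<in> freq_box N then (a l * cos c + a (- l) * cos c + b l * cos (pi / 2 + c) + b (- l) * cos (c - pi / 2)) / 2 else 0)"
proof -
  have "jet_coeff \<alpha> (restrict_jet (\<lambda>k t. \<Sum>h\<in>freq_box N. (a h * wave h 0 k t + b h * wave h (- (pi / 2)) k t) / (korobov_weight1 \<alpha> h)\<^sup>2)) l c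
     = (\<Sum>h\<in>freq_box N. (a h * jet_coeff \<alpha> (restrict_jet (wave h 0)) l c + b h * jet_coeff \<alpha> (restrict_jet (wave h (- (pi / 2)))) l c) / (korobov_weight1 \<alpha> h)\<^sup>2)"
    unfolding jet_coeff_def jet_inner_commute[of \<alpha> _ "restrict_jet (wave l c)"] jet_inner_wave_sum[OF sobolev_jet_restrict_wave]
    unfolding jet_coeff_def ..
  also have "\<dots> = (\<Sum>h\<in>freq_box N. (if h = l then (a h * cos c + b h * cos (pi / 2 + c)) / 2 else 0) + (if h = - l then (a h * cos c + b h * cos (c - pi / 2)) / 2 else 0))"
  proof (rule sum.cong[OF refl])
    fix h
    have r: "korobov_weight1 \<alpha> h \<noteq> 0" using korobov_weight1_pos[of \<alpha> h] by simp
    have c: "cos (- (pi / 2) - c) = cos (pi / 2 + c)" "cos (- (pi / 2) + c) = cos (c - pi / 2)"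
    proof -
      have "- (pi / 2) - c = - (pi / 2 + c)" "- (pi / 2) + c = c - pi / 2" by simp_all
      then show "cos (- (pi / 2) - c) = cos (pi / 2 + c)" "cos (- (pi / 2) + c) = cos (c - pi / 2)"
        by (simp_all only: cos_minus)
    qed
    show "(a h * jet_coeff \<alpha> (restrict_jet (wave h 0)) l c + b h * jet_coeff \<alpha> (restrict_jet (wave h (- (pi / 2)))) l c) / (korobov_weight1 \<alpha> h)\<^sup>2
      = (if h = l then (a h * cos c + b h * cos (pi / 2 + c)) / 2 else 0) + (if h = - l then (a h * cos c + b h * cos (c - pi / 2)) / 2 else 0)"
      unfolding jet_inner_wave_wave[OF \<alpha>] c using r by (auto simp: field_simps)
  qed
  also have "\<dots> = (if l \<in> freq_box N then (a l * cos c + a (- l) * cos c + b l * cos (pi / 2 + c) + b (- l) * cos (c - pi / 2)) / 2 else 0)"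
    unfolding sum.distrib by (simp add: sum.delta add_divide_distrib)
  finally show ?thesis .
qed

text \<open>This makes the partial sums orthogonal projections. The halves from \<open>h\<close> and
  \<open>- h\<close> add up by the parity in \<open>jet_coeff_minus\<close>.\<close>

lemma jet_coeff_partial_jet:
  assumes \<alpha>: "\<alpha> \<ge> 1"
  shows "jet_coeff \<alpha> (restrict_jet (partial_jet \<alpha> N G)) l 0 = (if l \<in> freq_box N then jet_coeff \<alpha> G l 0 else 0)"
    "jet_coeff \<alpha> (restrict_jet (partial_jet \<alpha> N G)) l (- (pi / 2)) = (if l \<in> freq_box N then jet_coeff \<alpha> G l (- (pi / 2)) else 0)"
  unfolding partial_jet_def[abs_def] jet_coeff_wave_sum[OF \<alpha>] by (simp_all add: jet_coeff_minus)

lemma freq_box_Int: "freq_box N \<inter> freq_box M = freq_box (min N M)"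
  by (auto simp: freq_box_def)

text \<open>Projections onto nested spaces compose to the smaller one, hence
  \<open>min N M\<close>.\<close>

lemma jet_inner_partial_partial:
  assumes \<alpha>: "\<alpha> \<ge> 1"
  shows "jet_inner \<alpha> (restrict_jet (partial_jet \<alpha> N G)) (restrict_jet (partial_jet \<alpha> M H)) = coeff_inner \<alpha> (min N M) G H"
proof -
  have "jet_inner \<alpha> (restrict_jet (partial_jet \<alpha> N G)) (restrict_jet (partial_jet \<alpha> M H))
    = (\<Sum>h\<in>freq_box M. if h \<in> freq_box N then (jet_coeff \<alpha> G h 0 * jet_coeff \<alpha> H h 0
     + jet_coeff \<alpha> G h (- (pi / 2)) * jet_coeff \<alpha> H h (- (pi / 2))) / (korobov_weight1 \<alpha> h)\<^sup>2 else 0)"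
    unfolding jet_inner_partial_jet[OF sobolev_jet_restrict_jet[OF smooth_partial_jet]] coeff_inner_def
      jet_coeff_partial_jet[OF \<alpha>]
    by (rule sum.cong) (auto simp: mult.commute)
  then show ?thesis
    unfolding coeff_inner_def freq_box_Int[symmetric]
    by (simp add: sum.inter_restrict[symmetric] Int_commute)
qed

lemma jet_inner_kernel_kernel:
  assumes \<alpha>: "\<alpha> \<ge> 1"
  shows "jet_inner \<alpha> (restrict_jet (kernel_jet \<alpha> N y)) (restrict_jet (kernel_jet \<alpha> M y)) = (\<Sum>h\<in>freq_box (min N M). 1 / (korobov_weight1 \<alpha> h)\<^sup>2)"
proof -
  have c: "jet_coeff \<alpha> (restrict_jet (kernel_jet \<alpha> N y)) l 0 = (if l \<in> freq_box N then cos (2 * pi * of_int l * y) else 0)"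
    "jet_coeff \<alpha> (restrict_jet (kernel_jet \<alpha> N y)) l (- (pi / 2)) = (if l \<in> freq_box N then sin (2 * pi * of_int l * y) else 0)" for l
    unfolding kernel_jet_eq[abs_def] jet_coeff_wave_sum[OF \<alpha>] by simp_all
  have "jet_inner \<alpha> (restrict_jet (kernel_jet \<alpha> N y)) (restrict_jet (kernel_jet \<alpha> M y))
    = (\<Sum>h\<in>freq_box M. if h \<in> freq_box N then 1 / (korobov_weight1 \<alpha> h)\<^sup>2 else 0)"
    unfolding jet_inner_kernel_jet[OF sobolev_jet_restrict_jet[OF smooth_kernel_jet]] partial_jet_def c wave_sin
  proof (rule sum.cong[OF refl])
    fix h
    have "cos (2 * pi * of_int h * y) * cos (2 * pi * of_int h * y) + sin (2 * pi * of_int h * y) * sin (2 * pi * of_int h * y) = 1"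
      using sin_cos_squared_add3 by (simp add: add.commute)
    then show "((if h \<in> freq_box N then cos (2 * pi * of_int h * y) else 0) * wave h 0 0 y
        + (if h \<in> freq_box N then sin (2 * pi * of_int h * y) else 0) * sin (2 * pi * of_int h * y)) / (korobov_weight1 \<alpha> h)\<^sup>2
      = (if h \<in> freq_box N then 1 / (korobov_weight1 \<alpha> h)\<^sup>2 else 0)"
      by (simp add: wave_def)
  qed
  then show ?thesis
    unfolding freq_box_Int[symmetric] by (simp add: sum.inter_restrict[symmetric] Int_commute)
qed

section \<open>Bernoulli polynomials and the mean-free remainder\<close>

lemma has_derivative_bernoulli_poly:
  "(bernoulli_poly (Suc n) has_real_derivative real (Suc n) * bernoulli_poly n t) (at t)"
proof -
  have "((\<lambda>x. \<Sum>k\<le>n. of_nat (Suc n choose k) * bernoulli_number k * x ^ (Suc n - k)) has_real_derivative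
      (\<Sum>k\<le>n. of_nat (Suc n choose k) * bernoulli_number k * (real (Suc n - k) * t ^ (n - k)))) (at t)"
  proof (rule DERIV_sum)
    fix k assume "k \<in> {..n}"
    then obtain m where m: "Suc n - k = Suc m" "n - k = m" by (auto simp: Suc_diff_le)
    show "((\<lambda>x. real (Suc n choose k) * bernoulli_number k * x ^ (Suc n - k)) has_real_derivative
         real (Suc n choose k) * bernoulli_number k * (real (Suc n - k) * t ^ (n - k))) (at t)"
      using DERIV_cmult[OF DERIV_pow[of "Suc m" t UNIV], of "real (Suc n choose k) * bernoulli_number k"] unfolding m by simp
  qed
  moreover have "(\<Sum>k\<le>n. of_nat (Suc n choose k) * bernoulli_number k * (real (Suc n - k) * t ^ (n - k))) = real (Suc n) * bernoulli_poly n t"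
    unfolding bernoulli_poly_def sum_distrib_left
  proof (rule sum.cong[OF refl])
    fix k
    have "(Suc n - k) * (Suc n choose k) = Suc n * (n choose k)"
      using binomial_absorb_comp[of "Suc n" k] by simp
    then have "real (Suc n - k) * real (Suc n choose k) = real (Suc n) * real (n choose k)"
      by (simp only: of_nat_mult[symmetric])
    then have "real (Suc n - k) * real (Suc n choose k) * (bernoulli_number k * t ^ (n - k)) = real (Suc n) * real (n choose k) * (bernoulli_number k * t ^ (n - k))"
      by (simp only:)
    then show "real (Suc n choose k) * bernoulli_number k * (real (Suc n - k) * t ^ (n - k)) = real (Suc n) * (real (n choose k) * bernoulli_number k * t ^ (n - k))"
      by (simp only: mult_ac)
  qed
  ultimately have "((\<lambda>x. (\<Sum>k\<le>n. of_nat (Suc n choose k) * bernoulli_number k * x ^ (Suc n - k)) + bernoulli_number (Suc n)) has_real_derivative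
      real (Suc n) * bernoulli_poly n t + 0) (at t)"
    by (intro DERIV_add DERIV_const) simp
  moreover have "bernoulli_poly (Suc n) = (\<lambda>x. (\<Sum>k\<le>n. of_nat (Suc n choose k) * bernoulli_number k * x ^ (Suc n - k)) + bernoulli_number (Suc n))"
    by (intro ext) (simp add: bernoulli_poly_def)
  ultimately show ?thesis by (simp only: add_0_right)
qed

lemma bernoulli_poly_0 [simp]: "bernoulli_poly 0 t = 1"
  by (simp add: bernoulli_poly_def bernoulli_number.simps)

text \<open>The recursion for \<open>bernoulli_number n\<close> says exactly that the coefficients
  of \<open>bernoulli_poly (Suc n)\<close> other than the constant one add up to 0.\<close>

lemma bernoulli_poly_periodic:
  assumes "n \<ge> 1"
  shows "bernoulli_poly (Suc n) 1 = bernoulli_poly (Suc n) 0"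
proof -
  have rec: "bernoulli_number n = - (\<Sum>k<n. of_nat (Suc n choose k) * bernoulli_number k) / of_nat (Suc n)"
    using assms by (subst bernoulli_number.simps) auto
  have "bernoulli_poly (Suc n) 1 = (\<Sum>k<n. of_nat (Suc n choose k) * bernoulli_number k) + of_nat (Suc n) * bernoulli_number n + bernoulli_number (Suc n)"
    unfolding bernoulli_poly_def lessThan_Suc_atMost[symmetric] by simp
  also have "\<dots> = bernoulli_number (Suc n)" unfolding rec by (simp del: of_nat_Suc)
  also have "\<dots> = bernoulli_poly (Suc n) 0"
  proof -
    have "bernoulli_poly (Suc n) 0 = (\<Sum>k\<le>Suc n. if k = Suc n then bernoulli_number (Suc n) else 0)"
      unfolding bernoulli_poly_def by (rule sum.cong) (auto simp: power_0_left)
    then show ?thesis by (simp add: sum.delta)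
  qed
  finally show ?thesis .
qed

definition bernoulli_jet :: "nat \<Rightarrow> jet" where
  "bernoulli_jet n k t = (if k \<le> n then bernoulli_poly (n - k) t / fact (n - k) else 0)"

lemma smooth_bernoulli_jet: "smooth_jet (bernoulli_jet n)"
  unfolding smooth_jet_def
proof (intro allI)
  fix k t
  consider "k < n" | "k = n" | "k > n" by linarith
  then show "(bernoulli_jet n k has_real_derivative bernoulli_jet n (Suc k) t) (at t)"
  proof cases
    case 1
    then obtain m where m: "n - k = Suc m" "n - Suc k = m" by (metis Suc_diff_Suc)
    have "((\<lambda>t. bernoulli_poly (Suc m) t / fact (Suc m)) has_real_derivative real (Suc m) * bernoulli_poly m t / fact (Suc m)) (at t)"
      by (rule DERIV_cdivide[OF has_derivative_bernoulli_poly])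
    moreover have "real (Suc m) * bernoulli_poly m t / fact (Suc m) = bernoulli_poly m t / fact m"
      unfolding fact_Suc of_nat_mult by (simp del: of_nat_Suc)
    ultimately show ?thesis using 1 m unfolding bernoulli_jet_def[abs_def] by simp
  qed (simp_all add: bernoulli_jet_def[abs_def])
qed

text \<open>A derivative of order below \<open>n\<close> has a primitive with equal end values, the
  derivative of order \<open>n\<close> is the constant 1. Hence these polynomials are dual to the
  means that the transform removes.\<close>

lemma integral_bernoulli_jet:
  "(LBINT t. restrict_jet (bernoulli_jet n) k t) = (if k = n then 1 else 0)"
proof -
  consider "k < n" | "k = n" | "k > n" by linarith
  then show ?thesis
  proof cases
    case 1
    then obtain m where m: "n = Suc m" "k \<le> m" by (metis Suc_leI less_Suc_eq_le not0_implies_Suc not_less_zero)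
    have "(LBINT t. restrict_jet (bernoulli_jet n) k t) = (LBINT t:{0..1}. bernoulli_jet (Suc n) (Suc k) t)"
      unfolding set_lebesgue_integral_def restrict_jet_def bernoulli_jet_def diff_Suc_Suc Suc_le_mono real_scaleR_def ..
    also have "\<dots> = bernoulli_jet (Suc n) k 1 - bernoulli_jet (Suc n) k 0"
      by (rule smooth_jet_FTC[OF smooth_bernoulli_jet]) simp
    also have "\<dots> = 0"
      using 1 bernoulli_poly_periodic[of "n - k"] by (simp add: bernoulli_jet_def Suc_diff_le)
    finally show ?thesis using 1 by simp
  qed (simp_all add: restrict_jet_def bernoulli_jet_def)
qed

text \<open>Removes the means of the derivatives of orders 1 to \<alpha>. The derivatives below
  \<alpha> then take equal values at 0 and 1, so integration by parts leaves no boundary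
  terms.\<close>

definition remainder_jet :: "nat \<Rightarrow> jet \<Rightarrow> jet" where
  "remainder_jet \<alpha> G k t = G k t - (\<Sum>m\<in>{1..\<alpha>}. (LBINT s. G m s) * restrict_jet (bernoulli_jet m) k t)"

lemma remainder_jet:
  assumes G: "sobolev_jet \<alpha> G"
  shows "sobolev_jet \<alpha> (remainder_jet \<alpha> G)"
    and "k \<le> \<alpha> \<Longrightarrow> (LBINT t. remainder_jet \<alpha> G k t) = (if k = 0 then \<integral>t. G 0 t \<partial>lborel else 0)"
proof -
  let ?B = "\<lambda>k t. \<Sum>m\<in>{1..\<alpha>}. (LBINT s. G m s) * restrict_jet (bernoulli_jet m) k t"
  have sB: "sobolev_jet \<alpha> (restrict_jet (bernoulli_jet m))" for m
    by (rule sobolev_jet_restrict_jet[OF smooth_bernoulli_jet])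
  have B: "sobolev_jet \<alpha> ?B"
    by (rule jet_inner_sum_right(2)[OF _ sB G]) simp
  have "sobolev_jet \<alpha> (\<lambda>k t. 1 * G k t + (- 1) * ?B k t)"
    by (rule sobolev_jet_linear_combination[OF G B])
  moreover have "(\<lambda>k t. 1 * G k t + (- 1) * ?B k t) = remainder_jet \<alpha> G"
    by (intro ext) (simp add: remainder_jet_def)
  ultimately show "sobolev_jet \<alpha> (remainder_jet \<alpha> G)" by (simp only:)
  assume k: "k \<le> \<alpha>"
  have "(LBINT t. remainder_jet \<alpha> G k t) = (LBINT t. G k t) - (LBINT t. ?B k t)"
    unfolding remainder_jet_def by (intro Bochner_Integration.integral_diff sobolev_jet_integrable[OF G k] sobolev_jet_integrable[OF B k])
  also have "(LBINT t. ?B k t) = (\<Sum>m\<in>{1..\<alpha>}. (LBINT s. G m s) * (if k = m then 1 else 0))"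
    unfolding integral_bernoulli_jet[symmetric]
    by (subst Bochner_Integration.integral_sum) (auto intro!: integrable_mult_right sobolev_jet_integrable[OF sB k])
  also have "\<dots> = (if k \<in> {1..\<alpha>} then (LBINT s. G k s) else 0)"
    by (simp add: if_distrib[of "\<lambda>x. _ * x"] sum.delta' cong: if_cong)
  finally show "(LBINT t. remainder_jet \<alpha> G k t) = (if k = 0 then \<integral>t. G 0 t \<partial>lborel else 0)" using k by auto
qed

lemma bernoulli_remainder_eq:
  assumes "t \<in> {0..1}"
  shows "bernoulli_remainder \<alpha> G t = remainder_jet \<alpha> G 0 t"
  using assms unfolding bernoulli_remainder_def remainder_jet_def
  by (simp add: restrict_jet_def bernoulli_jet_def mult.commute)

lemma remainder_jet_top:
  "remainder_jet \<alpha> G \<alpha> t = G \<alpha> t - (if \<alpha> = 0 then 0 else (LBINT s. G \<alpha> s)) * indicator {0..1} t"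
proof -
  have "(\<Sum>m\<in>{1..\<alpha>}. (LBINT s. G m s) * restrict_jet (bernoulli_jet m) \<alpha> t)
     = (\<Sum>m\<in>{1..\<alpha>}. if \<alpha> = m then (LBINT s. G \<alpha> s) * indicator {0..1} t else 0)"
    by (rule sum.cong) (auto simp: restrict_jet_def bernoulli_jet_def)
  then show ?thesis unfolding remainder_jet_def by (auto simp: sum.delta')
qed

text \<open>The difference of the end values is the mean of the next derivative, which
  vanishes.\<close>

lemma remainder_jet_periodic:
  assumes G: "sobolev_jet \<alpha> G" and k: "k < \<alpha>"
  shows "remainder_jet \<alpha> G k 1 = remainder_jet \<alpha> G k 0"
proof -
  let ?R = "remainder_jet \<alpha> G"
  have z: "?R (Suc k) t = 0" if "t \<notin> {0..1}" for t
    using sobolev_jetD(2)[OF remainder_jet(1)[OF G], of "Suc k" t] k that by simp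
  have "(LBINT r:{..1}. ?R (Suc k) r) = (LBINT r. ?R (Suc k) r)"
    unfolding set_lebesgue_integral_def by (rule lintegral_cong) (use z in \<open>auto simp: indicator_def\<close>)
  then show ?thesis
    using sobolev_jetD(4)[OF remainder_jet(1)[OF G]] sobolev_jetD(5)[OF remainder_jet(1)[OF G] k, of 1] remainder_jet(2)[OF G, of "Suc k"] k by simp
qed

lemma integral_cos_by_parts:
  assumes R: "sobolev_jet \<alpha> R" and k: "k < \<alpha>" and per: "R k 1 = R k 0"
  shows "(LBINT t. R (Suc k) t * cos (2 * pi * of_int h * t + c))
     = (2 * pi * of_int h) * (LBINT t. R k t * cos (2 * pi * of_int h * t + (c - pi / 2)))"
proof -
  let ?w = "2 * pi * of_int h :: real"
  let ?u = "\<lambda>t. cos (?w * t + c)" and ?u' = "\<lambda>t. - sin (?w * t + c) * ?w"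
  have z: "R k t = 0" if "t \<notin> {0..1}" for t using sobolev_jetD(2)[OF R, of k t] k that by simp
  have "(LBINT r. R (Suc k) r * ?u r) = R k 1 * ?u 1 - R k 0 * ?u 0 - (LBINT t:{0..1}. R k t * ?u' t)"
  proof (rule jet_by_parts)
    show "integrable lborel (R (Suc k))" using sobolev_jet_integrable[OF R] k by simp
    show "R (Suc k) t = 0" if "t \<notin> {0..1}" for t using sobolev_jetD(2)[OF R, of "Suc k" t] k that by simp
    show "R k t = R k 0 + (LBINT r:{..t}. R (Suc k) r)" if "t \<in> {0..1}" for t
      by (rule sobolev_jetD(5)[OF R k that])
    show "(?u has_real_derivative ?u' t) (at t)" for t by (auto intro!: derivative_eq_intros)
    show "continuous_on UNIV ?u'" by (auto intro!: continuous_intros)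
  qed
  also have "?u 1 = ?u 0"
    using sin_int_2pin[of h] cos_int_2pin[of h] by (simp add: cos_add mult_ac)
  also have "(LBINT t:{0..1}. R k t * ?u' t) = (LBINT t. (- ?w) * (R k t * cos (?w * t + (c - pi / 2))))"
    unfolding set_lebesgue_integral_def
  proof (rule lintegral_cong[OF refl])
    fix t
    have "?w * t + (c - pi / 2) = (?w * t + c) - pi / 2" by simp
    then have "cos (?w * t + (c - pi / 2)) = sin (?w * t + c)" by (simp only: cos_diff) simp
    then show "indicat_real {0..1} t *\<^sub>R (R k t * ?u' t) = (- ?w) * (R k t * cos (?w * t + (c - pi / 2)))"
      using z[of t] by (cases "t \<in> {0..1}") (simp_all add: mult_ac)
  qed
  finally show ?thesis using per by simp
qed

text \<open>Stops at order 1, since the comparison with the sawtooth needs the first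
  derivative.\<close>

lemma integral_cos_iterated_by_parts:
  assumes R: "sobolev_jet \<alpha> R" and per: "\<And>k. k < \<alpha> \<Longrightarrow> R k 1 = R k 0" and m: "m < \<alpha>"
  shows "(LBINT t. R (Suc m) t * cos (2 * pi * of_int h * t + c))
     = (2 * pi * of_int h) ^ m * (LBINT t. R 1 t * cos (2 * pi * of_int h * t + (c - real m * (pi / 2))))"
  using m
proof (induction m arbitrary: c)
  case (Suc m)
  have c: "c - pi / 2 - real m * (pi / 2) = c - real (Suc m) * (pi / 2)" by (simp add: algebra_simps add_divide_distrib)
  have "(LBINT t. R (Suc (Suc m)) t * cos (2 * pi * of_int h * t + c))
    = (2 * pi * of_int h) * (LBINT t. R (Suc m) t * cos (2 * pi * of_int h * t + (c - pi / 2)))"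
    using Suc.prems by (intro integral_cos_by_parts[OF R] per) auto
  also have "\<dots> = (2 * pi * of_int h) * ((2 * pi * of_int h) ^ m * (LBINT t. R 1 t * cos (2 * pi * of_int h * t + (c - real (Suc m) * (pi / 2)))))"
    using Suc.IH[of "c - pi / 2"] Suc.prems unfolding c by simp
  finally show ?case by (simp only: power_Suc mult.assoc)
qed simp

text \<open>Passing to the remainder changes the top derivative by a constant only, which is
  orthogonal to waves with \<open>h \<noteq> 0\<close>. Integrating by parts \<alpha> - 1 times then
  cancels the squared weight up to one factor.\<close>

lemma jet_coeff_remainder:
  assumes G: "sobolev_jet \<alpha> G" and \<alpha>: "\<alpha> \<ge> 1" and h: "h \<noteq> 0"
  shows "jet_coeff \<alpha> G h c / (korobov_weight1 \<alpha> h)\<^sup>2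
    = - (LBINT t. remainder_jet \<alpha> G 1 t * sin (2 * pi * of_int h * t + c)) / (2 * pi * of_int h)"
proof -
  let ?w = "2 * pi * of_int h :: real" and ?R = "remainder_jet \<alpha> G" and ?\<mu> = "\<integral>s. G \<alpha> s \<partial>lborel"
  let ?c = "c + real \<alpha> * (pi / 2)"
  note R = remainder_jet(1)[OF G]
  obtain m where m: "\<alpha> = Suc m" using \<alpha> by (cases \<alpha>) auto
  have zG: "G \<alpha> t = 0" if "t \<notin> {0..1}" for t using sobolev_jetD(2)[OF G order_refl that] .
  have zR: "?R 1 t = 0" if "t \<notin> {0..1}" for t using sobolev_jetD(2)[OF R \<alpha> that] .
  have "jet_coeff \<alpha> G h c = (LBINT t. G \<alpha> t * restrict_jet (wave h c) \<alpha> t)"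
    using h by (simp add: jet_coeff_eq[OF \<alpha>])
  also have "\<dots> = (LBINT t. ?w ^ \<alpha> * (?R \<alpha> t * cos (?w * t + ?c) + ?\<mu> * (indicator {0..1} t * cos (?w * t + ?c))))"
  proof (rule lintegral_cong[OF refl])
    fix t
    have "?w * t + c + real \<alpha> * (pi / 2) = ?w * t + ?c" by simp
    then show "G \<alpha> t * restrict_jet (wave h c) \<alpha> t = ?w ^ \<alpha> * (?R \<alpha> t * cos (?w * t + ?c) + ?\<mu> * (indicator {0..1} t * cos (?w * t + ?c)))"
      using zG[of t] \<alpha> unfolding remainder_jet_top restrict_jet_def wave_def
      by (cases "t \<in> {0..1}") (simp_all add: algebra_simps)
  qed
  also have "\<dots> = ?w ^ \<alpha> * (LBINT t. ?R \<alpha> t * cos (?w * t + ?c))"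
  proof -
    have i: "integrable lborel (\<lambda>t. ?R \<alpha> t * cos (?w * t + ?c))"
    proof (rule lintegrable_bound[OF sobolev_jet_integrable[OF R order_refl]])
      show "AE t in lborel. norm (?R \<alpha> t * cos (?w * t + ?c)) \<le> norm (?R \<alpha> t)"
        by (intro AE_I2) (simp add: abs_mult mult_left_le)
    qed (use sobolev_jetD(1)[OF R order_refl] in measurable)
    have "has_bochner_integral lborel (\<lambda>t. indicator {0..1} t * cos (?w * t + ?c)) 0"
      using has_bochner_integral_cos_period[of h ?c] h by simp
    from has_bochner_integral_mult_right[OF this, of ?\<mu>]
    have "has_bochner_integral lborel (\<lambda>t. ?\<mu> * (indicator {0..1} t * cos (?w * t + ?c))) 0" by simp
    from has_bochner_integral_add[OF has_bochner_integral_integrable[OF i] this]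
    have "(LBINT t. (?R \<alpha> t * cos (?w * t + ?c) + ?\<mu> * (indicator {0..1} t * cos (?w * t + ?c)))) = (LBINT t. ?R \<alpha> t * cos (?w * t + ?c)) + 0"
      by (rule has_bochner_integral_integral_eq)
    then show ?thesis by simp
  qed
  also have "(LBINT t. ?R \<alpha> t * cos (?w * t + ?c)) = ?w ^ m * (LBINT t. ?R 1 t * cos (?w * t + (?c - real m * (pi / 2))))"
    unfolding m using m by (intro integral_cos_iterated_by_parts remainder_jet_periodic) (use R G m in auto)
  also have "(LBINT t. ?R 1 t * cos (?w * t + (?c - real m * (pi / 2)))) = (LBINT t. - (?R 1 t * sin (?w * t + c)))"
  proof (rule lintegral_cong[OF refl])
    fix t
    have "?w * t + (?c - real m * (pi / 2)) = (?w * t + c) + pi / 2" unfolding m by (simp add: algebra_simps add_divide_distrib)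
    then have "cos (?w * t + (?c - real m * (pi / 2))) = - sin (?w * t + c)" by (simp only: cos_add) simp
    then show "?R 1 t * cos (?w * t + (?c - real m * (pi / 2))) = - (?R 1 t * sin (?w * t + c))" by simp
  qed
  finally have e: "jet_coeff \<alpha> G h c = ?w ^ \<alpha> * (?w ^ m * - (LBINT t. ?R 1 t * sin (?w * t + c)))" by simp
  have w: "?w \<noteq> 0" using h by simp
  have "(korobov_weight1 \<alpha> h)\<^sup>2 = ?w ^ \<alpha> * (?w ^ m * ?w)"
    unfolding korobov_weight1_square[OF h, symmetric] m by simp
  then show ?thesis unfolding e using w by (simp only: mult.assoc) (simp add: field_simps)
qed

text \<open>The shifted waves of the finite kernel collect both phases in a single
  coefficient.\<close>

lemma partial_jet_eq_coeff:
  assumes G: "sobolev_jet \<alpha> G"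
  shows "partial_jet \<alpha> N G 0 y = (\<Sum>h\<in>freq_box N. jet_coeff \<alpha> G h (- (2 * pi * of_int h * y)) / (korobov_weight1 \<alpha> h)\<^sup>2)"
proof -
  let ?H = "\<lambda>h. restrict_jet (wave h (- (2 * pi * of_int h * y)))"
  have "restrict_jet (kernel_jet \<alpha> N y) = (\<lambda>k t. \<Sum>h\<in>freq_box N. (1 / (korobov_weight1 \<alpha> h)\<^sup>2) * ?H h k t)"
    by (intro ext) (simp add: restrict_jet_def kernel_jet_def sum_distrib_left)
  then have "jet_inner \<alpha> G (restrict_jet (kernel_jet \<alpha> N y)) = (\<Sum>h\<in>freq_box N. (1 / (korobov_weight1 \<alpha> h)\<^sup>2) * jet_inner \<alpha> G (?H h))"
    using jet_inner_sum_right(1)[of "freq_box N" \<alpha> ?H G "\<lambda>h. 1 / (korobov_weight1 \<alpha> h)\<^sup>2"] sobolev_jet_restrict_wave G by simp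
  then show ?thesis unfolding jet_inner_kernel_jet[OF G] jet_coeff_def by simp
qed

section \<open>Partial sums and the sawtooth\<close>

text \<open>Partial sum of the Fourier series of the sawtooth that equals \<open>1 / 2 - u\<close>
  on \<open>(0,1)\<close>, which is minus the periodic Bernoulli function of degree 1.\<close>

definition sine_sum :: "nat \<Rightarrow> real \<Rightarrow> real" where
  "sine_sum N u = (\<Sum>n\<in>{1..N}. sin (2 * pi * real n * u) / (pi * real n))"

lemma continuous_on_sine_sum [continuous_intros]:
  fixes f :: "real \<Rightarrow> real"
  shows "continuous_on A f \<Longrightarrow> continuous_on A (\<lambda>x. sine_sum N (f x))"
  unfolding sine_sum_def divide_inverse by (intro continuous_on_sum continuous_on_mult continuous_on_sin continuous_on_const)

text \<open>By \<open>jet_coeff_remainder\<close> the frequencies \<open>n\<close> and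
  \<open>- n\<close> contribute equally, which doubles \<open>1 / (2 * pi * n)\<close> to the factor
  \<open>1 / (pi * n)\<close> of \<open>sine_sum\<close>.\<close>

lemma partial_jet_eq_sine_sum:
  assumes G: "sobolev_jet \<alpha> G" and \<alpha>: "\<alpha> \<ge> 1"
  shows "partial_jet \<alpha> N G 0 y = (LBINT t. G 0 t) - (LBINT t. remainder_jet \<alpha> G 1 t * sine_sum N (t - y))"
proof -
  let ?R = "remainder_jet \<alpha> G" and ?f = "\<lambda>h. jet_coeff \<alpha> G h (- (2 * pi * of_int h * y)) / (korobov_weight1 \<alpha> h)\<^sup>2"
  let ?I = "\<lambda>n. \<integral>t. ?R 1 t * (sin (2 * pi * real n * (t - y)) / (pi * real n)) \<partial>lborel"
  have R: "sobolev_jet \<alpha> ?R" by (rule remainder_jet(1)[OF G])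
  have f0: "?f 0 = (LBINT t. G 0 t)"
  proof -
    have "restrict_jet (wave 0 0) \<alpha> t = 0" for t using \<alpha> by (simp add: restrict_jet_def wave_def)
    then show ?thesis by (simp add: jet_coeff_eq[OF \<alpha>] korobov_weight1_def)
  qed
  have fh: "?f h = - (LBINT t. ?R 1 t * (sin (2 * pi * of_int h * (t - y)) / (2 * pi * of_int h)))" if "h \<noteq> 0" for h
  proof -
    have "2 * pi * of_int h * t + - (2 * pi * of_int h * y) = 2 * pi * of_int h * (t - y)" for t
      by (simp add: algebra_simps)
    then show ?thesis unfolding jet_coeff_remainder[OF G \<alpha> that] by simp
  qed
  have pair: "?f (int n) + ?f (- int n) = - ?I n" if n: "n \<in> {1..N}" for n
  proof -
    have e: "sin (2 * pi * of_int (- int n) * (t - y)) / (2 * pi * of_int (- int n)) = sin (2 * pi * of_int (int n) * (t - y)) / (2 * pi * of_int (int n))" for t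
    proof -
      have "2 * pi * of_int (- int n) * (t - y) = - (2 * pi * of_int (int n) * (t - y))" by simp
      then have "sin (2 * pi * of_int (- int n) * (t - y)) = - sin (2 * pi * of_int (int n) * (t - y))" by (simp only: sin_minus)
      then show ?thesis by simp
    qed
    have "?f (- int n) = - (LBINT t. ?R 1 t * (sin (2 * pi * of_int (- int n) * (t - y)) / (2 * pi * of_int (- int n))))"
      by (rule fh) (use n in simp)
    also have "\<dots> = ?f (int n)" unfolding e by (rule fh[symmetric]) (use n in simp)
    finally have "?f (- int n) = ?f (int n)" .
    then have "?f (int n) + ?f (- int n) = 2 * ?f (int n)" by simp
    also have "\<dots> = - ?I n" using n by (subst fh) (auto simp: field_simps)
    finally show ?thesis .
  qed
  have i: "integrable lborel (\<lambda>t. ?R 1 t * (sin (2 * pi * real n * (t - y)) / (pi * real n)))" for n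
  proof (rule lintegrable_bound)
    show "integrable lborel (\<lambda>t. ?R 1 t * (1 / (pi * real n)))" using sobolev_jet_integrable[OF R \<alpha>] by simp
    show "AE t in lborel. norm (?R 1 t * (sin (2 * pi * real n * (t - y)) / (pi * real n))) \<le> norm (?R 1 t * (1 / (pi * real n)))"
      by (intro AE_I2) (auto simp: abs_mult intro!: divide_right_mono mult_left_le)
  qed (use sobolev_jetD(1)[OF R \<alpha>] in measurable)
  have "partial_jet \<alpha> N G 0 y = ?f 0 + (\<Sum>n\<in>{1..N}. ?f (int n) + ?f (- int n))"
    unfolding partial_jet_eq_coeff[OF G] by (rule sum_freq_box)
  also have "(\<Sum>n\<in>{1..N}. ?f (int n) + ?f (- int n)) = - (\<Sum>n\<in>{1..N}. ?I n)"
    unfolding sum_negf[symmetric] by (rule sum.cong[OF refl pair])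
  also have "(\<Sum>n\<in>{1..N}. ?I n) = (LBINT t. ?R 1 t * sine_sum N (t - y))"
    unfolding sine_sum_def sum_distrib_left by (rule Bochner_Integration.integral_sum[symmetric, OF i])
  finally show ?thesis unfolding f0 by simp
qed

text \<open>Insert the minimum point of the quadratic or, for \<open>c = 0\<close>, a point where a
  nonconstant affine function would be negative.\<close>

lemma discriminant_nonneg:
  fixes a b c :: real
  assumes q: "\<And>t. a + 2 * t * b + t\<^sup>2 * c \<ge> 0" and c: "c \<ge> 0"
  shows "b\<^sup>2 \<le> a * c"
proof (cases "c = 0")
  case True
  show ?thesis
  proof (rule ccontr)
    assume "\<not> b\<^sup>2 \<le> a * c"
    then have "b \<noteq> 0" using True by auto
    let ?t = "- (a + 1) / (2 * b)"
    have "2 * ?t * b = - (a + 1)" using \<open>b \<noteq> 0\<close> by simp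
    moreover have "?t\<^sup>2 * c = 0" using True by simp
    ultimately show False using q[of ?t] by linarith
  qed
next
  case False
  then have "c * (a + 2 * (- b / c) * b + (- b / c)\<^sup>2 * c) = a * c - b\<^sup>2"
    by (simp add: power2_eq_square field_simps)
  then show ?thesis using q[of "- b / c"] mult_nonneg_nonneg[OF c, of "a + 2 * (- b / c) * b + (- b / c)\<^sup>2 * c"] by simp
qed

lemma integral_Cauchy_Schwarz:
  fixes f g :: "'a \<Rightarrow> real"
  assumes f: "integrable M (\<lambda>x. (f x)\<^sup>2)" and g: "integrable M (\<lambda>x. (g x)\<^sup>2)"
    and m: "f \<in> borel_measurable M" "g \<in> borel_measurable M"
  shows "(\<integral>x. f x * g x \<partial>M)\<^sup>2 \<le> (\<integral>x. (f x)\<^sup>2 \<partial>M) * (\<integral>x. (g x)\<^sup>2 \<partial>M)"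
proof (rule discriminant_nonneg)
  fix t :: real
  have fg: "integrable M (\<lambda>x. f x * g x)" by (rule integrable_mult_of_squares[OF f g m])
  have "0 \<le> (\<integral>x. (f x + t * g x)\<^sup>2 \<partial>M)" by simp
  also have "\<dots> = (\<integral>x. (f x)\<^sup>2 + (2 * t) * (f x * g x) + t\<^sup>2 * (g x)\<^sup>2 \<partial>M)"
    by (rule lintegral_cong) (simp_all add: power2_eq_square algebra_simps)
  also have "\<dots> = (\<integral>x. (f x)\<^sup>2 \<partial>M) + 2 * t * (\<integral>x. f x * g x \<partial>M) + t\<^sup>2 * (\<integral>x. (g x)\<^sup>2 \<partial>M)"
    using f g fg by (simp add: Bochner_Integration.integral_add)
  finally show "0 \<le> (\<integral>x. (f x)\<^sup>2 \<partial>M) + 2 * t * (\<integral>x. f x * g x \<partial>M) + t\<^sup>2 * (\<integral>x. (g x)\<^sup>2 \<partial>M)" .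
qed simp

text \<open>By the form of \<open>mean_kernel\<close>, almost everywhere on \<open>{0..1}\<close>
  the sum of the periodic Bernoulli function of degree 1 at \<open>t - y\<close> and a partial sum
  of the Fourier series of its negative.\<close>

definition sawtooth_error :: "nat \<Rightarrow> real \<Rightarrow> real \<Rightarrow> real" where
  "sawtooth_error N y t = indicator {0..1} t * (mean_kernel y t + 1 / 2 - y + sine_sum N (t - y))"

lemma mean_kernel_measurable [measurable]: "mean_kernel y \<in> borel_measurable borel"
  unfolding mean_kernel_def[abs_def] by measurable

lemma sawtooth_error_measurable [measurable]: "sawtooth_error N y \<in> borel_measurable borel"
proof -
  have [measurable]: "(\<lambda>t. sine_sum N (t - y)) \<in> borel_measurable borel"
    by (intro borel_measurable_continuous_onI continuous_intros)
  show ?thesis unfolding sawtooth_error_def[abs_def] by measurable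
qed

text \<open>Orthogonality of the sines: each contributes one half of its squared
  coefficient.\<close>

lemma has_bochner_integral_sine_sum_square:
  "has_bochner_integral lborel (\<lambda>t. indicator {0..1} t * (sine_sum N (t - y))\<^sup>2) ((\<Sum>n\<in>{1..N}. 1 / (real n)\<^sup>2) / (2 * pi\<^sup>2))"
proof -
  \<comment> \<open>The phase that turns the shifted sine into a cosine.\<close>
  let ?c = "\<lambda>n. - (2 * pi * of_int (int n) * y) - pi / 2"
  let ?g = "\<lambda>n m t. indicator {0..1} t * (cos (2 * pi * of_int (int n) * t + ?c n) * cos (2 * pi * of_int (int m) * t + ?c m))"
  have s: "sin (2 * pi * real n * (t - y)) = cos (2 * pi * of_int (int n) * t + ?c n)" for n t
  proof -
    have "2 * pi * of_int (int n) * t + ?c n = 2 * pi * real n * (t - y) - pi / 2" by (simp add: algebra_simps)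
    then show ?thesis by (simp only: cos_diff) simp
  qed
  have I: "has_bochner_integral lborel (?g n m) (if n = m then 1 / 2 else 0)" if "n \<in> {1..N}" for n m
    using has_bochner_integral_cos_mult[of "int n" "?c n" "int m" "?c m"] that by (cases "n = m") auto
  have "has_bochner_integral lborel (\<lambda>t. \<Sum>n\<in>{1..N}. \<Sum>m\<in>{1..N}. (1 / (pi * real n) * (1 / (pi * real m))) * ?g n m t)
      (\<Sum>n\<in>{1..N}. \<Sum>m\<in>{1..N}. (1 / (pi * real n) * (1 / (pi * real m))) * (if n = m then 1 / 2 else 0))"
    by (intro has_bochner_integral_sum has_bochner_integral_mult_right I)
  moreover have "(\<Sum>n\<in>{1..N}. \<Sum>m\<in>{1..N}. (1 / (pi * real n) * (1 / (pi * real m))) * ?g n m t)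
     = indicator {0..1} t * (sine_sum N (t - y))\<^sup>2" for t
    unfolding sine_sum_def power2_eq_square sum_product s
    unfolding sum_distrib_left by (intro sum.cong refl) (simp only: divide_inverse mult_1_left inverse_mult_distrib mult_ac)
  moreover have "(\<Sum>n\<in>{1..N}. \<Sum>m\<in>{1..N}. (1 / (pi * real n) * (1 / (pi * real m))) * (if n = m then 1 / 2 else 0))
     = (\<Sum>n\<in>{1..N}. 1 / (real n)\<^sup>2) / (2 * pi\<^sup>2)"
  proof -
    have "(\<Sum>m\<in>{1..N}. (1 / (pi * real n) * (1 / (pi * real m))) * (if n = m then 1 / 2 else 0)) = 1 / (real n)\<^sup>2 / (2 * pi\<^sup>2)" if "n \<in> {1..N}" for n
    proof -
      have "(\<Sum>m\<in>{1..N}. (1 / (pi * real n) * (1 / (pi * real m))) * (if n = m then 1 / 2 else 0)) = (\<Sum>m\<in>{1..N}. if n = m then 1 / (real n)\<^sup>2 / (2 * pi\<^sup>2) else 0)"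
        by (rule sum.cong) (auto simp: power2_eq_square)
      also have "\<dots> = 1 / (real n)\<^sup>2 / (2 * pi\<^sup>2)" by (subst sum.delta') (use that in auto)
      finally show ?thesis .
    qed
    then show ?thesis by (simp add: sum_divide_distrib)
  qed
  ultimately show ?thesis by (simp only:)
qed

text \<open>With \<open>W c u = (u + c)\<^sup>3 / 3 + 2 ((u + c) P u - Q u)\<close>, where \<open>P\<close> and \<open>Q\<close> are \<open>1\<close>-periodic
  and \<open>P' = s\<close>, \<open>Q' = P\<close> for \<open>s =\<close> \<^const>\<open>sine_sum\<close>, the function \<open>W c\<close> is a primitive of \<open>(u + c)\<^sup>2 + 2 (u + c) s u\<close>.\<close>

lemma has_bochner_integral_sawtooth_cross:
  assumes y: "y \<in> {0..1}"
  shows "has_bochner_integral lborel (\<lambda>t. indicator {0..1} t * ((mean_kernel y t + 1 / 2 - y)\<^sup>2 + 2 * (mean_kernel y t + 1 / 2 - y) * sine_sum N (t - y)))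
    (1 / 12 - (\<Sum>n\<in>{1..N}. 1 / (real n)\<^sup>2) / pi\<^sup>2)"
proof -
  define P where "P u = (\<Sum>n\<in>{1..N}. - cos (2 * pi * real n * u) / (2 * pi\<^sup>2 * (real n)\<^sup>2))" for u
  define Q where "Q u = (\<Sum>n\<in>{1..N}. - sin (2 * pi * real n * u) / (4 * pi ^ 3 * (real n) ^ 3))" for u
  define W where "W c u = (u + c) ^ 3 / 3 + 2 * ((u + c) * P u - Q u)" for c u
  define w where "w c u = (u + c)\<^sup>2 + 2 * (u + c) * sine_sum N u" for c u :: real
  have P': "(P has_real_derivative sine_sum N u) (at u)" for u
    unfolding P_def[abs_def] sine_sum_def
  proof (rule DERIV_sum)
    fix n assume "n \<in> {1..N}"
    then show "((\<lambda>u. - cos (2 * pi * real n * u) / (2 * pi\<^sup>2 * (real n)\<^sup>2)) has_real_derivative sin (2 * pi * real n * u) / (pi * real n)) (at u)"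
      by (auto intro!: derivative_eq_intros simp: power2_eq_square)
  qed
  have Q': "(Q has_real_derivative P u) (at u)" for u
    unfolding Q_def[abs_def] P_def
  proof (rule DERIV_sum)
    fix n assume "n \<in> {1..N}"
    then show "((\<lambda>u. - sin (2 * pi * real n * u) / (4 * pi ^ 3 * (real n) ^ 3)) has_real_derivative - cos (2 * pi * real n * u) / (2 * pi\<^sup>2 * (real n)\<^sup>2)) (at u)"
      by (auto intro!: derivative_eq_intros simp: power2_eq_square power3_eq_cube)
  qed
  have W': "((\<lambda>t. W c (t - y)) has_real_derivative w c (t - y)) (at t)" for c t
  proof -
    have W1: "(W c has_real_derivative w c u) (at u)" for u
    proof -
      have 1: "((\<lambda>u. (u + c) ^ 3 / 3) has_real_derivative (u + c)\<^sup>2) (at u)"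
        by (auto intro!: derivative_eq_intros simp: power2_eq_square)
      have "((\<lambda>u. u + c) has_real_derivative 1) (at u)" by (auto intro!: derivative_eq_intros)
      from DERIV_add[OF 1 DERIV_cmult[OF DERIV_diff[OF DERIV_mult[OF this P'] Q'], of 2]]
      have "(W c has_real_derivative (u + c)\<^sup>2 + 2 * (1 * P u + sine_sum N u * (u + c) - P u)) (at u)"
        unfolding W_def[abs_def] .
      moreover have "(u + c)\<^sup>2 + 2 * (1 * P u + sine_sum N u * (u + c) - P u) = w c u"
        by (simp add: w_def)
      ultimately show ?thesis by (simp only:)
    qed
    have "((\<lambda>t. t - y) has_real_derivative 1) (at t)" by (auto intro!: derivative_eq_intros)
    from DERIV_chain2[OF W1 this] show ?thesis by simp
  qed
  have piece: "has_bochner_integral lborel (\<lambda>t. indicator {a..b} t * w c (t - y)) (W c (b - y) - W c (a - y))" if "a \<le> b" for a b c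
  proof -
    have "has_bochner_integral lborel (\<lambda>t. indicator {a..b} t *\<^sub>R w c (t - y)) (W c (b - y) - W c (a - y))"
    proof (rule has_bochner_integral_FTC_Icc[OF that])
      show "((\<lambda>t. W c (t - y)) has_vector_derivative w c (t - y)) (at t within {a..b})" for t
        using W'[of c t] by (simp add: has_real_derivative_iff_has_vector_derivative has_vector_derivative_at_within)
      show "continuous_on {a..b} (\<lambda>t. w c (t - y))"
        unfolding w_def by (intro continuous_intros)
    qed
    then show ?thesis by simp
  qed
  have per: "P (u + 1) = P u" "Q (u + 1) = Q u" for u
  proof -
    have "2 * pi * real n * (u + 1) = 2 * pi * real n * u + 2 * pi * of_int (int n)" for n by (simp add: algebra_simps)
    then have "cos (2 * pi * real n * (u + 1)) = cos (2 * pi * real n * u)" "sin (2 * pi * real n * (u + 1)) = sin (2 * pi * real n * u)" for n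
      using sin_int_2pin[of "int n"] cos_int_2pin[of "int n"] by (simp_all only: cos_add sin_add)
    then show "P (u + 1) = P u" "Q (u + 1) = Q u" unfolding P_def Q_def by simp_all
  qed
  have "has_bochner_integral lborel (\<lambda>t. indicator {0..y} t * w (1 / 2) (t - y) + indicator {y..1} t * w (- (1 / 2)) (t - y))
     ((W (1 / 2) (y - y) - W (1 / 2) (0 - y)) + (W (- (1 / 2)) (1 - y) - W (- (1 / 2)) (y - y)))"
    using y by (intro has_bochner_integral_add piece) auto
  \<comment> \<open>By periodicity the values at the ends 0 and 1 cancel; only the jump of the
    sawtooth at \<open>y\<close> remains.\<close>
  moreover have "(W (1 / 2) (y - y) - W (1 / 2) (0 - y)) + (W (- (1 / 2)) (1 - y) - W (- (1 / 2)) (y - y)) = 1 / 12 + 2 * P 0"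
  proof -
    have "W (- (1 / 2)) (1 - y) = W (1 / 2) (0 - y)"
      using per(1)[of "0 - y"] per(2)[of "0 - y"] by (simp add: W_def algebra_simps)
    then show ?thesis by (simp add: W_def power3_eq_cube)
  qed
  moreover have "2 * P 0 = - ((\<Sum>n\<in>{1..N}. 1 / (real n)\<^sup>2) / pi\<^sup>2)"
    unfolding P_def sum_distrib_left sum_divide_distrib sum_negf[symmetric] by (rule sum.cong) auto
  ultimately have I: "has_bochner_integral lborel (\<lambda>t. indicator {0..y} t * w (1 / 2) (t - y) + indicator {y..1} t * w (- (1 / 2)) (t - y))
     (1 / 12 - (\<Sum>n\<in>{1..N}. 1 / (real n)\<^sup>2) / pi\<^sup>2)" by simp
  let ?f = "\<lambda>t. indicator {0..1} t * ((mean_kernel y t + 1 / 2 - y)\<^sup>2 + 2 * (mean_kernel y t + 1 / 2 - y) * sine_sum N (t - y))"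
  have [measurable]: "(\<lambda>t. sine_sum N (t - y)) \<in> borel_measurable borel"
    by (intro borel_measurable_continuous_onI continuous_intros)
  have "has_bochner_integral lborel ?f (1 / 12 - (\<Sum>n\<in>{1..N}. 1 / (real n)\<^sup>2) / pi\<^sup>2)
     \<longleftrightarrow> has_bochner_integral lborel (\<lambda>t. indicator {0..y} t * w (1 / 2) (t - y) + indicator {y..1} t * w (- (1 / 2)) (t - y)) (1 / 12 - (\<Sum>n\<in>{1..N}. 1 / (real n)\<^sup>2) / pi\<^sup>2)"
  proof (rule has_bochner_integral_cong_AE)
    show "AE t in lborel. ?f t = indicator {0..y} t * w (1 / 2) (t - y) + indicator {y..1} t * w (- (1 / 2)) (t - y)"
      using AE_lborel_singleton[of y]
    proof eventually_elim
      case (elim t)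
      consider "t \<notin> {0..1}" | "0 \<le> t" "t < y" | "y < t" "t \<le> 1" using elim y by fastforce
      then show ?case
      proof cases
        case 2
        have m: "mean_kernel y t + 1 / 2 - y = t - y + 1 / 2" using 2 y by (simp add: mean_kernel_def)
        show ?thesis unfolding m w_def using 2 y by simp
      next
        case 3
        have m: "mean_kernel y t + 1 / 2 - y = t - y + - (1 / 2)" using 3 y by (simp add: mean_kernel_def)
        show ?thesis unfolding m w_def using 3 y by simp
      qed (use y in auto)
    qed
    show "(\<lambda>t. indicator {0..y} t * w (1 / 2) (t - y) + indicator {y..1} t * w (- (1 / 2)) (t - y)) \<in> borel_measurable lborel"
      unfolding w_def by measurable
  qed measurable
  then show ?thesis using I by simp
qed

text \<open>\<open>1 / 12\<close> is the integral of the squared sawtooth, from which the squared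
  coefficients are subtracted as in Bessel's identity.\<close>

lemma sawtooth_error_square:
  assumes y: "y \<in> {0..1}"
  shows "has_bochner_integral lborel (\<lambda>t. (sawtooth_error N y t)\<^sup>2) (1 / 12 - (\<Sum>n\<in>{1..N}. 1 / (real n)\<^sup>2) / (2 * pi\<^sup>2))"
proof -
  have e: "(sawtooth_error N y t)\<^sup>2 = indicator {0..1} t * ((mean_kernel y t + 1 / 2 - y)\<^sup>2 + 2 * (mean_kernel y t + 1 / 2 - y) * sine_sum N (t - y))
     + indicator {0..1} t * (sine_sum N (t - y))\<^sup>2" for t
    unfolding sawtooth_error_def by (cases "t \<in> {0..1}") (simp_all add: power2_sum)
  have v: "1 / 12 - (\<Sum>n\<in>{1..N}. 1 / (real n)\<^sup>2) / (2 * pi\<^sup>2)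
     = (1 / 12 - (\<Sum>n\<in>{1..N}. 1 / (real n)\<^sup>2) / pi\<^sup>2) + (\<Sum>n\<in>{1..N}. 1 / (real n)\<^sup>2) / (2 * pi\<^sup>2)"
    by (simp add: field_simps)
  show ?thesis unfolding e v
    by (rule has_bochner_integral_add[OF has_bochner_integral_sawtooth_cross[OF y] has_bochner_integral_sine_sum_square])
qed

lemma sawtooth_error_tendsto:
  assumes y: "y \<in> {0..1}"
  shows "(\<lambda>N. \<integral>t. (sawtooth_error N y t)\<^sup>2 \<partial>lborel) \<longlonglongrightarrow> 0"
proof -
  have "(\<lambda>N. \<Sum>n<N. 1 / (real n + 1)\<^sup>2) \<longlonglongrightarrow> pi\<^sup>2 / 6"
    using inverse_squares_sums unfolding sums_def by (simp add: add.commute)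
  moreover have "(\<Sum>n<N. 1 / (real n + 1)\<^sup>2) = (\<Sum>n\<in>{1..N}. 1 / (real n)\<^sup>2)" for N
    by (rule sum.reindex_bij_witness[of _ "\<lambda>n. n - 1" Suc]) auto
  ultimately have "(\<lambda>N. \<Sum>n\<in>{1..N}. 1 / (real n)\<^sup>2) \<longlonglongrightarrow> pi\<^sup>2 / 6" by simp
  from tendsto_diff[OF tendsto_const tendsto_divide[OF this tendsto_const], of "2 * pi\<^sup>2" "1 / 12"]
  show ?thesis unfolding has_bochner_integral_integral_eq[OF sawtooth_error_square[OF y]] by simp
qed

text \<open>The first derivative of the remainder has mean 0, so the constant
  \<open>1 / 2 - y\<close> may be added to \<open>mean_kernel\<close>, which turns it into the
  sawtooth. Cauchy-Schwarz then leaves the L^2 norm of \<open>sawtooth_error\<close>.\<close>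

theorem partial_jet_tendsto:
  assumes G: "sobolev_jet \<alpha> G" and \<alpha>: "\<alpha> \<ge> 1" and y: "y \<in> {0..1}"
  shows "(\<lambda>N. partial_jet \<alpha> N G 0 y) \<longlonglongrightarrow> bernoulli_remainder \<alpha> G y"
proof -
  let ?R = "remainder_jet \<alpha> G"
  have R: "sobolev_jet \<alpha> ?R" by (rule remainder_jet(1)[OF G])
  have zR: "?R 1 t = 0" if "t \<notin> {0..1}" for t using sobolev_jetD(2)[OF R \<alpha> that] .
  have i1: "integrable lborel (?R 1)" by (rule sobolev_jet_integrable[OF R \<alpha>])
  have i2: "integrable lborel (\<lambda>t. (?R 1 t)\<^sup>2)" by (rule sobolev_jet_integrable_square[OF R \<alpha>])
  have [measurable]: "?R 1 \<in> borel_measurable borel" by (rule sobolev_jetD(1)[OF R \<alpha>])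
  have [measurable]: "(\<lambda>t. sine_sum N (t - y)) \<in> borel_measurable borel" for N
    by (intro borel_measurable_continuous_onI continuous_intros)
  have mR: "?R 1 \<in> borel_measurable lborel" by measurable
  have me: "sawtooth_error N y \<in> borel_measurable lborel" for N by measurable
  have ie: "integrable lborel (\<lambda>t. (sawtooth_error N y t)\<^sup>2)" for N
    using sawtooth_error_square[OF y] by (rule integrable.intros)
  have diff: "bernoulli_remainder \<alpha> G y - partial_jet \<alpha> N G 0 y = (LBINT t. ?R 1 t * sawtooth_error N y t)" for N
  proof -
    have im: "integrable lborel (\<lambda>t. mean_kernel y t * ?R 1 t)"
    proof (rule lintegrable_bound[OF i1])
      have "\<bar>mean_kernel y t\<bar> \<le> 1" for t by (auto simp: mean_kernel_def indicator_def)
      then show "AE t in lborel. norm (mean_kernel y t * ?R 1 t) \<le> norm (?R 1 t)"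
        by (intro AE_I2) (simp add: abs_mult mult_left_le_one_le)
    qed measurable
    have isn: "integrable lborel (\<lambda>t. ?R 1 t * sine_sum N (t - y))"
    proof (rule lintegrable_bound)
      let ?C = "\<Sum>n\<in>{1..N}. 1 / (pi * real n)"
      show "integrable lborel (\<lambda>t. ?R 1 t * ?C)" using i1 by simp
      have "\<bar>sine_sum N u\<bar> \<le> ?C" for u
        unfolding sine_sum_def by (rule order_trans[OF sum_abs]) (auto intro!: sum_mono divide_right_mono simp: abs_mult)
      moreover have "?C \<ge> 0" by (auto intro!: sum_nonneg)
      ultimately show "AE t in lborel. norm (?R 1 t * sine_sum N (t - y)) \<le> norm (?R 1 t * ?C)"
        by (intro AE_I2) (simp add: abs_mult mult_left_mono)
    qed measurable
    have "bernoulli_remainder \<alpha> G y - partial_jet \<alpha> N G 0 y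
       = (LBINT t. mean_kernel y t * ?R 1 t) + (LBINT t. ?R 1 t * sine_sum N (t - y)) + (LBINT t. (1 / 2 - y) * ?R 1 t)"
      unfolding bernoulli_remainder_eq[OF y] partial_jet_eq_sine_sum[OF G \<alpha>]
      using jet_mean_representation[OF R _ y, of 0] \<alpha> remainder_jet(2)[OF G, of 0] remainder_jet(2)[OF G \<alpha>] by simp
    also have "\<dots> = (LBINT t. mean_kernel y t * ?R 1 t + ?R 1 t * sine_sum N (t - y) + (1 / 2 - y) * ?R 1 t)"
      using im isn i1 by simp
    also have "\<dots> = (LBINT t. ?R 1 t * sawtooth_error N y t)"
    proof (rule lintegral_cong[OF refl])
      fix t
      show "mean_kernel y t * ?R 1 t + ?R 1 t * sine_sum N (t - y) + (1 / 2 - y) * ?R 1 t = ?R 1 t * sawtooth_error N y t"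
        using zR[of t] by (cases "t \<in> {0..1}") (simp_all add: sawtooth_error_def algebra_simps)
    qed
    finally show ?thesis .
  qed
  have "(\<lambda>N. (bernoulli_remainder \<alpha> G y - partial_jet \<alpha> N G 0 y)\<^sup>2) \<longlonglongrightarrow> 0"
  proof (rule tendsto_sandwich[OF _ _ tendsto_const])
    show "(\<lambda>N. (LBINT t. (?R 1 t)\<^sup>2) * (LBINT t. (sawtooth_error N y t)\<^sup>2)) \<longlonglongrightarrow> 0"
      using tendsto_mult_right_zero[OF sawtooth_error_tendsto[OF y]] by simp
    show "\<forall>\<^sub>F N in sequentially. (bernoulli_remainder \<alpha> G y - partial_jet \<alpha> N G 0 y)\<^sup>2
        \<le> (LBINT t. (?R 1 t)\<^sup>2) * (LBINT t. (sawtooth_error N y t)\<^sup>2)"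
      unfolding diff by (intro always_eventually allI integral_Cauchy_Schwarz[OF i2 ie mR me])
  qed simp
  then have "(\<lambda>N. bernoulli_remainder \<alpha> G y - partial_jet \<alpha> N G 0 y) \<longlonglongrightarrow> 0" by simp
  from tendsto_diff[OF tendsto_const this, of "bernoulli_remainder \<alpha> G y"] show ?thesis by simp
qed

section \<open>Trigonometric partial sums of tensors\<close>

lemma character_eq_prod: "character d h x = (\<Prod>j<d. cis (2 * pi * of_int (h j) * x j))"
proof -
  have "2 * of_real pi * \<i> * of_real (\<Sum>j<d. of_int (h j) * x j) = (\<Sum>j<d. \<i> * of_real (2 * pi * of_int (h j) * x j))"
    by (simp add: sum_distrib_left mult_ac)
  then show ?thesis unfolding character_def cis_conv_exp by (simp only: exp_sum finite_lessThan)
qed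

lemma norm_character [simp]: "norm (character d h x) = 1"
  unfolding character_eq_prod by (simp add: prod_norm[symmetric])

lemma character_mult_cnj: "character d h x * cnj (character d l x) = character d (\<lambda>j. h j - l j) x"
  unfolding character_eq_prod cnj_prod prod.distrib[symmetric]
  by (intro prod.cong refl) (simp add: cis_cnj cis_mult algebra_simps)

lemma has_bochner_integral_cis:
  "has_bochner_integral unit_lborel (\<lambda>t. cis (2 * pi * of_int m * t)) (if m = 0 then 1 else 0)"
proof -
  have c: "has_bochner_integral lborel (\<lambda>t. complex_of_real (indicator {0..1} t * cos (2 * pi * of_int m * t + c))) (complex_of_real (if m = 0 then cos c else 0))" for c
    by (rule has_bochner_integral_bounded_linear[OF bounded_linear_of_real has_bochner_integral_cos_period])
  have "has_bochner_integral lborel (\<lambda>t. complex_of_real (indicator {0..1} t * cos (2 * pi * of_int m * t + 0)) + \<i> * complex_of_real (indicator {0..1} t * cos (2 * pi * of_int m * t + - (pi / 2))))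
     (complex_of_real (if m = 0 then cos 0 else 0) + \<i> * complex_of_real (if m = 0 then cos (- (pi / 2)) else 0))"
    by (intro has_bochner_integral_add has_bochner_integral_mult_right c)
  moreover have "complex_of_real (indicator {0..1} t * cos (2 * pi * of_int m * t + 0)) + \<i> * complex_of_real (indicator {0..1} t * cos (2 * pi * of_int m * t + - (pi / 2)))
     = indicator {0..1} t *\<^sub>R cis (2 * pi * of_int m * t)" for t
  proof -
    have "cos (2 * pi * of_int m * t + - (pi / 2)) = sin (2 * pi * of_int m * t)" by (simp add: cos_diff)
    then show ?thesis by (cases "t \<in> {0..1}") (simp_all add: complex_eq_iff)
  qed
  moreover have "complex_of_real (if m = 0 then cos 0 else 0) + \<i> * complex_of_real (if m = 0 then cos (- (pi / 2)) else 0) = (if m = 0 then 1 else 0)"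
    by simp
  ultimately have "has_bochner_integral lborel (\<lambda>t. indicator {0..1} t *\<^sub>R cis (2 * pi * of_int m * t)) (if m = 0 then 1 else 0)"
    by (simp only:)
  then show ?thesis by (simp add: has_bochner_integral_iff integrable_restrict_space integral_restrict_space)
qed

lemma has_bochner_integral_character:
  assumes h: "h \<in> frequencies d" "l \<in> frequencies d"
  shows "has_bochner_integral (unit_lborel_on {..<d}) (\<lambda>x. character d h x * cnj (character d l x)) (if h = l then 1 else 0)"
proof -
  let ?f = "\<lambda>j t. cis (2 * pi * of_int (h j - l j) * t)"
  have i: "integrable unit_lborel (?f j)" for j
    using has_bochner_integral_cis by (rule integrable.intros)
  have "(\<integral>x. (\<Prod>j<d. ?f j (x j)) \<partial>unit_lborel_on {..<d}) = (\<Prod>j<d. \<integral>t. ?f j t \<partial>unit_lborel)"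
    by (rule unit_PiM.product_integral_prod[OF _ i]) simp
  also have "\<dots> = (\<Prod>j<d. if h j - l j = 0 then 1 else 0)"
    by (intro prod.cong refl has_bochner_integral_integral_eq has_bochner_integral_cis)
  also have "\<dots> = (if h = l then 1 else 0)"
  proof (cases "h = l")
    case False
    then obtain j where "j < d" "h j \<noteq> l j"
      using h unfolding frequencies_def by (metis PiE_ext lessThan_iff)
    then have "(\<Prod>j<d. if h j - l j = 0 then 1 else (0 :: complex)) = 0" by (intro prod_zero) auto
    then show ?thesis using False by simp
  qed simp
  finally have "(\<integral>x. (\<Prod>j<d. ?f j (x j)) \<partial>unit_lborel_on {..<d}) = (if h = l then 1 else 0)" .
  moreover have "integrable (unit_lborel_on {..<d}) (\<lambda>x. \<Prod>j<d. ?f j (x j))"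
    by (rule unit_PiM.product_integrable_prod[OF _ i]) simp
  ultimately show ?thesis
    unfolding character_mult_cnj unfolding character_eq_prod has_bochner_integral_iff by (simp only: simp_thms)
qed

lemma sum_freq_box_cnj:
  assumes "\<And>h. f (- h) = cnj (f h)"
  shows "(\<Sum>h\<in>freq_box N. f h) = of_real (\<Sum>h\<in>freq_box N. Re (f h))"
proof (rule complex_eqI)
  have "(\<Sum>h\<in>freq_box N. Im (f h)) = (\<Sum>h\<in>freq_box N. Im (f (- h)))"
    by (rule sum.reindex_bij_witness[of _ uminus uminus]) auto
  also have "\<dots> = - (\<Sum>h\<in>freq_box N. Im (f h))" by (simp add: assms sum_negf)
  finally show "Im (\<Sum>h\<in>freq_box N. f h) = Im (of_real (\<Sum>h\<in>freq_box N. Re (f h)))" by simp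
qed simp

text \<open>A Fourier coefficient of the transform, not of \<open>G\<close>: the inner product with
  the character, divided by the squared weight. The minus sign makes the sine coefficient an
  imaginary part.\<close>

definition jet_fourier :: "nat \<Rightarrow> jet \<Rightarrow> int \<Rightarrow> complex" where
  "jet_fourier \<alpha> G h = Complex (jet_coeff \<alpha> G h 0) (- jet_coeff \<alpha> G h (- (pi / 2))) / of_real ((korobov_weight1 \<alpha> h)\<^sup>2)"

lemma jet_fourier_minus: "jet_fourier \<alpha> G (- h) = cnj (jet_fourier \<alpha> G h)"
  unfolding jet_fourier_def jet_coeff_minus korobov_weight1_minus by (simp add: complex_eq_iff)

lemma partial_jet_fourier:
  "of_real (partial_jet \<alpha> N G 0 y) = (\<Sum>h\<in>freq_box N. jet_fourier \<alpha> G h * cis (2 * pi * of_int h * y))"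
proof -
  have m: "jet_fourier \<alpha> G (- h) * cis (2 * pi * of_int (- h) * y) = cnj (jet_fourier \<alpha> G h * cis (2 * pi * of_int h * y))" for h
    by (simp add: jet_fourier_minus cis_cnj)
  have "Re (jet_fourier \<alpha> G h * cis (2 * pi * of_int h * y)) =
     (jet_coeff \<alpha> G h 0 * wave h 0 0 y + jet_coeff \<alpha> G h (- (pi / 2)) * wave h (- (pi / 2)) 0 y) / (korobov_weight1 \<alpha> h)\<^sup>2" for h
  proof -
    have "wave h 0 0 y = cos (2 * pi * of_int h * y)" by (simp add: wave_def)
    then show ?thesis unfolding jet_fourier_def wave_sin by (simp add: Re_divide_of_real Im_divide_of_real add_divide_distrib del: of_real_power)
  qed
  then show ?thesis unfolding sum_freq_box_cnj[of "\<lambda>h. jet_fourier \<alpha> G h * cis (2 * pi * of_int h * y)", OF m] partial_jet_def by simp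
qed

lemma coeff_inner_fourier:
  "of_real (coeff_inner \<alpha> N G H) = (\<Sum>h\<in>freq_box N. jet_fourier \<alpha> G h * cnj (jet_fourier \<alpha> H h) * of_real ((korobov_weight1 \<alpha> h)\<^sup>2))"
proof -
  have m: "jet_fourier \<alpha> G (- h) * cnj (jet_fourier \<alpha> H (- h)) * of_real ((korobov_weight1 \<alpha> (- h))\<^sup>2)
     = cnj (jet_fourier \<alpha> G h * cnj (jet_fourier \<alpha> H h) * of_real ((korobov_weight1 \<alpha> h)\<^sup>2))" for h
    by (simp add: jet_fourier_minus korobov_weight1_minus)
  have "Re (jet_fourier \<alpha> G h * cnj (jet_fourier \<alpha> H h) * of_real ((korobov_weight1 \<alpha> h)\<^sup>2))
     = (jet_coeff \<alpha> G h 0 * jet_coeff \<alpha> H h 0 + jet_coeff \<alpha> G h (- (pi / 2)) * jet_coeff \<alpha> H h (- (pi / 2))) / (korobov_weight1 \<alpha> h)\<^sup>2" for h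
  proof -
    have r: "(korobov_weight1 \<alpha> h)\<^sup>2 \<noteq> 0" using korobov_weight1_pos[of \<alpha> h] by simp
    define s where "s = (korobov_weight1 \<alpha> h)\<^sup>2"
    have "s \<noteq> 0" using r by (simp add: s_def)
    then show ?thesis unfolding jet_fourier_def s_def[symmetric]
      by (simp add: Re_divide_of_real Im_divide_of_real field_simps)
  qed
  then show ?thesis unfolding sum_freq_box_cnj[of "\<lambda>h. jet_fourier \<alpha> G h * cnj (jet_fourier \<alpha> H h) * of_real ((korobov_weight1 \<alpha> h)\<^sup>2)", OF m] coeff_inner_def by simp
qed

section \<open>Boxes of frequencies and summability of the weights\<close>

definition frequency_box :: "nat \<Rightarrow> nat \<Rightarrow> (nat \<Rightarrow> int) set" where
  "frequency_box d N = {..<d} \<rightarrow>\<^sub>E freq_box N"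

lemma frequency_box: "finite (frequency_box d N)" "frequency_box d N \<subseteq> frequencies d"
  unfolding frequency_box_def frequencies_def by (auto intro: finite_PiE)

lemma frequency_box_Int: "frequency_box d N \<inter> frequency_box d M = frequency_box d (min N M)"
  unfolding frequency_box_def freq_box_Int[symmetric] by (auto simp: PiE_iff)

lemma prod_sum_freq_box:
  fixes f :: "nat \<Rightarrow> int \<Rightarrow> 'a::comm_semiring_1"
  shows "(\<Prod>j<d. \<Sum>h\<in>freq_box N. f j h) = (\<Sum>h\<in>frequency_box d N. \<Prod>j<d. f j (h j))"
  unfolding frequency_box_def by (rule prod_sum_PiE) auto

lemma frequency_box_absorbs:
  assumes X: "finite X" "X \<subseteq> frequencies d"
  shows "\<exists>M. \<forall>N\<ge>M. X \<subseteq> frequency_box d N"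
proof -
  \<comment> \<open>A crude bound for all entries of all members of \<open>X\<close>.\<close>
  let ?M = "\<Sum>h\<in>X. \<Sum>j<d. nat \<bar>h j\<bar>"
  have "h \<in> frequency_box d N" if h: "h \<in> X" and N: "N \<ge> ?M" for h N
  proof -
    have "h j \<in> freq_box N" if j: "j < d" for j
    proof -
      have "nat \<bar>h j\<bar> \<le> (\<Sum>j<d. nat \<bar>h j\<bar>)" by (rule member_le_sum) (use j in auto)
      also have "\<dots> \<le> ?M" by (rule member_le_sum[OF h]) (use X in auto)
      finally have "nat \<bar>h j\<bar> \<le> N" using N by simp
      then show ?thesis by (auto simp: freq_box_def)
    qed
    then show ?thesis using h X unfolding frequency_box_def frequencies_def by (auto simp: PiE_iff)
  qed
  then show ?thesis by blast
qed

text \<open>Every finite set of frequencies lies in all large boxes, so the boxes are a sequence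
  running through the filter of finite subsets.\<close>

lemma has_sum_frequency_box:
  assumes "(f has_sum S) (frequencies d)"
  shows "(\<lambda>N. \<Sum>h\<in>frequency_box d N. f h) \<longlonglongrightarrow> S"
proof -
  have "filterlim (frequency_box d) (finite_subsets_at_top (frequencies d)) sequentially"
    unfolding filterlim_finite_subsets_at_top eventually_sequentially
    using frequency_box frequency_box_absorbs by meson
  then show ?thesis using assms unfolding has_sum_def by (rule filterlim_compose[rotated])
qed

lemma korobov_weight_pos: "korobov_weight \<alpha> d h > 0"
  unfolding korobov_weight_def by (intro prod_pos) (simp add: korobov_weight1_pos)

text \<open>The weight at \<open>n\<close> is at least \<open>n\<close>, and the series of inverse
  squares is counted once for each sign.\<close>

lemma sum_korobov_weight1_le:
  assumes "\<alpha> \<ge> 1"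
  shows "(\<Sum>h\<in>freq_box N. 1 / (korobov_weight1 \<alpha> h)\<^sup>2) \<le> 1 + pi\<^sup>2 / 3"
proof -
  have le: "1 / (korobov_weight1 \<alpha> (int n))\<^sup>2 \<le> 1 / (real n)\<^sup>2" if "n \<in> {1..N}" for n
  proof -
    have n: "real n \<ge> 1" using that by simp
    have "real n = 1 * real n" by simp
    also have "\<dots> \<le> 2 * pi * real n" using pi_gt3 n by (intro mult_right_mono) auto
    finally have a: "real n \<le> 2 * pi * real n" .
    then have b: "1 \<le> 2 * pi * real n" using n by linarith
    have "(2 * pi * real n) ^ 1 \<le> (2 * pi * real n) ^ \<alpha>" by (rule power_increasing[OF assms b])
    then have "real n \<le> (2 * pi * real n) ^ \<alpha>" unfolding power_one_right using a by (rule order_trans[rotated])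
    moreover have "korobov_weight1 \<alpha> (int n) = (2 * pi * real n) ^ \<alpha>" using n by (simp add: korobov_weight1_def)
    ultimately have "real n \<le> korobov_weight1 \<alpha> (int n)" by (simp only:)
    then have "(real n)\<^sup>2 \<le> (korobov_weight1 \<alpha> (int n))\<^sup>2" by (intro power_mono) auto
    then show ?thesis using n by (intro frac_le) auto
  qed
  have s: "(\<lambda>n. 1 / (real n + 1)\<^sup>2) sums (pi\<^sup>2 / 6)" using inverse_squares_sums by (simp add: add.commute)
  have "(\<Sum>n\<in>{1..N}. 1 / (real n)\<^sup>2) = (\<Sum>n<N. 1 / (real n + 1)\<^sup>2)"
    by (rule sum.reindex_bij_witness[of _ Suc "\<lambda>n. n - 1"]) auto
  also have "\<dots> \<le> pi\<^sup>2 / 6"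
    unfolding sums_unique[OF s] by (rule sum_le_suminf[OF sums_summable[OF s]]) auto
  finally have sq: "(\<Sum>n\<in>{1..N}. 1 / (real n)\<^sup>2) \<le> pi\<^sup>2 / 6" .
  have "(\<Sum>h\<in>freq_box N. 1 / (korobov_weight1 \<alpha> h)\<^sup>2) = 1 + (\<Sum>n\<in>{1..N}. 2 * (1 / (korobov_weight1 \<alpha> (int n))\<^sup>2))"
    unfolding sum_freq_box korobov_weight1_minus by (simp add: korobov_weight1_def)
  also have "\<dots> \<le> 1 + (\<Sum>n\<in>{1..N}. 2 * (1 / (real n)\<^sup>2))"
    by (intro add_left_mono sum_mono mult_left_mono le) auto
  also have "\<dots> \<le> 1 + pi\<^sup>2 / 3" using sq unfolding sum_distrib_left[symmetric] by simp
  finally show ?thesis .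
qed

lemma sum_korobov_weight_eq:
  "(\<Sum>h\<in>frequency_box d N. 1 / (korobov_weight \<alpha> d h)\<^sup>2) = (\<Sum>h\<in>freq_box N. 1 / (korobov_weight1 \<alpha> h)\<^sup>2) ^ d"
proof -
  have "(\<Sum>h\<in>freq_box N. 1 / (korobov_weight1 \<alpha> h)\<^sup>2) ^ d = (\<Prod>j<d. \<Sum>h\<in>freq_box N. 1 / (korobov_weight1 \<alpha> h)\<^sup>2)" by simp
  then show ?thesis unfolding prod_sum_freq_box korobov_weight_def by (simp add: prod_power_distrib prod_dividef)
qed

lemma sum_korobov_weight_le:
  assumes "\<alpha> \<ge> 1"
  shows "(\<Sum>h\<in>frequency_box d N. 1 / (korobov_weight \<alpha> d h)\<^sup>2) \<le> (1 + pi\<^sup>2 / 3) ^ d"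
  unfolding sum_korobov_weight_eq by (intro power_mono sum_korobov_weight1_le assms sum_nonneg) auto

lemma korobov_weight_summable:
  assumes "\<alpha> \<ge> 1"
  shows "(\<lambda>h. 1 / (korobov_weight \<alpha> d h)\<^sup>2) summable_on frequencies d"
proof (rule nonneg_bdd_above_summable_on)
  show "bdd_above (sum (\<lambda>h. 1 / (korobov_weight \<alpha> d h)\<^sup>2) ` {F. F \<subseteq> frequencies d \<and> finite F})"
  proof (rule bdd_aboveI2)
    fix X assume "X \<in> {F. F \<subseteq> frequencies d \<and> finite F}"
    then have "\<exists>M. \<forall>N\<ge>M. X \<subseteq> frequency_box d N" by (intro frequency_box_absorbs) auto
    then obtain N where "\<forall>n\<ge>N. X \<subseteq> frequency_box d n" ..
    then have "X \<subseteq> frequency_box d N" by simp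
    then have "(\<Sum>h\<in>X. 1 / (korobov_weight \<alpha> d h)\<^sup>2) \<le> (\<Sum>h\<in>frequency_box d N. 1 / (korobov_weight \<alpha> d h)\<^sup>2)"
      by (intro sum_mono2 frequency_box) auto
    also have "\<dots> \<le> (1 + pi\<^sup>2 / 3) ^ d" by (rule sum_korobov_weight_le[OF assms])
    finally show "(\<Sum>h\<in>X. 1 / (korobov_weight \<alpha> d h)\<^sup>2) \<le> (1 + pi\<^sup>2 / 3) ^ d" .
  qed
qed simp

section \<open>Projections of tensors and their Fourier coefficients\<close>

definition tensor_partial :: "nat \<Rightarrow> nat \<Rightarrow> tensor \<Rightarrow> tensor" where
  "tensor_partial \<alpha> N L = map (\<lambda>J j. restrict_jet (partial_jet \<alpha> N (J j))) L"

definition tensor_fourier :: "nat \<Rightarrow> nat \<Rightarrow> tensor \<Rightarrow> (nat \<Rightarrow> int) \<Rightarrow> complex" where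
  "tensor_fourier \<alpha> d L h = (\<Sum>J\<leftarrow>L. \<Prod>j<d. jet_fourier \<alpha> (J j) (h j))"

definition tensor_coeff_inner :: "nat \<Rightarrow> nat \<Rightarrow> nat \<Rightarrow> tensor \<Rightarrow> tensor \<Rightarrow> real" where
  "tensor_coeff_inner \<alpha> d N L M = (\<Sum>J\<leftarrow>L. \<Sum>K\<leftarrow>M. \<Prod>j<d. coeff_inner \<alpha> N (J j) (K j))"

lemma tensor_deriv_partial:
  assumes "x \<in> unit_cube d"
  shows "tensor_deriv d (\<lambda>_. 0) (tensor_partial \<alpha> N L) x = (\<Sum>J\<leftarrow>L. \<Prod>j<d. partial_jet \<alpha> N (J j) 0 (x j))"
proof -
  have "restrict_jet (partial_jet \<alpha> N G) 0 (x j) = partial_jet \<alpha> N G 0 (x j)" if "j < d" for G j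
    using assms that by (auto simp: unit_cube_def PiE_iff restrict_jet_def)
  then have "(\<Prod>j<d. restrict_jet (partial_jet \<alpha> N (J j)) 0 (x j)) = (\<Prod>j<d. partial_jet \<alpha> N (J j) 0 (x j))" for J :: "nat \<Rightarrow> jet"
    by (intro prod.cong) auto
  then show ?thesis unfolding tensor_deriv_def tensor_partial_def map_map o_def by simp
qed

lemma tensor_partial_fourier:
  assumes "x \<in> unit_cube d"
  shows "of_real (tensor_deriv d (\<lambda>_. 0) (tensor_partial \<alpha> N L) x) = (\<Sum>h\<in>frequency_box d N. tensor_fourier \<alpha> d L h * character d h x)"
  unfolding tensor_deriv_partial[OF assms] tensor_fourier_def sum_list_conv_sum character_eq_prod of_real_sum of_real_prod
    partial_jet_fourier prod_sum_freq_box sum_distrib_right prod.distrib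
  by (rule sum.swap)

lemma tensor_coeff_inner_fourier:
  "of_real (tensor_coeff_inner \<alpha> d N L M)
    = (\<Sum>h\<in>frequency_box d N. tensor_fourier \<alpha> d L h * cnj (tensor_fourier \<alpha> d M h) * of_real ((korobov_weight \<alpha> d h)\<^sup>2))"
proof -
  have "of_real (tensor_coeff_inner \<alpha> d N L M) = (\<Sum>i<length L. \<Sum>k<length M. \<Sum>h\<in>frequency_box d N.
     \<Prod>j<d. jet_fourier \<alpha> ((L ! i) j) (h j) * cnj (jet_fourier \<alpha> ((M ! k) j) (h j)) * of_real ((korobov_weight1 \<alpha> (h j))\<^sup>2))"
    unfolding tensor_coeff_inner_def sum_list_conv_sum of_real_sum of_real_prod coeff_inner_fourier prod_sum_freq_box ..
  also have "\<dots> = (\<Sum>h\<in>frequency_box d N. \<Sum>i<length L. \<Sum>k<length M.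
     \<Prod>j<d. jet_fourier \<alpha> ((L ! i) j) (h j) * cnj (jet_fourier \<alpha> ((M ! k) j) (h j)) * of_real ((korobov_weight1 \<alpha> (h j))\<^sup>2))"
    by (simp only: sum.swap[of _ _ "frequency_box d N"])
  also have "\<dots> = (\<Sum>h\<in>frequency_box d N. tensor_fourier \<alpha> d L h * cnj (tensor_fourier \<alpha> d M h) * of_real ((korobov_weight \<alpha> d h)\<^sup>2))"
    unfolding tensor_fourier_def sum_list_conv_sum cnj_sum cnj_prod sum_product korobov_weight_def
      prod_power_distrib of_real_prod prod.distrib
    unfolding sum_distrib_right ..
  finally show ?thesis .
qed

lemma tensor_coeff_inner_self:
  "tensor_coeff_inner \<alpha> d N L L = (\<Sum>h\<in>frequency_box d N. (norm (tensor_fourier \<alpha> d L h))\<^sup>2 * (korobov_weight \<alpha> d h)\<^sup>2)"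
proof -
  have "complex_of_real (tensor_coeff_inner \<alpha> d N L L) = of_real (\<Sum>h\<in>frequency_box d N. (norm (tensor_fourier \<alpha> d L h))\<^sup>2 * (korobov_weight \<alpha> d h)\<^sup>2)"
    unfolding tensor_coeff_inner_fourier complex_norm_square[symmetric] of_real_sum of_real_mult ..
  then show ?thesis by (simp only: of_real_eq_iff)
qed

text \<open>Orthonormality of the characters. Only the values of \<open>f\<close> on the cube are
  given, which is all that the completed measure sees.\<close>

lemma fourier_coeff_trigonometric:
  assumes f: "\<And>x. x \<in> unit_cube d \<Longrightarrow> of_real (f x) = (\<Sum>h\<in>frequency_box d N. c h * character d h x)"
    and l: "l \<in> frequencies d"
  shows "fourier_coeff d f l = (if l \<in> frequency_box d N then c l else 0)"
proof -
  let ?P = "unit_lborel_on {..<d}"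
  let ?g = "\<lambda>x. \<Sum>h\<in>frequency_box d N. c h * (character d h x * cnj (character d l x))"
  have hb: "has_bochner_integral ?P ?g (\<Sum>h\<in>frequency_box d N. c h * (if h = l then 1 else 0))"
    by (intro has_bochner_integral_sum has_bochner_integral_mult_right has_bochner_integral_character l) (use frequency_box in blast)
  have "fourier_coeff d f l = (\<integral>x. ?g x \<partial>?P)"
    unfolding fourier_coeff_def cube_measure_def
  proof (rule integral_completion_AE_eq)
    show "?g \<in> borel_measurable ?P" using hb by (rule borel_measurable_has_bochner_integral)
    show "AE x in ?P. of_real (f x) * cnj (character d l x) = ?g x"
    proof (rule AE_I2)
      fix x assume "x \<in> space ?P"
      then have "x \<in> unit_cube d" by (simp add: space_PiM unit_cube_def space_restrict_space)
      then show "of_real (f x) * cnj (character d l x) = ?g x" by (simp add: f sum_distrib_right mult.assoc)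
    qed
  qed
  also have "\<dots> = (\<Sum>h\<in>frequency_box d N. c h * (if h = l then 1 else 0))"
    by (rule has_bochner_integral_integral_eq[OF hb])
  also have "\<dots> = (if l \<in> frequency_box d N then c l else 0)"
    by (simp add: if_distrib[of "\<lambda>y. _ * y"] sum.delta frequency_box(1) cong: if_cong)
  finally show ?thesis .
qed

text \<open>Dominated convergence with a constant majorant on a space of measure 1; the limit
  function is measurable as a pointwise limit.\<close>

lemma fourier_coeff_limit:
  assumes conv: "\<And>x. x \<in> unit_cube d \<Longrightarrow> (\<lambda>n. f n x) \<longlonglongrightarrow> F x"
    and bound: "\<And>n x. x \<in> unit_cube d \<Longrightarrow> \<bar>f n x\<bar> \<le> B"
    and meas: "\<And>n. f n \<in> borel_measurable (cube_measure {..<d})"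
  shows "(\<lambda>n. fourier_coeff d (f n) l) \<longlonglongrightarrow> fourier_coeff d F l"
proof -
  let ?P = "unit_lborel_on {..<d}" and ?M = "cube_measure {..<d}"
  have sp: "space ?M = unit_cube d"
    by (simp add: cube_measure_def space_PiM unit_cube_def space_restrict_space)
  have "emeasure ?M (space ?M) = 1"
    unfolding cube_measure_def using emeasure_space_unit_PiM[of "{..<d}"] by (simp add: emeasure_completion)
  then interpret finite_measure ?M by (intro finite_measureI) simp
  have iB: "integrable ?M (\<lambda>_. B)" by simp
  have "character d l \<in> borel_measurable ?P"
    unfolding character_eq_prod[abs_def]
    using has_bochner_integral_cis[THEN borel_measurable_has_bochner_integral]
    by (intro borel_measurable_prod measurable_compose[OF measurable_component_singleton]) auto
  then have [measurable]: "character d l \<in> borel_measurable ?M" unfolding cube_measure_def by (rule measurable_completion)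
  note [measurable] = meas
  have [measurable]: "F \<in> borel_measurable ?M"
    by (rule borel_measurable_LIMSEQ_real[OF _ meas]) (use conv sp in auto)
  have cnj [measurable]: "(\<lambda>x. cnj (character d l x)) \<in> borel_measurable ?M"
    by (rule borel_measurable_continuous_on[OF _ \<open>character d l \<in> borel_measurable ?M\<close>]) (intro continuous_intros)
  show ?thesis
    unfolding fourier_coeff_def
  proof (rule integral_dominated_convergence[OF _ _ iB])
    show "AE x in ?M. (\<lambda>n. of_real (f n x) * cnj (character d l x)) \<longlonglongrightarrow> of_real (F x) * cnj (character d l x)"
      by (rule AE_I2) (auto simp: sp intro!: tendsto_intros conv)
    show "AE x in ?M. norm (of_real (f n x) * cnj (character d l x)) \<le> B" for n
      by (rule AE_I2) (auto simp: sp norm_mult bound)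
  qed measurable
qed

section \<open>Limits of tensors\<close>

text \<open>Lists of elementary tensors are added by concatenation; a sign is absorbed by the first factor.\<close>

definition neg_tensor :: "tensor \<Rightarrow> tensor" where
  "neg_tensor L = map (\<lambda>J. J(0 := \<lambda>k t. - J 0 k t)) L"

definition tensor_diff :: "tensor \<Rightarrow> tensor \<Rightarrow> tensor" where
  "tensor_diff A B = A @ neg_tensor B"

text \<open>Concatenation and sign suffice for differences and telescoping sums, the only
  combinations that occur.\<close>

definition tensor_linear :: "(tensor \<Rightarrow> 'a::ab_group_add) \<Rightarrow> bool" where
  "tensor_linear T \<longleftrightarrow> (\<forall>A B. T (A @ B) = T A + T B) \<and> (\<forall>A. T (neg_tensor A) = - T A)"

lemma tensor_linearD:
  assumes "tensor_linear T"
  shows "T (A @ B) = T A + T B" "T (neg_tensor A) = - T A" "T (tensor_diff A B) = T A - T B"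
proof -
  show 1: "T (A @ B) = T A + T B" for A B using assms unfolding tensor_linear_def by blast
  show 2: "T (neg_tensor A) = - T A" for A using assms unfolding tensor_linear_def by blast
  show "T (tensor_diff A B) = T A - T B" unfolding tensor_diff_def 1 2 by simp
qed

lemma tensor_linear_sum_list:
  assumes "\<And>J. c (J(0 := \<lambda>k t. - J 0 k t)) = - c J"
  shows "tensor_linear (\<lambda>L. \<Sum>J\<leftarrow>L. c J)"
proof -
  have gen: "(\<Sum>J\<leftarrow>map \<nu> A. c J) = - (\<Sum>J\<leftarrow>A. c J)" if "\<And>J. c (\<nu> J) = - c J" for \<nu> A
    using that by (induction A) simp_all
  have "(\<Sum>J\<leftarrow>neg_tensor A. c J) = - (\<Sum>J\<leftarrow>A. c J)" for A
    unfolding neg_tensor_def by (rule gen) (rule assms)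
  then show ?thesis unfolding tensor_linear_def by simp
qed

text \<open>Here \<open>d \<ge> 1\<close> matters: the sign sits in coordinate 0.\<close>

lemma prod_fun_upd_uminus:
  fixes u :: "nat \<Rightarrow> jet \<Rightarrow> 'a::comm_ring_1"
  assumes d: "d \<ge> 1" and u: "\<And>j G. u j (\<lambda>k t. - G k t) = - u j G"
  shows "(\<Prod>j<d. u j ((J(0 := \<lambda>k t. - J 0 k t)) j)) = - (\<Prod>j<d. u j (J j))"
proof -
  let ?J = "J(0 := \<lambda>k t. - J 0 k t)"
  have split: "(\<Prod>j<d. f j) = f 0 * (\<Prod>j\<in>{..<d} - {0}. f j)" for f :: "nat \<Rightarrow> 'a"
    using d by (intro prod.remove) auto
  have "(\<Prod>j\<in>{..<d} - {0}. u j (?J j)) = (\<Prod>j\<in>{..<d} - {0}. u j (J j))" by (rule prod.cong) auto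
  moreover have "u 0 (?J 0) = - u 0 (J 0)" using u[of 0 "J 0"] by simp
  ultimately show ?thesis
    unfolding split[of "\<lambda>j. u j (?J j)"] split[of "\<lambda>j. u j (J j)"] by simp
qed

lemma tensor_linear_prod:
  fixes u :: "nat \<Rightarrow> jet \<Rightarrow> 'a::comm_ring_1"
  assumes "d \<ge> 1" "\<And>j G. u j (\<lambda>k t. - G k t) = - u j G"
  shows "tensor_linear (\<lambda>L. \<Sum>J\<leftarrow>L. \<Prod>j<d. u j (J j))"
  by (rule tensor_linear_sum_list) (rule prod_fun_upd_uminus[where u = u, OF assms])

lemma jet_inner_uminus: "jet_inner \<alpha> (\<lambda>k t. - G k t) H = - jet_inner \<alpha> G H"
  by (simp add: jet_inner_def sum_negf)

lemma jet_coeff_uminus: "jet_coeff \<alpha> (\<lambda>k t. - G k t) h c = - jet_coeff \<alpha> G h c"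
  unfolding jet_coeff_def by (rule jet_inner_uminus)

lemma partial_jet_uminus: "partial_jet \<alpha> N (\<lambda>k t. - G k t) k t = - partial_jet \<alpha> N G k t"
  unfolding partial_jet_def jet_coeff_uminus sum_negf[symmetric]
  by (intro sum.cong refl) (simp add: add_divide_distrib diff_divide_distrib)

lemma tensor_partial_append: "tensor_partial \<alpha> N (A @ B) = tensor_partial \<alpha> N A @ tensor_partial \<alpha> N B"
  by (simp add: tensor_partial_def)

lemma tensor_partial_neg: "tensor_partial \<alpha> N (neg_tensor A) = neg_tensor (tensor_partial \<alpha> N A)"
proof -
  have "restrict_jet (partial_jet \<alpha> N (\<lambda>k t. - G k t)) = (\<lambda>k t. - restrict_jet (partial_jet \<alpha> N G) k t)" for G
    by (intro ext) (simp add: restrict_jet_def partial_jet_uminus)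
  then have "(\<lambda>j. restrict_jet (partial_jet \<alpha> N ((J(0 := \<lambda>k t. - J 0 k t)) j)))
    = (\<lambda>j. restrict_jet (partial_jet \<alpha> N (J j)))(0 := \<lambda>k t. - restrict_jet (partial_jet \<alpha> N (J 0)) k t)" for J :: "nat \<Rightarrow> jet"
    by (intro ext) (auto simp only: fun_upd_apply split: if_split)
  then show ?thesis
    by (simp only: tensor_partial_def neg_tensor_def map_map o_def)
qed

lemma tensor_partial_diff: "tensor_partial \<alpha> N (tensor_diff A B) = tensor_diff (tensor_partial \<alpha> N A) (tensor_partial \<alpha> N B)"
  unfolding tensor_diff_def tensor_partial_append tensor_partial_neg ..

lemma tensor_inner_commute: "tensor_inner \<alpha> d A B = tensor_inner \<alpha> d B A"
  unfolding tensor_inner_def sum_list_conv_sum by (subst sum.swap) (simp only: jet_inner_commute)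

lemma tensor_linear_deriv: "d \<ge> 1 \<Longrightarrow> tensor_linear (\<lambda>L. tensor_deriv d \<tau> L x)"
  unfolding tensor_deriv_def by (rule tensor_linear_prod) auto

lemma tensor_linear_fourier: "d \<ge> 1 \<Longrightarrow> tensor_linear (\<lambda>L. tensor_fourier \<alpha> d L h)"
  unfolding tensor_fourier_def
  by (rule tensor_linear_prod) (simp_all add: jet_fourier_def jet_coeff_uminus complex_eq_iff)

lemma tensor_linear_transform: "d \<ge> 1 \<Longrightarrow> tensor_linear (\<lambda>L. tensor_transform \<alpha> d L x)"
  unfolding tensor_transform_def
  by (rule tensor_linear_prod) (auto simp: bernoulli_remainder_def sum_negf)

lemma tensor_linear_inner:
  assumes "d \<ge> 1"
  shows "tensor_linear (\<lambda>L. tensor_inner \<alpha> d L M)"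
  unfolding tensor_inner_def
proof (rule tensor_linear_sum_list)
  fix J :: "nat \<Rightarrow> jet"
  show "(\<Sum>K\<leftarrow>M. \<Prod>j<d. jet_inner \<alpha> ((J(0 := \<lambda>k t. - J 0 k t)) j) (K j)) = - (\<Sum>K\<leftarrow>M. \<Prod>j<d. jet_inner \<alpha> (J j) (K j))"
  proof -
    have "(\<Sum>K\<leftarrow>M. a K) = - (\<Sum>K\<leftarrow>M. b K)" if "\<And>K. a K = - b K" for a b :: "(nat \<Rightarrow> jet) \<Rightarrow> real"
      using that by (induction M) simp_all
    moreover have "(\<Prod>j<d. jet_inner \<alpha> ((J(0 := \<lambda>k t. - J 0 k t)) j) (K j)) = - (\<Prod>j<d. jet_inner \<alpha> (J j) (K j))" for K
      by (rule prod_fun_upd_uminus[where u = "\<lambda>j G. jet_inner \<alpha> G (K j)", OF assms jet_inner_uminus])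
    ultimately show ?thesis by simp
  qed
qed

text \<open>Turns a sequence of tensors into a series whose partial sums take the values of the
  sequence under every linear functional; the results on series then apply to sequences.\<close>

definition telescope :: "(nat \<Rightarrow> tensor) \<Rightarrow> nat \<Rightarrow> tensor" where
  "telescope L n = (case n of 0 \<Rightarrow> L 0 | Suc m \<Rightarrow> tensor_diff (L (Suc m)) (L m))"

lemma sum_telescope:
  assumes "tensor_linear T"
  shows "(\<Sum>n<Suc N. T (telescope L n)) = T (L N)"
proof (induction N)
  case (Suc N)
  have "(\<Sum>n<Suc (Suc N). T (telescope L n)) = T (L N) + T (tensor_diff (L (Suc N)) (L N))"
    using Suc.IH by (simp add: telescope_def)
  then show ?case unfolding tensor_linearD(3)[OF assms] by simp
qed (simp add: telescope_def)

lemma jet_tensors_append: "jet_tensors \<alpha> d (A @ B) \<longleftrightarrow> jet_tensors \<alpha> d A \<and> jet_tensors \<alpha> d B"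
  by (auto simp: jet_tensors_def)

lemma jet_tensors_neg:
  assumes "jet_tensors \<alpha> d A"
  shows "jet_tensors \<alpha> d (neg_tensor A)"
proof -
  have "sobolev_jet \<alpha> (\<lambda>k t. - G k t)" if "sobolev_jet \<alpha> G" for G
    using sobolev_jet_linear_combination[OF that that, of "- 1" 0] by simp
  then show ?thesis using assms by (auto simp: jet_tensors_def neg_tensor_def)
qed

lemma jet_tensors_diff: "jet_tensors \<alpha> d A \<Longrightarrow> jet_tensors \<alpha> d B \<Longrightarrow> jet_tensors \<alpha> d (tensor_diff A B)"
  unfolding tensor_diff_def jet_tensors_append using jet_tensors_neg by blast

lemma jet_tensors_partial: "jet_tensors \<alpha> d (tensor_partial \<alpha> N A)"
  unfolding jet_tensors_def tensor_partial_def by (auto intro!: sobolev_jet_restrict_jet smooth_partial_jet)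

definition tensor_norm :: "nat \<Rightarrow> nat \<Rightarrow> tensor \<Rightarrow> real" where
  "tensor_norm \<alpha> d A = sqrt (tensor_inner \<alpha> d A A)"

lemma tensor_norm_square: "jet_tensors \<alpha> d A \<Longrightarrow> (tensor_norm \<alpha> d A)\<^sup>2 = tensor_inner \<alpha> d A A"
  unfolding tensor_norm_def by (intro real_sqrt_pow2 nn_integral_tensor_hat_square(2))

lemma tensor_norm_nonneg: "jet_tensors \<alpha> d A \<Longrightarrow> tensor_norm \<alpha> d A \<ge> 0"
  unfolding tensor_norm_def by (intro real_sqrt_ge_zero nn_integral_tensor_hat_square(2))

text \<open>By the isometry this is the inequality for \<open>tensor_hat\<close> in L^2.\<close>

lemma tensor_Cauchy_Schwarz:
  assumes A: "jet_tensors \<alpha> d A" and B: "jet_tensors \<alpha> d B"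
  shows "\<bar>tensor_inner \<alpha> d A B\<bar> \<le> tensor_norm \<alpha> d A * tensor_norm \<alpha> d B"
proof -
  let ?P = "lborel_on {..<d}"
  have i: "integrable ?P (\<lambda>z. (tensor_hat \<alpha> d A z)\<^sup>2)" "(\<integral>z. (tensor_hat \<alpha> d A z)\<^sup>2 \<partial>?P) = tensor_inner \<alpha> d A A"
    if "jet_tensors \<alpha> d A" for A
    using has_bochner_integral_tensor_hat_mult[OF that that] by (simp_all add: has_bochner_integral_iff power2_eq_square)
  have "(\<integral>z. tensor_hat \<alpha> d A z * tensor_hat \<alpha> d B z \<partial>?P) = tensor_inner \<alpha> d A B"
    by (rule has_bochner_integral_integral_eq[OF has_bochner_integral_tensor_hat_mult[OF A B]])
  then have "(tensor_inner \<alpha> d A B)\<^sup>2 \<le> tensor_inner \<alpha> d A A * tensor_inner \<alpha> d B B"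
    using integral_Cauchy_Schwarz[OF i(1)[OF A] i(1)[OF B] tensor_hat_measurable[OF A] tensor_hat_measurable[OF B]]
    unfolding i(2)[OF A] i(2)[OF B] by simp
  then have "sqrt ((tensor_inner \<alpha> d A B)\<^sup>2) \<le> sqrt (tensor_inner \<alpha> d A A * tensor_inner \<alpha> d B B)"
    by (rule real_sqrt_le_mono)
  then show ?thesis unfolding tensor_norm_def real_sqrt_mult by simp
qed

text \<open>Cauchy-Schwarz over the index with the weights \<open>(1 / 2) ^ n\<close> and
  \<open>2 ^ n\<close>. It reduces square integrability of an infinite sum to summability of
  weighted squared norms.\<close>

lemma suminf_square_le:
  fixes a :: "nat \<Rightarrow> ennreal"
  shows "(\<Sum>n. a n)\<^sup>2 \<le> (\<Sum>n. ennreal ((1 / 4) ^ n)) * (\<Sum>n. ennreal (4 ^ n) * (a n)\<^sup>2)"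
proof -
  have "ennreal ((1 / 2) ^ n) * (ennreal (2 ^ n) * a n) = a n" for n
  proof -
    have "ennreal ((1 / 2) ^ n) * ennreal (2 ^ n) = 1"
      by (simp add: ennreal_mult'[symmetric] power_mult_distrib[symmetric])
    then show ?thesis by (simp add: mult.assoc[symmetric])
  qed
  then have "(\<Sum>n. a n)\<^sup>2 = (\<integral>\<^sup>+n. ennreal ((1 / 2) ^ n) * (ennreal (2 ^ n) * a n) \<partial>count_space UNIV)\<^sup>2"
    by (simp add: nn_integral_count_space_nat)
  also have "\<dots> \<le> (\<integral>\<^sup>+n. (ennreal ((1 / 2) ^ n))\<^sup>2 \<partial>count_space UNIV) * (\<integral>\<^sup>+n. (ennreal (2 ^ n) * a n)\<^sup>2 \<partial>count_space UNIV)"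
    by (rule Cauchy_Schwarz_nn_integral) auto
  also have "(\<integral>\<^sup>+n. (ennreal ((1 / 2) ^ n))\<^sup>2 \<partial>count_space UNIV) = (\<Sum>n. ennreal ((1 / 4) ^ n))"
  proof -
    have "(ennreal ((1 / 2) ^ n))\<^sup>2 = ennreal ((1 / 4) ^ n)" for n
    proof -
      have "((1 / 2 :: real) ^ n)\<^sup>2 = (1 / 4) ^ n" by (simp add: power_mult[symmetric] power_even_eq mult.commute power2_eq_square flip: power_mult_distrib)
      then show ?thesis by (simp add: ennreal_power)
    qed
    then show ?thesis by (simp add: nn_integral_count_space_nat)
  qed
  also have "(\<integral>\<^sup>+n. (ennreal (2 ^ n) * a n)\<^sup>2 \<partial>count_space UNIV) = (\<Sum>n. ennreal (4 ^ n) * (a n)\<^sup>2)"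
  proof -
    have "(ennreal (2 ^ n) * a n)\<^sup>2 = ennreal (4 ^ n) * (a n)\<^sup>2" for n
    proof -
      have "((2 :: real) ^ n)\<^sup>2 = 4 ^ n" by (simp add: power2_eq_square flip: power_mult_distrib)
      then have "(ennreal (2 ^ n))\<^sup>2 = ennreal (4 ^ n)" by (subst ennreal_power) auto
      then show ?thesis by (simp only: power_mult_distrib)
    qed
    then show ?thesis by (simp add: nn_integral_count_space_nat)
  qed
  finally show ?thesis .
qed

section \<open>Cauchy sequences of tensors\<close>

locale sobolev_tensors =
  fixes d \<alpha> :: nat
  assumes d: "d \<ge> 1" and \<alpha>: "\<alpha> \<ge> 1"
begin

abbreviation jets :: "tensor \<Rightarrow> bool" where "jets \<equiv> jet_tensors \<alpha> d"
abbreviation ip :: "tensor \<Rightarrow> tensor \<Rightarrow> real" where "ip \<equiv> tensor_inner \<alpha> d"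
abbreviation nrm :: "tensor \<Rightarrow> real" where "nrm \<equiv> tensor_norm \<alpha> d"
abbreviation val :: "tensor \<Rightarrow> point \<Rightarrow> real" where "val \<equiv> tensor_deriv d (\<lambda>_. 0)"
abbreviation gap :: "tensor \<Rightarrow> tensor \<Rightarrow> real" where "gap A B \<equiv> nrm (tensor_diff A B)"

lemma ip_diff_left: "ip (tensor_diff A B) C = ip A C - ip B C"
  by (rule tensor_linearD(3)[OF tensor_linear_inner[OF d]])

lemma ip_diff_right: "ip A (tensor_diff B C) = ip A B - ip A C"
  unfolding tensor_inner_commute[of \<alpha> d A] by (rule ip_diff_left)

lemma nrm_diff_commute: "gap A B = gap B A"
  unfolding tensor_norm_def ip_diff_left ip_diff_right by (simp add: algebra_simps)

lemma nrm_le_diff: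
  assumes A: "jets A" and B: "jets B"
  shows "nrm A \<le> gap A B + nrm B"
proof (rule power2_le_imp_le)
  have D: "jets (tensor_diff A B)" by (rule jet_tensors_diff[OF A B])
  have "(nrm A)\<^sup>2 = (gap A B)\<^sup>2 + (nrm B)\<^sup>2 + 2 * ip (tensor_diff A B) B"
    unfolding tensor_norm_square[OF A] tensor_norm_square[OF B] tensor_norm_square[OF D] ip_diff_left ip_diff_right
    by (simp add: tensor_inner_commute[of \<alpha> d B A])
  moreover have "ip (tensor_diff A B) B \<le> gap A B * nrm B"
    using tensor_Cauchy_Schwarz[OF D B] by linarith
  ultimately show "(nrm A)\<^sup>2 \<le> (gap A B + nrm B)\<^sup>2" by (simp add: power2_sum)
  show "0 \<le> gap A B + nrm B" using tensor_norm_nonneg[OF D] tensor_norm_nonneg[OF B] by simp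
qed

lemma nrm_diff_triangle:
  assumes A: "jets A" and B: "jets B" and C: "jets C"
  shows "gap A C \<le> gap A B + gap B C"
proof -
  have "gap (tensor_diff A C) (tensor_diff B C) = gap A B"
    unfolding tensor_norm_def ip_diff_left ip_diff_right by (simp add: algebra_simps)
  then show ?thesis using nrm_le_diff[OF jet_tensors_diff[OF A C] jet_tensors_diff[OF B C]] by simp
qed

definition tensor_cauchy :: "(nat \<Rightarrow> tensor) \<Rightarrow> bool" where
  "tensor_cauchy L \<longleftrightarrow> (\<forall>n. jets (L n)) \<and> (\<forall>e>0. \<exists>N. \<forall>m\<ge>N. \<forall>n\<ge>N. gap (L m) (L n) < e)"

text \<open>Tensors stand for a function on the cube through the limits of their values; the norm in
  the Cauchy condition is the algebraic one of tensors.\<close>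

definition represents :: "(nat \<Rightarrow> tensor) \<Rightarrow> (point \<Rightarrow> real) \<Rightarrow> bool" where
  "represents L f \<longleftrightarrow> tensor_cauchy L \<and> (\<forall>x\<in>unit_cube d. (\<lambda>n. val (L n) x) \<longlonglongrightarrow> f x)"

lemma tensor_cauchyD:
  assumes "tensor_cauchy L"
  shows "jets (L n)" "e > 0 \<Longrightarrow> \<exists>N. \<forall>m\<ge>N. \<forall>n\<ge>N. gap (L m) (L n) < e"
  using assms unfolding tensor_cauchy_def by auto

lemma tensor_cauchy_bounded:
  assumes L: "tensor_cauchy L"
  shows "\<exists>B>0. \<forall>n. nrm (L n) \<le> B"
proof -
  note J = tensor_cauchyD(1)[OF L]
  obtain N where N: "\<And>m n. m \<ge> N \<Longrightarrow> n \<ge> N \<Longrightarrow> gap (L m) (L n) < 1"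
    using tensor_cauchyD(2)[OF L, of 1] by auto
  let ?S = "\<Sum>n\<le>N. nrm (L n)"
  have S: "nrm (L n) \<le> ?S" if "n \<le> N" for n
    by (rule member_le_sum) (use that tensor_norm_nonneg[OF J] in auto)
  have "nrm (L n) \<le> 1 + ?S" for n
  proof (cases "n \<le> N")
    case False
    then show ?thesis using nrm_le_diff[OF J J, of n N] N[of n N] S[of N] by simp
  qed (use S[of n] in simp)
  moreover have "1 + ?S > 0" using tensor_norm_nonneg[OF J] by (simp add: sum_nonneg add_pos_nonneg)
  ultimately show ?thesis by blast
qed

text \<open>A bilinear Cauchy estimate. It settles the existence of the limit; its value will come
  from a subsequence.\<close>

lemma convergent_tensor_inner:
  assumes L: "tensor_cauchy L" and M: "tensor_cauchy M"
  shows "convergent (\<lambda>n. ip (L n) (M n))"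
proof -
  note J = tensor_cauchyD(1)[OF L] tensor_cauchyD(1)[OF M]
  obtain B1 B2 where B: "B1 > 0" "\<And>n. nrm (L n) \<le> B1" "B2 > 0" "\<And>n. nrm (M n) \<le> B2"
    using tensor_cauchy_bounded[OF L] tensor_cauchy_bounded[OF M] by auto
  have "Cauchy (\<lambda>n. ip (L n) (M n))"
    unfolding Cauchy_def
  proof (intro allI impI)
    fix e :: real assume e: "e > 0"
    let ?e = "e / (B1 + B2)"
    have pos: "?e > 0" using e B by simp
    obtain N1 where N1: "\<forall>m\<ge>N1. \<forall>n\<ge>N1. gap (L m) (L n) < ?e"
      using tensor_cauchyD(2)[OF L pos] ..
    obtain N2 where N2: "\<forall>m\<ge>N2. \<forall>n\<ge>N2. gap (M m) (M n) < ?e"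
      using tensor_cauchyD(2)[OF M pos] ..
    have "dist (ip (L m) (M m)) (ip (L n) (M n)) < e" if "m \<ge> max N1 N2" "n \<ge> max N1 N2" for m n
    proof -
      have 1: "gap (L m) (L n) < ?e" and 2: "gap (M m) (M n) < ?e" using N1 N2 that by auto
      have "ip (L m) (M m) - ip (L n) (M n) = ip (tensor_diff (L m) (L n)) (M m) + ip (L n) (tensor_diff (M m) (M n))"
        unfolding ip_diff_left ip_diff_right by simp
      then have "\<bar>ip (L m) (M m) - ip (L n) (M n)\<bar> \<le> gap (L m) (L n) * nrm (M m) + nrm (L n) * gap (M m) (M n)"
        using tensor_Cauchy_Schwarz[OF jet_tensors_diff[OF J(1) J(1)] J(2), of m n m]
          tensor_Cauchy_Schwarz[OF J(1) jet_tensors_diff[OF J(2) J(2)], of n m n] by linarith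
      also have "\<dots> \<le> gap (L m) (L n) * B2 + B1 * gap (M m) (M n)"
        by (intro add_mono mult_left_mono mult_right_mono B tensor_norm_nonneg jet_tensors_diff J)
      also have "\<dots> < ?e * B2 + B1 * ?e"
        using 1 2 B(1,3) by (intro add_strict_mono mult_strict_left_mono mult_strict_right_mono)
      also have "\<dots> = ?e * (B1 + B2)" by (simp only: distrib_left mult.commute[of B1] add.commute)
      also have "\<dots> = e"
      proof -
        have "B1 + B2 \<noteq> 0" using B(1,3) by simp
        then show ?thesis unfolding times_divide_eq_left by (rule nonzero_mult_div_cancel_right)
      qed
      finally show ?thesis by (simp add: dist_real_def)
    qed
    then show "\<exists>K. \<forall>m\<ge>K. \<forall>n\<ge>K. dist (ip (L m) (M m)) (ip (L n) (M n)) < e" by blast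
  qed
  then show ?thesis by (rule real_Cauchy_convergent)
qed

text \<open>Against the weights \<open>4 ^ n\<close> of \<open>suminf_square_le\<close>, the bound
  on the squared norms leaves the summable \<open>(1 / 2) ^ n\<close>.\<close>

definition fast :: "(nat \<Rightarrow> tensor) \<Rightarrow> bool" where
  "fast L \<longleftrightarrow> (\<forall>n. jets (L n)) \<and> (\<forall>n. ip (tensor_diff (L (Suc n)) (L n)) (tensor_diff (L (Suc n)) (L n)) \<le> (1 / 8) ^ n)"

text \<open>Inner products are taken at equal indices, so one subsequence has to serve both
  arguments.\<close>

lemma fast_subsequence:
  assumes L: "tensor_cauchy L" and M: "tensor_cauchy M"
  shows "\<exists>r :: nat \<Rightarrow> nat. strict_mono r \<and> fast (\<lambda>n. L (r n)) \<and> fast (\<lambda>n. M (r n))"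
proof -
  note J = tensor_cauchyD(1)[OF L] tensor_cauchyD(1)[OF M]
  define Q where "Q k N \<longleftrightarrow> (\<forall>m\<ge>N. \<forall>n\<ge>N. gap (L m) (L n) < sqrt ((1 / 8) ^ k) \<and> gap (M m) (M n) < sqrt ((1 / 8) ^ k))" for k N :: nat
  have "\<exists>N. Q k N" for k
  proof -
    have pos: "sqrt ((1 / 8) ^ k) > 0" by simp
    obtain N1 where N1: "\<forall>m\<ge>N1. \<forall>n\<ge>N1. gap (L m) (L n) < sqrt ((1 / 8) ^ k)"
      using tensor_cauchyD(2)[OF L pos] ..
    obtain N2 where N2: "\<forall>m\<ge>N2. \<forall>n\<ge>N2. gap (M m) (M n) < sqrt ((1 / 8) ^ k)"
      using tensor_cauchyD(2)[OF M pos] ..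
    have "Q k (max N1 N2)" unfolding Q_def using N1 N2 by simp
    then show ?thesis ..
  qed
  then obtain N where N: "\<And>k. Q k (N k)" by metis
  \<comment> \<open>Adding \<open>n\<close> makes \<open>r\<close> strictly increasing, and the sum
    puts \<open>r n\<close> and all later values above \<open>N n\<close>.\<close>
  define r where "r n = n + (\<Sum>k\<le>n. N k)" for n
  have r: "strict_mono r" by (rule strict_monoI_Suc) (simp add: r_def)
  have ge: "r n \<ge> N n" "r (Suc n) \<ge> N n" for n
  proof -
    have "N n \<le> (\<Sum>k\<le>n. N k)" by (rule member_le_sum) auto
    then show "r n \<ge> N n" "r (Suc n) \<ge> N n" by (simp_all add: r_def)
  qed
  have b: "ip (tensor_diff A B) (tensor_diff A B) \<le> (1 / 8) ^ n" if "jets A" "jets B" "gap A B < sqrt ((1 / 8) ^ n)" for A B n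
  proof -
    have "(gap A B)\<^sup>2 \<le> (sqrt ((1 / 8) ^ n))\<^sup>2"
      using that tensor_norm_nonneg[OF jet_tensors_diff[OF that(1,2)]] by (intro power_mono) auto
    then show ?thesis unfolding tensor_norm_square[OF jet_tensors_diff[OF that(1,2)]] by simp
  qed
  have q: "gap (L (r (Suc n))) (L (r n)) < sqrt ((1 / 8) ^ n)" "gap (M (r (Suc n))) (M (r n)) < sqrt ((1 / 8) ^ n)" for n
    using N[of n] ge[of n] unfolding Q_def by auto
  have "fast (\<lambda>n. L (r n))" "fast (\<lambda>n. M (r n))"
    unfolding fast_def using J b[OF J(1) J(1) q(1)] b[OF J(2) J(2) q(2)] by auto
  then show ?thesis using r by blast
qed

text \<open>Square integrability of the summed absolute values follows from
  \<open>suminf_square_le\<close>, once the isometry has turned integrals of squares into inner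
  products.\<close>

lemma tensor_series_telescope:
  assumes L: "fast L"
  shows "\<exists>C. tensor_series d \<alpha> (telescope L) C"
proof (rule tensor_deriv_bound[of \<alpha> d])
  have J: "jets (L n)" for n using L by (simp add: fast_def)
  have T: "jets (telescope L n)" for n
    unfolding telescope_def using J jet_tensors_diff[OF J J] by (cases n) auto
  fix C :: real
  assume C: "C \<ge> 1" and bound: "\<And>L \<tau> (x :: point) w. jet_tensors \<alpha> d L \<Longrightarrow> (\<And>j. j < d \<Longrightarrow> \<tau> j \<le> \<alpha>) \<Longrightarrow> w = {j. j < d \<and> \<tau> j = \<alpha>}
    \<Longrightarrow> (\<And>j. j < d \<Longrightarrow> x j \<in> {0..1}) \<Longrightarrow> (\<And>j. j \<in> w \<Longrightarrow> x j \<noteq> 1) \<Longrightarrow>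
    ennreal \<bar>tensor_deriv d \<tau> L x\<bar> \<le> ennreal C * marginal d w (\<lambda>z. ennreal \<bar>tensor_hat \<alpha> d L z\<bar>) x"
  let ?P = "lborel_on {..<d}"
  let ?a = "\<lambda>n z. ennreal \<bar>tensor_hat \<alpha> d (telescope L n) z\<bar>"
  let ?q = "\<lambda>n. 4 ^ n * ip (telescope L n) (telescope L n)"
  have q0: "?q n \<ge> 0" for n using nn_integral_tensor_hat_square(2)[OF T] by simp
  have "summable ?q"
  \<comment> \<open>The first term is \<open>L 0\<close>, of arbitrary norm, so the comparison
    starts at 1; this shift of the index turns the factor 4 into 8.\<close>
  proof (rule summable_comparison_test'[of "\<lambda>n. 8 * (1 / 2) ^ n" 1])
    show "summable (\<lambda>n. 8 * (1 / 2 :: real) ^ n)" by (intro summable_mult summable_geometric) simp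
    fix n :: nat assume "n \<ge> 1"
    then obtain m where m: "n = Suc m" by (cases n) auto
    have "?q n \<le> 4 ^ n * (1 / 8) ^ m"
      using L unfolding m telescope_def fast_def by (intro mult_left_mono) auto
    also have "\<dots> = 4 * (1 / 2) ^ m" unfolding m by (simp flip: power_mult_distrib)
    also have "\<dots> \<le> 8 * (1 / 2) ^ n" unfolding m by simp
    finally show "norm (?q n) \<le> 8 * (1 / 2) ^ n" using q0[of n] by simp
  qed
  have am: "?a n \<in> borel_measurable ?P" for n using tensor_hat_measurable[OF T] by measurable
  let ?K = "\<Sum>n. ennreal ((1 / 4) ^ n)"
  have K: "?K = ennreal (\<Sum>n. (1 / 4) ^ n)" by (rule suminf_ennreal2) (auto intro: summable_geometric)
  have "(\<integral>\<^sup>+z. (\<Sum>n. ?a n z)\<^sup>2 \<partial>?P) \<le> (\<integral>\<^sup>+z. ?K * (\<Sum>n. ennreal (4 ^ n) * (?a n z)\<^sup>2) \<partial>?P)"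
    by (rule nn_integral_mono) (rule suminf_square_le)
  also have "\<dots> = ?K * (\<Sum>n. ennreal (4 ^ n) * (\<integral>\<^sup>+z. (?a n z)\<^sup>2 \<partial>?P))"
    using am by (simp add: nn_integral_cmult nn_integral_suminf)
  also have "(\<Sum>n. ennreal (4 ^ n) * (\<integral>\<^sup>+z. (?a n z)\<^sup>2 \<partial>?P)) = (\<Sum>n. ennreal (?q n))"
    unfolding nn_integral_tensor_hat_square(1)[OF T] by (intro arg_cong[where f = suminf] ext ennreal_mult'[symmetric]) simp
  also have "\<dots> = ennreal (suminf ?q)" by (rule suminf_ennreal2[OF q0 \<open>summable ?q\<close>])
  also have "?K * ennreal (suminf ?q) < \<infinity>" unfolding K by (simp add: ennreal_mult_less_top)
  finally have fin: "(\<integral>\<^sup>+z. (\<Sum>n. ?a n z)\<^sup>2 \<partial>?P) < \<infinity>" .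
  have "tensor_series d \<alpha> (telescope L) C"
  proof (rule tensor_series.intro)
    show "jets (telescope L n)" for n by (rule T)
    show "0 \<le> C" using C by simp
    fix n \<tau> w and x :: point
    assume "\<And>j. j < d \<Longrightarrow> \<tau> j \<le> \<alpha>" "w = {j. j < d \<and> \<tau> j = \<alpha>}" "\<And>j. j < d \<Longrightarrow> x j \<in> {0..1}" "\<And>j. j \<in> w \<Longrightarrow> x j \<noteq> 1"
    then show "ennreal \<bar>tensor_deriv d \<tau> (telescope L n) x\<bar> \<le> ennreal C * marginal d w (\<lambda>z. ennreal \<bar>tensor_hat \<alpha> d (telescope L n) z\<bar>) x"
      by (rule bound[OF T])
  qed (rule \<alpha> fin)+
  then show ?thesis ..
qed

lemma telescope_sums:
  assumes "tensor_linear T" "(\<lambda>n. T (L n)) \<longlonglongrightarrow> l"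
  shows "(\<lambda>n. T (telescope L n)) sums l"
  unfolding sums_def by (rule LIMSEQ_imp_Suc) (use assms in \<open>simp only: sum_telescope\<close>)

text \<open>The series theorem identifies the limit along a fast subsequence; the full sequence
  converges, so it has the same limit.\<close>

theorem tensor_inner_limit:
  assumes L: "represents L f" and M: "represents M g"
  shows "(\<lambda>n. ip (L n) (M n)) \<longlonglongrightarrow> sobolev_inner \<alpha> d f g"
proof -
  have c: "tensor_cauchy L" "tensor_cauchy M" using assms by (auto simp: represents_def)
  obtain r :: "nat \<Rightarrow> nat" where r: "strict_mono r" and fast: "fast (\<lambda>n. L (r n))" "fast (\<lambda>n. M (r n))"
    using fast_subsequence[OF c] by auto
  obtain C C' where ts: "tensor_series d \<alpha> (telescope (\<lambda>n. L (r n))) C" "tensor_series d \<alpha> (telescope (\<lambda>n. M (r n))) C'"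
    using tensor_series_telescope[OF fast(1)] tensor_series_telescope[OF fast(2)] by auto
  have sums: "(\<lambda>n. val (telescope (\<lambda>n. A (r n)) n) x) sums h x" if A: "represents A h" and x: "x \<in> unit_cube d" for A h x
  proof (rule telescope_sums[OF tensor_linear_deriv[OF d]])
    have "(\<lambda>n. val (A n) x) \<longlonglongrightarrow> h x" using A x by (simp add: represents_def)
    from LIMSEQ_subseq_LIMSEQ[OF this r] show "(\<lambda>n. val (A (r n)) x) \<longlonglongrightarrow> h x" by (simp add: o_def)
  qed
  have "(\<lambda>N. \<Sum>n<N. \<Sum>m<N. ip (telescope (\<lambda>n. L (r n)) n) (telescope (\<lambda>n. M (r n)) m)) \<longlonglongrightarrow> sobolev_inner \<alpha> d f g"
    by (rule sobolev_inner_limit[OF ts sums[OF L] sums[OF M]])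
  then have "(\<lambda>N. \<Sum>n<Suc N. \<Sum>m<Suc N. ip (telescope (\<lambda>n. L (r n)) n) (telescope (\<lambda>n. M (r n)) m)) \<longlonglongrightarrow> sobolev_inner \<alpha> d f g"
    by (rule LIMSEQ_Suc)
  moreover have "(\<Sum>n<Suc N. \<Sum>m<Suc N. ip (telescope (\<lambda>n. L (r n)) n) (telescope (\<lambda>n. M (r n)) m)) = ip (L (r N)) (M (r N))" for N
  proof -
    have "tensor_linear (ip A)" for A
      using tensor_linear_inner[OF d, of \<alpha> A] unfolding tensor_inner_commute[of \<alpha> d _ A] by simp
    then have "(\<Sum>m<Suc N. ip A (telescope (\<lambda>n. M (r n)) m)) = ip A (M (r N))" for A by (rule sum_telescope)
    then show ?thesis using sum_telescope[OF tensor_linear_inner[OF d, of \<alpha> "M (r N)"], of "\<lambda>n. L (r n)" N] by (simp only:)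
  qed
  ultimately have sub: "(\<lambda>N. ip (L (r N)) (M (r N))) \<longlonglongrightarrow> sobolev_inner \<alpha> d f g" by simp
  obtain l where l: "(\<lambda>n. ip (L n) (M n)) \<longlonglongrightarrow> l" using convergent_tensor_inner[OF c] unfolding convergent_def ..
  from LIMSEQ_subseq_LIMSEQ[OF l r] have "(\<lambda>N. ip (L (r N)) (M (r N))) \<longlonglongrightarrow> l" by (simp add: o_def)
  then have "l = sobolev_inner \<alpha> d f g" using sub by (rule LIMSEQ_unique)
  then show ?thesis using l by simp
qed

text \<open>Again a fast subsequence identifies the limit. Convergence of the full sequence is
  supplied later by the uniform bound on transforms.\<close>

lemma transform_limit:
  assumes L: "represents L f" and x: "x \<in> unit_cube d" and conv: "convergent (\<lambda>n. tensor_transform \<alpha> d (L n) x)"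
  shows "(\<lambda>n. tensor_transform \<alpha> d (L n) x) \<longlonglongrightarrow> bernoulli_transform \<alpha> d f x"
proof -
  have c: "tensor_cauchy L" using assms by (auto simp: represents_def)
  obtain r :: "nat \<Rightarrow> nat" where r: "strict_mono r" and fast: "fast (\<lambda>n. L (r n))"
    using fast_subsequence[OF c c] by auto
  obtain C where ts: "tensor_series d \<alpha> (telescope (\<lambda>n. L (r n))) C" using tensor_series_telescope[OF fast] by auto
  have sums: "(\<lambda>n. val (telescope (\<lambda>n. L (r n)) n) y) sums f y" if y: "y \<in> unit_cube d" for y
  proof (rule telescope_sums[OF tensor_linear_deriv[OF d]])
    have "(\<lambda>n. val (L n) y) \<longlonglongrightarrow> f y" using L y by (simp add: represents_def)
    from LIMSEQ_subseq_LIMSEQ[OF this r] show "(\<lambda>n. val (L (r n)) y) \<longlonglongrightarrow> f y" by (simp add: o_def)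
  qed
  obtain l where l: "(\<lambda>n. tensor_transform \<alpha> d (L n) x) \<longlonglongrightarrow> l" using conv unfolding convergent_def ..
  from LIMSEQ_subseq_LIMSEQ[OF l r] have "(\<lambda>n. tensor_transform \<alpha> d (L (r n)) x) \<longlonglongrightarrow> l" by (simp add: o_def)
  then have "(\<lambda>n. tensor_transform \<alpha> d (telescope (\<lambda>n. L (r n)) n) x) sums l"
    by (rule telescope_sums[OF tensor_linear_transform[OF d]])
  moreover have "(\<lambda>n. tensor_transform \<alpha> d (telescope (\<lambda>n. L (r n)) n) x) sums bernoulli_transform \<alpha> d f x"
    by (rule tensor_series.bernoulli_transform_sums[OF ts sums x])
  ultimately have "l = bernoulli_transform \<alpha> d f x" by (rule sums_unique2)
  then show ?thesis using l by simp
qed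

end

lemma coeff_inner_commute: "coeff_inner \<alpha> N G H = coeff_inner \<alpha> N H G"
  by (simp add: coeff_inner_def mult.commute)

text \<open>The factors are taken before the cut-off in \<open>restrict_jet\<close>, since
  \<open>smooth_sobolev1\<close> concerns functions that are smooth on the whole line.\<close>

lemma partial_in_algebraic_tensor:
  "tensor_deriv d (\<lambda>_. 0) (tensor_partial \<alpha> N A) \<in> algebraic_tensor \<alpha> d"
proof -
  let ?g = "\<lambda>i j. partial_jet \<alpha> N ((A ! i) j) 0"
  show ?thesis
    unfolding algebraic_tensor_def
  proof (rule CollectI, rule exI[of _ "length A"], rule exI[of _ ?g], intro conjI allI impI ballI)
    show "?g i j \<in> sobolev1 \<alpha>" for i j by (rule smooth_sobolev1[OF smooth_partial_jet])
    show "tensor_deriv d (\<lambda>_. 0) (tensor_partial \<alpha> N A) x = (\<Sum>i<length A. \<Prod>j<d. ?g i j (x j))" if "x \<in> unit_cube d" for x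
      unfolding tensor_deriv_partial[OF that] sum_list_conv_sum ..
  qed
qed

lemma tensor_deriv_measurable:
  assumes "jet_tensors \<alpha> d A"
  shows "tensor_deriv d (\<lambda>_. 0) A \<in> borel_measurable (cube_measure {..<d})"
proof -
  have "has_bochner_integral (unit_lborel_on {..<d})
     (\<lambda>z. tensor_deriv d (\<lambda>_. 0) A (override_on undefined z {..<d})) (tensor_mean d {..<d} (\<lambda>_. 0) A undefined)"
    by (rule has_bochner_integral_tensor_deriv[OF assms]) auto
  then have "(\<lambda>z. tensor_deriv d (\<lambda>_. 0) A (override_on undefined z {..<d})) \<in> borel_measurable (unit_lborel_on {..<d})"
    by (rule borel_measurable_has_bochner_integral)
  moreover have "tensor_deriv d (\<lambda>_. 0) A (override_on undefined z {..<d}) = tensor_deriv d (\<lambda>_. 0) A z" for z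
    unfolding tensor_deriv_def by (intro arg_cong[where f = sum_list] map_cong refl prod.cong) simp_all
  ultimately show ?thesis unfolding cube_measure_def by (intro measurable_completion) simp
qed

section \<open>Projections and finite kernels as tensors\<close>

context sobolev_tensors
begin

abbreviation part :: "nat \<Rightarrow> tensor \<Rightarrow> tensor" where "part \<equiv> tensor_partial \<alpha>"
abbreviation cip :: "nat \<Rightarrow> tensor \<Rightarrow> tensor \<Rightarrow> real" where "cip \<equiv> tensor_coeff_inner \<alpha> d"

lemma inner_partial:
  assumes A: "jets A"
  shows "ip A (part N B) = cip N A B"
proof -
  have 1: "(\<Prod>j<d. jet_inner \<alpha> (J j) (restrict_jet (partial_jet \<alpha> N (K j)))) = (\<Prod>j<d. coeff_inner \<alpha> N (J j) (K j))"
    if "J \<in> set A" for J and K :: "nat \<Rightarrow> jet"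
  proof (rule prod.cong[OF refl])
    fix j assume "j \<in> {..<d}"
    then have "sobolev_jet \<alpha> (J j)" using A that by (simp add: jet_tensors_def)
    then show "jet_inner \<alpha> (J j) (restrict_jet (partial_jet \<alpha> N (K j))) = coeff_inner \<alpha> N (J j) (K j)"
      unfolding coeff_inner_commute[of \<alpha> N "J j"] by (rule jet_inner_partial_jet)
  qed
  show ?thesis
    unfolding tensor_inner_def tensor_partial_def tensor_coeff_inner_def map_map o_def
    by (rule arg_cong[where f = sum_list], rule map_cong[OF refl]) (simp only: 1)
qed

lemma inner_partial_partial: "ip (part n A) (part m B) = cip (min n m) A B"
  unfolding tensor_inner_def tensor_partial_def tensor_coeff_inner_def map_map o_def jet_inner_partial_partial[OF \<alpha>] ..

text \<open>As for any orthogonal projection, the squared norm of the image is its inner product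
  with \<open>A\<close>.\<close>

lemma nrm_partial_le:
  assumes A: "jets A"
  shows "nrm (part n A) \<le> nrm A"
proof -
  let ?p = "nrm (part n A)"
  have p: "?p \<ge> 0" by (rule tensor_norm_nonneg[OF jet_tensors_partial])
  have "?p\<^sup>2 = ip A (part n A)"
    unfolding tensor_norm_square[OF jet_tensors_partial] inner_partial_partial inner_partial[OF A] by simp
  then have "?p * ?p \<le> nrm A * ?p"
    using tensor_Cauchy_Schwarz[OF A jet_tensors_partial, of n A] by (simp add: power2_eq_square)
  then show ?thesis
    using p tensor_norm_nonneg[OF A] mult_right_le_imp_le[of ?p ?p "nrm A"] by (cases "?p = 0") auto
qed

definition kernel_tensor :: "nat \<Rightarrow> point \<Rightarrow> tensor" where
  "kernel_tensor N y = [\<lambda>j. restrict_jet (kernel_jet \<alpha> N (y j))]"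

lemma jets_kernel: "jets (kernel_tensor N y)"
  unfolding jet_tensors_def kernel_tensor_def by (auto intro!: sobolev_jet_restrict_jet smooth_kernel_jet)

lemma inner_kernel:
  assumes A: "jets A" and y: "y \<in> unit_cube d"
  shows "ip A (kernel_tensor N y) = val (part N A) y"
proof -
  have "(\<Prod>j<d. jet_inner \<alpha> (J j) (restrict_jet (kernel_jet \<alpha> N (y j)))) = (\<Prod>j<d. partial_jet \<alpha> N (J j) 0 (y j))"
    if "J \<in> set A" for J
    by (intro prod.cong refl jet_inner_kernel_jet) (use A that in \<open>simp add: jet_tensors_def\<close>)
  then show ?thesis
    unfolding tensor_inner_def kernel_tensor_def tensor_deriv_partial[OF y]
    by (intro arg_cong[where f = sum_list] map_cong refl) simp
qed

lemma inner_kernel_kernel: "ip (kernel_tensor n y) (kernel_tensor m y) = (\<Sum>h\<in>freq_box (min n m). 1 / (korobov_weight1 \<alpha> h)\<^sup>2) ^ d"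
  unfolding tensor_inner_def kernel_tensor_def by (simp add: jet_inner_kernel_kernel[OF \<alpha>])

text \<open>Bounds the norms of all finite kernels, hence the values of all partial sums, uniformly
  in the point and in the number of frequencies.\<close>

definition eval_bound :: real where "eval_bound = sqrt ((1 + pi\<^sup>2 / 3) ^ d)"

lemma eval_bound_nonneg: "eval_bound \<ge> 0"
  unfolding eval_bound_def by simp

lemma nrm_kernel_le: "nrm (kernel_tensor n y) \<le> eval_bound"
  unfolding tensor_norm_def eval_bound_def inner_kernel_kernel
  by (intro real_sqrt_le_mono power_mono sum_korobov_weight1_le \<alpha> sum_nonneg) auto

lemma val_partial_le:
  assumes A: "jets A" and y: "y \<in> unit_cube d"
  shows "\<bar>val (part n A) y\<bar> \<le> eval_bound * nrm A"
proof -
  have "\<bar>val (part n A) y\<bar> \<le> nrm A * nrm (kernel_tensor n y)"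
    unfolding inner_kernel[OF A y, symmetric] by (rule tensor_Cauchy_Schwarz[OF A jets_kernel])
  also have "\<dots> \<le> nrm A * eval_bound"
    by (intro mult_left_mono nrm_kernel_le tensor_norm_nonneg A)
  finally show ?thesis by (simp add: mult.commute)
qed

lemma val_partial_tendsto:
  assumes A: "jets A" and y: "y \<in> unit_cube d"
  shows "(\<lambda>n. val (part n A) y) \<longlonglongrightarrow> tensor_transform \<alpha> d A y"
  unfolding tensor_deriv_partial[OF y] tensor_transform_def sum_list_conv_sum
proof (intro tendsto_sum tendsto_prod)
  fix i j assume "i \<in> {..<length A}" "j \<in> {..<d}"
  then show "(\<lambda>n. partial_jet \<alpha> n ((A ! i) j) 0 (y j)) \<longlonglongrightarrow> bernoulli_remainder \<alpha> ((A ! i) j) (y j)"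
    using y by (intro partial_jet_tendsto[OF _ \<alpha>] jet_tensorsD[OF A]) (auto simp: unit_cube_def PiE_iff)
qed

lemma transform_le:
  assumes A: "jets A" and y: "y \<in> unit_cube d"
  shows "\<bar>tensor_transform \<alpha> d A y\<bar> \<le> eval_bound * nrm A"
  by (rule LIMSEQ_le_const2[OF tendsto_rabs[OF val_partial_tendsto[OF A y]]]) (use val_partial_le[OF A y] in blast)

text \<open>If the Gram matrix is \<open>b (min n m)\<close>, then \<open>b\<close> increases and
  the squared distance of two members is \<open>\<bar>b m - b n\<bar>\<close>.\<close>

lemma tensor_cauchy_min:
  assumes A: "\<And>n. jets (A n)" and b: "\<And>n m. ip (A n) (A m) = b (min n m)" and B: "\<And>n. b n \<le> B"
  shows "tensor_cauchy A"
proof -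
  have D: "jets (tensor_diff (A m) (A n))" for m n by (rule jet_tensors_diff[OF A A])
  have sq: "(gap (A m) (A n))\<^sup>2 = b m + b n - 2 * b (min m n)" for m n
    unfolding tensor_norm_square[OF D] ip_diff_left ip_diff_right b by (simp add: min.commute)
  have mono: "b n \<le> b m" if "n \<le> m" for n m
  proof -
    have "0 \<le> b m + b n - 2 * b (min m n)" unfolding sq[symmetric] by simp
    then show ?thesis using that by (simp add: min_absorb2)
  qed
  have sq': "(gap (A m) (A n))\<^sup>2 = \<bar>b m - b n\<bar>" for m n
    unfolding sq using mono[of m n] mono[of n m] by (cases "m \<le> n") (simp_all add: min_absorb1 min_absorb2)
  have "incseq b" using mono by (simp add: incseq_def)
  then obtain l where "b \<longlonglongrightarrow> l" using incseq_convergent[of b B] B by blast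
  then have "Cauchy b" by (intro convergent_Cauchy convergentI)
  show ?thesis
    unfolding tensor_cauchy_def
  proof (intro conjI allI impI A)
    fix e :: real assume e: "e > 0"
    then obtain N where N: "\<forall>m\<ge>N. \<forall>n\<ge>N. norm (b m - b n) < e\<^sup>2"
      using CauchyD[OF \<open>Cauchy b\<close>, of "e\<^sup>2"] by auto
    have "gap (A m) (A n) < e" if "m \<ge> N" "n \<ge> N" for m n
    proof (rule power2_less_imp_less)
      show "(gap (A m) (A n))\<^sup>2 < e\<^sup>2" unfolding sq' using N that by simp
    qed (use e in simp)
    then show "\<exists>N. \<forall>m\<ge>N. \<forall>n\<ge>N. gap (A m) (A n) < e" by blast
  qed
qed

lemma tensor_cauchy_partial:
  assumes A: "jets A"
  shows "tensor_cauchy (\<lambda>n. part n A)"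
proof (rule tensor_cauchy_min[where A = "\<lambda>n. part n A" and b = "\<lambda>n. cip n A A"])
  show "jets (part n A)" for n by (rule jet_tensors_partial)
  show "ip (part n A) (part m A) = cip (min n m) A A" for n m by (rule inner_partial_partial)
  fix n
  have "cip n A A = (nrm (part n A))\<^sup>2"
    unfolding tensor_norm_square[OF jet_tensors_partial] inner_partial_partial by simp
  also have "\<dots> \<le> (nrm A)\<^sup>2"
    by (intro power_mono nrm_partial_le A tensor_norm_nonneg jet_tensors_partial)
  finally show "cip n A A \<le> (nrm A)\<^sup>2" .
qed

text \<open>Compare with the partial sums of one fixed \<open>L k\<close>: projecting does not
  increase the distance of \<open>L n\<close> to \<open>L k\<close>, and the partial sums of
  \<open>L k\<close> form a Cauchy sequence.\<close>

lemma tensor_cauchy_diagonal: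
  assumes L: "tensor_cauchy L"
  shows "tensor_cauchy (\<lambda>n. part n (L n))"
  unfolding tensor_cauchy_def
proof (intro conjI allI impI jet_tensors_partial)
  note J = tensor_cauchyD(1)[OF L]
  fix e :: real assume "e > 0"
  then have e: "e / 3 > 0" by simp
  obtain k where k: "\<forall>m\<ge>k. \<forall>n\<ge>k. gap (L m) (L n) < e / 3" using tensor_cauchyD(2)[OF L e] ..
  obtain N where N: "\<forall>m\<ge>N. \<forall>n\<ge>N. gap (part m (L k)) (part n (L k)) < e / 3"
    using tensor_cauchyD(2)[OF tensor_cauchy_partial[OF J[of k]] e] ..
  have c: "gap (part n (L n)) (part n (L k)) < e / 3" if "n \<ge> k" for n
  proof -
    have "gap (part n (L n)) (part n (L k)) \<le> gap (L n) (L k)"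
      unfolding tensor_partial_diff[symmetric] by (rule nrm_partial_le[OF jet_tensors_diff[OF J J]])
    then show ?thesis using k that by fastforce
  qed
  have "gap (part m (L m)) (part n (L n)) < e" if mn: "m \<ge> max k N" "n \<ge> max k N" for m n
  proof -
    have "gap (part m (L m)) (part n (L n)) \<le> gap (part m (L m)) (part m (L k)) + gap (part m (L k)) (part n (L n))"
      by (rule nrm_diff_triangle) (rule jet_tensors_partial)+
    moreover have "gap (part m (L k)) (part n (L n)) \<le> gap (part m (L k)) (part n (L k)) + gap (part n (L k)) (part n (L n))"
      by (rule nrm_diff_triangle) (rule jet_tensors_partial)+
    moreover have "gap (part m (L m)) (part m (L k)) < e / 3" using c mn by simp
    moreover have "gap (part n (L k)) (part n (L n)) < e / 3"
      unfolding nrm_diff_commute[of "part n (L k)"] using c mn by simp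
    moreover have "gap (part m (L k)) (part n (L k)) < e / 3" using N mn by simp
    ultimately show ?thesis by linarith
  qed
  then show "\<exists>N. \<forall>m\<ge>N. \<forall>n\<ge>N. gap (part m (L m)) (part n (L n)) < e" by blast
qed

lemma transform_diff: "tensor_transform \<alpha> d A y - tensor_transform \<alpha> d B y = tensor_transform \<alpha> d (tensor_diff A B) y"
  by (rule tensor_linearD(3)[OF tensor_linear_transform[OF d], symmetric])

lemma val_diff: "val A y - val B y = val (tensor_diff A B) y"
  by (rule tensor_linearD(3)[OF tensor_linear_deriv[OF d], symmetric])

lemma small_multiple:
  assumes "e > 0"
  obtains \<delta> where "\<delta> > 0" "eval_bound * \<delta> \<le> e"
proof
  show "e / (eval_bound + 1) > 0" using assms eval_bound_nonneg by simp
  have "eval_bound / (eval_bound + 1) \<le> 1" using eval_bound_nonneg by simp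
  then have "e * (eval_bound / (eval_bound + 1)) \<le> e * 1" using assms by (intro mult_left_mono) auto
  then show "eval_bound * (e / (eval_bound + 1)) \<le> e" by (simp add: mult.commute)
qed

lemma convergent_transform:
  assumes L: "tensor_cauchy L" and y: "y \<in> unit_cube d"
  shows "convergent (\<lambda>n. tensor_transform \<alpha> d (L n) y)"
proof -
  note J = tensor_cauchyD(1)[OF L]
  have "Cauchy (\<lambda>n. tensor_transform \<alpha> d (L n) y)"
  proof (rule CauchyI)
    fix e :: real assume "e > 0"
    then obtain \<delta> where \<delta>: "\<delta> > 0" "eval_bound * \<delta> \<le> e / 2" using small_multiple[of "e / 2"] by auto
    obtain N where N: "\<forall>m\<ge>N. \<forall>n\<ge>N. gap (L m) (L n) < \<delta>" using tensor_cauchyD(2)[OF L \<delta>(1)] ..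
    have "norm (tensor_transform \<alpha> d (L m) y - tensor_transform \<alpha> d (L n) y) < e" if "m \<ge> N" "n \<ge> N" for m n
    proof -
      have "\<bar>tensor_transform \<alpha> d (L m) y - tensor_transform \<alpha> d (L n) y\<bar> \<le> eval_bound * gap (L m) (L n)"
        unfolding transform_diff by (rule transform_le[OF jet_tensors_diff[OF J J] y])
      also have "\<dots> \<le> eval_bound * \<delta>" using N that by (intro mult_left_mono eval_bound_nonneg less_imp_le) auto
      finally show ?thesis using \<delta>(2) \<open>e > 0\<close> by simp
    qed
    then show "\<exists>N. \<forall>m\<ge>N. \<forall>n\<ge>N. norm (tensor_transform \<alpha> d (L m) y - tensor_transform \<alpha> d (L n) y) < e" by blast
  qed
  then show ?thesis by (rule real_Cauchy_convergent)
qed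

text \<open>Interchange of limits: \<open>L n\<close> is replaced by a fixed \<open>L k\<close> at a
  cost uniform in \<open>n\<close>, both in the values of partial sums and in the
  transforms.\<close>

lemma val_diagonal_tendsto:
  assumes L: "tensor_cauchy L" and y: "y \<in> unit_cube d"
    and F: "(\<lambda>n. tensor_transform \<alpha> d (L n) y) \<longlonglongrightarrow> F"
  shows "(\<lambda>n. val (part n (L n)) y) \<longlonglongrightarrow> F"
proof (rule LIMSEQ_I)
  note J = tensor_cauchyD(1)[OF L]
  fix e :: real assume "e > 0"
  then have e: "e / 4 > 0" by simp
  obtain \<delta> where \<delta>: "\<delta> > 0" "eval_bound * \<delta> \<le> e / 4" using small_multiple[OF e] by auto
  obtain k where k: "\<forall>m\<ge>k. \<forall>n\<ge>k. gap (L m) (L n) < \<delta>" using tensor_cauchyD(2)[OF L \<delta>(1)] ..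
  have b: "eval_bound * gap (L n) (L k) \<le> e / 4" if "n \<ge> k" for n
  proof -
    have "eval_bound * gap (L n) (L k) \<le> eval_bound * \<delta>"
      using k that by (intro mult_left_mono eval_bound_nonneg less_imp_le) auto
    then show ?thesis using \<delta>(2) by simp
  qed
  have t: "\<bar>tensor_transform \<alpha> d (L n) y - tensor_transform \<alpha> d (L k) y\<bar> \<le> e / 4" if "n \<ge> k" for n
    using transform_le[OF jet_tensors_diff[OF J J] y, of n k] b[OF that] unfolding transform_diff by linarith
  have Fk: "\<bar>F - tensor_transform \<alpha> d (L k) y\<bar> \<le> e / 4"
    by (rule LIMSEQ_le_const2[OF tendsto_rabs[OF tendsto_diff[OF F tendsto_const]]]) (use t in blast)
  have v: "\<bar>val (part n (L n)) y - val (part n (L k)) y\<bar> \<le> e / 4" if "n \<ge> k" for n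
    using val_partial_le[OF jet_tensors_diff[OF J J] y, of n n k] b[OF that]
    unfolding val_diff tensor_partial_diff by linarith
  obtain N where N: "\<forall>n\<ge>N. norm (val (part n (L k)) y - tensor_transform \<alpha> d (L k) y) < e / 4"
    using LIMSEQ_D[OF val_partial_tendsto[OF J y] e, of k] ..
  have "norm (val (part n (L n)) y - F) < e" if "n \<ge> max k N" for n
  proof -
    have "\<bar>val (part n (L k)) y - tensor_transform \<alpha> d (L k) y\<bar> < e / 4" using N that by simp
    moreover have "\<bar>val (part n (L n)) y - val (part n (L k)) y\<bar> \<le> e / 4" using v that by simp
    ultimately show ?thesis using Fk \<open>e > 0\<close> unfolding real_norm_def by linarith
  qed
  then show "\<exists>no. \<forall>n\<ge>no. norm (val (part n (L n)) y - F) < e" by blast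
qed

text \<open>A single sequence of trigonometric tensors thus represents the transform, and inner
  products as well as Fourier coefficients can be computed along it.\<close>

lemma represents_transform:
  assumes L: "represents L f" and F: "\<And>x. x \<in> unit_cube d \<Longrightarrow> F x = bernoulli_transform \<alpha> d f x"
  shows "represents (\<lambda>n. part n (L n)) F"
proof -
  have c: "tensor_cauchy L" using L by (simp add: represents_def)
  have "(\<lambda>n. val (part n (L n)) x) \<longlonglongrightarrow> F x" if x: "x \<in> unit_cube d" for x
    unfolding F[OF x] by (rule val_diagonal_tendsto[OF c x transform_limit[OF L x convergent_transform[OF c x]]])
  then show ?thesis unfolding represents_def using tensor_cauchy_diagonal[OF c] by blast
qed

section \<open>Sobolev functions and the kernel as limits of tensors\<close>

lemma represents_const:
  assumes A: "jets A" and h: "\<And>x. x \<in> unit_cube d \<Longrightarrow> h x = val A x"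
  shows "represents (\<lambda>_. A) h"
proof -
  have "gap A A = 0" unfolding tensor_norm_def ip_diff_left by simp
  then show ?thesis unfolding represents_def tensor_cauchy_def using A h by simp
qed

text \<open>Constant sequences in \<open>tensor_inner_limit\<close> identify the norm built from
  derivatives and integrals with the algebraic one. So the Cauchy condition of
  \<open>sobolev_space\<close> becomes \<open>tensor_cauchy\<close>, and conversely.\<close>

lemma sobolev_norm_eq_nrm:
  assumes A: "jets A" and h: "\<And>x. x \<in> unit_cube d \<Longrightarrow> h x = val A x"
  shows "sobolev_norm \<alpha> d h = nrm A"
proof -
  have "(\<lambda>n. ip A A) \<longlonglongrightarrow> sobolev_inner \<alpha> d h h"
    by (rule tensor_inner_limit[OF represents_const[OF A h] represents_const[OF A h]])
  then have "sobolev_inner \<alpha> d h h = ip A A" using LIMSEQ_unique tendsto_const by blast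
  then show ?thesis unfolding sobolev_norm_def tensor_norm_def by simp
qed

lemma algebraic_tensor_jets:
  assumes \<phi>: "\<phi> \<in> algebraic_tensor \<alpha> d"
  shows "\<exists>A. jets A \<and> (\<forall>x\<in>unit_cube d. \<phi> x = val A x)"
proof -
  obtain m :: nat and g where g: "\<forall>i<m. \<forall>j<d. g i j \<in> sobolev1 \<alpha>"
    and eq: "\<forall>x\<in>unit_cube d. \<phi> x = (\<Sum>i<m. \<Prod>j<d. g i j (x j))"
    using \<phi> unfolding algebraic_tensor_def by blast
  define Q where "Q G u \<longleftrightarrow> sobolev_jet \<alpha> G \<and> (\<forall>t\<in>{0..1}. G 0 t = u t)" for G :: jet and u
  have "\<exists>G. Q G u" if u: "u \<in> sobolev1 \<alpha>" for u
  proof (rule sobolev1_jet[OF u \<alpha>])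
    fix G assume "sobolev_jet \<alpha> G" "\<And>t. t \<in> {0..1} \<Longrightarrow> G 0 t = u t"
    then have "Q G u" unfolding Q_def by simp
    then show "\<exists>G. Q G u" by (rule exI[of "\<lambda>G. Q G u" G])
  qed
  then have Q: "Q (SOME G. Q G u) u" if "u \<in> sobolev1 \<alpha>" for u using that by (intro someI_ex[of "\<lambda>G. Q G u"])
  define G where "G i j = (SOME G. Q G (g i j))" for i j
  have G: "sobolev_jet \<alpha> (G i j)" "t \<in> {0..1} \<Longrightarrow> G i j 0 t = g i j t" if "i < m" "j < d" for i j t
    using Q[of "g i j"] g that unfolding G_def[symmetric] unfolding Q_def by auto
  let ?A = "map G [0..<m]"
  have "jets ?A" unfolding jet_tensors_def using G(1) by auto
  moreover have "\<phi> x = val ?A x" if x: "x \<in> unit_cube d" for x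
  proof -
    have "val ?A x = (\<Sum>i<m. \<Prod>j<d. G i j 0 (x j))"
      unfolding tensor_deriv_def sum_list_conv_sum by simp
    also have "\<dots> = (\<Sum>i<m. \<Prod>j<d. g i j (x j))"
      by (intro sum.cong prod.cong refl G(2)) (use x in \<open>auto simp: unit_cube_def PiE_iff\<close>)
    finally show ?thesis using eq x by simp
  qed
  ultimately show ?thesis by blast
qed

lemma sobolev_space_represents:
  assumes "f \<in> sobolev_space \<alpha> d"
  shows "\<exists>L. represents L f"
proof -
  obtain \<phi> :: "nat \<Rightarrow> point \<Rightarrow> real" where \<phi>: "\<forall>n. \<phi> n \<in> algebraic_tensor \<alpha> d"
    and c: "\<forall>\<epsilon>>0. \<exists>N. \<forall>m\<ge>N. \<forall>n\<ge>N. sobolev_norm \<alpha> d (\<lambda>x. \<phi> m x - \<phi> n x) < \<epsilon>"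
    and lim: "\<forall>x\<in>unit_cube d. (\<lambda>n. \<phi> n x) \<longlonglongrightarrow> f x"
    using assms unfolding sobolev_space_def by blast
  have "\<forall>n. \<exists>A. jets A \<and> (\<forall>x\<in>unit_cube d. \<phi> n x = val A x)" using \<phi> algebraic_tensor_jets by blast
  from choice[OF this] obtain L where L: "\<And>n. jets (L n)" "\<And>n x. x \<in> unit_cube d \<Longrightarrow> \<phi> n x = val (L n) x" by blast
  have "sobolev_norm \<alpha> d (\<lambda>x. \<phi> m x - \<phi> n x) = gap (L m) (L n)" for m n
    by (rule sobolev_norm_eq_nrm[OF jet_tensors_diff[OF L(1) L(1)]]) (simp add: L(2) val_diff)
  then have "tensor_cauchy L" using c L(1) unfolding tensor_cauchy_def by simp
  moreover have "(\<lambda>n. val (L n) x) \<longlonglongrightarrow> f x" if "x \<in> unit_cube d" for x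
  proof -
    have "(\<lambda>n. \<phi> n x) \<longlonglongrightarrow> f x" using lim that by blast
    then show ?thesis using L(2)[OF that] by simp
  qed
  ultimately show ?thesis unfolding represents_def by blast
qed

lemma represents_in_sobolev_space:
  assumes Q: "represents (\<lambda>n. part n (L n)) F"
  shows "F \<in> sobolev_space \<alpha> d"
proof -
  let ?\<phi> = "\<lambda>n. val (part n (L n))"
  have "sobolev_norm \<alpha> d (\<lambda>x. ?\<phi> m x - ?\<phi> n x) = gap (part m (L m)) (part n (L n))" for m n
    by (rule sobolev_norm_eq_nrm[OF jet_tensors_diff[OF jet_tensors_partial jet_tensors_partial]]) (simp add: val_diff)
  then have "\<forall>\<epsilon>>0. \<exists>N. \<forall>m\<ge>N. \<forall>n\<ge>N. sobolev_norm \<alpha> d (\<lambda>x. ?\<phi> m x - ?\<phi> n x) < \<epsilon>"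
    using Q unfolding represents_def tensor_cauchy_def by simp
  moreover have "?\<phi> n \<in> algebraic_tensor \<alpha> d" for n by (rule partial_in_algebraic_tensor)
  moreover have "\<forall>x\<in>unit_cube d. (\<lambda>n. ?\<phi> n x) \<longlonglongrightarrow> F x" using Q unfolding represents_def by blast
  ultimately show ?thesis unfolding sobolev_space_def by (intro CollectI exI[of _ ?\<phi>]) (simp only: simp_thms)
qed

lemma kernel_jet_complex:
  "of_real (kernel_jet \<alpha> N y 0 x) = (\<Sum>h\<in>freq_box N. cis (2 * pi * of_int h * (x - y)) / of_real ((korobov_weight1 \<alpha> h)\<^sup>2))"
proof -
  let ?f = "\<lambda>h. cis (2 * pi * of_int h * (x - y)) / of_real ((korobov_weight1 \<alpha> h)\<^sup>2)"
  have m: "?f (- h) = cnj (?f h)" for h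
    by (simp add: korobov_weight1_minus cis_cnj)
  have "Re (?f h) = wave h (- (2 * pi * of_int h * y)) 0 x / (korobov_weight1 \<alpha> h)\<^sup>2" for h
  proof -
    have "wave h (- (2 * pi * of_int h * y)) 0 x = cos (2 * pi * of_int h * (x - y))"
      by (simp add: wave_def algebra_simps)
    then show ?thesis by (simp add: Re_divide_of_real del: of_real_power)
  qed
  then have re: "(\<Sum>h\<in>freq_box N. Re (?f h)) = (\<Sum>h\<in>freq_box N. wave h (- (2 * pi * of_int h * y)) 0 x / (korobov_weight1 \<alpha> h)\<^sup>2)"
    by (rule sum.cong[OF refl])
  show ?thesis unfolding sum_freq_box_cnj[of ?f, OF m] kernel_jet_def re ..
qed

text \<open>The Gram matrix of the finite kernels depends on \<open>min n m\<close> and stays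
  bounded, which gives the Cauchy property; absolute summability of the kernel series makes its box
  sums converge at each point.\<close>

lemma represents_kernel:
  assumes y: "y \<in> unit_cube d"
  shows "represents (\<lambda>n. kernel_tensor n y) (\<lambda>x. korobov_kernel \<alpha> d x y)"
proof -
  have "tensor_cauchy (\<lambda>n. kernel_tensor n y)"
  proof (rule tensor_cauchy_min[where A = "\<lambda>n. kernel_tensor n y" and b = "\<lambda>n. (\<Sum>h\<in>freq_box n. 1 / (korobov_weight1 \<alpha> h)\<^sup>2) ^ d"])
    show "jets (kernel_tensor n y)" for n by (rule jets_kernel)
    show "ip (kernel_tensor n y) (kernel_tensor m y) = (\<Sum>h\<in>freq_box (min n m). 1 / (korobov_weight1 \<alpha> h)\<^sup>2) ^ d" for n m
      by (rule inner_kernel_kernel)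
    show "(\<Sum>h\<in>freq_box n. 1 / (korobov_weight1 \<alpha> h)\<^sup>2) ^ d \<le> (1 + pi\<^sup>2 / 3) ^ d" for n
      by (intro power_mono sum_korobov_weight1_le \<alpha> sum_nonneg) auto
  qed
  moreover have "(\<lambda>n. val (kernel_tensor n y) x) \<longlonglongrightarrow> korobov_kernel \<alpha> d x y" if x: "x \<in> unit_cube d" for x
  proof -
    let ?g = "\<lambda>h. character d h (\<lambda>j. x j - y j) / of_real ((korobov_weight \<alpha> d h)\<^sup>2)"
    have "complex_of_real (val (kernel_tensor n y) x) = (\<Sum>h\<in>frequency_box d n. ?g h)" for n
    proof -
      have "val (kernel_tensor n y) x = (\<Prod>j<d. kernel_jet \<alpha> n (y j) 0 (x j))"
        unfolding tensor_deriv_def kernel_tensor_def using x by (auto simp: restrict_jet_def unit_cube_def PiE_iff intro!: prod.cong)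
      then show ?thesis
        by (simp only: of_real_prod kernel_jet_complex prod_sum_freq_box prod_dividef character_eq_prod korobov_weight_def prod_power_distrib)
    qed
    then have v: "val (kernel_tensor n y) x = Re (\<Sum>h\<in>frequency_box d n. ?g h)" for n by (metis Re_complex_of_real)
    have "(\<lambda>h. norm (?g h)) summable_on frequencies d"
      using korobov_weight_summable[OF \<alpha>, of d] by (simp add: norm_divide norm_power)
    then have "(?g has_sum (\<Sum>\<^sub>\<infinity>h\<in>frequencies d. ?g h)) (frequencies d)"
      by (rule has_sum_infsum[OF abs_summable_summable])
    from tendsto_Re[OF has_sum_frequency_box[OF this]] show ?thesis unfolding v korobov_kernel_def .
  qed
  ultimately show ?thesis unfolding represents_def by blast
qed

end

section \<open>Fourier series and Korobov norm of the limit\<close>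

context sobolev_tensors
begin

text \<open>The estimate for the difference of \<open>L m\<close> and \<open>L n\<close> is uniform
  in the box, so it survives the limit in \<open>m\<close>: the weighted coefficients converge in
  l^2.\<close>

lemma sum_fourier_diff_le:
  assumes L: "tensor_cauchy L" and conv: "\<And>h. h \<in> frequencies d \<Longrightarrow> (\<lambda>m. tensor_fourier \<alpha> d (L m) h) \<longlonglongrightarrow> c h" and e: "e > 0"
  shows "\<exists>K. \<forall>n\<ge>K. \<forall>N. L2_set (\<lambda>h. norm (c h - tensor_fourier \<alpha> d (L n) h) * korobov_weight \<alpha> d h) (frequency_box d N) \<le> e"
proof -
  note J = tensor_cauchyD(1)[OF L]
  obtain K where K: "\<forall>m\<ge>K. \<forall>n\<ge>K. gap (L m) (L n) < e" using tensor_cauchyD(2)[OF L e] ..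
  let ?s = "\<lambda>m n N. \<Sum>h\<in>frequency_box d N. (norm (tensor_fourier \<alpha> d (L m) h - tensor_fourier \<alpha> d (L n) h))\<^sup>2 * (korobov_weight \<alpha> d h)\<^sup>2"
  have s: "?s m n N \<le> e\<^sup>2" if "m \<ge> K" "n \<ge> K" for m n N
  proof -
    let ?D = "tensor_diff (L m) (L n)"
    have D: "jets ?D" by (rule jet_tensors_diff[OF J J])
    have "?s m n N = cip N ?D ?D"
      unfolding tensor_coeff_inner_self tensor_linearD(3)[OF tensor_linear_fourier[OF d]] ..
    also have "\<dots> = (nrm (part N ?D))\<^sup>2"
      unfolding tensor_norm_square[OF jet_tensors_partial] inner_partial_partial by simp
    also have "\<dots> \<le> e\<^sup>2"
      using nrm_partial_le[OF D, of N] K that by (intro power_mono tensor_norm_nonneg jet_tensors_partial) fastforce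
    finally show ?thesis .
  qed
  have "L2_set (\<lambda>h. norm (c h - tensor_fourier \<alpha> d (L n) h) * korobov_weight \<alpha> d h) (frequency_box d N) \<le> e" if n: "n \<ge> K" for n N
  proof -
    have "(\<lambda>m. ?s m n N) \<longlonglongrightarrow> (\<Sum>h\<in>frequency_box d N. (norm (c h - tensor_fourier \<alpha> d (L n) h))\<^sup>2 * (korobov_weight \<alpha> d h)\<^sup>2)"
      by (intro tendsto_intros conv) (use frequency_box(2) in blast)
    then have "(\<Sum>h\<in>frequency_box d N. (norm (c h - tensor_fourier \<alpha> d (L n) h))\<^sup>2 * (korobov_weight \<alpha> d h)\<^sup>2) \<le> e\<^sup>2"
      by (rule LIMSEQ_le_const2) (use s n in blast)
    then have "sqrt (\<Sum>h\<in>frequency_box d N. (norm (c h - tensor_fourier \<alpha> d (L n) h))\<^sup>2 * (korobov_weight \<alpha> d h)\<^sup>2) \<le> sqrt (e\<^sup>2)"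
      by (rule real_sqrt_le_mono)
    then show ?thesis unfolding L2_set_def power_mult_distrib using e by simp
  qed
  then show ?thesis by blast
qed

text \<open>Once its box contains \<open>h\<close>, the diagonal partial sum has the coefficient
  \<open>tensor_fourier \<alpha> d (L n) h\<close>; the partial sums are uniformly bounded, which
  permits the limit under the integral.\<close>

lemma fourier_coeff_tendsto:
  assumes L: "tensor_cauchy L" and F: "represents (\<lambda>n. part n (L n)) F" and h: "h \<in> frequencies d"
  shows "(\<lambda>n. tensor_fourier \<alpha> d (L n) h) \<longlonglongrightarrow> fourier_coeff d F h"
proof -
  note J = tensor_cauchyD(1)[OF L]
  obtain B where B: "B > 0" "\<forall>n. nrm (L n) \<le> B" using tensor_cauchy_bounded[OF L] by auto
  have "(\<lambda>n. fourier_coeff d (val (part n (L n))) h) \<longlonglongrightarrow> fourier_coeff d F h"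
  proof (rule fourier_coeff_limit)
    show "(\<lambda>n. val (part n (L n)) x) \<longlonglongrightarrow> F x" if "x \<in> unit_cube d" for x using F that by (simp add: represents_def)
    show "\<bar>val (part n (L n)) x\<bar> \<le> eval_bound * B" if "x \<in> unit_cube d" for n x
    proof -
      have "\<bar>val (part n (L n)) x\<bar> \<le> eval_bound * nrm (L n)" by (rule val_partial_le[OF J that])
      also have "\<dots> \<le> eval_bound * B" using B by (intro mult_left_mono eval_bound_nonneg) auto
      finally show ?thesis .
    qed
    show "val (part n (L n)) \<in> borel_measurable (cube_measure {..<d})" for n
      by (rule tensor_deriv_measurable[OF jet_tensors_partial])
  qed
  moreover have "\<exists>M. \<forall>N\<ge>M. {h} \<subseteq> frequency_box d N" using h by (intro frequency_box_absorbs) auto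
  then obtain M where M: "\<forall>N\<ge>M. h \<in> frequency_box d N" by auto
  have "fourier_coeff d (val (part n (L n))) h = tensor_fourier \<alpha> d (L n) h" if "n \<ge> M" for n
    using fourier_coeff_trigonometric[OF tensor_partial_fourier h, of \<alpha> n "L n"] M that by simp
  then have "\<forall>\<^sub>F n in sequentially. fourier_coeff d (val (part n (L n))) h = tensor_fourier \<alpha> d (L n) h"
    unfolding eventually_sequentially by blast
  ultimately show ?thesis by (rule Lim_transform_eventually)
qed

text \<open>Box and sequence index grow together. The triangle inequality in l^2 replaces the
  coefficients of the limit by those of \<open>L n\<close>, for which the sum over the box is the
  norm of a trigonometric tensor.\<close>

lemma fourier_L2_tendsto:
  assumes L: "tensor_cauchy L" and F: "represents (\<lambda>n. part n (L n)) F"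
  shows "(\<lambda>n. L2_set (\<lambda>h. norm (fourier_coeff d F h) * korobov_weight \<alpha> d h) (frequency_box d n)) \<longlonglongrightarrow> sobolev_norm \<alpha> d F"
proof -
  let ?c = "fourier_coeff d F" and ?C = "\<lambda>n. tensor_fourier \<alpha> d (L n)" and ?w = "korobov_weight \<alpha> d"
  let ?l = "\<lambda>n u. L2_set (\<lambda>h. norm (u h) * ?w h) (frequency_box d n)"
  have w: "?w h \<ge> 0" for h using korobov_weight_pos[of \<alpha> d h] by simp
  have tri: "?l n u \<le> ?l n v + ?l n (\<lambda>h. u h - v h)" for n and u v :: "(nat \<Rightarrow> int) \<Rightarrow> complex"
  proof -
    have "?l n u \<le> L2_set (\<lambda>h. norm (v h) * ?w h + norm (u h - v h) * ?w h) (frequency_box d n)"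
    proof (rule L2_set_mono)
      fix h
      have "norm (u h) \<le> norm (v h) + norm (u h - v h)" using norm_triangle_sub[of "u h" "v h"] .
      then have "norm (u h) * ?w h \<le> (norm (v h) + norm (u h - v h)) * ?w h" using w by (rule mult_right_mono)
      then show "norm (u h) * ?w h \<le> norm (v h) * ?w h + norm (u h - v h) * ?w h" by (simp only: distrib_right)
      show "0 \<le> norm (u h) * ?w h" using w by simp
    qed
    also have "\<dots> \<le> ?l n v + ?l n (\<lambda>h. u h - v h)" by (rule L2_set_triangle_ineq)
    finally show ?thesis .
  qed
  have q: "nrm (part n (L n)) = ?l n (?C n)" for n
    unfolding tensor_norm_def inner_partial_partial min.idem tensor_coeff_inner_self L2_set_def power_mult_distrib ..
  have "(\<lambda>n. sqrt (ip (part n (L n)) (part n (L n)))) \<longlonglongrightarrow> sqrt (sobolev_inner \<alpha> d F F)"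
    by (intro tendsto_real_sqrt tensor_inner_limit F)
  then have lim: "(\<lambda>n. ?l n (?C n)) \<longlonglongrightarrow> sobolev_norm \<alpha> d F"
    unfolding q[symmetric] unfolding tensor_norm_def sobolev_norm_def .
  have "(\<lambda>n. ?l n ?c - ?l n (?C n)) \<longlonglongrightarrow> 0"
  proof (rule LIMSEQ_I)
    fix e :: real assume "e > 0"
    then have "e / 2 > 0" by simp
    from sum_fourier_diff_le[OF L fourier_coeff_tendsto[OF L F] this]
    obtain K where K: "\<forall>n\<ge>K. \<forall>N. ?l N (\<lambda>h. ?c h - ?C n h) \<le> e / 2" by blast
    have "norm (?l n ?c - ?l n (?C n) - 0) < e" if "n \<ge> K" for n
    proof -
      have "?l n (\<lambda>h. ?c h - ?C n h) \<le> e / 2" using K that by simp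
      moreover have t: "?l n ?c \<le> ?l n (?C n) + ?l n (\<lambda>h. ?c h - ?C n h)" "?l n (?C n) \<le> ?l n ?c + ?l n (\<lambda>h. ?C n h - ?c h)"
        by (rule tri)+
      moreover have "?l n (\<lambda>h. ?C n h - ?c h) = ?l n (\<lambda>h. ?c h - ?C n h)" by (simp only: norm_minus_commute)
      ultimately show ?thesis using t \<open>e > 0\<close> unfolding real_norm_def by linarith
    qed
    then show "\<exists>no. \<forall>n\<ge>no. norm (?l n ?c - ?l n (?C n) - 0) < e" by blast
  qed
  from tendsto_add[OF this lim] show ?thesis by simp
qed

text \<open>The box sums increase and have a known limit, so all finite sums are bounded by it and
  the infinite sum equals it.\<close>

lemma korobov_summable:
  assumes L: "tensor_cauchy L" and F: "represents (\<lambda>n. part n (L n)) F"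
  shows "(\<lambda>h. (norm (fourier_coeff d F h))\<^sup>2 * (korobov_weight \<alpha> d h)\<^sup>2) summable_on frequencies d"
    and "(\<Sum>\<^sub>\<infinity>h\<in>frequencies d. (norm (fourier_coeff d F h))\<^sup>2 * (korobov_weight \<alpha> d h)\<^sup>2) = (sobolev_norm \<alpha> d F)\<^sup>2"
proof -
  let ?g = "\<lambda>h. (norm (fourier_coeff d F h))\<^sup>2 * (korobov_weight \<alpha> d h)\<^sup>2"
  let ?S = "\<lambda>n. \<Sum>h\<in>frequency_box d n. ?g h"
  have "(\<lambda>n. (L2_set (\<lambda>h. norm (fourier_coeff d F h) * korobov_weight \<alpha> d h) (frequency_box d n))\<^sup>2) \<longlonglongrightarrow> (sobolev_norm \<alpha> d F)\<^sup>2"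
    by (intro tendsto_power fourier_L2_tendsto[OF L F])
  moreover have "(L2_set (\<lambda>h. norm (fourier_coeff d F h) * korobov_weight \<alpha> d h) (frequency_box d n))\<^sup>2 = ?S n" for n
    unfolding L2_set_def power_mult_distrib by (intro real_sqrt_pow2 sum_nonneg) simp
  ultimately have lim: "?S \<longlonglongrightarrow> (sobolev_norm \<alpha> d F)\<^sup>2" by simp
  have "incseq ?S"
  proof (rule incseq_SucI)
    fix n
    have "frequency_box d n \<subseteq> frequency_box d (Suc n)"
      using frequency_box_Int[of d n "Suc n"] by (simp add: Int_absorb2[symmetric] inf.absorb_iff1)
    then show "?S n \<le> ?S (Suc n)" by (intro sum_mono2 frequency_box) auto
  qed
  then have le: "?S n \<le> (sobolev_norm \<alpha> d F)\<^sup>2" for n by (rule incseq_le[OF _ lim])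
  show summ: "?g summable_on frequencies d"
  proof (rule nonneg_bdd_above_summable_on)
    show "bdd_above (sum ?g ` {X. X \<subseteq> frequencies d \<and> finite X})"
    proof (rule bdd_aboveI2)
      fix X assume "X \<in> {X. X \<subseteq> frequencies d \<and> finite X}"
      then have "\<exists>M. \<forall>N\<ge>M. X \<subseteq> frequency_box d N" by (intro frequency_box_absorbs) auto
      then obtain N where "\<forall>n\<ge>N. X \<subseteq> frequency_box d n" ..
      then have "X \<subseteq> frequency_box d N" by simp
      then have "sum ?g X \<le> ?S N" by (intro sum_mono2 frequency_box) auto
      then show "sum ?g X \<le> (sobolev_norm \<alpha> d F)\<^sup>2" using le[of N] by linarith
    qed
  qed simp
  show "(\<Sum>\<^sub>\<infinity>h\<in>frequencies d. ?g h) = (sobolev_norm \<alpha> d F)\<^sup>2"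
    by (rule LIMSEQ_unique[OF has_sum_frequency_box[OF has_sum_infsum[OF summ]] lim])
qed

text \<open>With weight \<open>w\<close>, a coefficient of modulus \<open>a\<close> satisfies
  \<open>2 * a \<le> a^2 * w^2 + 1 / w^2\<close>, and both parts are summable.\<close>

lemma fourier_coeff_summable:
  assumes L: "tensor_cauchy L" and F: "represents (\<lambda>n. part n (L n)) F"
  shows "(\<lambda>h. norm (fourier_coeff d F h)) summable_on frequencies d"
proof (rule summable_on_comparison_test)
  show "(\<lambda>h. (norm (fourier_coeff d F h))\<^sup>2 * (korobov_weight \<alpha> d h)\<^sup>2 + 1 / (korobov_weight \<alpha> d h)\<^sup>2) summable_on frequencies d"
    by (intro summable_on_add korobov_summable(1)[OF L F] korobov_weight_summable \<alpha>)
  fix h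
  let ?a = "norm (fourier_coeff d F h)" and ?w = "korobov_weight \<alpha> d h"
  have w: "?w > 0" by (rule korobov_weight_pos)
  have "2 * (?a * ?w) * (1 / ?w) \<le> (?a * ?w)\<^sup>2 + (1 / ?w)\<^sup>2" by (rule sum_squares_bound)
  then have "2 * ?a \<le> ?a\<^sup>2 * ?w\<^sup>2 + 1 / ?w\<^sup>2" using w by (simp add: power_mult_distrib power_divide)
  moreover have "?a \<ge> 0" by simp
  ultimately show "?a \<le> ?a\<^sup>2 * ?w\<^sup>2 + 1 / ?w\<^sup>2" by linarith
qed simp

text \<open>The partial sums with the coefficients of \<open>F\<close> differ from the diagonal
  tensors by at most an l^2 error times the l^2 norm of the inverse weights, which
  \<open>eval_bound\<close> controls.\<close>

lemma fourier_series_eq: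
  assumes L: "tensor_cauchy L" and F: "represents (\<lambda>n. part n (L n)) F" and x: "x \<in> unit_cube d"
  shows "of_real (F x) = (\<Sum>\<^sub>\<infinity>h\<in>frequencies d. fourier_coeff d F h * character d h x)"
proof -
  let ?c = "fourier_coeff d F" and ?C = "\<lambda>n. tensor_fourier \<alpha> d (L n)" and ?w = "korobov_weight \<alpha> d"
  let ?T = "\<lambda>n. \<Sum>h\<in>frequency_box d n. ?c h * character d h x"
  have "(\<lambda>h. norm (?c h * character d h x)) summable_on frequencies d"
    using fourier_coeff_summable[OF L F] by (simp add: norm_mult)
  then have lim: "?T \<longlonglongrightarrow> (\<Sum>\<^sub>\<infinity>h\<in>frequencies d. ?c h * character d h x)"
    by (rule has_sum_frequency_box[OF has_sum_infsum[OF abs_summable_summable]])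
  have b: "norm (?T n - of_real (val (part n (L n)) x)) \<le> L2_set (\<lambda>h. norm (?c h - ?C n h) * ?w h) (frequency_box d n) * eval_bound" for n
  proof -
    have "?T n - of_real (val (part n (L n)) x) = (\<Sum>h\<in>frequency_box d n. (?c h - ?C n h) * character d h x)"
      unfolding tensor_partial_fourier[OF x] sum_subtractf[symmetric] by (simp only: left_diff_distrib)
    also have "norm \<dots> \<le> (\<Sum>h\<in>frequency_box d n. norm (?c h - ?C n h))"
      by (rule order_trans[OF norm_sum]) (simp add: norm_mult)
    also have "\<dots> = (\<Sum>h\<in>frequency_box d n. \<bar>norm (?c h - ?C n h) * ?w h\<bar> * \<bar>1 / ?w h\<bar>)"
      using korobov_weight_pos[of \<alpha> d] by (intro sum.cong refl) (simp add: abs_mult less_imp_neq[THEN not_sym])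
    also have "\<dots> \<le> L2_set (\<lambda>h. norm (?c h - ?C n h) * ?w h) (frequency_box d n) * L2_set (\<lambda>h. 1 / ?w h) (frequency_box d n)"
      by (rule L2_set_mult_ineq)
    also have "\<dots> \<le> L2_set (\<lambda>h. norm (?c h - ?C n h) * ?w h) (frequency_box d n) * eval_bound"
    proof (rule mult_left_mono[OF _ L2_set_nonneg])
      show "L2_set (\<lambda>h. 1 / ?w h) (frequency_box d n) \<le> eval_bound"
        unfolding L2_set_def eval_bound_def power_divide power_one by (rule real_sqrt_le_mono[OF sum_korobov_weight_le[OF \<alpha>]])
    qed
    finally show ?thesis .
  qed
  have "(\<lambda>n. ?T n - of_real (val (part n (L n)) x)) \<longlonglongrightarrow> 0"
  proof (rule LIMSEQ_I)
    fix e :: real assume "e > 0"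
    then have "e / 2 > 0" by simp
    then obtain \<delta> where \<delta>: "\<delta> > 0" "eval_bound * \<delta> \<le> e / 2" by (rule small_multiple)
    from sum_fourier_diff_le[OF L fourier_coeff_tendsto[OF L F] \<delta>(1)]
    obtain K where K: "\<forall>n\<ge>K. \<forall>N. L2_set (\<lambda>h. norm (?c h - ?C n h) * ?w h) (frequency_box d N) \<le> \<delta>" by blast
    have "norm (?T n - of_real (val (part n (L n)) x) - 0) < e" if "n \<ge> K" for n
    proof -
      have "L2_set (\<lambda>h. norm (?c h - ?C n h) * ?w h) (frequency_box d n) * eval_bound \<le> \<delta> * eval_bound"
        using K that by (intro mult_right_mono eval_bound_nonneg) auto
      then show ?thesis using b[of n] \<delta>(2) \<open>e > 0\<close> by (simp add: mult.commute)
    qed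
    then show "\<exists>no. \<forall>n\<ge>no. norm (?T n - of_real (val (part n (L n)) x) - 0) < e" by blast
  qed
  from tendsto_diff[OF lim this]
  have "(\<lambda>n. complex_of_real (val (part n (L n)) x)) \<longlonglongrightarrow> (\<Sum>\<^sub>\<infinity>h\<in>frequencies d. ?c h * character d h x)" by simp
  moreover have "(\<lambda>n. complex_of_real (val (part n (L n)) x)) \<longlonglongrightarrow> of_real (F x)"
    using F x by (intro tendsto_of_real) (simp add: represents_def)
  ultimately show ?thesis by (rule LIMSEQ_unique[rotated])
qed

end

text \<open>The values of \<open>F\<close> are prescribed on the cube only, where the transform is
  meant. Membership in both spaces is part of the claim, since it gives the two norms of
  \<open>F\<close> their meaning.\<close>

theorem proposition3:
  fixes d \<alpha> :: nat and f F :: "point \<Rightarrow> real"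
  assumes "d \<ge> 1" and "\<alpha> \<ge> 1"
    and "f \<in> sobolev_space \<alpha> d"
    and "\<And>x. x \<in> unit_cube d \<Longrightarrow> F x = bernoulli_transform \<alpha> d f x"
  shows "(\<forall>y\<in>unit_cube d. F y = sobolev_inner \<alpha> d f (\<lambda>x. korobov_kernel \<alpha> d x y))
    \<and> F \<in> korobov_space \<alpha> d \<and> F \<in> sobolev_space \<alpha> d
    \<and> korobov_norm \<alpha> d F = sobolev_norm \<alpha> d F
    \<and> sobolev_norm \<alpha> d F \<le> sobolev_norm \<alpha> d f"
proof -
  interpret sobolev_tensors d \<alpha> by unfold_locales (fact assms)+
  obtain L where L: "represents L f" using sobolev_space_represents[OF assms(3)] ..
  have c: "tensor_cauchy L" using L by (simp add: represents_def)
  have F: "represents (\<lambda>n. part n (L n)) F" by (rule represents_transform[OF L assms(4)])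
  have kernel: "F y = sobolev_inner \<alpha> d f (\<lambda>x. korobov_kernel \<alpha> d x y)" if y: "y \<in> unit_cube d" for y
  proof -
    \<comment> \<open>Inner products with the finite kernels are the values of the diagonal partial
      sums, so one sequence has both sides as its limit.\<close>
    have "(\<lambda>n. ip (L n) (kernel_tensor n y)) \<longlonglongrightarrow> sobolev_inner \<alpha> d f (\<lambda>x. korobov_kernel \<alpha> d x y)"
      by (rule tensor_inner_limit[OF L represents_kernel[OF y]])
    then have "(\<lambda>n. val (part n (L n)) y) \<longlonglongrightarrow> sobolev_inner \<alpha> d f (\<lambda>x. korobov_kernel \<alpha> d x y)"
      unfolding inner_kernel[OF tensor_cauchyD(1)[OF c] y] .
    moreover have "(\<lambda>n. val (part n (L n)) y) \<longlonglongrightarrow> F y" using F y by (simp add: represents_def)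
    ultimately show ?thesis by (rule LIMSEQ_unique[rotated])
  qed
  have sob: "F \<in> sobolev_space \<alpha> d" by (rule represents_in_sobolev_space[OF F])
  have kor: "F \<in> korobov_space \<alpha> d"
    unfolding korobov_space_def
    using fourier_coeff_summable[OF c F] fourier_series_eq[OF c F] korobov_summable(1)[OF c F] by blast
  have norm_le: "sobolev_norm \<alpha> d F \<le> sobolev_norm \<alpha> d f"
    unfolding sobolev_norm_def
  proof (rule real_sqrt_le_mono, rule LIMSEQ_le[OF tensor_inner_limit[OF F F] tensor_inner_limit[OF L L]])
    have "ip (part n (L n)) (part n (L n)) \<le> ip (L n) (L n)" for n
      unfolding tensor_norm_square[OF jet_tensors_partial, symmetric] tensor_norm_square[OF tensor_cauchyD(1)[OF c], symmetric]
      by (intro power_mono nrm_partial_le tensor_norm_nonneg jet_tensors_partial tensor_cauchyD(1)[OF c])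
    then show "\<exists>N. \<forall>n\<ge>N. ip (part n (L n)) (part n (L n)) \<le> ip (L n) (L n)" by blast
  qed
  have "korobov_inner \<alpha> d F F = (sobolev_norm \<alpha> d F)\<^sup>2"
  proof -
    let ?g = "\<lambda>h. (norm (fourier_coeff d F h))\<^sup>2 * (korobov_weight \<alpha> d h)\<^sup>2"
    have "((\<lambda>h. complex_of_real (?g h)) has_sum of_real (infsum ?g (frequencies d))) (frequencies d)"
      by (rule has_sum_of_real[OF has_sum_infsum[OF korobov_summable(1)[OF c F]]])
    then have "(\<Sum>\<^sub>\<infinity>h\<in>frequencies d. complex_of_real (?g h)) = of_real ((sobolev_norm \<alpha> d F)\<^sup>2)"
      unfolding korobov_summable(2)[OF c F] by (rule infsumI)
    moreover have "fourier_coeff d F h * cnj (fourier_coeff d F h) * of_real ((korobov_weight \<alpha> d h)\<^sup>2) = complex_of_real (?g h)" for h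
      by (simp only: complex_norm_square[symmetric] of_real_mult)
    ultimately show ?thesis unfolding korobov_inner_def by (simp only: Re_complex_of_real)
  qed
  \<comment> \<open>Needed to take the root of the square; the sign comes from the approximating
    tensors.\<close>
  moreover have "sobolev_norm \<alpha> d F \<ge> 0"
  proof -
    have "0 \<le> sobolev_inner \<alpha> d F F"
      by (rule LIMSEQ_le_const[OF tensor_inner_limit[OF F F]])
        (use nn_integral_tensor_hat_square(2)[OF jet_tensors_partial] in blast)
    then show ?thesis by (simp add: sobolev_norm_def)
  qed
  ultimately have "korobov_norm \<alpha> d F = sobolev_norm \<alpha> d F" unfolding korobov_norm_def by simp
  then show ?thesis using kernel kor sob norm_le by blast
qed

end
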